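(* For every integer $r\ge 4$ and every integer $\ell\ge 2$ there exists a constant $c>0$ such that if $p=p(n)\ge (\log n)^{2r-2}n^{-r+2+\frac{1}{2\ell-1}}$, then asymptotically almost surely $$\mathrm{ex}(G^r_{n,p},C^r_{2\ell})\le c\,p\,n^{r-1}.$$
   Context: An $r$-graph is an $r$-uniform hypergraph. $G^r_{n,p}$ is the random $r$-graph on vertex set $[n]$ in which each $r$-subset is an edge independently with probability $p$. For an $r$-graph $F$, $\mathrm{ex}(G^r_{n,p},F)$ is the maximum number of edges in a subgraph of $G^r_{n,p}$ containing no copy of $F$. A statement holds asymptotically almost surely (a.a.s.) if its probability tends to $1$ as $n\to\infty$. For $k\ge 3$, the $r$-uniform linear cycle $C^r_k$ is the $r$-graph with $k(r-1)$ vertices $v_1,\dots,v_{k(r-1)}$ and $k$ edges $e_1,\dots,e_k$, where $e_i=\{v_{(i-1)(r-1)},\dots,v_{i(r-1)}\}$ for $1\le i\le k$ and $v_0=v_{k(r-1)}$. *)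

theory Defs
  imports "HOL-Probability.Probability"
begin

record 'a hypergraph =
  verts :: "'a set"
  edges :: "'a set set"

definition subhypergraph :: "'a hypergraph \<Rightarrow> 'a hypergraph \<Rightarrow> bool" where
  "subhypergraph H G \<longleftrightarrow>
     verts H \<subseteq> verts G \<and> edges H \<subseteq> edges G \<and> (\<forall>e\<in>edges H. e \<subseteq> verts H)"

definition map_hypergraph :: "('a \<Rightarrow> 'b) \<Rightarrow> 'a hypergraph \<Rightarrow> 'b hypergraph" where
  "map_hypergraph f F = \<lparr>verts = f ` verts F, edges = (\<lambda>e. f ` e) ` edges F\<rparr>"

definition contains_copy :: "'b hypergraph \<Rightarrow> 'a hypergraph \<Rightarrow> bool" where
  "contains_copy H F \<longleftrightarrow>
     (\<exists>f. inj_on f (verts F) \<and> subhypergraph (map_hypergraph f F) H)"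

(* Meaningful when G has finitely many edges and F has at least one edge: then the set
   below is finite and contains 0. *)
definition ex_number :: "'b hypergraph \<Rightarrow> 'a hypergraph \<Rightarrow> nat" where
  "ex_number G F =
     Max {card (edges H) | H. subhypergraph H G \<and> \<not> contains_copy H F}"

definition r_subsets :: "nat \<Rightarrow> nat \<Rightarrow> nat set set" where
  "r_subsets r n = {e. e \<subseteq> {1..n} \<and> card e = r}"

definition random_r_graph :: "nat \<Rightarrow> nat \<Rightarrow> real \<Rightarrow> nat hypergraph pmf" where
  "random_r_graph r n p =
     map_pmf (\<lambda>f. \<lparr>verts = {1..n}, edges = {e \<in> r_subsets r n. f e}\<rparr>)
       (Pi_pmf (r_subsets r n) False (\<lambda>_. bernoulli_pmf p))"

(* The vertex v_j is represented by the number j for 1 \<le> j \<le> k(r - 1); the conditional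
   implements the identification of v_0 with v_{k(r-1)}. *)
definition linear_cycle :: "nat \<Rightarrow> nat \<Rightarrow> nat hypergraph" where
  "linear_cycle r k =
     \<lparr>verts = {1..k * (r - 1)},
      edges = (\<lambda>i. (\<lambda>j. if j = 0 then k * (r - 1) else j) ` {(i - 1) * (r - 1)..i * (r - 1)})
                ` {1..k}\<rparr>"

end

theory Submission
  imports Defs
begin

text \<open>Write \<open>E = n powr (1 / (2 * l - 1))\<close>. The heart of the argument is a balanced supersaturation
  theorem: an \<open>r\<close>-graph with at least \<open>K * n ^ (r - 1)\<close> edges carries a probability measure on its
  copies of the linear \<open>2 * l\<close>-cycle under which \<open>s\<close> given edges in given positions occur with
  probability at most \<open>C / e * (E ^ (2 * l) / e) ^ (s - 1)\<close>, where \<open>e\<close> is the number of edges. A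
  container lemma for such spread measures, iterated until all containers have at most
  \<open>K * n ^ (r - 1)\<close> edges, covers the cycle-free \<open>r\<close>-graphs by \<open>exp (O (E ^ (2 * l) * (ln n)\<^sup>2))\<close>
  containers, and a union bound over the containers concludes.

  For the supersaturation, pairs of vertices are weighted by their codegree. Since \<open>r \<ge> 4\<close>, all but
  \<open>n ^ (r - 1)\<close> edges contain a pair that is light at both ends; keeping only these pairs gives a
  weighted graph in which every step of the random walk has probability \<open>O (1 / E ^ l)\<close>. Spread
  closed walks of length \<open>2 * l\<close> in it are made of two walks of a suitable length \<open>q \<le> l\<close>
  from a common start, joined by a zigzag between the levels \<open>q\<close> and \<open>q - 1\<close>. Replacing each pair by
  a random edge through it gives a linear cycle with probability at least one half, because every
  \<open>(r - 1)\<close>-set inside an edge may be assumed to have large degree.\<close>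

section \<open>Containers\<close>

text \<open>The spread bound is calibrated. In a random-like graph with E^(2l-1) vertices and degree
  E^l, a pair has probability about E^(1-3l) and a closed 2l-walk about E^(-2l^2), which is
  E^(2l(1-3l)) * (E^(2l))^(2l-1). So the bound is met with equality, up to constants, when all 2l
  pairs are prescribed, while a shorter prescribed path has a spare factor E for each pair after the
  first. The estimates below are a budget of these spare factors. The obstacle is that the weighted
  graph need not be random-like: some parts of a walk may be joined far more often than the rest,
  and closed walks then concentrate there. The remedy is to measure a connection of length j by its
  probability times E^j and to take for q a length where this is largest. No subwalk of length at
  least two then beats the whole walk, which is what pays for a gap between prescribed steps. The
  zigzag fills up the length 2l, and each of its downward steps may use a factor E.\<close>

lemma sum_PiE_insert:
  fixes F :: "('i \<Rightarrow> 'a) \<Rightarrow> 'b::comm_monoid_add"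
  assumes "j \<notin> A"
  shows "(\<Sum>e\<in>insert j A \<rightarrow>\<^sub>E V. F e) = (\<Sum>e\<in>A \<rightarrow>\<^sub>E V. \<Sum>v\<in>V. F (e(j := v)))"
proof -
  have "(\<Sum>e\<in>insert j A \<rightarrow>\<^sub>E V. F e) = (\<Sum>e\<in>(\<lambda>(v, e). e(j := v)) ` (V \<times> (A \<rightarrow>\<^sub>E V)). F e)"
    by (simp add: PiE_insert_eq)
  also have "\<dots> = (\<Sum>(v, e)\<in>V \<times> (A \<rightarrow>\<^sub>E V). F (e(j := v)))"
    using assms by (subst sum.reindex) (auto intro!: inj_combinator simp: case_prod_beta)
  also have "\<dots> = (\<Sum>v\<in>V. \<Sum>e\<in>A \<rightarrow>\<^sub>E V. F (e(j := v)))" by (simp add: sum.cartesian_product)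
  also have "\<dots> = (\<Sum>e\<in>A \<rightarrow>\<^sub>E V. \<Sum>v\<in>V. F (e(j := v)))" by (rule sum.swap)
  finally show ?thesis .
qed

lemma sum_PiE_last:
  fixes F :: "(nat \<Rightarrow> 'a) \<Rightarrow> 'b::comm_monoid_add"
  shows "(\<Sum>e\<in>{..<Suc k} \<rightarrow>\<^sub>E V. F e) = (\<Sum>e\<in>{..<k} \<rightarrow>\<^sub>E V. \<Sum>v\<in>V. F (e(k := v)))"
  unfolding lessThan_Suc by (rule sum_PiE_insert) simp

section \<open>Marginals and spread measures on tuples\<close>

definition marg :: "nat \<Rightarrow> 'a set \<Rightarrow> ((nat \<Rightarrow> 'a) \<Rightarrow> real) \<Rightarrow> nat set \<Rightarrow> (nat \<Rightarrow> 'a) \<Rightarrow> real" where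
  "marg k V \<mu> S g = (\<Sum>e | e \<in> {..<k} \<rightarrow>\<^sub>E V \<and> (\<forall>i\<in>S. e i = g i). \<mu> e)"

text \<open>Balanced supersaturation in the form of a probability measure. Ordered tuples instead of
  edge sets keep the notion closed under the recursion: the link of a vertex at the last coordinate
  is again a measure on tuples, one coordinate shorter.\<close>

definition spread :: "nat \<Rightarrow> 'a set \<Rightarrow> ((nat \<Rightarrow> 'a) \<Rightarrow> real) \<Rightarrow> real \<Rightarrow> real \<Rightarrow> bool" where
  "spread k V \<mu> C \<tau> \<longleftrightarrow>
     (\<forall>e\<in>{..<k} \<rightarrow>\<^sub>E V. 0 \<le> \<mu> e) \<and> (\<Sum>e\<in>{..<k} \<rightarrow>\<^sub>E V. \<mu> e) = 1 \<and>
     (\<forall>S\<subseteq>{..<k}. S \<noteq> {} \<longrightarrow> (\<forall>g. marg k V \<mu> S g \<le> C / real (card V) * \<tau> ^ (card S - 1)))"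

definition independent :: "nat \<Rightarrow> ((nat \<Rightarrow> 'a) \<Rightarrow> real) \<Rightarrow> 'a set \<Rightarrow> bool" where
  "independent k \<mu> I \<longleftrightarrow> (\<forall>e\<in>{..<k} \<rightarrow>\<^sub>E I. \<mu> e = 0)"

definition coverable :: "'a set \<Rightarrow> ('a set \<Rightarrow> bool) \<Rightarrow> real \<Rightarrow> nat \<Rightarrow> bool" where
  "coverable V Q s M \<longleftrightarrow>
     (\<exists>\<C>. finite \<C> \<and> card \<C> \<le> M \<and> (\<forall>C\<in>\<C>. C \<subseteq> V \<and> real (card C) \<le> s) \<and>
          (\<forall>I. I \<subseteq> V \<longrightarrow> Q I \<longrightarrow> (\<exists>C\<in>\<C>. I \<subseteq> C)))"

lemma coverable_mono:
  assumes "coverable V Q s M" "\<And>I. I \<subseteq> V \<Longrightarrow> Q' I \<Longrightarrow> Q I" "s \<le> s'" "M \<le> M'"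
  shows "coverable V Q' s' M'"
proof -
  obtain \<C> where "finite \<C>" "card \<C> \<le> M" "\<forall>C\<in>\<C>. C \<subseteq> V \<and> real (card C) \<le> s"
      "\<forall>I. I \<subseteq> V \<longrightarrow> Q I \<longrightarrow> (\<exists>C\<in>\<C>. I \<subseteq> C)"
    using assms(1) unfolding coverable_def by blast
  then show ?thesis
    unfolding coverable_def using assms(2-4) by (intro exI[of _ \<C>]) force
qed

lemma coverable_un:
  assumes "coverable V Q1 s M1" "coverable V Q2 s M2" "\<And>I. I \<subseteq> V \<Longrightarrow> Q I \<Longrightarrow> Q1 I \<or> Q2 I"
  shows "coverable V Q s (M1 + M2)"
proof -
  obtain \<C>1 \<C>2 where
    1: "finite \<C>1" "card \<C>1 \<le> M1" "\<forall>C\<in>\<C>1. C \<subseteq> V \<and> real (card C) \<le> s"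
       "\<forall>I. I \<subseteq> V \<longrightarrow> Q1 I \<longrightarrow> (\<exists>C\<in>\<C>1. I \<subseteq> C)" and
    2: "finite \<C>2" "card \<C>2 \<le> M2" "\<forall>C\<in>\<C>2. C \<subseteq> V \<and> real (card C) \<le> s"
       "\<forall>I. I \<subseteq> V \<longrightarrow> Q2 I \<longrightarrow> (\<exists>C\<in>\<C>2. I \<subseteq> C)"
    using assms(1,2) unfolding coverable_def by auto
  show ?thesis unfolding coverable_def
  proof (intro exI[of _ "\<C>1 \<union> \<C>2"] conjI)
    show "card (\<C>1 \<union> \<C>2) \<le> M1 + M2"
      using card_Un_le[of \<C>1 \<C>2] 1(2) 2(2) by linarith
    show "\<forall>I\<subseteq>V. Q I \<longrightarrow> (\<exists>C\<in>\<C>1 \<union> \<C>2. I \<subseteq> C)"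
      using 1(4) 2(4) assms(3) by (metis UnCI)
  qed (use 1 2 in auto)
qed

lemma sum_marg_le:
  assumes "finite V" "\<forall>e\<in>{..<k} \<rightarrow>\<^sub>E V. 0 \<le> \<mu> e" "S \<subseteq> {..<k}"
  shows "(\<Sum>g\<in>S \<rightarrow>\<^sub>E V. marg k V \<mu> S g) = (\<Sum>e\<in>{..<k} \<rightarrow>\<^sub>E V. \<mu> e)"
proof -
  have fin: "finite ({..<k} \<rightarrow>\<^sub>E V)" "finite (S \<rightarrow>\<^sub>E V)"
    using assms(1,3) by (auto intro!: finite_PiE intro: finite_subset)
  have "(\<Sum>g\<in>S \<rightarrow>\<^sub>E V. marg k V \<mu> S g)
      = (\<Sum>g\<in>S \<rightarrow>\<^sub>E V. \<Sum>e\<in>{..<k} \<rightarrow>\<^sub>E V. if \<forall>i\<in>S. e i = g i then \<mu> e else 0)"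
    unfolding marg_def using fin(1)
    by (intro sum.cong[OF refl] sum.inter_filter) simp
  also have "\<dots> = (\<Sum>e\<in>{..<k} \<rightarrow>\<^sub>E V. \<Sum>g\<in>S \<rightarrow>\<^sub>E V. if \<forall>i\<in>S. e i = g i then \<mu> e else 0)"
    by (rule sum.swap)
  also have "\<dots> = (\<Sum>e\<in>{..<k} \<rightarrow>\<^sub>E V. \<Sum>g\<in>S \<rightarrow>\<^sub>E V. if g = restrict e S then \<mu> e else 0)"
  proof (intro sum.cong[OF refl] if_cong refl)
    fix e g assume "g \<in> S \<rightarrow>\<^sub>E V"
    then have g: "restrict g S = g"
      by (rule PiE_restrict)
    show "(\<forall>i\<in>S. e i = g i) = (g = restrict e S)"
    proof
      assume "\<forall>i\<in>S. e i = g i"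
      then have "restrict e S = restrict g S" by (intro restrict_ext) auto
      then show "g = restrict e S" using g by simp
    next
      assume "g = restrict e S"
      then show "\<forall>i\<in>S. e i = g i" by simp
    qed
  qed
  also have "\<dots> = (\<Sum>e\<in>{..<k} \<rightarrow>\<^sub>E V. \<mu> e)"
  proof (intro sum.cong[OF refl])
    fix e assume "e \<in> {..<k} \<rightarrow>\<^sub>E V"
    then have "restrict e S \<in> S \<rightarrow>\<^sub>E V"
      using assms(3) by auto
    then show "(\<Sum>g\<in>S \<rightarrow>\<^sub>E V. if g = restrict e S then \<mu> e else 0) = \<mu> e"
      by (simp add: fin(2))
  qed
  finally show ?thesis .
qed

lemma marg_if:
  assumes "finite V"
  shows "marg k V \<mu> S g = (\<Sum>e\<in>{..<k} \<rightarrow>\<^sub>E V. if \<forall>i\<in>S. e i = g i then \<mu> e else 0)"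
  unfolding marg_def by (rule sum.inter_filter, rule finite_PiE) (use assms in auto)

lemma marg_cong: "(\<And>i. i \<in> S \<Longrightarrow> g i = g' i) \<Longrightarrow> marg k V \<mu> S g = marg k V \<mu> S g'"
  unfolding marg_def by (rule sum.cong) simp_all

lemma marg_Suc:
  assumes "finite V" "S \<subseteq> {..<k}"
  shows "marg (Suc k) V \<mu> S g = marg k V (\<lambda>e. \<Sum>v\<in>V. \<mu> (e(k := v))) S g"
proof -
  have *: "(\<forall>i\<in>S. (e(k := v)) i = g i) \<longleftrightarrow> (\<forall>i\<in>S. e i = g i)" for e v
    using assms(2) by auto
  have sum_if: "(\<Sum>v\<in>V. if b then F v else 0) = (if b then \<Sum>v\<in>V. F v else 0)" for b and F :: "'a \<Rightarrow> real"
    by simp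
  show ?thesis
    unfolding marg_if[OF assms(1)] sum_PiE_last *
    by (rule sum.cong[OF refl], rule sum_if)
qed

text \<open>This is how the spread of a measure bounds the marginals of a single link: pinning the
  last coordinate adds one element to the index set and hence one factor of the spread
  parameter.\<close>

lemma marg_insert_last:
  assumes "finite V" "S \<subseteq> {..<k}" "v \<in> V"
  shows "marg (Suc k) V \<mu> (insert k S) (g(k := v)) = marg k V (\<lambda>e. \<mu> (e(k := v))) S g"
proof -
  have *: "(\<forall>i\<in>insert k S. (e(k := x)) i = (g(k := v)) i) \<longleftrightarrow> x = v \<and> (\<forall>i\<in>S. e i = g i)" for e x
    using assms(2) by auto
  show ?thesis
    unfolding marg_if[OF assms(1)] sum_PiE_last *
  proof (intro sum.cong refl)
    fix e
    have "(\<Sum>x\<in>V. if x = v \<and> (\<forall>i\<in>S. e i = g i) then \<mu> (e(k := x)) else 0)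
        = (\<Sum>x\<in>V. if x = v then (if \<forall>i\<in>S. e i = g i then \<mu> (e(k := v)) else 0) else 0)"
      by (intro sum.cong refl) auto
    then show "(\<Sum>x\<in>V. if x = v \<and> (\<forall>i\<in>S. e i = g i) then \<mu> (e(k := x)) else 0)
        = (if \<forall>i\<in>S. e i = g i then \<mu> (e(k := v)) else 0)"
      using assms(1,3) by simp
  qed
qed

text \<open>One level of the container algorithm. The vertices of \<open>R\<close> are known to lie outside the
  independent set and those of \<open>T\<close> inside; \<open>\<mu>'\<close> collects the links, at the last
  coordinate, of the vertices of \<open>T\<close>, where a tuple stops contributing as soon as one of its
  marginals exceeds \<open>A / N * \<tau> ^ s\<close>.\<close>

lemma container_branch:
  fixes V :: "'a set" and \<mu> :: "(nat \<Rightarrow> 'a) \<Rightarrow> real" and C \<tau> A c :: real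
  assumes V: "finite V" "V \<noteq> {}"
    and sp: "spread (Suc k) V \<mu> C \<tau>"
    and C: "C \<ge> 1" and \<tau>: "0 < \<tau>" "\<tau> \<le> 1 / (16 * C)" "\<tau> * card V \<ge> 1"
    and b: "b = nat \<lceil>\<tau> * card V\<rceil>" and A: "A = 2 ^ (k + 4) * C\<^sup>2"
    and c: "c \<le> 1 / (8 * C)"
    and IH: "\<And>\<mu>'. spread k V \<mu>' (2 * (A + C)) \<tau> \<Longrightarrow>
               coverable V (independent k \<mu>') ((1 - c) * card V) M"
    and M: "M \<ge> 1"
  shows "R \<subseteq> V \<Longrightarrow> T \<subseteq> V \<Longrightarrow> R \<inter> T = {} \<Longrightarrow> card T + j = b \<Longrightarrow>
     \<forall>e\<in>{..<k} \<rightarrow>\<^sub>E V. 0 \<le> \<mu>' e \<Longrightarrow>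
     \<forall>e\<in>{..<k} \<rightarrow>\<^sub>E V. \<mu>' e \<noteq> 0 \<longrightarrow> (\<exists>v\<in>T. \<mu> (e(k := v)) \<noteq> 0) \<Longrightarrow>
     card T / (2 * card V) \<le> (\<Sum>e\<in>{..<k} \<rightarrow>\<^sub>E V. \<mu>' e) \<Longrightarrow>
     (\<Sum>e\<in>{..<k} \<rightarrow>\<^sub>E V. \<mu>' e) \<le> card T * C / card V \<Longrightarrow>
     \<forall>S\<subseteq>{..<k}. S \<noteq> {} \<longrightarrow> (\<forall>g. marg k V \<mu>' S g \<le> (A + C) / card V * \<tau> ^ card S) \<Longrightarrow>
     coverable V (\<lambda>I. independent (Suc k) \<mu> I \<and> T \<subseteq> I \<and> I \<inter> R = {})
       ((1 - c) * card V) ((card (V - R - T) + 1) ^ j * M)"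
proof (induction "card (V - R - T)" arbitrary: R T j \<mu>' rule: less_induct)
  case (less R T j \<mu>')
  let ?N = "real (card V)"
  let ?P = "{..<k} \<rightarrow>\<^sub>E V"
  have N: "?N > 0" using V by (simp add: card_gt_0_iff)
  have fP: "finite ?P" using V by (intro finite_PiE) auto
  have A0: "A > 0" using A C by simp
  note R = less.prems(1) and T = less.prems(2) and RT = less.prems(3) and cT = less.prems(4)
    and pos = less.prems(5) and supp = less.prems(6) and lo = less.prems(7) and hi = less.prems(8)
    and mar = less.prems(9)
  have fRT: "finite R" "finite T" using R T V finite_subset by auto
  have pos\<mu>: "\<forall>e\<in>{..<Suc k} \<rightarrow>\<^sub>E V. 0 \<le> \<mu> e" and sum\<mu>: "(\<Sum>e\<in>{..<Suc k} \<rightarrow>\<^sub>E V. \<mu> e) = 1"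
    and mar\<mu>: "\<And>S g. S \<subseteq> {..<Suc k} \<Longrightarrow> S \<noteq> {} \<Longrightarrow>
      marg (Suc k) V \<mu> S g \<le> C / ?N * \<tau> ^ (card S - 1)"
    using sp unfolding spread_def by auto
  have upd: "e(k := v) \<in> {..<Suc k} \<rightarrow>\<^sub>E V" if "e \<in> ?P" "v \<in> V" for e v
    using that PiE_fun_upd[of v "\<lambda>_. V" k e "{..<k}"] by (simp add: lessThan_Suc)
  have pos\<mu>': "0 \<le> \<mu> (e(k := v))" if "e \<in> ?P" "v \<in> V" for e v
    using pos\<mu> upd[OF that] by blast
  have b1: "real b \<le> 2 * \<tau> * ?N" "real b \<ge> \<tau> * ?N"
    using \<tau>(3) unfolding b by linarith+
  have M1: "(card (V - R - T) + 1) ^ j * M \<ge> 1"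
    using M by simp
  \<comment> \<open>A branch ends when the quota \<open>b\<close> of accepted vertices is filled, or
    when so many vertices are rejected that the rest is already a container. Otherwise one more
    vertex is decided.\<close>
  consider (full) "j = 0" | (rej) "real (card R) \<ge> c * ?N" | (go) "j > 0" "real (card R) < c * ?N"
    by fastforce
  then show ?case
  proof cases
    case full
    define m where "m = (\<Sum>e\<in>?P. \<mu>' e)"
    have cTb: "real (card T) = real b" using cT full by simp
    have mge: "m \<ge> \<tau> / 2"
    proof -
      have "\<tau> / 2 = \<tau> * ?N / (2 * ?N)" using N by simp
      also have "\<dots> \<le> real b / (2 * ?N)" using b1(2) N by (intro divide_right_mono) auto
      also have "\<dots> \<le> m" using lo cTb unfolding m_def by simp
      finally show ?thesis .
    qed
    have m0: "m > 0" using mge \<tau>(1) by linarith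
    \<comment> \<open>The mass \<open>m\<close> is at least half of \<open>\<tau>\<close>, so
      normalising lowers the exponent \<open>card S\<close> to \<open>card S - 1\<close>. The spread
      parameter is unchanged and only the constant grows, to \<open>2 * (A + C)\<close>.\<close>
    have "spread k V (\<lambda>e. \<mu>' e / m) (2 * (A + C)) \<tau>"
      unfolding spread_def
    proof (intro conjI ballI allI impI)
      show "0 \<le> \<mu>' e / m" if "e \<in> ?P" for e using that pos m0 by simp
      show "(\<Sum>e\<in>?P. \<mu>' e / m) = 1"
        using m0 by (simp add: sum_divide_distrib[symmetric] m_def[symmetric])
      fix S g assume S: "S \<subseteq> {..<k}" "S \<noteq> {}"
      have cS: "card S > 0" using S by (meson card_gt_0_iff finite_lessThan finite_subset)
      then have pw: "\<tau> ^ card S = \<tau> * \<tau> ^ (card S - 1)"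
        by (metis power_Suc Suc_pred')
      have "marg k V (\<lambda>e. \<mu>' e / m) S g = marg k V \<mu>' S g / m"
        unfolding marg_def by (simp add: sum_divide_distrib)
      also have "\<dots> \<le> (A + C) / ?N * \<tau> ^ card S / m"
        using mar S m0 by (intro divide_right_mono) auto
      also have "\<dots> \<le> (A + C) / ?N * \<tau> ^ card S / (\<tau> / 2)"
        using mge \<tau>(1) A0 C N by (intro divide_left_mono) auto
      also have "\<dots> = 2 * (A + C) / ?N * \<tau> ^ (card S - 1)"
        using \<tau>(1) by (simp add: pw)
      finally show "marg k V (\<lambda>e. \<mu>' e / m) S g \<le> 2 * (A + C) / ?N * \<tau> ^ (card S - 1)" .
    qed
    from IH[OF this] show ?thesis
    proof (rule coverable_mono)
      fix I assume I: "I \<subseteq> V" and *: "independent (Suc k) \<mu> I \<and> T \<subseteq> I \<and> I \<inter> R = {}"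
      show "independent k (\<lambda>e. \<mu>' e / m) I"
        unfolding independent_def
      proof (intro ballI)
        fix e assume e: "e \<in> {..<k} \<rightarrow>\<^sub>E I"
        then have eP: "e \<in> ?P" using I by (meson PiE_mono subsetD)
        have "\<mu>' e = 0"
        proof (rule ccontr)
          assume "\<mu>' e \<noteq> 0"
          then obtain v where v: "v \<in> T" "\<mu> (e(k := v)) \<noteq> 0" using supp eP by blast
          have "e(k := v) \<in> {..<Suc k} \<rightarrow>\<^sub>E I"
            using e v(1) * PiE_fun_upd[of v "\<lambda>_. I" k e "{..<k}"] by (auto simp: lessThan_Suc)
          then show False using * v(2) unfolding independent_def by blast
        qed
        then show "\<mu>' e / m = 0" by simp
      qed
    qed (use full in auto)
  next
    case rej
    have "real (card (V - R)) \<le> (1 - c) * ?N"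
      using rej R fRT V by (simp add: card_Diff_subset of_nat_diff card_mono algebra_simps)
    then show ?thesis
      unfolding coverable_def using M1
      by (intro exI[of _ "{V - R}"]) auto
  next
    case go
    define cap where "cap S g \<longleftrightarrow> marg k V \<mu>' S g > A / ?N * \<tau> ^ card S" for S g
    define ok where "ok e \<longleftrightarrow> (\<forall>S\<subseteq>{..<k}. S \<noteq> {} \<longrightarrow> \<not> cap S e)" for e
    define dg where "dg v = (\<Sum>e\<in>?P. if ok e then \<mu> (e(k := v)) else 0)" for v
    have dg_le: "dg v \<le> marg (Suc k) V \<mu> {k} (\<lambda>_. v)" if "v \<in> V" for v
    proof -
      have "dg v \<le> (\<Sum>e\<in>?P. \<mu> (e(k := v)))"
        unfolding dg_def using pos\<mu>' that by (intro sum_mono) auto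
      also have "\<dots> = marg (Suc k) V \<mu> {k} ((\<lambda>_. v)(k := v))"
        by (subst marg_insert_last[OF V(1) _ that]) (auto simp: marg_def)
      also have "(\<lambda>_. v)(k := v) = (\<lambda>_. v)" by auto
      finally show ?thesis .
    qed
    have dgC: "dg v \<le> C / ?N" if "v \<in> V" for v
      using dg_le[OF that] mar\<mu>[of "{k}" "\<lambda>_. v"] by simp
    have ncap: "(\<Sum>g\<in>S \<rightarrow>\<^sub>E V. if cap S g then marg (Suc k) V \<mu> S g else 0) \<le> 2 * C\<^sup>2 / A"
      if S: "S \<subseteq> {..<k}" "S \<noteq> {}" for S
    proof -
      have fS: "finite S" using S(1) finite_subset by blast
      have fSV: "finite (S \<rightarrow>\<^sub>E V)" using V(1) fS by (intro finite_PiE) auto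
      have cS: "card S > 0" using S fS by (simp add: card_gt_0_iff)
      then have pw: "\<tau> ^ card S = \<tau> * \<tau> ^ (card S - 1)"
        by (metis power_Suc Suc_pred')
      define Q where "Q = {g \<in> S \<rightarrow>\<^sub>E V. cap S g}"
      have marg0: "marg k V \<mu>' S g \<ge> 0" for g
        unfolding marg_def using pos by (intro sum_nonneg) auto
      \<comment> \<open>Each capped \<open>g\<close> takes at least the cap out of the total mass of
        \<open>\<mu>'\<close>, which is at most \<open>2 * \<tau> * C\<close>; this limits their
        number.\<close>
      have "card Q * (A / ?N * \<tau> ^ card S) = (\<Sum>g\<in>Q. A / ?N * \<tau> ^ card S)" by simp
      also have "\<dots> \<le> (\<Sum>g\<in>Q. marg k V \<mu>' S g)"
        by (intro sum_mono) (auto simp: Q_def cap_def)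
      also have "\<dots> \<le> (\<Sum>g\<in>S \<rightarrow>\<^sub>E V. marg k V \<mu>' S g)"
        using fSV marg0 by (intro sum_mono2) (auto simp: Q_def)
      also have "\<dots> = (\<Sum>e\<in>?P. \<mu>' e)" by (rule sum_marg_le[OF V(1) pos S(1)])
      also have "\<dots> \<le> card T * C / ?N" by (rule hi)
      also have "\<dots> \<le> (2 * \<tau> * ?N) * C / ?N"
        using b1(1) cT C N by (intro divide_right_mono mult_right_mono) auto
      finally have "card Q * (A / ?N * \<tau> ^ card S) \<le> 2 * \<tau> * C"
        using N by simp
      then have cQ: "card Q * \<tau> ^ (card S - 1) \<le> 2 * C * ?N / A"
        using \<tau>(1) A0 N by (simp add: pw field_simps)
      have "(\<Sum>g\<in>S \<rightarrow>\<^sub>E V. if cap S g then marg (Suc k) V \<mu> S g else 0)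
          = (\<Sum>g\<in>Q. marg (Suc k) V \<mu> S g)"
        unfolding Q_def using fSV by (rule sum.inter_filter[symmetric])
      also have "\<dots> \<le> (\<Sum>g\<in>Q. C / ?N * \<tau> ^ (card S - 1))"
      proof (rule sum_mono)
        fix g
        have "S \<subseteq> {..<Suc k}" using S(1) by auto
        then show "marg (Suc k) V \<mu> S g \<le> C / ?N * \<tau> ^ (card S - 1)"
          using mar\<mu> S(2) by blast
      qed
      also have "\<dots> = C / ?N * (card Q * \<tau> ^ (card S - 1))" by simp
      also have "\<dots> \<le> C / ?N * (2 * C * ?N / A)"
        using cQ C N by (intro mult_left_mono) auto
      also have "\<dots> = 2 * C\<^sup>2 / A" using N by (simp add: power2_eq_square)
      finally show ?thesis .
    qed
    define full_link where "full_link e = (\<Sum>v\<in>V. \<mu> (e(k := v)))" for e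
    have fl0: "full_link e \<ge> 0" if "e \<in> ?P" for e
      unfolding full_link_def using pos\<mu>' that by (intro sum_nonneg) auto
    define \<S> where "\<S> = {S. S \<subseteq> {..<k} \<and> S \<noteq> {}}"
    have f\<S>: "finite \<S>" unfolding \<S>_def by simp
    have c\<S>: "real (card \<S>) \<le> 2 ^ k"
    proof -
      have "card \<S> \<le> card (Pow {..<k})" unfolding \<S>_def by (intro card_mono) auto
      then have "card \<S> \<le> 2 ^ k" by (simp add: card_Pow)
      then show ?thesis by (metis of_nat_le_iff of_nat_numeral of_nat_power)
    qed
    \<comment> \<open>A tuple is lost only if one of its marginals is capped. The union bound over
      the at most \<open>2 ^ k\<close> index sets costs \<open>2 ^ k * (2 * C\<^sup>2 / A)\<close>,
      and \<open>A\<close> is chosen to make this \<open>1 / 8\<close>.\<close>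
    have "(\<Sum>e\<in>?P. if ok e then 0 else full_link e)
        \<le> (\<Sum>e\<in>?P. \<Sum>S\<in>\<S>. \<Sum>g\<in>S \<rightarrow>\<^sub>E V. if cap S g \<and> (\<forall>i\<in>S. e i = g i) then full_link e else 0)"
    proof (rule sum_mono)
      fix e assume e: "e \<in> ?P"
      have nn: "0 \<le> (\<Sum>g\<in>S \<rightarrow>\<^sub>E V. if cap S g \<and> (\<forall>i\<in>S. e i = g i) then full_link e else 0)" for S
        using fl0[OF e] by (intro sum_nonneg) auto
      show "(if ok e then 0 else full_link e)
        \<le> (\<Sum>S\<in>\<S>. \<Sum>g\<in>S \<rightarrow>\<^sub>E V. if cap S g \<and> (\<forall>i\<in>S. e i = g i) then full_link e else 0)"
      proof (cases "ok e")
        case True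
        then show ?thesis using nn by (simp add: sum_nonneg)
      next
        case False
        then obtain S where S: "S \<in> \<S>" "cap S e" unfolding ok_def \<S>_def by auto
        have fSV: "finite (S \<rightarrow>\<^sub>E V)"
          using V(1) S(1) unfolding \<S>_def by (intro finite_PiE) (auto intro: finite_subset)
        have g: "restrict e S \<in> S \<rightarrow>\<^sub>E V" using S(1) e unfolding \<S>_def by auto
        have "cap S (restrict e S)"
          using S(2) marg_cong[of S e "restrict e S" k V \<mu>'] unfolding cap_def by simp
        then have "full_link e = (if cap S (restrict e S) \<and> (\<forall>i\<in>S. e i = restrict e S i) then full_link e else 0)"
          by simp
        also have "\<dots> \<le> (\<Sum>g\<in>S \<rightarrow>\<^sub>E V. if cap S g \<and> (\<forall>i\<in>S. e i = g i) then full_link e else 0)"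
          by (rule member_le_sum[OF g _ fSV]) (use fl0[OF e] in auto)
        also have "\<dots> \<le> (\<Sum>S\<in>\<S>. \<Sum>g\<in>S \<rightarrow>\<^sub>E V. if cap S g \<and> (\<forall>i\<in>S. e i = g i) then full_link e else 0)"
          by (rule member_le_sum[OF S(1) _ f\<S>]) (use nn in auto)
        finally show ?thesis using False by simp
      qed
    qed
    also have "\<dots> = (\<Sum>S\<in>\<S>. \<Sum>g\<in>S \<rightarrow>\<^sub>E V. \<Sum>e\<in>?P. if cap S g \<and> (\<forall>i\<in>S. e i = g i) then full_link e else 0)"
      by (subst sum.swap) (intro sum.cong refl sum.swap)
    also have "\<dots> = (\<Sum>S\<in>\<S>. \<Sum>g\<in>S \<rightarrow>\<^sub>E V. if cap S g then marg (Suc k) V \<mu> S g else 0)"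
    proof (intro sum.cong refl)
      fix S g assume "S \<in> \<S>"
      then have "S \<subseteq> {..<k}" unfolding \<S>_def by auto
      from marg_Suc[OF V(1) this, of \<mu> g]
      show "(\<Sum>e\<in>?P. if cap S g \<and> (\<forall>i\<in>S. e i = g i) then full_link e else 0)
          = (if cap S g then marg (Suc k) V \<mu> S g else 0)"
        unfolding marg_if[OF V(1)] full_link_def[symmetric] by (cases "cap S g") simp_all
    qed
    also have "\<dots> \<le> (\<Sum>S\<in>\<S>. 2 * C\<^sup>2 / A)"
      using ncap by (intro sum_mono) (auto simp: \<S>_def)
    also have "\<dots> \<le> 2 ^ k * (2 * C\<^sup>2 / A)"
      using c\<S> A0 by (simp add: mult_right_mono divide_right_mono)
    also have "\<dots> = 1 / 8"
      using C by (simp add: A power_add field_simps)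
    finally have lost: "(\<Sum>e\<in>?P. if ok e then 0 else full_link e) \<le> 1 / 8" .
    have "(\<Sum>v\<in>V. dg v) = (\<Sum>e\<in>?P. if ok e then full_link e else 0)"
      unfolding dg_def full_link_def by (subst sum.swap) (intro sum.cong refl, auto)
    moreover have "(\<Sum>e\<in>?P. full_link e) = 1"
      using sum\<mu> unfolding sum_PiE_last full_link_def .
    moreover have "(\<Sum>e\<in>?P. full_link e)
        = (\<Sum>e\<in>?P. if ok e then full_link e else 0) + (\<Sum>e\<in>?P. if ok e then 0 else full_link e)"
      by (subst sum.distrib[symmetric]) (intro sum.cong refl, auto)
    ultimately have dgV: "(\<Sum>v\<in>V. dg v) \<ge> 7 / 8" using lost by linarith
    have dgR: "(\<Sum>v\<in>R. dg v) \<le> 1 / 8"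
    proof -
      have "(\<Sum>v\<in>R. dg v) \<le> (\<Sum>v\<in>R. C / ?N)" using dgC R by (intro sum_mono) auto
      also have "\<dots> = card R * (C / ?N)" by simp
      also have "\<dots> \<le> (c * ?N) * (C / ?N)" using go(2) C N by (intro mult_right_mono) auto
      also have "\<dots> = c * C" using N by simp
      also have "\<dots> \<le> 1 / (8 * C) * C" using c C by (intro mult_right_mono) auto
      finally show ?thesis using C by simp
    qed
    have dgT: "(\<Sum>v\<in>T. dg v) \<le> 1 / 8"
    proof -
      have "(\<Sum>v\<in>T. dg v) \<le> (\<Sum>v\<in>T. C / ?N)" using dgC T by (intro sum_mono) auto
      also have "\<dots> = card T * (C / ?N)" by simp
      also have "\<dots> \<le> (2 * \<tau> * ?N) * (C / ?N)" using cT b1(1) C N by (intro mult_right_mono) auto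
      also have "\<dots> = 2 * C * \<tau>" using N by simp
      also have "\<dots> \<le> 2 * C * (1 / (16 * C))" using \<tau>(2) C by (intro mult_left_mono) auto
      finally show ?thesis using C by simp
    qed
    have "(\<Sum>v\<in>V. dg v) = (\<Sum>v\<in>V - R - T. dg v) + (\<Sum>v\<in>T. dg v) + (\<Sum>v\<in>R. dg v)"
    proof -
      have "T \<subseteq> V - R" using T RT by auto
      then show ?thesis
        using sum.subset_diff[OF R V(1), of dg] sum.subset_diff[of T "V - R" dg] V(1) by simp
    qed
    then have rest: "(\<Sum>v\<in>V - R - T. dg v) \<ge> 5 / 8" using dgV dgR dgT by linarith
    \<comment> \<open>At least 7/8 of the mass survives, and \<open>R\<close> and \<open>T\<close>
      hold at most 1/8 each by the bounds on \<open>c\<close> and \<open>\<tau>\<close>. The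
      remaining 5/8 lies on at most N vertices, so some vertex has at least 1/(2N).\<close>
    have "\<exists>v\<in>V - R - T. dg v \<ge> 1 / (2 * ?N)"
    proof (rule ccontr)
      assume "\<not> ?thesis"
      then have "(\<Sum>v\<in>V - R - T. dg v) \<le> (\<Sum>v\<in>V - R - T. 1 / (2 * ?N))"
        by (intro sum_mono) (auto simp: not_le intro: less_imp_le)
      also have "\<dots> = card (V - R - T) * (1 / (2 * ?N))" by simp
      also have "\<dots> \<le> ?N * (1 / (2 * ?N))"
        using V N by (intro mult_right_mono) (auto intro!: card_mono)
      also have "\<dots> = 1 / 2" using N by simp
      finally show False using rest by simp
    qed
    then obtain v where "v \<in> V - R - T" and dgv: "dg v \<ge> 1 / (2 * ?N)" ..
    then have v: "v \<in> V" "v \<notin> R" "v \<notin> T" by simp_all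
    define \<nu> where "\<nu> e = \<mu>' e + (if ok e then \<mu> (e(k := v)) else 0)" for e
    define a where "a = card (V - R - T)"
    have a1: "card (V - insert v R - T) = a - 1" "card (V - R - insert v T) = a - 1"
      and a0: "a > 0"
    proof -
      have "V - insert v R - T = (V - R - T) - {v}" "V - R - insert v T = (V - R - T) - {v}"
        by auto
      moreover have "v \<in> V - R - T" using v by auto
      ultimately show "card (V - insert v R - T) = a - 1" "card (V - R - insert v T) = a - 1" "a > 0"
        using V unfolding a_def by (auto simp: card_gt_0_iff)
    qed
    obtain j' where j': "j = Suc j'" using go(1) gr0_implies_Suc by blast
    have cov1: "coverable V (\<lambda>I. independent (Suc k) \<mu> I \<and> T \<subseteq> I \<and> I \<inter> insert v R = {})
        ((1 - c) * ?N) ((card (V - insert v R - T) + 1) ^ j * M)"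
      by (rule less.hyps[where \<mu>' = \<mu>'])
         (use a1 a0 R T RT cT pos supp lo hi mar v in \<open>auto simp: a_def\<close>)
    have sum\<nu>: "(\<Sum>e\<in>?P. \<nu> e) = (\<Sum>e\<in>?P. \<mu>' e) + dg v"
      by (simp add: \<nu>_def dg_def sum.distrib)
    have cTv: "real (card (insert v T)) = real (card T) + 1"
      using v fRT by simp
    have cov2: "coverable V (\<lambda>I. independent (Suc k) \<mu> I \<and> insert v T \<subseteq> I \<and> I \<inter> R = {})
        ((1 - c) * ?N) ((card (V - R - insert v T) + 1) ^ j' * M)"
    proof (rule less.hyps[where \<mu>' = \<nu>])
      show "card (V - R - insert v T) < card (V - R - T)" using a1 a0 a_def by simp
      show "card (insert v T) + j' = b" using cT j' v fRT by simp
      show "\<forall>e\<in>?P. 0 \<le> \<nu> e" using pos pos\<mu>' v by (simp add: \<nu>_def)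
      show "\<forall>e\<in>?P. \<nu> e \<noteq> 0 \<longrightarrow> (\<exists>v\<in>insert v T. \<mu> (e(k := v)) \<noteq> 0)"
        unfolding \<nu>_def using supp by (metis add.right_neutral add_0 insertCI)
      show "real (card (insert v T)) / real (2 * card V) \<le> (\<Sum>e\<in>?P. \<nu> e)"
        unfolding sum\<nu> cTv add_divide_distrib using lo dgv by simp
      show "(\<Sum>e\<in>?P. \<nu> e) \<le> real (card (insert v T)) * C / ?N"
        unfolding sum\<nu> cTv using hi dgC[OF v(1)] by (simp add: algebra_simps add_divide_distrib)
      show "\<forall>S\<subseteq>{..<k}. S \<noteq> {} \<longrightarrow> (\<forall>g. marg k V \<nu> S g \<le> (A + C) / ?N * \<tau> ^ card S)"
      proof (intro allI impI)
        fix S g assume S: "S \<subseteq> {..<k}" "S \<noteq> {}"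
        have fS: "finite S" using S(1) finite_subset by blast
        have split: "marg k V \<nu> S g = marg k V \<mu>' S g + marg k V (\<lambda>e. if ok e then \<mu> (e(k := v)) else 0) S g"
          unfolding marg_def \<nu>_def by (rule sum.distrib)
        show "marg k V \<nu> S g \<le> (A + C) / ?N * \<tau> ^ card S"
        \<comment> \<open>A capped marginal receives nothing more. An uncapped one is at most the
          cap with constant \<open>A\<close>, and a single link adds at most the same expression
          with constant \<open>C\<close>; hence the bound \<open>A + C\<close>.\<close>
        proof (cases "cap S g")
          case True
          have "marg k V (\<lambda>e. if ok e then \<mu> (e(k := v)) else 0) S g = 0"
            unfolding marg_def
          proof (intro sum.neutral ballI)
            fix e assume "e \<in> {e \<in> ?P. \<forall>i\<in>S. e i = g i}"
            then have "cap S e" using True marg_cong[of S e g k V \<mu>'] unfolding cap_def by simp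
            then have "\<not> ok e" using S unfolding ok_def by blast
            then show "(if ok e then \<mu> (e(k := v)) else 0) = 0" by simp
          qed
          then show ?thesis using mar S split by simp
        next
          case False
          have "k \<notin> S" using S(1) by auto
          then have kS: "card (insert k S) - 1 = card S" using fS by simp
          have "marg k V (\<lambda>e. if ok e then \<mu> (e(k := v)) else 0) S g \<le> marg k V (\<lambda>e. \<mu> (e(k := v))) S g"
            unfolding marg_def using pos\<mu>' v(1) by (intro sum_mono) auto
          also have "\<dots> = marg (Suc k) V \<mu> (insert k S) (g(k := v))"
            by (rule marg_insert_last[OF V(1) S(1) v(1), symmetric])
          also have "\<dots> \<le> C / ?N * \<tau> ^ card S"
            using mar\<mu>[of "insert k S" "g(k := v)"] S(1) kS by (simp add: lessThan_Suc subset_insertI2)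
          finally show ?thesis
            using False unfolding split cap_def by (simp add: add_divide_distrib algebra_simps)
        qed
      qed
    qed (use R T RT v in auto)
    have "coverable V (\<lambda>I. independent (Suc k) \<mu> I \<and> T \<subseteq> I \<and> I \<inter> R = {}) ((1 - c) * ?N)
        ((card (V - insert v R - T) + 1) ^ j * M + (card (V - R - insert v T) + 1) ^ j' * M)"
      by (rule coverable_un[OF cov1 cov2]) auto
    then show ?thesis
    proof (rule coverable_mono)
      \<comment> \<open>Rejecting \<open>v\<close> keeps the quota j, accepting it leaves j - 1,
        both with a - 1 undecided vertices: a^j + a^(j-1) is at most (a+1)^j.\<close>
      have "(card (V - insert v R - T) + 1) ^ j * M + (card (V - R - insert v T) + 1) ^ j' * M
          = (a ^ j' * (a + 1)) * M"
        using a0 by (simp add: a1 j' algebra_simps)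
      also have "\<dots> \<le> ((a + 1) ^ j' * (a + 1)) * M"
        by (intro mult_right_mono power_mono) auto
      finally show "(card (V - insert v R - T) + 1) ^ j * M + (card (V - R - insert v T) + 1) ^ j' * M
          \<le> (card (V - R - T) + 1) ^ j * M"
        by (simp add: a_def j' mult.commute)
    qed auto
  qed
qed

text \<open>Each coordinate is removed by one run of the branching, whose leaves cost a factor
  \<open>(card V + 1) ^ b\<close> with \<open>b\<close> the rounded value of
  \<open>\<tau> * card V\<close>; k coordinates give the exponent. The constants depend only on k
  and C because the spread constant passes from \<open>C\<close> to \<open>2 * (A + C)\<close> at
  each level.\<close>

lemma container_lemma:
  fixes C :: real
  assumes "C \<ge> 1"
  shows "\<exists>(c::real) (\<tau>0::real). c > 0 \<and> \<tau>0 > 0 \<and> c < 1 \<and> (\<forall>(V::'a set) \<mu> (\<tau>::real). finite V \<longrightarrow> V \<noteq> {} \<longrightarrow> spread k V \<mu> C \<tau> \<longrightarrow>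
    0 < \<tau> \<longrightarrow> \<tau> \<le> \<tau>0 \<longrightarrow> \<tau> * card V \<ge> 1 \<longrightarrow>
    coverable V (independent k \<mu>) ((1 - c) * card V) ((card V + 1) ^ (k * nat \<lceil>\<tau> * card V\<rceil>)))"
  using assms
proof (induction k arbitrary: C)
  case 0
  have "coverable V (independent 0 \<mu>) ((1 - 1 / 2) * real (card V)) 1"
    if "spread 0 V \<mu> C \<tau>" for V :: "'a set" and \<mu> \<tau>
  proof -
    \<comment> \<open>Without coordinates the undefined function is the only tuple and carries all
      the mass, so no set is independent and the empty family covers.\<close>
    have "\<mu> (\<lambda>_. undefined) = 1" using that by (simp add: spread_def)
    then have "\<not> independent 0 \<mu> I" for I by (auto simp: independent_def)
    then show ?thesis unfolding coverable_def by (intro exI[of _ "{}"]) auto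
  qed
  then show ?case
    by (intro exI[of _ "1/2 :: real"]) simp
next
  case (Suc k C)
  define A :: real where "A = 2 ^ (k + 4) * C\<^sup>2"
  have A0: "A > 0" using Suc.prems by (simp add: A_def)
  then have "A + C \<ge> 1" using Suc.prems by linarith
  then have "2 * (A + C) \<ge> 1" by simp
  from Suc.IH[OF this] obtain c \<tau>0 :: real where c: "c > 0" "\<tau>0 > 0" "c < 1" and
    IH: "\<And>(V::'a set) \<mu> (\<tau>::real). finite V \<Longrightarrow> V \<noteq> {} \<Longrightarrow> spread k V \<mu> (2 * (A + C)) \<tau> \<Longrightarrow>
    0 < \<tau> \<Longrightarrow> \<tau> \<le> \<tau>0 \<Longrightarrow> \<tau> * card V \<ge> 1 \<Longrightarrow>
    coverable V (independent k \<mu>) ((1 - c) * card V) ((card V + 1) ^ (k * nat \<lceil>\<tau> * card V\<rceil>))"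
    by metis
  define c' where "c' = min c (1 / (8 * C))"
  define \<tau>1 where "\<tau>1 = min \<tau>0 (1 / (16 * C))"
  show ?case
  proof (rule exI[of _ c'], rule exI[of _ \<tau>1], intro conjI allI impI)
    show "0 < c'" "0 < \<tau>1" "c' < 1" using c Suc.prems by (auto simp: c'_def \<tau>1_def)
    fix V :: "'a set" and \<mu> and \<tau> :: real
    assume V: "finite V" "V \<noteq> {}" and sp: "spread (Suc k) V \<mu> C \<tau>"
      and \<tau>: "0 < \<tau>" "\<tau> \<le> \<tau>1" "\<tau> * card V \<ge> 1"
    define b where "b = nat \<lceil>\<tau> * card V\<rceil>"
    have "coverable V (\<lambda>I. independent (Suc k) \<mu> I \<and> {} \<subseteq> I \<and> I \<inter> {} = {})
       ((1 - c') * card V) ((card (V - {} - {}) + 1) ^ b * (card V + 1) ^ (k * b))"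
    proof (rule container_branch[OF V sp Suc.prems \<tau>(1) _ \<tau>(3) b_def A_def, where \<mu>' = "\<lambda>_. 0"])
      show "\<tau> \<le> 1 / (16 * C)" "c' \<le> 1 / (8 * C)" using \<tau>(2) by (auto simp: \<tau>1_def c'_def)
      show "coverable V (independent k \<mu>') ((1 - c') * card V) ((card V + 1) ^ (k * b))"
        if "spread k V \<mu>' (2 * (A + C)) \<tau>" for \<mu>'
      proof (rule coverable_mono)
        show "coverable V (independent k \<mu>') ((1 - c) * card V) ((card V + 1) ^ (k * b))"
          unfolding b_def by (rule IH[OF V that \<tau>(1) _ \<tau>(3)]) (use \<tau>(2) in \<open>simp add: \<tau>1_def\<close>)
      qed (auto simp: c'_def intro!: mult_right_mono)
    qed (use A0 Suc.prems \<tau>(1) in \<open>auto simp: marg_def\<close>)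
    then show "coverable V (independent (Suc k) \<mu>) ((1 - c') * card V)
        ((card V + 1) ^ (Suc k * nat \<lceil>\<tau> * card V\<rceil>))"
      by (rule coverable_mono) (simp_all add: b_def power_add)
  qed
qed

section \<open>Spread closed walks in weighted graphs\<close>

lemma sum_PiE_first:
  fixes F :: "(nat \<Rightarrow> 'a) \<Rightarrow> 'b::comm_monoid_add"
  shows "(\<Sum>e\<in>{..<Suc k} \<rightarrow>\<^sub>E V. F e) = (\<Sum>v\<in>V. \<Sum>e\<in>{..<k} \<rightarrow>\<^sub>E V. F (case_nat v e))"
proof -
  have "(\<Sum>e\<in>{..<Suc k} \<rightarrow>\<^sub>E V. F e) = (\<Sum>(v, e)\<in>V \<times> ({..<k} \<rightarrow>\<^sub>E V). F (case_nat v e))"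
  proof (rule sum.reindex_bij_witness[where i = "\<lambda>(v, e). case_nat v e" and j = "\<lambda>e. (e 0, e \<circ> Suc)"])
    fix e assume "e \<in> {..<Suc k} \<rightarrow>\<^sub>E V"
    then show "(e 0, e \<circ> Suc) \<in> V \<times> ({..<k} \<rightarrow>\<^sub>E V)"
      by (auto simp: PiE_iff extensional_def)
    show "(case (e 0, e \<circ> Suc) of (v, e) \<Rightarrow> case_nat v e) = e"
      by (auto split: nat.split)
    show "(case (e 0, e \<circ> Suc) of (v, e) \<Rightarrow> F (case_nat v e)) = F e"
      by (simp, intro arg_cong[of _ _ F]) (auto split: nat.split)
  next
    fix b assume "b \<in> V \<times> ({..<k} \<rightarrow>\<^sub>E V)"
    then show "(case b of (v, e) \<Rightarrow> case_nat v e) \<in> {..<Suc k} \<rightarrow>\<^sub>E V"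
      by (cases b) (auto simp: PiE_iff extensional_def split: nat.split)
    show "((case b of (v, e) \<Rightarrow> case_nat v e) 0, (case b of (v, e) \<Rightarrow> case_nat v e) \<circ> Suc) = b"
      by (cases b) (simp add: comp_def)
  qed
  then show ?thesis by (simp add: sum.cartesian_product)
qed

text \<open>\<open>E ^ (2 * l - 1)\<close> stands for the number of vertices. Thus
  \<open>deg_lo\<close> gives every vertex at least \<kappa> times its uniform share of the
  stationary law, and \<open>w_hi\<close> bounds every transition probability by
  \<open>D / E ^ l\<close>, as in a graph whose degrees are of order \<open>E ^ l\<close>.\<close>

locale weighted_walk =
  fixes X :: "'a set" and w :: "'a \<Rightarrow> 'a \<Rightarrow> real" and E \<kappa> D :: real and l :: nat
  assumes finX: "finite X"
    and w_nonneg: "\<And>x y. x \<in> X \<Longrightarrow> y \<in> X \<Longrightarrow> 0 \<le> w x y"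
    and w_sym: "\<And>x y. x \<in> X \<Longrightarrow> y \<in> X \<Longrightarrow> w x y = w y x"
    and tot_pos: "0 < (\<Sum>x\<in>X. \<Sum>y\<in>X. w x y)"
    and deg_lo: "\<And>x. x \<in> X \<Longrightarrow> \<kappa> * (\<Sum>x\<in>X. \<Sum>y\<in>X. w x y) \<le> (\<Sum>y\<in>X. w x y) * E ^ (2 * l - 1)"
    and w_hi: "\<And>x y. x \<in> X \<Longrightarrow> y \<in> X \<Longrightarrow> w x y * E ^ l \<le> D * (\<Sum>y\<in>X. w x y)"
    and E1: "E \<ge> 1" and \<kappa>: "0 < \<kappa>" "\<kappa> \<le> 1" and D1: "D \<ge> 1" and l2: "l \<ge> 2"
begin

definition deg :: "'a \<Rightarrow> real" where "deg x = (\<Sum>y\<in>X. w x y)"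
definition tot :: real where "tot = (\<Sum>x\<in>X. deg x)"
definition pi :: "'a \<Rightarrow> real" where "pi x = deg x / tot"
definition ew :: "'a \<Rightarrow> 'a \<Rightarrow> real" where "ew x y = w x y / tot"
definition p :: "'a \<Rightarrow> 'a \<Rightarrow> real" where "p x y = w x y / deg x"

primrec pk :: "nat \<Rightarrow> 'a \<Rightarrow> 'a \<Rightarrow> real" where
  "pk 0 x y = (if x = y then 1 else 0)"
| "pk (Suc k) x y = (\<Sum>z\<in>X. pk k x z * p z y)"

abbreviation Wk :: "nat \<Rightarrow> (nat \<Rightarrow> 'a) set" where "Wk m \<equiv> {..<Suc m} \<rightarrow>\<^sub>E X"

lemma E0: "E > 0" using E1 by linarith
lemma Epow1: "E ^ k \<ge> 1" using E1 by simp
lemma tot0: "tot > 0" using tot_pos by (simp add: tot_def deg_def)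

lemma deg_pos: assumes "x \<in> X" shows "deg x > 0"
proof -
  have "0 < \<kappa> * tot" using \<kappa>(1) tot0 by simp
  also have "\<dots> \<le> deg x * E ^ (2 * l - 1)" using deg_lo[OF assms] by (simp add: tot_def deg_def)
  finally show ?thesis using E0 by (simp add: zero_less_mult_iff)
qed

lemma pi_pos: "x \<in> X \<Longrightarrow> pi x > 0" using deg_pos tot0 by (simp add: pi_def)

lemma pi_lo: assumes "x \<in> X" shows "\<kappa> \<le> pi x * E ^ (2 * l - 1)"
  using deg_lo[OF assms] tot0 by (simp add: pi_def tot_def deg_def field_simps)

lemma pi_sum: "(\<Sum>x\<in>X. pi x) = 1"
  using tot0 by (simp add: pi_def sum_divide_distrib[symmetric] tot_def)

lemma ew_nonneg: "x \<in> X \<Longrightarrow> y \<in> X \<Longrightarrow> ew x y \<ge> 0" using w_nonneg tot0 by (simp add: ew_def)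
lemma ew_sym: "x \<in> X \<Longrightarrow> y \<in> X \<Longrightarrow> ew x y = ew y x" using w_sym by (simp add: ew_def)
lemma pi_p: "x \<in> X \<Longrightarrow> pi x * p x y = ew x y" using deg_pos[of x] by (simp add: pi_def p_def ew_def)

lemma p_nonneg: "x \<in> X \<Longrightarrow> y \<in> X \<Longrightarrow> p x y \<ge> 0"
  using w_nonneg[of x y] deg_pos[of x] by (simp add: p_def)

lemma p_sum: "x \<in> X \<Longrightarrow> (\<Sum>y\<in>X. p x y) = 1"
  using deg_pos[of x] by (simp add: p_def sum_divide_distrib[symmetric] deg_def)

lemma p_le: assumes "x \<in> X" "y \<in> X" shows "p x y \<le> D / E ^ l"
  using w_hi[OF assms] deg_pos[OF assms(1)] E0 by (simp add: p_def deg_def field_simps)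

text \<open>The price of prescribing a further step: conditioning on the current vertex divides the
  edge law by a stationary mass that is at least \<open>\<kappa> / E ^ (2 * l - 1)\<close>.\<close>

lemma p_le_ew: assumes "x \<in> X" "y \<in> X" shows "p x y \<le> ew x y * E ^ (2 * l - 1) / \<kappa>"
proof -
  have "\<kappa> * tot \<le> deg x * E ^ (2 * l - 1)" using deg_lo[OF assms(1)] by (simp add: tot_def deg_def)
  then have "w x y * (\<kappa> * tot) \<le> w x y * (deg x * E ^ (2 * l - 1))"
    using w_nonneg[OF assms] by (intro mult_left_mono)
  then show ?thesis
    using deg_pos[OF assms(1)] tot0 \<kappa>(1) by (simp add: p_def ew_def field_simps)
qed

lemma pk_nonneg: "x \<in> X \<Longrightarrow> y \<in> X \<Longrightarrow> pk k x y \<ge> 0"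
  by (induction k arbitrary: y) (auto intro!: sum_nonneg mult_nonneg_nonneg p_nonneg)

lemma pk_sum: "x \<in> X \<Longrightarrow> (\<Sum>y\<in>X. pk k x y) = 1"
proof (induction k)
  case 0
  then show ?case using finX by simp
next
  case (Suc k)
  have "(\<Sum>y\<in>X. pk (Suc k) x y) = (\<Sum>z\<in>X. pk k x z * (\<Sum>y\<in>X. p z y))"
    unfolding pk.simps by (subst sum.swap) (simp add: sum_distrib_left)
  then show ?case using Suc by (simp add: p_sum)
qed

lemma pk_stat: "y \<in> X \<Longrightarrow> (\<Sum>x\<in>X. pi x * pk k x y) = pi y"
proof (induction k arbitrary: y)
  case 0
  then show ?case using finX by (simp add: if_distrib cong: if_cong)
next
  case (Suc k)
  have "(\<Sum>x\<in>X. pi x * pk (Suc k) x y) = (\<Sum>z\<in>X. (\<Sum>x\<in>X. pi x * pk k x z) * p z y)"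
    unfolding pk.simps by (simp add: sum_distrib_left sum_distrib_right, subst sum.swap) (simp add: mult_ac)
  also have "\<dots> = (\<Sum>z\<in>X. pi z * p z y)" using Suc by simp
  also have "\<dots> = (\<Sum>z\<in>X. pi y * p y z)" using Suc.prems by (intro sum.cong refl) (simp add: pi_p ew_sym)
  also have "\<dots> = pi y" using Suc.prems by (simp add: sum_distrib_left[symmetric] p_sum)
  finally show ?case .
qed

lemma pk_le: assumes "x \<in> X" "y \<in> X" "k \<ge> 1" shows "pk k x y \<le> D / E ^ l"
proof -
  obtain k' where k': "k = Suc k'" using assms(3) by (cases k) auto
  have "pk k x y \<le> (\<Sum>z\<in>X. pk k' x z * (D / E ^ l))"
    unfolding k' pk.simps using assms by (intro sum_mono mult_left_mono p_le pk_nonneg) auto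
  also have "\<dots> = (\<Sum>z\<in>X. pk k' x z) * (D / E ^ l)" by (rule sum_distrib_right[symmetric])
  also have "\<dots> = D / E ^ l" using assms(1) by (simp add: pk_sum)
  finally show ?thesis .
qed

section \<open>Stationary walks, their windows and good walks\<close>

definition wt :: "nat \<Rightarrow> (nat \<Rightarrow> 'a) \<Rightarrow> real" where
  "wt m g = pi (g 0) * (\<Prod>i<m. p (g i) (g (Suc i)))"

lemma Wk_in: "g \<in> Wk m \<Longrightarrow> i \<le> m \<Longrightarrow> g i \<in> X"
  by (auto simp: PiE_iff)

lemma finWk: "finite (Wk m)" using finX by (intro finite_PiE) auto

lemma wt_nonneg: "g \<in> Wk m \<Longrightarrow> wt m g \<ge> 0"
  unfolding wt_def by (intro mult_nonneg_nonneg prod_nonneg ballI p_nonneg less_imp_le[OF pi_pos])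
    (auto intro: Wk_in)

lemma sum_wt_last:
  assumes "\<And>g y. g \<in> Wk m \<Longrightarrow> y \<in> X \<Longrightarrow> \<phi> (g(Suc m := y)) = \<phi> g"
  shows "(\<Sum>g\<in>Wk (Suc m). wt (Suc m) g * \<phi> g) = (\<Sum>g\<in>Wk m. wt m g * \<phi> g)"
proof -
  have "(\<Sum>g\<in>Wk (Suc m). wt (Suc m) g * \<phi> g)
      = (\<Sum>g\<in>Wk m. \<Sum>y\<in>X. wt (Suc m) (g(Suc m := y)) * \<phi> (g(Suc m := y)))"
    by (rule sum_PiE_last)
  also have "\<dots> = (\<Sum>g\<in>Wk m. \<Sum>y\<in>X. (wt m g * \<phi> g) * p (g m) y)"
  proof (intro sum.cong refl)
    fix g y assume "g \<in> Wk m" "y \<in> X"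
    moreover have "(\<Prod>i<m. p ((g(Suc m := y)) i) ((g(Suc m := y)) (Suc i))) = (\<Prod>i<m. p (g i) (g (Suc i)))"
      by (intro prod.cong refl) simp
    ultimately show "wt (Suc m) (g(Suc m := y)) * \<phi> (g(Suc m := y)) = (wt m g * \<phi> g) * p (g m) y"
      using assms by (simp add: wt_def)
  qed
  also have "\<dots> = (\<Sum>g\<in>Wk m. wt m g * \<phi> g)"
    by (intro sum.cong refl) (simp add: sum_distrib_left[symmetric] p_sum Wk_in)
  finally show ?thesis .
qed

lemma sum_wt_first:
  "(\<Sum>g\<in>Wk (Suc m). wt (Suc m) g * \<phi> (g \<circ> Suc)) = (\<Sum>g\<in>Wk m. wt m g * \<phi> g)"
proof -
  have "(\<Sum>g\<in>Wk (Suc m). wt (Suc m) g * \<phi> (g \<circ> Suc))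
      = (\<Sum>x\<in>X. \<Sum>g\<in>Wk m. wt (Suc m) (case_nat x g) * \<phi> (case_nat x g \<circ> Suc))"
    by (rule sum_PiE_first)
  also have "\<dots> = (\<Sum>x\<in>X. \<Sum>g\<in>Wk m. ew x (g 0) * ((\<Prod>i<m. p (g i) (g (Suc i))) * \<phi> g))"
  proof (intro sum.cong refl)
    fix x g assume *: "x \<in> X" "g \<in> Wk m"
    have "case_nat x g \<circ> Suc = g" by auto
    then show "wt (Suc m) (case_nat x g) * \<phi> (case_nat x g \<circ> Suc)
        = ew x (g 0) * ((\<Prod>i<m. p (g i) (g (Suc i))) * \<phi> g)"
      using * by (simp add: wt_def prod.lessThan_Suc_shift pi_p[symmetric] del: prod.lessThan_Suc)
  qed
  also have "\<dots> = (\<Sum>g\<in>Wk m. (\<Sum>x\<in>X. ew x (g 0)) * ((\<Prod>i<m. p (g i) (g (Suc i))) * \<phi> g))"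
    by (subst sum.swap) (simp add: sum_distrib_right)
  also have "\<dots> = (\<Sum>g\<in>Wk m. wt m g * \<phi> g)"
  proof (intro sum.cong refl)
    fix g assume "g \<in> Wk m"
    then have g0: "g 0 \<in> X" by (rule Wk_in) simp
    have "(\<Sum>x\<in>X. ew x (g 0)) = (\<Sum>x\<in>X. pi (g 0) * p (g 0) x)"
      using g0 by (intro sum.cong refl) (simp add: pi_p ew_sym)
    also have "\<dots> = pi (g 0)" using g0 by (simp add: sum_distrib_left[symmetric] p_sum)
    finally show "(\<Sum>x\<in>X. ew x (g 0)) * ((\<Prod>i<m. p (g i) (g (Suc i))) * \<phi> g) = wt m g * \<phi> g"
      by (simp add: wt_def)
  qed
  finally show ?thesis .
qed

text \<open>Stationarity of the walk. Vertices after the window sum out because the rows of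
  \<open>p\<close> sum to one, vertices before it because \<open>pi\<close> is stationary.\<close>

lemma sum_wt_window:
  assumes "\<And>g g'. (\<And>i. i \<le> q \<Longrightarrow> g i = g' i) \<Longrightarrow> \<phi> g = \<phi> g'"
  shows "(\<Sum>g\<in>Wk (a + q + b). wt (a + q + b) g * \<phi> (\<lambda>i. g (a + i))) = (\<Sum>g\<in>Wk q. wt q g * \<phi> g)"
proof (induction b)
  case 0
  have "(\<Sum>g\<in>Wk (a + q). wt (a + q) g * \<phi> (\<lambda>i. g (a + i))) = (\<Sum>g\<in>Wk q. wt q g * \<phi> g)"
  proof (induction a)
    case 0
    then show ?case by simp
  next
    case (Suc a)
    have "(\<Sum>g\<in>Wk (Suc a + q). wt (Suc a + q) g * \<phi> (\<lambda>i. g (Suc a + i)))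
       = (\<Sum>g\<in>Wk (Suc (a + q)). wt (Suc (a + q)) g * \<phi> (\<lambda>i. (g \<circ> Suc) (a + i)))"
      by simp
    also have "\<dots> = (\<Sum>g\<in>Wk (a + q). wt (a + q) g * \<phi> (\<lambda>i. g (a + i)))"
      by (rule sum_wt_first)
    finally show ?case using Suc by simp
  qed
  then show ?case by simp
next
  case (Suc b)
  have "(\<Sum>g\<in>Wk (Suc (a + q + b)). wt (Suc (a + q + b)) g * \<phi> (\<lambda>i. g (a + i)))
     = (\<Sum>g\<in>Wk (a + q + b). wt (a + q + b) g * \<phi> (\<lambda>i. g (a + i)))"
    by (rule sum_wt_last) (rule assms, simp)
  then show ?case using Suc by simp
qed

lemma sum_wt: "(\<Sum>g\<in>Wk m. wt m g) = 1"
proof -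
  have "(\<Sum>g\<in>Wk (0 + 0 + m). wt (0 + 0 + m) g * 1) = (\<Sum>g\<in>Wk 0. wt 0 g * 1)"
    by (rule sum_wt_window) simp
  also have "\<dots> = (\<Sum>x\<in>X. pi x)"
    by (subst sum_PiE_last) (simp add: wt_def)
  finally show ?thesis by (simp add: pi_sum)
qed

lemma sum_wt_pk:
  "(\<Sum>g\<in>Wk m. wt m g * \<phi> (g 0) (g m)) = (\<Sum>x\<in>X. \<Sum>y\<in>X. pi x * pk m x y * \<phi> x y)"
proof (induction m arbitrary: \<phi>)
  case 0
  have "(\<Sum>x\<in>X. \<Sum>y\<in>X. pi x * pk 0 x y * \<phi> x y) = (\<Sum>x\<in>X. \<Sum>y\<in>X. if x = y then pi x * \<phi> x x else 0)"
    by (intro sum.cong refl) auto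
  also have "\<dots> = (\<Sum>x\<in>X. pi x * \<phi> x x)" using finX by simp
  finally show ?case by (subst sum_PiE_last) (simp add: wt_def)
next
  case (Suc m)
  have "(\<Sum>g\<in>Wk (Suc m). wt (Suc m) g * \<phi> (g 0) (g (Suc m)))
     = (\<Sum>g\<in>Wk m. \<Sum>y\<in>X. wt (Suc m) (g(Suc m := y)) * \<phi> (g 0) y)"
    by (subst sum_PiE_last) simp
  also have "\<dots> = (\<Sum>g\<in>Wk m. \<Sum>y\<in>X. wt m g * (p (g m) y * \<phi> (g 0) y))"
  proof (intro sum.cong refl)
    fix g y
    have "(\<Prod>i<m. p ((g(Suc m := y)) i) ((g(Suc m := y)) (Suc i))) = (\<Prod>i<m. p (g i) (g (Suc i)))"
      by (intro prod.cong refl) simp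
    then show "wt (Suc m) (g(Suc m := y)) * \<phi> (g 0) y = wt m g * (p (g m) y * \<phi> (g 0) y)"
      by (simp add: wt_def)
  qed
  also have "\<dots> = (\<Sum>g\<in>Wk m. wt m g * (\<Sum>y\<in>X. p (g m) y * \<phi> (g 0) y))"
    by (simp add: sum_distrib_left)
  also have "\<dots> = (\<Sum>x\<in>X. \<Sum>z\<in>X. pi x * pk m x z * (\<Sum>y\<in>X. p z y * \<phi> x y))"
    by (rule Suc)
  also have "\<dots> = (\<Sum>x\<in>X. \<Sum>y\<in>X. pi x * pk (Suc m) x y * \<phi> x y)"
  proof (rule sum.cong[OF refl])
    fix x
    have "(\<Sum>z\<in>X. pi x * pk m x z * (\<Sum>y\<in>X. p z y * \<phi> x y))
        = (\<Sum>z\<in>X. \<Sum>y\<in>X. pi x * pk m x z * p z y * \<phi> x y)"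
      by (simp add: sum_distrib_left mult.assoc)
    also have "\<dots> = (\<Sum>y\<in>X. \<Sum>z\<in>X. pi x * pk m x z * p z y * \<phi> x y)" by (rule sum.swap)
    finally show "(\<Sum>z\<in>X. pi x * pk m x z * (\<Sum>y\<in>X. p z y * \<phi> x y))
        = (\<Sum>y\<in>X. pi x * pk (Suc m) x y * \<phi> x y)"
      by (simp add: sum_distrib_left sum_distrib_right mult.assoc)
  qed
  finally show ?case .
qed

text \<open>Chosen so that \<open>D = B * (\<kappa> / 2)\<close>. The bound \<open>D / E ^ l\<close>
  on a single step can then be compared with the lower bound \<open>\<kappa> / 2\<close> in
  \<open>gw\<close>.\<close>

definition B :: real where "B = 2 * D / \<kappa>"

lemma B1: "B \<ge> 1" "B \<ge> D"
proof -
  have "D * \<kappa> \<le> 2 * D" using \<kappa> D1 mult_left_mono[of \<kappa> 2 D] by simp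
  then show "B \<ge> D" using \<kappa> by (simp add: B_def field_simps)
  then show "B \<ge> 1" using D1 by linarith
qed

text \<open>In the normalisation \<open>pk j * E ^ j\<close>, no subwalk beats the whole walk by
  more than the factor \<open>B\<close>. The last conjunct keeps the connection from being much
  rarer than for a random-like graph; it is needed when a whole arm of the cycle is
  prescribed.\<close>

definition gw :: "nat \<Rightarrow> (nat \<Rightarrow> 'a) \<Rightarrow> bool" where
  "gw q g \<longleftrightarrow> (\<forall>a b. a < b \<and> b \<le> q \<longrightarrow> pk (b - a) (g a) (g b) \<le> B * E ^ (q - (b - a)) * pk q (g 0) (g q))
     \<and> \<kappa> / 2 \<le> pk q (g 0) (g q) * E ^ (l + q - 1)"

lemma gw_cong: "(\<And>i. i \<le> q \<Longrightarrow> g i = g' i) \<Longrightarrow> gw q g \<longleftrightarrow> gw q g'"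
proof -
  assume *: "\<And>i. i \<le> q \<Longrightarrow> g i = g' i"
  then have "g 0 = g' 0" "g q = g' q" by auto
  then show ?thesis
    unfolding gw_def by (intro conj_cong all_cong1 imp_cong) (auto simp: *)
qed

text \<open>A window \<open>[i, i + q]\<close> of an \<open>l\<close>-walk that maximises \<open>pk q * E ^ q\<close> is good; since the
  walk is stationary, the window may be moved to the start.\<close>

lemma good_window:
  assumes g: "g \<in> Wk l" and lo: "pi (g l) / 2 \<le> pk l (g 0) (g l)"
  shows "\<exists>i q. 2 \<le> q \<and> i + q \<le> l \<and> gw q (\<lambda>j. g (i + j))"
proof -
  define val where "val = (\<lambda>(i, q). pk q (g i) (g (i + q)) * E ^ q)"
  \<comment> \<open>Windows of length one are left out so that the maximiser satisfies
    \<open>q \<ge> 2\<close>. Single steps are compared separately below, through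
    \<open>pk_le\<close>, and are the reason for the factor \<open>B\<close>.\<close>
  define I where "I = {(i, q). 2 \<le> q \<and> i + q \<le> l}"
  have "I \<subseteq> {..l} \<times> {..l}" unfolding I_def by auto
  then have finI: "finite I" by (rule finite_subset) simp
  have lI: "(0, l) \<in> I" using l2 by (simp add: I_def)
  have "Max (val ` I) \<in> val ` I" using finI lI by (intro Max_in) auto
  then obtain iq where iq: "iq \<in> I" and "val iq = Max (val ` I)" by auto
  then have mx: "val jk \<le> val iq" if "jk \<in> I" for jk
    using Max_ge[of "val ` I" "val jk"] finI that by simp
  obtain i q where [simp]: "iq = (i, q)" by (cases iq)
  have q: "2 \<le> q" "i + q \<le> l" using iq by (auto simp: I_def)
  let ?P = "pk q (g i) (g (i + q))"
  have gX: "g j \<in> X" if "j \<le> l" for j using g that by (rule Wk_in)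
  \<comment> \<open>The walk joins its ends with at least half the stationary probability of the
    last vertex. Maximality carries this lower bound from length \<open>l\<close> to length
    \<open>q\<close>.\<close>
  have "\<kappa> / 2 \<le> pi (g l) * E ^ (2 * l - 1) / 2" using pi_lo[of "g l"] gX by simp
  also have "\<dots> \<le> pk l (g 0) (g l) * E ^ (2 * l - 1)"
    using mult_right_mono[OF lo, of "E ^ (2 * l - 1)"] E0 by simp
  also have "\<dots> = val (0, l) * E ^ (l - 1)"
  proof -
    have "2 * l - 1 = l + (l - 1)" using l2 by simp
    then have "E ^ (2 * l - 1) = E ^ l * E ^ (l - 1)" by (metis power_add)
    then show ?thesis by (simp add: val_def)
  qed
  also have "\<dots> \<le> val (i, q) * E ^ (l - 1)"
    using mx[OF lI] E0 by (intro mult_right_mono) auto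
  also have "\<dots> = ?P * E ^ (l + q - 1)"
  proof -
    have "l + q - 1 = q + (l - 1)" using l2 by simp
    then have "E ^ (l + q - 1) = E ^ q * E ^ (l - 1)" by (metis power_add)
    then show ?thesis by (simp add: val_def)
  qed
  finally have lower: "\<kappa> / 2 \<le> ?P * E ^ (l + q - 1)" .
  have "pk (b - a) (g (i + a)) (g (i + b)) \<le> B * E ^ (q - (b - a)) * ?P" if ab: "a < b" "b \<le> q" for a b
  proof (cases "b - a \<ge> 2")
    case True
    then have "(i + a, b - a) \<in> I" using ab q by (auto simp: I_def)
    from mx[OF this] have "pk (b - a) (g (i + a)) (g (i + b)) * E ^ (b - a) \<le> ?P * E ^ q"
      using ab by (simp add: val_def)
    also have "\<dots> = (E ^ (q - (b - a)) * ?P) * E ^ (b - a)"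
      using ab by (simp add: power_add[symmetric])
    finally have "pk (b - a) (g (i + a)) (g (i + b)) \<le> 1 * (E ^ (q - (b - a)) * ?P)"
      using E0 by simp
    also have "\<dots> \<le> B * (E ^ (q - (b - a)) * ?P)"
      using B1(1) E0 q gX by (intro mult_right_mono mult_nonneg_nonneg pk_nonneg) auto
    finally show ?thesis by simp
  next
    case False
    then have ba: "b - a = 1" using ab by linarith
    have "pk (b - a) (g (i + a)) (g (i + b)) \<le> D / E ^ l"
      using ab q by (intro pk_le gX) auto
    also have "\<dots> = B * (\<kappa> / 2) / E ^ l" using \<kappa> by (simp add: B_def)
    also have "\<dots> \<le> B * (?P * E ^ (l + q - 1)) / E ^ l"
      using lower B1(1) E0 by (intro divide_right_mono mult_left_mono) auto
    also have "E ^ (l + q - 1) = E ^ l * E ^ (q - 1)"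
      using q by (simp add: power_add[symmetric])
    also have "B * (?P * (E ^ l * E ^ (q - 1))) / E ^ l = B * E ^ (q - (b - a)) * ?P"
      using E0 ba by simp
    finally show ?thesis .
  qed
  then have "gw q (\<lambda>j. g (i + j))" unfolding gw_def using lower by simp
  then show ?thesis using q by blast
qed

text \<open>Walks whose ends are joined with less than half the stationary probability have total
  mass at most 1/2, since \<open>pi\<close> sums to one. Every other walk has a good window, and
  there are at most l^2 candidates for its place and length, so one candidate receives mass 1/(2
  l^2).\<close>

lemma good_length:
  "\<exists>q. 2 \<le> q \<and> q \<le> l \<and> 1 / (2 * real l ^ 2) \<le> (\<Sum>g\<in>Wk q. wt q g * (if gw q g then 1 else 0))"
proof -
  define low where "low = (\<lambda>x y. if pk l x y < pi y / 2 then 1 else 0 :: real)"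
  have "(\<Sum>g\<in>Wk l. wt l g * low (g 0) (g l)) = (\<Sum>x\<in>X. \<Sum>y\<in>X. pi x * pk l x y * low x y)"
    by (rule sum_wt_pk)
  also have "\<dots> \<le> (\<Sum>x\<in>X. \<Sum>y\<in>X. pi x * (pi y / 2))"
  proof (intro sum_mono)
    fix x y assume "x \<in> X" "y \<in> X"
    then show "pi x * pk l x y * low x y \<le> pi x * (pi y / 2)"
      using pi_pos[of x] pi_pos[of y] by (auto simp: low_def)
  qed
  also have "\<dots> = 1 / 2"
    by (simp add: sum_distrib_left[symmetric] sum_distrib_right[symmetric] sum_divide_distrib[symmetric] pi_sum)
  finally have L: "(\<Sum>g\<in>Wk l. wt l g * low (g 0) (g l)) \<le> 1 / 2" .
  define I where "I = {..<l} \<times> {2..l}"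
  have cI: "real (card I) \<le> real l ^ 2"
  proof -
    have "card I \<le> l * l" unfolding I_def by (simp add: card_cartesian_product)
    then show ?thesis by (simp add: power2_eq_square flip: of_nat_mult)
  qed
  define ind where "ind = (\<lambda>(i, q) g. if i + q \<le> l \<and> gw q (\<lambda>j. g (i + j)) then 1 else 0 :: real)"
  have "1 = (\<Sum>g\<in>Wk l. wt l g)" by (simp add: sum_wt)
  also have "\<dots> \<le> (\<Sum>g\<in>Wk l. wt l g * low (g 0) (g l) + (\<Sum>iq\<in>I. wt l g * ind iq g))"
  proof (rule sum_mono)
    fix g assume g: "g \<in> Wk l"
    have nn: "wt l g * ind iq g \<ge> 0" for iq
      using wt_nonneg[OF g] by (cases iq) (simp add: ind_def)
    show "wt l g \<le> wt l g * low (g 0) (g l) + (\<Sum>iq\<in>I. wt l g * ind iq g)"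
    proof (cases "pk l (g 0) (g l) < pi (g l) / 2")
      case True
      then show ?thesis using nn by (simp add: low_def sum_nonneg)
    next
      case False
      then obtain i q where iq: "2 \<le> q" "i + q \<le> l" "gw q (\<lambda>j. g (i + j))"
        using good_window[OF g] by auto
      then have "(i, q) \<in> I" unfolding I_def using l2 by auto
      then have "wt l g * ind (i, q) g \<le> (\<Sum>iq\<in>I. wt l g * ind iq g)"
        by (rule member_le_sum) (use nn in \<open>auto simp: I_def\<close>)
      then show ?thesis using iq False by (simp add: ind_def low_def)
    qed
  qed
  also have "\<dots> = (\<Sum>g\<in>Wk l. wt l g * low (g 0) (g l)) + (\<Sum>iq\<in>I. \<Sum>g\<in>Wk l. wt l g * ind iq g)"
    by (simp add: sum.distrib) (rule sum.swap)
  finally have half: "1 / 2 \<le> (\<Sum>iq\<in>I. \<Sum>g\<in>Wk l. wt l g * ind iq g)" using L by linarith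
  have "\<exists>iq\<in>I. 1 / (2 * real l ^ 2) \<le> (\<Sum>g\<in>Wk l. wt l g * ind iq g)"
  proof (rule ccontr)
    assume "\<not> ?thesis"
    then have "(\<Sum>iq\<in>I. \<Sum>g\<in>Wk l. wt l g * ind iq g) < (\<Sum>iq\<in>I. 1 / (2 * real l ^ 2))"
    proof (intro sum_strict_mono)
      have "(0, 2) \<in> I" using l2 by (simp add: I_def)
      then show "finite I" "I \<noteq> {}" by (auto simp: I_def)
    qed (use not_le in blast)
    also have "\<dots> = card I * (1 / (2 * real l ^ 2))" by simp
    also have "\<dots> \<le> real l ^ 2 * (1 / (2 * real l ^ 2))" using cI by (intro mult_right_mono) auto
    also have "\<dots> = 1 / 2" using l2 by simp
    finally show False using half by simp
  qed
  then obtain i q where iq: "(i, q) \<in> I" and le: "1 / (2 * real l ^ 2) \<le> (\<Sum>g\<in>Wk l. wt l g * ind (i, q) g)"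
    by auto
  have pos: "0 < 1 / (2 * real l ^ 2)" using l2 by simp
  have iql: "i + q \<le> l"
  proof (rule ccontr)
    assume "\<not> ?thesis"
    then have "(\<Sum>g\<in>Wk l. wt l g * ind (i, q) g) = 0" by (simp add: ind_def)
    then show False using le pos by linarith
  qed
  then obtain b where b: "l = i + q + b" using le_Suc_ex by blast
  have "(\<Sum>g\<in>Wk l. wt l g * ind (i, q) g)
      = (\<Sum>g\<in>Wk (i + q + b). wt (i + q + b) g * (if gw q (\<lambda>j. g (i + j)) then 1 else 0))"
    unfolding b[symmetric] ind_def using iql by simp
  also have "\<dots> = (\<Sum>g\<in>Wk q. wt q g * (if gw q g then 1 else 0))"
    by (rule sum_wt_window[where \<phi> = "\<lambda>g. if gw q g then 1 else 0"]) (metis gw_cong)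
  finally show ?thesis using le iq by (intro exI[of _ q]) (auto simp: I_def)
qed

end

section \<open>The law of a closed walk with prescribed levels\<close>

locale cycle_law = weighted_walk +
  fixes q h :: nat
  assumes q2: "q \<ge> 2" and lqh: "l = q + h"
begin

text \<open>In the law \<open>F\<close> of a closed walk \<open>f\<close>, position \<open>i\<close> has level \<open>lam i\<close>, meaning that given \<open>f 0 = u\<close> the
  vertex \<open>f i\<close> is distributed like the \<open>lam i\<close>-th vertex of the walk from \<open>u\<close>. The levels rise from
  \<open>0\<close> to \<open>q\<close>, alternate between \<open>q\<close> and \<open>q - 1\<close>, and fall back to \<open>0\<close>. An upward step follows the
  random walk and a downward step its time reversal given \<open>u\<close>: \<open>om u i\<close> is the joint law of
  consecutive vertices and \<open>K u i\<close> the resulting transition kernel.\<close>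

definition lam :: "nat \<Rightarrow> nat" where
  "lam i = (if i \<le> q then i else if q + 2 * h \<le> i then 2 * l - i else if even (i - q) then q else q - 1)"

abbreviation M :: nat where "M \<equiv> q + 2 * h"

lemma M_l: "2 * l = M + q" using lqh by simp

lemma lam_first: "i \<le> q \<Longrightarrow> lam i = i" by (simp add: lam_def)
lemma lam_last: "M \<le> i \<Longrightarrow> i \<le> 2 * l \<Longrightarrow> lam i = 2 * l - i"
  unfolding lam_def using M_l by auto
lemma lam_mid: assumes "j \<le> 2 * h" shows "lam (q + j) = (if even j then q else q - 1)"
proof -
  have "2 * l - (q + j) = q" if "2 * h \<le> j" using M_l that assms by linarith
  moreover have "even j" if "2 * h \<le> j" using that assms by (metis dvd_triv_left order_antisym)
  ultimately show ?thesis using assms unfolding lam_def by auto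
qed

lemma lam_rev: assumes "i \<le> 2 * l" shows "lam (2 * l - i) = lam i"
proof -
  consider "i \<le> q" | "M \<le> i" | "q \<le> i" "i \<le> M" by linarith
  then show ?thesis
  proof cases
    case 1
    then have "M \<le> 2 * l - i" "2 * l - (2 * l - i) = i" using lqh assms by auto
    then show ?thesis using lam_last[of "2 * l - i"] lam_first[OF 1] by simp
  next
    case 2
    then have "2 * l - i \<le> q" using lqh by simp
    then show ?thesis using lam_last[OF 2 assms] lam_first[of "2 * l - i"] by simp
  next
    case 3
    then have j: "i = q + (i - q)" "i - q \<le> 2 * h" by simp_all
    then obtain j where j: "i = q + j" "j \<le> 2 * h" by blast
    then have "2 * l - i = q + (2 * h - j)" using lqh by simp
    then show ?thesis using lam_mid[of j] lam_mid[of "2 * h - j"] j by simp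
  qed
qed

lemma lam_step: assumes "i < 2 * l"
  shows "lam (Suc i) = Suc (lam i) \<or> lam i = Suc (lam (Suc i))"
proof -
  consider "i < q" | "M \<le> i" | "q \<le> i" "i < M" by linarith
  then show ?thesis
  proof cases
    case 1
    then show ?thesis by (simp add: lam_first)
  next
    case 2
    then show ?thesis using lam_last[of i] lam_last[of "Suc i"] assms by (simp add: Suc_diff_Suc)
  next
    case 3
    then have "i = q + (i - q)" "i - q < 2 * h" by simp_all
    then obtain j where j: "i = q + j" "j < 2 * h" by blast
    then show ?thesis using lam_mid[of j] lam_mid[of "Suc j"] q2 by auto
  qed
qed

definition om :: "'a \<Rightarrow> nat \<Rightarrow> 'a \<Rightarrow> 'a \<Rightarrow> real" where
  "om u i x y = (if lam i < lam (Suc i) then pk (lam i) u x * p x y else pk (lam (Suc i)) u y * p y x)"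

definition K :: "'a \<Rightarrow> nat \<Rightarrow> 'a \<Rightarrow> 'a \<Rightarrow> real" where
  "K u i x y = om u i x y / pk (lam i) u x"

lemma om_nonneg: "u \<in> X \<Longrightarrow> x \<in> X \<Longrightarrow> y \<in> X \<Longrightarrow> om u i x y \<ge> 0"
  unfolding om_def by (auto intro!: mult_nonneg_nonneg pk_nonneg p_nonneg)

lemma K_nonneg: "u \<in> X \<Longrightarrow> x \<in> X \<Longrightarrow> y \<in> X \<Longrightarrow> K u i x y \<ge> 0"
  unfolding K_def by (intro divide_nonneg_nonneg om_nonneg pk_nonneg)

lemma om_row: assumes "i < 2 * l" "u \<in> X" "x \<in> X" shows "(\<Sum>y\<in>X. om u i x y) = pk (lam i) u x"
  using lam_step[OF assms(1)] assms by (auto simp: om_def sum_distrib_left[symmetric] p_sum)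

lemma om_col: assumes "i < 2 * l" "u \<in> X" "y \<in> X" shows "(\<Sum>x\<in>X. om u i x y) = pk (lam (Suc i)) u y"
  using lam_step[OF assms(1)] assms by (auto simp: om_def sum_distrib_left[symmetric] p_sum)

text \<open>Averaged over a stationary start, a step has the edge law whatever its level. This gives
  the first prescribed step its cost \<open>ew\<close>.\<close>

lemma om_stat: assumes "x \<in> X" "y \<in> X" shows "(\<Sum>u\<in>X. pi u * om u i x y) = ew x y"
proof -
  have "(\<Sum>u\<in>X. pi u * (pk a u x * p x y)) = ew x y" if "x \<in> X" for a x y
    using pk_stat[OF that, of a] that by (simp add: mult.assoc[symmetric] sum_distrib_right[symmetric] pi_p)
  from this[OF assms(1), of "lam i" y] this[OF assms(2), of "lam (Suc i)" x] show ?thesis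
    using ew_sym[OF assms] unfolding om_def by (cases "lam i < lam (Suc i)") simp_all
qed

text \<open>An inequality, because where \<open>pk (lam i) u x\<close> vanishes the whole row of
  \<open>K\<close> is zero by the convention for division.\<close>

lemma K_row: assumes "i < 2 * l" "u \<in> X" "x \<in> X" shows "(\<Sum>y\<in>X. K u i x y) \<le> 1"
  using om_row[OF assms] by (simp add: K_def sum_divide_distrib[symmetric])

definition F :: "(nat \<Rightarrow> 'a) \<Rightarrow> real" where
  "F f = pi (f 0) * (\<Prod>i<2 * l. K (f 0) i (f i) (f (Suc i)))"

definition Fp :: "nat \<Rightarrow> (nat \<Rightarrow> 'a) \<Rightarrow> real" where
  "Fp m f = pi (f 0) * (\<Prod>i<m. K (f 0) i (f i) (f (Suc i)))"

lemma F_Fp: "F f = Fp (2 * l) f" by (simp add: F_def Fp_def)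

lemma Fp_upd: "Fp (Suc m) (f(Suc m := y)) = Fp m f * K (f 0) m (f m) y"
proof -
  have "(\<Prod>i<m. K (f 0) i ((f(Suc m := y)) i) ((f(Suc m := y)) (Suc i))) = (\<Prod>i<m. K (f 0) i (f i) (f (Suc i)))"
    by (intro prod.cong refl) simp
  then show ?thesis by (simp add: Fp_def)
qed

lemma Fp_cong: "(\<And>i. i \<le> m \<Longrightarrow> f i = g i) \<Longrightarrow> Fp m f = Fp m g"
  unfolding Fp_def by (intro arg_cong2[of _ _ _ _ "(*)"] prod.cong) auto

lemma Fp_nonneg: assumes "f \<in> Wk m" shows "Fp m f \<ge> 0"
  unfolding Fp_def using assms
  by (intro mult_nonneg_nonneg prod_nonneg ballI K_nonneg less_imp_le[OF pi_pos]) (auto intro: Wk_in)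

lemma sum_Fp_step:
  "(\<Sum>f\<in>Wk (Suc m). Fp (Suc m) f * H f) = (\<Sum>f\<in>Wk m. Fp m f * (\<Sum>y\<in>X. K (f 0) m (f m) y * H (f(Suc m := y))))"
  by (subst sum_PiE_last) (simp add: Fp_upd sum_distrib_left mult.assoc)

lemma sum_Fp_drop:
  assumes "m < 2 * l" "\<And>f. f \<in> Wk m \<Longrightarrow> H f \<ge> 0"
    "\<And>f y. f \<in> Wk m \<Longrightarrow> y \<in> X \<Longrightarrow> H' (f(Suc m := y)) \<le> H f"
  shows "(\<Sum>f\<in>Wk (Suc m). Fp (Suc m) f * H' f) \<le> (\<Sum>f\<in>Wk m. Fp m f * H f)"
  unfolding sum_Fp_step
proof (intro sum_mono mult_left_mono Fp_nonneg)
  fix f assume f: "f \<in> Wk m"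
  then have fX: "f 0 \<in> X" "f m \<in> X" by (auto intro: Wk_in)
  have "(\<Sum>y\<in>X. K (f 0) m (f m) y * H' (f(Suc m := y))) \<le> (\<Sum>y\<in>X. K (f 0) m (f m) y * H f)"
    using assms(3)[OF f] fX by (intro sum_mono mult_left_mono K_nonneg) auto
  also have "\<dots> = (\<Sum>y\<in>X. K (f 0) m (f m) y) * H f" by (simp add: sum_distrib_right)
  also have "\<dots> \<le> 1 * H f" using K_row[OF assms(1) fX] assms(2)[OF f] by (intro mult_right_mono) auto
  finally show "(\<Sum>y\<in>X. K (f 0) m (f m) y * H' (f(Suc m := y))) \<le> H f" by simp
qed

text \<open>\<open>om u i\<close> has the marginals \<open>pk (lam i) u\<close> and
  \<open>pk (lam (Suc i)) u\<close>, so the kernels carry one level law into the next. This is the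
  precise sense in which position m is distributed like the vertex at its level.\<close>

lemma sum_Fp_forward:
  assumes "m \<le> 2 * l" "\<And>u x. u \<in> X \<Longrightarrow> x \<in> X \<Longrightarrow> \<phi> u x \<ge> 0"
  shows "(\<Sum>f\<in>Wk m. Fp m f * \<phi> (f 0) (f m)) \<le> (\<Sum>u\<in>X. pi u * (\<Sum>x\<in>X. pk (lam m) u x * \<phi> u x))"
  using assms
proof (induction m arbitrary: \<phi>)
  case 0
  have "(\<Sum>f\<in>Wk 0. Fp 0 f * \<phi> (f 0) (f 0)) = (\<Sum>u\<in>X. pi u * \<phi> u u)"
    by (subst sum_PiE_last) (simp add: Fp_def)
  also have "\<dots> = (\<Sum>u\<in>X. pi u * (\<Sum>x\<in>X. if x = u then \<phi> u u else 0))" using finX by simp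
  also have "\<dots> = (\<Sum>u\<in>X. pi u * (\<Sum>x\<in>X. pk (lam 0) u x * \<phi> u x))"
    by (intro sum.cong refl arg_cong2[of _ _ _ _ "(*)"]) (auto simp: lam_def)
  finally show ?case by simp
next
  case (Suc m)
  have "(\<Sum>f\<in>Wk (Suc m). Fp (Suc m) f * \<phi> (f 0) (f (Suc m)))
     = (\<Sum>f\<in>Wk m. Fp m f * (\<Sum>y\<in>X. K (f 0) m (f m) y * \<phi> (f 0) y))"
    by (subst sum_Fp_step) simp
  also have "\<dots> \<le> (\<Sum>u\<in>X. pi u * (\<Sum>x\<in>X. pk (lam m) u x * (\<Sum>y\<in>X. K u m x y * \<phi> u y)))"
    by (rule Suc.IH) (use Suc.prems in \<open>auto intro!: sum_nonneg mult_nonneg_nonneg K_nonneg\<close>)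
  also have "\<dots> \<le> (\<Sum>u\<in>X. pi u * (\<Sum>y\<in>X. pk (lam (Suc m)) u y * \<phi> u y))"
  proof (rule sum_mono, rule mult_left_mono[OF _ less_imp_le[OF pi_pos]])
    fix u assume u: "u \<in> X"
    then show "u \<in> X" .
    have "(\<Sum>x\<in>X. pk (lam m) u x * (\<Sum>y\<in>X. K u m x y * \<phi> u y))
        = (\<Sum>x\<in>X. \<Sum>y\<in>X. (pk (lam m) u x * K u m x y) * \<phi> u y)"
      by (simp add: sum_distrib_left mult.assoc)
    also have "\<dots> \<le> (\<Sum>x\<in>X. \<Sum>y\<in>X. om u m x y * \<phi> u y)"
      using u Suc.prems(2) om_nonneg
      by (intro sum_mono mult_right_mono) (auto simp: K_def)
    also have "\<dots> = (\<Sum>y\<in>X. \<Sum>x\<in>X. om u m x y * \<phi> u y)" by (rule sum.swap)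
    also have "\<dots> = (\<Sum>y\<in>X. pk (lam (Suc m)) u y * \<phi> u y)"
      using Suc.prems(1) u by (simp add: sum_distrib_right[symmetric] om_col)
    finally show "(\<Sum>x\<in>X. pk (lam m) u x * (\<Sum>y\<in>X. K u m x y * \<phi> u y)) \<le> (\<Sum>y\<in>X. pk (lam (Suc m)) u y * \<phi> u y)" .
  qed
  finally show ?case .
qed

lemma Fp_total: assumes "m \<le> 2 * l" shows "(\<Sum>f\<in>Wk m. Fp m f) \<le> 1"
proof -
  have "(\<Sum>f\<in>Wk m. Fp m f * 1) \<le> (\<Sum>u\<in>X. pi u * (\<Sum>x\<in>X. pk (lam m) u x * 1))"
    by (rule sum_Fp_forward[OF assms]) simp
  also have "\<dots> = 1" by (simp add: pk_sum pi_sum)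
  finally show ?thesis by simp
qed

text \<open>The last step falls from level 1 to level 0, and its joint law contains
  \<open>pk 0 u y\<close>, which vanishes unless y = u.\<close>

lemma F_closed: assumes "F f \<noteq> 0" shows "f (2 * l) = f 0"
proof -
  have "\<forall>i<2 * l. K (f 0) i (f i) (f (Suc i)) \<noteq> 0"
    using assms by (auto simp: F_def)
  moreover have "2 * l - 1 < 2 * l" using l2 by simp
  ultimately have "K (f 0) (2 * l - 1) (f (2 * l - 1)) (f (Suc (2 * l - 1))) \<noteq> 0" by blast
  moreover have "Suc (2 * l - 1) = 2 * l" using l2 by simp
  moreover have "lam (2 * l - 1) = 1" "lam (2 * l) = 0"
    using lam_rev[of 1] lam_rev[of 0] lam_first q2 l2 by simp_all
  ultimately show ?thesis by (auto simp: K_def om_def split: if_splits)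
qed

lemma F_edge: assumes "F f \<noteq> 0" "i < 2 * l" "f \<in> Wk (2 * l)" shows "w (f i) (f (Suc i)) > 0"
proof -
  have X: "f i \<in> X" "f (Suc i) \<in> X" using assms by (auto intro: Wk_in)
  have "K (f 0) i (f i) (f (Suc i)) \<noteq> 0" using assms by (auto simp: F_def)
  then have "w (f i) (f (Suc i)) \<noteq> 0"
    using w_sym[OF X] by (auto simp: K_def om_def p_def split: if_splits)
  then show ?thesis using w_nonneg[OF X] by simp
qed

definition rv :: "(nat \<Rightarrow> 'a) \<Rightarrow> nat \<Rightarrow> 'a" where
  "rv f = (\<lambda>i. if i \<le> 2 * l then f (2 * l - i) else undefined)"

lemma rv_Wk: "f \<in> Wk (2 * l) \<Longrightarrow> rv f \<in> Wk (2 * l)"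
  by (auto simp: rv_def PiE_iff extensional_def)

lemma rv_rv: "f \<in> Wk (2 * l) \<Longrightarrow> rv (rv f) = f"
  by (rule ext) (auto simp: rv_def PiE_iff extensional_def)

lemma om_rev: assumes "i < 2 * l" shows "om u (2 * l - Suc i) y x = om u i x y"
proof -
  have "Suc (2 * l - Suc i) = 2 * l - i" using assms by simp
  then have e: "lam (2 * l - Suc i) = lam (Suc i)" "lam (Suc (2 * l - Suc i)) = lam i"
    using lam_rev[of i] lam_rev[of "Suc i"] assms by simp_all
  have "lam (Suc i) < lam i \<longleftrightarrow> \<not> lam i < lam (Suc i)" using lam_step[OF assms] by linarith
  then show ?thesis unfolding om_def e by (cases "lam i < lam (Suc i)") simp_all
qed

text \<open>For a fixed start, \<open>F\<close> is the product of all \<open>om\<close> divided by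
  the product of all \<open>pk (lam i)\<close>. Both products are unchanged by reversal, because the
  level profile is symmetric and the two ends of the walk coincide.\<close>

lemma F_rv: "F (rv f) = F f"
proof (cases "f (2 * l) = f 0")
  case False
  then have "F f = 0" "F (rv f) = 0" using F_closed[of f] F_closed[of "rv f"] by (auto simp: rv_def)
  then show ?thesis by simp
next
  case True
  define u where "u = f 0"
  have K: "F g = pi u * ((\<Prod>i<2 * l. om u i (g i) (g (Suc i))) / (\<Prod>i<2 * l. pk (lam i) u (g i)))" if "g 0 = u" for g
    using that by (simp add: F_def K_def prod_dividef)
  have g0: "rv f 0 = u" using True by (simp add: rv_def u_def)
  have "(\<Prod>i<2 * l. om u i (rv f i) (rv f (Suc i))) = (\<Prod>i<2 * l. om u (2 * l - Suc i) (f (2 * l - Suc i)) (f (2 * l - i)))"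
  proof (intro prod.cong refl)
    fix i assume "i \<in> {..<2 * l}"
    then show "om u i (rv f i) (rv f (Suc i)) = om u (2 * l - Suc i) (f (2 * l - Suc i)) (f (2 * l - i))"
      using om_rev[of i u "f (2 * l - Suc i)" "f (2 * l - i)"] by (simp add: rv_def)
  qed
  also have "\<dots> = (\<Prod>i<2 * l. (\<lambda>j. om u j (f j) (f (Suc j))) (2 * l - Suc i))"
    by (intro prod.cong refl) (simp add: Suc_diff_Suc)
  also have "\<dots> = (\<Prod>i<2 * l. om u i (f i) (f (Suc i)))"
    by (rule prod.nat_diff_reindex)
  finally have num: "(\<Prod>i<2 * l. om u i (rv f i) (rv f (Suc i))) = (\<Prod>i<2 * l. om u i (f i) (f (Suc i)))" .
  obtain m where m: "2 * l = Suc m" using l2 by (cases "2 * l") auto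
  define g where "g j = pk (lam j) u (f j)" for j
  have ends: "g 0 = 1" "g (2 * l) = 1"
    using lam_rev[of 0] True by (simp_all add: g_def u_def lam_first)
  have "(\<Prod>i<2 * l. pk (lam i) u (rv f i)) = (\<Prod>i<2 * l. g (2 * l - i))"
    by (intro prod.cong refl) (simp add: g_def rv_def lam_rev)
  also have "\<dots> = g (2 * l) * (\<Prod>i<m. g (2 * l - Suc i))"
    unfolding m by (subst prod.lessThan_Suc_shift) simp
  also have "(\<Prod>i<m. g (2 * l - Suc i)) = (\<Prod>i<m. (\<lambda>j. g (Suc j)) (m - Suc i))"
    unfolding m by (intro prod.cong refl) (simp add: Suc_diff_Suc)
  also have "\<dots> = (\<Prod>j<m. g (Suc j))" by (rule prod.nat_diff_reindex)
  also have "g (2 * l) * \<dots> = g 0 * (\<Prod>j<m. g (Suc j))" using ends by simp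
  also have "\<dots> = (\<Prod>i<2 * l. g i)" unfolding m by (subst prod.lessThan_Suc_shift) simp
  finally have den: "(\<Prod>i<2 * l. pk (lam i) u (rv f i)) = (\<Prod>i<2 * l. pk (lam i) u (f i))"
    by (simp add: g_def)
  show ?thesis unfolding K[of "rv f", OF g0] K[of f, OF u_def[symmetric]] num den ..
qed

text \<open>The goodness inequality for the subwalk that omits only the last step, demanded of every
  zigzag step. It bounds the ratio of level laws by which a downward kernel exceeds the walk, so
  that such a step costs at most a factor \<open>B * E\<close>.\<close>

definition zz :: "'a \<Rightarrow> nat \<Rightarrow> 'a \<Rightarrow> 'a \<Rightarrow> bool" where
  "zz u i x y \<longleftrightarrow> (if lam i < lam (Suc i) then pk (q - 1) u x \<le> B * E * pk q u y
                  else pk (q - 1) u y \<le> B * E * pk q u x)"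

definition good :: "(nat \<Rightarrow> 'a) \<Rightarrow> bool" where
  "good f \<longleftrightarrow> f (2 * l) = f 0 \<and> gw q f \<and> gw q (\<lambda>i. f (2 * l - i)) \<and>
     (\<forall>i. q \<le> i \<and> i < M \<longrightarrow> zz (f 0) i (f i) (f (Suc i)))"

lemma zz_rev: assumes "i < 2 * l" shows "zz u (2 * l - Suc i) y x \<longleftrightarrow> zz u i x y"
proof -
  have "Suc (2 * l - Suc i) = 2 * l - i" using assms by simp
  then have e: "lam (2 * l - Suc i) = lam (Suc i)" "lam (Suc (2 * l - Suc i)) = lam i"
    using lam_rev[of i] lam_rev[of "Suc i"] assms by simp_all
  have "lam (Suc i) < lam i \<longleftrightarrow> \<not> lam i < lam (Suc i)" using lam_step[OF assms] by linarith
  then show ?thesis unfolding zz_def e by (cases "lam i < lam (Suc i)") simp_all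
qed

lemma good_rv: assumes "good f" shows "good (rv f)"
proof -
  have ql: "q \<le> 2 * l" using lqh by simp
  have "gw q (rv f) \<longleftrightarrow> gw q (\<lambda>i. f (2 * l - i))"
    by (rule gw_cong) (use ql in \<open>simp add: rv_def\<close>)
  moreover have "gw q (\<lambda>i. rv f (2 * l - i)) \<longleftrightarrow> gw q f"
    by (rule gw_cong) (use ql in \<open>simp add: rv_def\<close>)
  moreover have "zz (rv f 0) i (rv f i) (rv f (Suc i))" if i: "q \<le> i" "i < M" for i
  proof -
    have "i < 2 * l" using i lqh by simp
    moreover have "q \<le> 2 * l - Suc i" "2 * l - Suc i < M" using i lqh q2 by auto
    moreover have "Suc (2 * l - Suc i) = 2 * l - i" using i lqh by simp
    ultimately show ?thesis
      using assms zz_rev[of i "f 0" "f (2 * l - Suc i)" "f (2 * l - i)"] by (auto simp: good_def rv_def)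
  qed
  ultimately show ?thesis using assms by (auto simp: good_def rv_def)
qed

lemma K_up: assumes "lam i < lam (Suc i)" "u \<in> X" "x \<in> X" "y \<in> X" shows "K u i x y \<le> p x y"
  using assms p_nonneg[of x y] by (simp add: K_def om_def)

lemma down_level: assumes "q \<le> i" "i < M" "\<not> lam i < lam (Suc i)"
  shows "lam i = q" "lam (Suc i) = q - 1"
proof -
  have "i = q + (i - q)" "i - q < 2 * h" using assms by simp_all
  then obtain j where j: "i = q + j" "j < 2 * h" by blast
  then show "lam i = q" "lam (Suc i) = q - 1"
    using assms(3) lam_mid[of j] lam_mid[of "Suc j"] q2 by (auto split: if_splits)
qed

lemma K_down: assumes "q \<le> i" "i < M" "\<not> lam i < lam (Suc i)" "zz u i x y" "u \<in> X" "x \<in> X" "y \<in> X"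
  shows "K u i x y \<le> B * E * p y x"
proof (cases "pk q u x = 0")
  case True
  then show ?thesis using down_level[OF assms(1-3)] B1 E0 p_nonneg assms by (simp add: K_def)
next
  case False
  then have pos: "pk q u x > 0" using pk_nonneg assms by (simp add: order_less_le)
  have "K u i x y = pk (q - 1) u y / pk q u x * p y x"
    using assms(3) down_level[OF assms(1-3)] by (simp add: K_def om_def)
  also have "\<dots> \<le> B * E * p y x"
    using assms pos p_nonneg by (intro mult_right_mono) (auto simp: zz_def field_simps)
  finally show ?thesis .
qed

definition bet :: "'a \<Rightarrow> 'a \<Rightarrow> real" where "bet x y = ew x y * E ^ (2 * l - 1) / \<kappa>"

lemma bet_nonneg: "x \<in> X \<Longrightarrow> y \<in> X \<Longrightarrow> bet x y \<ge> 0"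
  using ew_nonneg E0 \<kappa> by (simp add: bet_def)

definition mul :: "nat \<Rightarrow> real" where "mul i = (if lam i < lam (Suc i) then 1 else B * E)"

lemma BE1: "B * E \<ge> 1" using mult_mono[OF B1(1) E1] B1 by simp

lemma mul_bounds: "1 \<le> mul i" "mul i \<le> B * E" using BE1 by (auto simp: mul_def)

lemma first_up: "i < q \<Longrightarrow> lam i < lam (Suc i)" by (simp add: lam_first)

text \<open>Only downward steps pay the additional factor \<open>B * E\<close> in
  \<open>mul\<close>. When both arms are prescribed this refined cost is needed, since the downward
  steps must then be counted.\<close>

lemma K_bet: assumes "i < M" "q \<le> i \<Longrightarrow> zz u i x y" "u \<in> X" "x \<in> X" "y \<in> X"
  shows "K u i x y \<le> mul i * bet x y"
proof (cases "lam i < lam (Suc i)")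
  case True
  then show ?thesis
    using order_trans[OF K_up[OF True assms(3-5)] p_le_ew[OF assms(4,5)]] by (simp add: mul_def bet_def)
next
  case False
  then have qi: "q \<le> i" using first_up by (meson not_less)
  have "K u i x y \<le> B * E * p y x" using K_down[OF qi assms(1) False] assms qi by blast
  also have "\<dots> \<le> B * E * bet x y"
    using p_le_ew[of y x] ew_sym[of x y] assms BE1 by (intro mult_left_mono) (auto simp: bet_def)
  finally show ?thesis using False by (simp add: mul_def)
qed

lemma K_small: assumes "i < M" "q \<le> i \<Longrightarrow> zz u i x y" "u \<in> X" "x \<in> X" "y \<in> X"
  shows "K u i x y \<le> B * D * E / E ^ l"
proof (cases "lam i < lam (Suc i)")
  case True
  have "K u i x y \<le> 1 * (D / E ^ l)" using order_trans[OF K_up[OF True assms(3-5)] p_le[OF assms(4,5)]] by simp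
  also have "\<dots> \<le> (B * E) * (D / E ^ l)" using BE1 D1 E0 by (intro mult_right_mono) auto
  finally show ?thesis by (simp add: mult_ac)
next
  case False
  then have qi: "q \<le> i" using first_up by (meson not_less)
  have "K u i x y \<le> B * E * p y x" using K_down[OF qi assms(1) False] assms qi by blast
  also have "\<dots> \<le> B * E * (D / E ^ l)"
    using p_le[of y x] assms BE1 by (intro mult_left_mono) auto
  finally show ?thesis by (simp add: mult_ac)
qed


section \<open>Prescribed steps before the falling arm\<close>

definition cons :: "nat set \<Rightarrow> (nat \<Rightarrow> 'a \<times> 'a) \<Rightarrow> (nat \<Rightarrow> 'a) \<Rightarrow> bool" where
  "cons S ab f \<longleftrightarrow> (\<forall>i\<in>S. f i = fst (ab i) \<and> f (Suc i) = snd (ab i))"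

definition zzs :: "nat \<Rightarrow> (nat \<Rightarrow> 'a) \<Rightarrow> bool" where
  "zzs m f \<longleftrightarrow> (\<forall>i. q \<le> i \<and> i < m \<longrightarrow> zz (f 0) i (f i) (f (Suc i)))"

text \<open>Of goodness and of the prescribed steps, the part that can be tested during the first m
  steps. Goodness of the arms is absent on purpose: it is used only when the falling arm is summed
  out.\<close>

definition cz :: "nat set \<Rightarrow> (nat \<Rightarrow> 'a \<times> 'a) \<Rightarrow> nat \<Rightarrow> (nat \<Rightarrow> 'a) \<Rightarrow> real" where
  "cz S ab m f = (if cons (S \<inter> {..<m}) ab f \<and> zzs m f then 1 else 0)"

lemma cz_nonneg: "cz S ab m f \<ge> 0" by (simp add: cz_def)

lemma cz_Suc:
  "cz S ab (Suc m) (f(Suc m := y)) =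
    (if (m \<in> S \<longrightarrow> f m = fst (ab m) \<and> y = snd (ab m)) \<and> (q \<le> m \<longrightarrow> zz (f 0) m (f m) y) then cz S ab m f else 0)"
proof -
  let ?g = "f(Suc m := y)"
  have "cons (S \<inter> {..<Suc m}) ab ?g \<longleftrightarrow>
      cons (S \<inter> {..<m}) ab ?g \<and> (m \<in> S \<longrightarrow> ?g m = fst (ab m) \<and> ?g (Suc m) = snd (ab m))"
    unfolding cons_def lessThan_Suc by blast
  moreover have "cons (S \<inter> {..<m}) ab ?g \<longleftrightarrow> cons (S \<inter> {..<m}) ab f"
    unfolding cons_def by (intro ball_cong refl) simp
  moreover have "zzs (Suc m) ?g \<longleftrightarrow> zzs m ?g \<and> (q \<le> m \<longrightarrow> zz (?g 0) m (?g m) (?g (Suc m)))"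
    unfolding zzs_def less_Suc_eq by blast
  moreover have "zzs m ?g \<longleftrightarrow> zzs m f"
    unfolding zzs_def by (intro all_cong1 imp_cong refl) simp
  ultimately show ?thesis unfolding cz_def by simp
qed

lemma step_missing:
  assumes "m < 2 * l" "m \<notin> S"
  shows "(\<Sum>f\<in>Wk (Suc m). Fp (Suc m) f * cz S ab (Suc m) f) \<le> (\<Sum>f\<in>Wk m. Fp m f * cz S ab m f)"
  by (rule sum_Fp_drop[OF assms(1)]) (auto simp: cz_Suc cz_nonneg)

lemma inner_pinned:
  assumes f: "f \<in> Wk m" and m: "m < M" and ab: "snd (ab m) \<in> X" and mS: "m \<in> S"
  shows "(\<Sum>y\<in>X. K (f 0) m (f m) y * cz S ab (Suc m) (f(Suc m := y)))
    = (if f m = fst (ab m) \<and> (q \<le> m \<longrightarrow> zz (f 0) m (f m) (snd (ab m))) then K (f 0) m (f m) (snd (ab m)) * cz S ab m f else 0)"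
proof -
  have "(\<Sum>y\<in>X. K (f 0) m (f m) y * cz S ab (Suc m) (f(Suc m := y)))
    = (\<Sum>y\<in>X. if y = snd (ab m) then (if f m = fst (ab m) \<and> (q \<le> m \<longrightarrow> zz (f 0) m (f m) (snd (ab m))) then K (f 0) m (f m) (snd (ab m)) * cz S ab m f else 0) else 0)"
    using mS by (intro sum.cong refl) (auto simp: cz_Suc)
  then show ?thesis using ab finX by simp
qed

lemma step_pinned:
  assumes "m < M" "m \<in> S" "fst (ab m) \<in> X" "snd (ab m) \<in> X"
    and \<phi>: "\<And>x. 0 \<le> \<phi> x" "\<And>x. \<phi> x \<le> 1"
  shows "(\<Sum>f\<in>Wk (Suc m). Fp (Suc m) f * (cz S ab (Suc m) f * \<phi> (f (Suc m))))
      \<le> (\<Sum>f\<in>Wk m. Fp m f * (cz S ab m f * (if f m = fst (ab m) then 1 else 0))) * (mul m * bet (fst (ab m)) (snd (ab m)))"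
proof -
  have "(\<Sum>f\<in>Wk (Suc m). Fp (Suc m) f * (cz S ab (Suc m) f * \<phi> (f (Suc m))))
      \<le> (\<Sum>f\<in>Wk (Suc m). Fp (Suc m) f * cz S ab (Suc m) f)"
    using \<phi> cz_nonneg by (intro sum_mono mult_left_mono Fp_nonneg) (auto intro: mult_left_le)
  also have "\<dots> = (\<Sum>f\<in>Wk m. Fp m f * (\<Sum>y\<in>X. K (f 0) m (f m) y * cz S ab (Suc m) (f(Suc m := y))))"
    by (rule sum_Fp_step)
  also have "\<dots> \<le> (\<Sum>f\<in>Wk m. Fp m f * (cz S ab m f * (if f m = fst (ab m) then 1 else 0) * (mul m * bet (fst (ab m)) (snd (ab m)))))"
  proof (intro sum_mono mult_left_mono Fp_nonneg)
    fix f assume f: "f \<in> Wk m"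
    have nn: "0 \<le> mul m * bet (fst (ab m)) (snd (ab m))"
      using mul_bounds(1)[of m] bet_nonneg assms by simp
    show "(\<Sum>y\<in>X. K (f 0) m (f m) y * cz S ab (Suc m) (f(Suc m := y)))
        \<le> cz S ab m f * (if f m = fst (ab m) then 1 else 0) * (mul m * bet (fst (ab m)) (snd (ab m)))"
    proof (cases "f m = fst (ab m) \<and> (q \<le> m \<longrightarrow> zz (f 0) m (f m) (snd (ab m)))")
      case True
      then have "K (f 0) m (f m) (snd (ab m)) \<le> mul m * bet (fst (ab m)) (snd (ab m))"
        using K_bet[of m "f 0" "f m" "snd (ab m)"] assms f Wk_in[OF f] by auto
      then have "K (f 0) m (f m) (snd (ab m)) * cz S ab m f \<le> mul m * bet (fst (ab m)) (snd (ab m)) * cz S ab m f"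
        using cz_nonneg by (intro mult_right_mono)
      then show ?thesis
        unfolding inner_pinned[where f = f and m = m and ab = ab and S = S, OF f assms(1) assms(4) assms(2)] if_P[OF True]
        using True by (simp add: mult_ac)
    next
      case False
      then show ?thesis
        unfolding inner_pinned[where f = f and m = m and ab = ab and S = S, OF f assms(1) assms(4) assms(2)] using nn cz_nonneg by auto
    qed
  qed
  also have "\<dots> = (\<Sum>f\<in>Wk m. Fp m f * (cz S ab m f * (if f m = fst (ab m) then 1 else 0))) * (mul m * bet (fst (ab m)) (snd (ab m)))"
    by (simp only: sum_distrib_right mult.assoc)
  finally show ?thesis .
qed

lemma mul_bet: "x \<in> X \<Longrightarrow> y \<in> X \<Longrightarrow> mul m * bet x y \<le> ew x y * (B / \<kappa> * E ^ (2 * l))"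
proof -
  assume xy: "x \<in> X" "y \<in> X"
  have "mul m * bet x y \<le> B * E * bet x y" using mul_bounds(2) bet_nonneg[OF xy] by (intro mult_right_mono)
  also have "\<dots> = ew x y * (B / \<kappa> * (E * E ^ (2 * l - 1)))" by (simp add: bet_def)
  also have "E * E ^ (2 * l - 1) = E ^ (2 * l)" using l2 by (metis power_eq_if mult_eq_0_iff not_numeral_le_zero numeral_eq_iff zero_neq_numeral)
  finally show ?thesis .
qed

text \<open>A free step sums to at most one. The first prescribed step costs its edge law, by
  \<open>om_stat\<close>; each later one costs at most \<open>mul * bet\<close>, which is the edge
  law times \<open>B / \<kappa> * E ^ (2 * l)\<close>.\<close>

lemma prefix_spread:
  assumes "m \<le> M" "S \<inter> {..<m} \<noteq> {}" "\<forall>i\<in>S. fst (ab i) \<in> X \<and> snd (ab i) \<in> X"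
  shows "(\<Sum>f\<in>Wk m. Fp m f * cz S ab m f)
    \<le> (\<Prod>i\<in>S \<inter> {..<m}. ew (fst (ab i)) (snd (ab i))) * (B / \<kappa> * E ^ (2 * l)) ^ (card (S \<inter> {..<m}) - 1)"
  using assms(1,2)
proof (induction m)
  case 0
  then show ?case by simp
next
  case (Suc m)
  have mM: "m < M" "m < 2 * l" using Suc.prems M_l by auto
  show ?case
  proof (cases "m \<in> S")
    case False
    then have eq: "S \<inter> {..<Suc m} = S \<inter> {..<m}" by (auto simp: less_Suc_eq)
    then have "(\<Sum>f\<in>Wk m. Fp m f * cz S ab m f)
      \<le> (\<Prod>i\<in>S \<inter> {..<m}. ew (fst (ab i)) (snd (ab i))) * (B / \<kappa> * E ^ (2 * l)) ^ (card (S \<inter> {..<m}) - 1)"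
      using Suc by auto
    then show ?thesis using step_missing[OF mM(2) False, of ab] eq by simp
  next
    case True
    then have eq: "S \<inter> {..<Suc m} = insert m (S \<inter> {..<m})" by (auto simp: less_Suc_eq)
    have abX: "fst (ab m) \<in> X" "snd (ab m) \<in> X" using True assms(3) by auto
    show ?thesis
    proof (cases "S \<inter> {..<m} = {}")
      case S0: True
      have "(\<Sum>f\<in>Wk (Suc m). Fp (Suc m) f * cz S ab (Suc m) f)
          = (\<Sum>f\<in>Wk m. Fp m f * (\<Sum>y\<in>X. K (f 0) m (f m) y * cz S ab (Suc m) (f(Suc m := y))))"
        by (rule sum_Fp_step)
      also have "\<dots> \<le> (\<Sum>f\<in>Wk m. Fp m f * (\<lambda>u x. if x = fst (ab m) then K u m x (snd (ab m)) else 0) (f 0) (f m))"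
      proof (intro sum_mono mult_left_mono Fp_nonneg)
        fix f assume f: "f \<in> Wk m"
        then have "0 \<le> K (f 0) m (f m) (snd (ab m))" using abX by (intro K_nonneg) (auto intro: Wk_in)
        then show "(\<Sum>y\<in>X. K (f 0) m (f m) y * cz S ab (Suc m) (f(Suc m := y)))
            \<le> (\<lambda>u x. if x = fst (ab m) then K u m x (snd (ab m)) else 0) (f 0) (f m)"
          unfolding inner_pinned[where f = f and m = m and ab = ab and S = S, OF f mM(1) abX(2) True] by (auto simp: cz_def)
      qed
      also have "\<dots> \<le> (\<Sum>u\<in>X. pi u * (\<Sum>x\<in>X. pk (lam m) u x * (\<lambda>u x. if x = fst (ab m) then K u m x (snd (ab m)) else 0) u x))"
        by (rule sum_Fp_forward) (use mM abX K_nonneg in auto)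
      also have "\<dots> = (\<Sum>u\<in>X. pi u * (\<Sum>x\<in>X. if x = fst (ab m) then pk (lam m) u x * K u m x (snd (ab m)) else 0))"
        by (intro sum.cong refl arg_cong2[of _ _ _ _ "(*)"]) auto
      also have "\<dots> = (\<Sum>u\<in>X. pi u * (pk (lam m) u (fst (ab m)) * K u m (fst (ab m)) (snd (ab m))))"
        using finX abX by simp
      also have "\<dots> \<le> (\<Sum>u\<in>X. pi u * om u m (fst (ab m)) (snd (ab m)))"
        using abX om_nonneg by (intro sum_mono mult_left_mono less_imp_le[OF pi_pos]) (auto simp: K_def)
      also have "\<dots> = ew (fst (ab m)) (snd (ab m))" using abX by (rule om_stat)
      finally show ?thesis unfolding eq S0 by simp
    next
      case S1: False
      let ?e = "ew (fst (ab m)) (snd (ab m))" and ?c = "B / \<kappa> * E ^ (2 * l)"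
      let ?pr = "\<Prod>i\<in>S \<inter> {..<m}. ew (fst (ab i)) (snd (ab i))"
      have pr0: "?pr \<ge> 0" using assms(3) by (intro prod_nonneg) (auto intro!: ew_nonneg)
      have c0: "?c \<ge> 0" using B1 \<kappa> E0 by simp
      have "(\<Sum>f\<in>Wk (Suc m). Fp (Suc m) f * cz S ab (Suc m) f)
         = (\<Sum>f\<in>Wk (Suc m). Fp (Suc m) f * (cz S ab (Suc m) f * 1))" by simp
      also have "\<dots> \<le> (\<Sum>f\<in>Wk m. Fp m f * (cz S ab m f * (if f m = fst (ab m) then 1 else 0))) * (mul m * bet (fst (ab m)) (snd (ab m)))"
        by (rule step_pinned[where m = m and S = S and ab = ab and \<phi> = "\<lambda>_. 1", OF mM(1) True abX]) auto
      also have "\<dots> \<le> (\<Sum>f\<in>Wk m. Fp m f * cz S ab m f) * (?e * ?c)"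
      proof (rule mult_mono[OF _ mul_bet[OF abX]])
        show "(\<Sum>f\<in>Wk m. Fp m f * (cz S ab m f * (if f m = fst (ab m) then 1 else 0))) \<le> (\<Sum>f\<in>Wk m. Fp m f * cz S ab m f)"
          using cz_nonneg by (intro sum_mono mult_left_mono Fp_nonneg) auto
        show "0 \<le> (\<Sum>f\<in>Wk m. Fp m f * cz S ab m f)"
          using cz_nonneg Fp_nonneg by (intro sum_nonneg mult_nonneg_nonneg) auto
        show "0 \<le> mul m * bet (fst (ab m)) (snd (ab m))"
          using mul_bounds(1)[of m] bet_nonneg[OF abX] by simp
      qed
      also have "\<dots> \<le> (?pr * ?c ^ (card (S \<inter> {..<m}) - 1)) * (?e * ?c)"
      proof (rule mult_right_mono)
        show "(\<Sum>f\<in>Wk m. Fp m f * cz S ab m f) \<le> ?pr * ?c ^ (card (S \<inter> {..<m}) - 1)"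
          using Suc.IH Suc.prems S1 by simp
        show "0 \<le> ?e * ?c" using mult_nonneg_nonneg[OF ew_nonneg[OF abX] c0] .
      qed
      also have "\<dots> = (?e * ?pr) * ?c ^ (Suc (card (S \<inter> {..<m}) - 1))" by simp
      also have "Suc (card (S \<inter> {..<m}) - 1) = card (insert m (S \<inter> {..<m})) - 1"
        using S1 by (simp add: card_gt_0_iff)
      finally show ?thesis unfolding eq by simp
    qed
  qed
qed

section \<open>Prescribed steps on the falling arm\<close>

primrec AA :: "(nat \<Rightarrow> 'a \<Rightarrow> 'a \<Rightarrow> bool) \<Rightarrow> 'a \<Rightarrow> nat \<Rightarrow> 'a \<Rightarrow> real" where
  "AA R u 0 x = (if x = u then 1 else 0)"
| "AA R u (Suc c) y = (\<Sum>x\<in>X. AA R u c x * (if R c x y then p x y else 0))"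

lemma AA_nonneg: "y \<in> X \<Longrightarrow> AA R u c y \<ge> 0"
  by (induction c arbitrary: y) (auto intro!: sum_nonneg mult_nonneg_nonneg p_nonneg)

text \<open>The last \<open>c\<close> vertices of the cycle are summed out; read away from \<open>f 0\<close> they form an
  ordinary walk, whose constrained weight is \<open>AA\<close>.\<close>

lemma tail_sum:
  assumes "c \<le> q" "\<And>f. Q f \<ge> 0"
    and "\<And>f i y. 2 * l - c < i \<Longrightarrow> Q (f(i := y)) = Q f"
    and "\<And>f i y. M < i \<Longrightarrow> R (f(i := y)) = R f"
  shows "(\<Sum>f\<in>Wk (2 * l). Fp (2 * l) f * (Q f * (if \<forall>c'<c. R f c' (f (2 * l - c')) (f (2 * l - Suc c')) then 1 else 0)))
    \<le> (\<Sum>f\<in>Wk (2 * l - c). Fp (2 * l - c) f * (Q f * (AA (R f) (f 0) c (f (2 * l - c)) / pk c (f 0) (f (2 * l - c)))))"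
  using assms(1-3)
proof (induction c arbitrary: Q)
  case 0
  show ?case
  proof (rule order_eq_refl, unfold diff_zero, rule sum.cong[OF refl])
    fix f assume f: "f \<in> Wk (2 * l)"
    show "Fp (2 * l) f * (Q f * (if \<forall>c'<0. R f c' (f (2 * l - c')) (f (2 * l - Suc c')) then 1 else 0))
       = Fp (2 * l) f * (Q f * (AA (R f) (f 0) 0 (f (2 * l)) / pk 0 (f 0) (f (2 * l))))"
      using F_closed[of f] by (cases "f (2 * l) = f 0") (auto simp: F_Fp)
  qed
next
  case (Suc c)
  define m where "m = 2 * l - Suc c"
  have m: "Suc m = 2 * l - c" "M \<le> m" "m < 2 * l" using Suc.prems(1) M_l q2 by (auto simp: m_def)
  have lamm: "lam m = Suc c" "lam (Suc m) = c" using m lam_last[of m] lam_last[of "Suc m"] by (auto simp: m_def)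
  define Q' where "Q' f = Q f * (if R f c (f (2 * l - c)) (f (2 * l - Suc c)) then 1 else 0)" for f
  have "(\<Sum>f\<in>Wk (2 * l). Fp (2 * l) f * (Q f * (if \<forall>c'<Suc c. R f c' (f (2 * l - c')) (f (2 * l - Suc c')) then 1 else 0)))
     = (\<Sum>f\<in>Wk (2 * l). Fp (2 * l) f * (Q' f * (if \<forall>c'<c. R f c' (f (2 * l - c')) (f (2 * l - Suc c')) then 1 else 0)))"
  proof (rule sum.cong[OF refl])
    fix f
    have "(\<forall>c'<Suc c. R f c' (f (2 * l - c')) (f (2 * l - Suc c'))) \<longleftrightarrow>
        R f c (f (2 * l - c)) (f (2 * l - Suc c)) \<and> (\<forall>c'<c. R f c' (f (2 * l - c')) (f (2 * l - Suc c')))"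
      unfolding less_Suc_eq by blast
    note eq = this
    show "Fp (2 * l) f * (Q f * (if \<forall>c'<Suc c. R f c' (f (2 * l - c')) (f (2 * l - Suc c')) then 1 else 0))
       = Fp (2 * l) f * (Q' f * (if \<forall>c'<c. R f c' (f (2 * l - c')) (f (2 * l - Suc c')) then 1 else 0))"
      unfolding Q'_def eq by (cases "R f c (f (2 * l - c)) (f (2 * l - Suc c))") simp_all
  qed
  also have "\<dots> \<le> (\<Sum>f\<in>Wk (2 * l - c). Fp (2 * l - c) f * (Q' f * (AA (R f) (f 0) c (f (2 * l - c)) / pk c (f 0) (f (2 * l - c)))))"
  proof (rule Suc.IH)
    show "c \<le> q" using Suc.prems(1) by simp
    show "Q' f \<ge> 0" for f using Suc.prems(2) by (simp add: Q'_def)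
    show "Q' (f(i := y)) = Q' f" if "2 * l - c < i" for f i y
    proof -
      have "Q (f(i := y)) = Q f" by (rule Suc.prems(3)) (use that in simp)
      moreover have "R (f(i := y)) = R f" by (rule assms(4)) (use that m in simp)
      moreover have "(f(i := y)) (2 * l - c) = f (2 * l - c)" "(f(i := y)) (2 * l - Suc c) = f (2 * l - Suc c)"
        using that by auto
      ultimately show ?thesis unfolding Q'_def by (simp only:)
    qed
  qed
  also have "\<dots> = (\<Sum>f\<in>Wk (Suc m). Fp (Suc m) f * (Q' f * (AA (R f) (f 0) c (f (Suc m)) / pk c (f 0) (f (Suc m)))))"
    by (simp add: m(1))
  also have "\<dots> = (\<Sum>f\<in>Wk m. Fp m f * (\<Sum>y\<in>X. K (f 0) m (f m) y * (Q' (f(Suc m := y)) * (AA (R f) (f 0) c y / pk c (f 0) y))))"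
    using m(2) assms(4) by (subst sum_Fp_step) simp
  also have "\<dots> \<le> (\<Sum>f\<in>Wk m. Fp m f * (Q f * (AA (R f) (f 0) (Suc c) (f m) / pk (Suc c) (f 0) (f m))))"
  proof (rule sum_mono, rule mult_left_mono[OF _ Fp_nonneg])
    fix f assume f: "f \<in> Wk m"
    then show "f \<in> Wk m" .
    have fX: "f 0 \<in> X" "f m \<in> X" using f by (auto intro: Wk_in)
    let ?u = "f 0" and ?x = "f m"
    have "(\<Sum>y\<in>X. K ?u m ?x y * (Q' (f(Suc m := y)) * (AA (R f) ?u c y / pk c ?u y)))
       \<le> (\<Sum>y\<in>X. (AA (R f) ?u c y * (if R f c y ?x then p y ?x else 0)) * (Q f / pk (Suc c) ?u ?x))"
    proof (rule sum_mono)
      fix y assume y: "y \<in> X"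
      have Q'y: "Q' (f(Suc m := y)) = Q f * (if R f c y ?x then 1 else 0)"
      proof -
        have "Q (f(Suc m := y)) = Q f" by (rule Suc.prems(3)) (use m in simp)
        moreover have "R (f(Suc m := y)) = R f" by (rule assms(4)) (use m in simp)
        moreover have "(f(Suc m := y)) (2 * l - c) = y" "(f(Suc m := y)) (2 * l - Suc c) = f m"
          unfolding m(1)[symmetric] m_def[symmetric] by simp_all
        ultimately show ?thesis unfolding Q'_def by (simp only:)
      qed
      have Ky: "K ?u m ?x y = pk c ?u y * p y ?x / pk (Suc c) ?u ?x"
        by (simp add: K_def om_def lamm)
      \<comment> \<open>On the falling arm the numerator of \<open>K\<close> contains the level law
        that is the denominator left by the previous step. The two cancel, or both sides allow for
        zero, so only the outermost denominator survives.\<close>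
      have "pk c ?u y * (AA (R f) ?u c y / pk c ?u y) \<le> AA (R f) ?u c y"
        using AA_nonneg[OF y] by simp
      then have "(pk c ?u y * (AA (R f) ?u c y / pk c ?u y)) * ((if R f c y ?x then p y ?x else 0) * (Q f / pk (Suc c) ?u ?x))
         \<le> AA (R f) ?u c y * ((if R f c y ?x then p y ?x else 0) * (Q f / pk (Suc c) ?u ?x))"
        using p_nonneg[OF y fX(2)] Suc.prems(2)[of f] pk_nonneg[OF fX, of "Suc c"]
        by (intro mult_right_mono mult_nonneg_nonneg divide_nonneg_nonneg) auto
      then show "K ?u m ?x y * (Q' (f(Suc m := y)) * (AA (R f) ?u c y / pk c ?u y))
         \<le> (AA (R f) ?u c y * (if R f c y ?x then p y ?x else 0)) * (Q f / pk (Suc c) ?u ?x)"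
        unfolding Q'y Ky by (simp add: mult_ac split: if_splits)
    qed
    also have "\<dots> = AA (R f) ?u (Suc c) ?x * (Q f / pk (Suc c) ?u ?x)"
      unfolding AA.simps(2) by (rule sum_distrib_right[symmetric])
    also have "\<dots> = Q f * (AA (R f) ?u (Suc c) ?x / pk (Suc c) ?u ?x)"
      by (simp only: times_divide_eq_right mult.commute)
    finally show "(\<Sum>y\<in>X. K ?u m ?x y * (Q' (f(Suc m := y)) * (AA (R f) ?u c y / pk c ?u y)))
       \<le> Q f * (AA (R f) ?u (Suc c) ?x / pk (Suc c) ?u ?x)" .
  qed
  finally show ?case unfolding m_def .
qed


text \<open>\<open>ST\<close> holds the prescribed steps of the falling arm, counted from its end;
  \<open>lo c\<close> and \<open>hi c\<close> are their ends at distance c and c + 1 from the start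
  vertex along the arm.\<close>

context
  fixes ST :: "nat set" and lo hi :: "nat \<Rightarrow> 'a" and R
  assumes ST: "ST \<subseteq> {..<q}" and lohi: "\<And>c. c \<in> ST \<Longrightarrow> lo c \<in> X \<and> hi c \<in> X"
    and R: "R = (\<lambda>c x y. c \<in> ST \<longrightarrow> x = lo c \<and> y = hi c)"
begin

private definition Pr :: "nat \<Rightarrow> real" where "Pr c = (\<Prod>c'\<in>ST \<inter> {..<c}. bet (lo c') (hi c'))"

private lemma Pr0: "Pr 0 = 1" by (simp add: Pr_def)

private lemma Pr_in: "c \<in> ST \<Longrightarrow> Pr (Suc c) = Pr c * bet (lo c) (hi c)"
  by (simp add: Pr_def lessThan_Suc Int_insert_right mult.commute)

private lemma Pr_out: "c \<notin> ST \<Longrightarrow> Pr (Suc c) = Pr c"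
  by (simp add: Pr_def lessThan_Suc Int_insert_right)

private lemma Pr_nonneg: "Pr c \<ge> 0"
  unfolding Pr_def using lohi by (intro prod_nonneg) (auto intro: bet_nonneg)

private lemma AA_in: assumes "c \<in> ST" shows "AA R u (Suc c) y = (if y = hi c then AA R u c (lo c) * p (lo c) (hi c) else 0)"
proof -
  have "AA R u (Suc c) y = (\<Sum>x\<in>X. if x = lo c then (if y = hi c then AA R u c (lo c) * p (lo c) (hi c) else 0) else 0)"
    unfolding AA.simps(2) R using assms by (intro sum.cong refl) auto
  then show ?thesis using finX lohi[OF assms] by simp
qed

private lemma AA_out: assumes "c \<notin> ST" shows "AA R u (Suc c) y = (\<Sum>x\<in>X. AA R u c x * p x y)"
  unfolding AA.simps(2) R using assms by simp

private lemma p_bet: "c \<in> ST \<Longrightarrow> p (lo c) (hi c) \<le> bet (lo c) (hi c)"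
  using p_le_ew lohi by (simp add: bet_def)

private lemma AA_in_le:
  assumes "c \<in> ST" "AA R u c (lo c) \<le> Pr c * v" "v \<ge> 0"
  shows "AA R u (Suc c) y \<le> Pr (Suc c) * v * (if y = hi c then 1 else 0)"
proof -
  have "AA R u c (lo c) * p (lo c) (hi c) \<le> (Pr c * v) * bet (lo c) (hi c)"
    using assms p_bet[OF assms(1)] lohi[OF assms(1)] Pr_nonneg p_nonneg AA_nonneg
    by (intro mult_mono) auto
  then show ?thesis unfolding AA_in[OF assms(1)] Pr_in[OF assms(1)] by (simp add: mult_ac)
qed

lemma AA_initial:
  assumes "\<forall>c'<c. c' \<in> ST" "u \<in> X" "x \<in> X"
  shows "AA R u c x \<le> (\<Prod>c'\<in>ST \<inter> {..<c}. bet (lo c') (hi c')) * (if x = (if c = 0 then u else hi (c - 1)) then 1 else 0)"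
proof -
  have "AA R u c x \<le> Pr c * (if x = (if c = 0 then u else hi (c - 1)) then 1 else 0)"
    using assms
  proof (induction c arbitrary: x)
    case 0
    then show ?case by (simp add: Pr0)
  next
    case (Suc c)
    have cS: "c \<in> ST" using Suc.prems by auto
    have "AA R u c (lo c) \<le> Pr c * (if lo c = (if c = 0 then u else hi (c - 1)) then 1 else 0)"
      using Suc lohi[OF cS] by auto
    also have "\<dots> \<le> Pr c * 1" using Pr_nonneg[of c] by (intro mult_left_mono) auto
    finally show ?case using AA_in_le[OF cS, of u 1 x] by simp
  qed
  then show ?thesis by (simp add: Pr_def)
qed

text \<open>The first gap \<open>[a, b]\<close> of the constraint set is paid for by the goodness of the path; one
  further gap already gains the factor \<open>D / E ^ l\<close>.\<close>

lemma final_run: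
  assumes nST: "ST \<noteq> {..<q}"
  shows "\<exists>a b. a < b \<and> b \<le> q \<and> (a = 0 \<or> a - 1 \<in> ST) \<and> (b < q \<longrightarrow> b \<in> ST) \<and>
    (\<forall>u\<in>X. \<forall>z\<in>X. pk (b - a) (if a = 0 then u else hi (a - 1)) (if b < q then lo b else z) \<le> B * E ^ (q - (b - a)) * pk q u z \<longrightarrow>
       AA R u q z \<le> B * D * (\<Prod>c\<in>ST. E * bet (lo c) (hi c)) * pk q u z)"
proof -
  \<comment> \<open>\<open>a\<close> is the first free step, and \<open>b\<close> the next
    prescribed step or the end of the arm. Both ends of this gap are thus known vertices: the start,
    a prescribed vertex, or the end \<open>z\<close>.\<close>
  define a where "a = (LEAST c. c \<notin> ST)"
  obtain c0 where c0: "c0 < q" "c0 \<notin> ST" using ST nST by auto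
  have a: "a \<notin> ST" unfolding a_def using c0(2) by (rule LeastI)
  have aq: "a < q" unfolding a_def using Least_le[of "\<lambda>c. c \<notin> ST", OF c0(2)] c0(1) by linarith
  have a_lt: "c \<in> ST" if "c < a" for c using that not_less_Least[of c "\<lambda>c. c \<notin> ST"] unfolding a_def by blast
  define b where "b = (LEAST c. a < c \<and> (c \<in> ST \<or> c = q))"
  have exb: "a < q \<and> (q \<in> ST \<or> q = q)" using aq by simp
  have b: "a < b" "b \<in> ST \<or> b = q" unfolding b_def using LeastI[of "\<lambda>c. a < c \<and> (c \<in> ST \<or> c = q)", OF exb] by auto
  have bq: "b \<le> q" unfolding b_def by (rule Least_le[of "\<lambda>c. a < c \<and> (c \<in> ST \<or> c = q)", OF exb])
  have b_gap: "c \<notin> ST" if "a \<le> c" "c < b" for c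
    using that a not_less_Least[of c "\<lambda>c. a < c \<and> (c \<in> ST \<or> c = q)"] unfolding b_def
    by (cases "c = a") auto
  have fST: "finite ST" using ST finite_subset by blast
  have STeq: "ST \<inter> {..<c} = {..<a}" if "a \<le> c" "c \<le> b" for c
  proof (intro equalityI subsetI)
    fix x assume "x \<in> ST \<inter> {..<c}"
    then show "x \<in> {..<a}" using b_gap[of x] that by (cases "a \<le> x") auto
  qed (use a_lt that in auto)
  have PrEq: "Pr c = Pr a" if "a \<le> c" "c \<le> b" for c
    unfolding Pr_def using STeq[of a] STeq[OF that] b(1) by simp
  let ?va = "\<lambda>u. if a = 0 then u else hi (a - 1)"
  have vaX: "?va u \<in> X" if "u \<in> X" for u using that a_lt[of "a - 1"] lohi[of "a - 1"] by (cases "a = 0") auto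
  have gap: "AA R u c x \<le> Pr a * pk (c - a) (?va u) x" if "a \<le> c" "c \<le> b" "u \<in> X" "x \<in> X" for u c x
    using that
  proof (induction c arbitrary: x rule: dec_induct)
    case base
    have "AA R u a x \<le> Pr a * (if x = ?va u then 1 else 0)"
      using AA_initial[of a u x] a_lt that base by (simp add: Pr_def)
    also have "\<dots> = Pr a * pk (a - a) (?va u) x" by auto
    finally show ?case .
  next
    case (step c)
    have "AA R u (Suc c) x = (\<Sum>y\<in>X. AA R u c y * p y x)" using b_gap step by (intro AA_out) auto
    also have "\<dots> \<le> (\<Sum>y\<in>X. (Pr a * pk (c - a) (?va u) y) * p y x)"
      using step p_nonneg by (intro sum_mono mult_right_mono) auto
    also have "\<dots> = Pr a * pk (Suc c - a) (?va u) x"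
      using step by (simp add: Suc_diff_le sum_distrib_left mult.assoc)
    finally show ?case .
  qed
  have "AA R u q z \<le> B * D * (\<Prod>c\<in>ST. E * bet (lo c) (hi c)) * pk q u z"
    if uz: "u \<in> X" "z \<in> X"
      and good: "pk (b - a) (?va u) (if b < q then lo b else z) \<le> B * E ^ (q - (b - a)) * pk q u z" for u z
  proof -
    let ?V = "pk (b - a) (?va u) (if b < q then lo b else z)"
    have V0: "?V \<ge> 0" using b(2) lohi uz vaX by (intro pk_nonneg) auto
    have Prq: "Pr q = (\<Prod>c\<in>ST. bet (lo c) (hi c))"
      using ST by (simp add: Pr_def Int_absorb2)
    have prodE: "(\<Prod>c\<in>ST. E * bet (lo c) (hi c)) = E ^ card ST * Pr q"
      by (simp add: prod.distrib Prq)
    have pq0: "pk q u z \<ge> 0" using uz by (rule pk_nonneg)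
    \<comment> \<open>If the gap is the only one, then \<open>E ^ (q - (b - a))\<close> from
      goodness is exactly one factor E for each prescribed step. If there is another free step, its
      gain \<open>D / E ^ l\<close> already absorbs that power of E.\<close>
    have "AA R u q z \<le> Pr q * ?V \<and> card ST = q - (b - a) \<or> AA R u q z \<le> Pr q * ?V * (D / E ^ l)"
    proof (cases "b = q")
      case True
      have "ST \<inter> {..<q} = ST" using ST by auto
      then have "card ST = a" using STeq[of q] True b(1) by (metis card_lessThan less_imp_le order_refl)
      moreover have "Pr q = Pr a" using PrEq[of q] True b(1) by simp
      ultimately show ?thesis using gap[of q u z] True b(1) uz by simp
    next
      case False
      then have bST: "b \<in> ST" and bq': "b < q" using b(2) bq by auto
      have Prb: "Pr b = Pr a" using PrEq[of b] b(1) by simp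
      have V: "?V = pk (b - a) (?va u) (lo b)" using bq' by simp
      \<comment> \<open>Two invariants: the total mass never grows, and after a further free step
        each single vertex has at most the share \<open>D / E ^ l\<close> of it. Prescribed steps
        preserve both at the cost \<open>bet\<close>.\<close>
      have "(\<Sum>x\<in>X. AA R u c x) \<le> Pr c * ?V \<and>
          ((\<exists>c'. b < c' \<and> c' < c \<and> c' \<notin> ST) \<longrightarrow> (\<forall>x\<in>X. AA R u c x \<le> Pr c * ?V * (D / E ^ l)))"
        if "Suc b \<le> c" "c \<le> q" for c
        using that
      proof (induction c rule: dec_induct)
        case base
        have "AA R u b (lo b) \<le> Pr b * ?V" using gap[of b u "lo b"] b(1) uz lohi[OF bST] V Prb by simp
        then have "AA R u (Suc b) x \<le> Pr (Suc b) * ?V * (if x = hi b then 1 else 0)" for x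
          using AA_in_le[OF bST _ V0] by blast
        then have "(\<Sum>x\<in>X. AA R u (Suc b) x) \<le> (\<Sum>x\<in>X. if x = hi b then Pr (Suc b) * ?V else 0)"
          by (intro sum_mono) (simp add: if_distrib[of "\<lambda>t. _ * t"] cong: if_cong)
        also have "\<dots> = Pr (Suc b) * ?V" using finX lohi[OF bST] by simp
        finally show ?case by auto
      next
        case (step c)
        then have IH: "(\<Sum>x\<in>X. AA R u c x) \<le> Pr c * ?V"
          "(\<exists>c'. b < c' \<and> c' < c \<and> c' \<notin> ST) \<Longrightarrow> \<forall>x\<in>X. AA R u c x \<le> Pr c * ?V * (D / E ^ l)" by auto
        show ?case
        proof (cases "c \<in> ST")
          case True
          have loX: "lo c \<in> X" "hi c \<in> X" using lohi[OF True] by auto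
          have "AA R u c (lo c) \<le> (\<Sum>x\<in>X. AA R u c x)"
            using AA_nonneg finX loX by (intro member_le_sum) auto
          then have "AA R u c (lo c) \<le> Pr c * ?V" using IH by linarith
          then have "AA R u (Suc c) x \<le> Pr (Suc c) * ?V * (if x = hi c then 1 else 0)" for x
            using AA_in_le[OF True _ V0] by blast
          then have "(\<Sum>x\<in>X. AA R u (Suc c) x) \<le> (\<Sum>x\<in>X. if x = hi c then Pr (Suc c) * ?V else 0)"
            by (intro sum_mono) (simp add: if_distrib[of "\<lambda>t. _ * t"] cong: if_cong)
          also have "\<dots> = Pr (Suc c) * ?V" using finX loX by simp
          finally have mass: "(\<Sum>x\<in>X. AA R u (Suc c) x) \<le> Pr (Suc c) * ?V" .
          have "AA R u (Suc c) x \<le> Pr (Suc c) * ?V * (D / E ^ l)"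
            if ex: "\<exists>c'. b < c' \<and> c' < Suc c \<and> c' \<notin> ST" and x: "x \<in> X" for x
          proof -
            have "\<exists>c'. b < c' \<and> c' < c \<and> c' \<notin> ST" using ex True less_Suc_eq by auto
            then have "AA R u c (lo c) \<le> Pr c * (?V * (D / E ^ l))" using IH(2) loX by (simp add: mult.assoc)
            then have "AA R u (Suc c) x \<le> Pr (Suc c) * (?V * (D / E ^ l)) * (if x = hi c then 1 else 0)"
              using AA_in_le[OF True, of u "?V * (D / E ^ l)" x] V0 D1 E0 by simp
            also have "\<dots> \<le> Pr (Suc c) * (?V * (D / E ^ l)) * 1"
              using V0 D1 E0 Pr_nonneg by (intro mult_left_mono mult_nonneg_nonneg divide_nonneg_nonneg) auto
            finally show ?thesis by (simp add: mult.assoc)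
          qed
          then show ?thesis using mass by blast
        next
          case False
          have nn: "AA R u c x \<ge> 0" if "x \<in> X" for x using that by (rule AA_nonneg)
          have "(\<Sum>y\<in>X. AA R u (Suc c) y) = (\<Sum>x\<in>X. \<Sum>y\<in>X. AA R u c x * p x y)"
            unfolding AA_out[OF False] by (rule sum.swap)
          also have "\<dots> = (\<Sum>x\<in>X. AA R u c x)"
            by (simp add: sum_distrib_left[symmetric] p_sum)
          finally have mass: "(\<Sum>y\<in>X. AA R u (Suc c) y) \<le> Pr (Suc c) * ?V"
            using IH(1) Pr_out[OF False] by simp
          have "AA R u (Suc c) y \<le> Pr (Suc c) * ?V * (D / E ^ l)" if y: "y \<in> X" for y
          proof -
            have "AA R u (Suc c) y \<le> (\<Sum>x\<in>X. AA R u c x * (D / E ^ l))"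
              unfolding AA_out[OF False] using nn y by (intro sum_mono mult_left_mono p_le) auto
            also have "\<dots> = (\<Sum>x\<in>X. AA R u c x) * (D / E ^ l)" by (rule sum_distrib_right[symmetric])
            also have "\<dots> \<le> Pr c * ?V * (D / E ^ l)" using IH(1) D1 E0 by (intro mult_right_mono) auto
            finally show ?thesis using Pr_out[OF False] by simp
          qed
          then show ?thesis using mass by blast
        qed
      qed
      from this[of q] have fin: "(\<Sum>x\<in>X. AA R u q x) \<le> Pr q * ?V"
        "(\<exists>c'. b < c' \<and> c' < q \<and> c' \<notin> ST) \<Longrightarrow> \<forall>x\<in>X. AA R u q x \<le> Pr q * ?V * (D / E ^ l)"
        using bq' by auto
      show ?thesis
      proof (cases "\<exists>c'. b < c' \<and> c' < q \<and> c' \<notin> ST")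
        case True
        then show ?thesis using fin(2) uz by auto
      next
        case all: False
        have "ST = {..<a} \<union> {b..<q}"
        proof (intro equalityI subsetI)
          fix c assume "c \<in> ST"
          then show "c \<in> {..<a} \<union> {b..<q}" using ST b_gap[of c] by force
        next
          fix c assume "c \<in> {..<a} \<union> {b..<q}"
          then show "c \<in> ST" using a_lt all bST by (cases "c = b") force+
        qed
        moreover have "{..<a} \<inter> {b..<q} = {}" using b(1) by auto
        ultimately have "card ST = a + (q - b)" by (simp add: card_Un_disjoint)
        then have "card ST = q - (b - a)" using b(1) bq by linarith
        moreover have "AA R u q z \<le> (\<Sum>x\<in>X. AA R u q x)"
          using AA_nonneg finX uz by (intro member_le_sum) auto
        ultimately show ?thesis using fin(1) by linarith
      qed
    qed
    then show ?thesis
    proof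
      assume *: "AA R u q z \<le> Pr q * ?V \<and> card ST = q - (b - a)"
      then have "AA R u q z \<le> Pr q * (B * E ^ card ST * pk q u z)"
        using mult_left_mono[OF good Pr_nonneg[of q]] by simp
      also have "\<dots> = B * 1 * (E ^ card ST * Pr q) * pk q u z" by simp
      also have "\<dots> \<le> B * D * (E ^ card ST * Pr q) * pk q u z"
        using B1 D1 E0 Pr_nonneg pq0 by (intro mult_right_mono mult_left_mono) auto
      finally show ?thesis unfolding prodE .
    next
      assume *: "AA R u q z \<le> Pr q * ?V * (D / E ^ l)"
      also have "\<dots> \<le> Pr q * (B * E ^ (q - (b - a)) * pk q u z) * (D / E ^ l)"
        using good Pr_nonneg D1 E0 by (intro mult_right_mono mult_left_mono) auto
      also have "\<dots> = B * D * (E ^ (q - (b - a)) / E ^ l * Pr q) * pk q u z" by simp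
      also have "\<dots> \<le> B * D * (E ^ card ST * Pr q) * pk q u z"
      proof (intro mult_right_mono mult_left_mono pq0 Pr_nonneg)
        have "E ^ (q - (b - a)) \<le> E ^ l" using E1 lqh by (intro power_increasing) auto
        then have "E ^ (q - (b - a)) / E ^ l \<le> 1" using E0 by simp
        then show "E ^ (q - (b - a)) / E ^ l \<le> E ^ card ST" using Epow1 order_trans by blast
      qed (use B1 D1 in auto)
      finally show ?thesis unfolding prodE .
    qed
  qed
  moreover have "a = 0 \<or> a - 1 \<in> ST" using a_lt[of "a - 1"] by (cases a) auto
  moreover have "b < q \<longrightarrow> b \<in> ST" using b(2) by auto
  ultimately show ?thesis using b(1) bq by blast
qed

end


section \<open>Spread of the good closed walks\<close>

definition Ssum :: "nat set \<Rightarrow> (nat \<Rightarrow> 'a \<times> 'a) \<Rightarrow> real" where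
  "Ssum S ab = (\<Sum>f\<in>Wk (2 * l). if good f \<and> cons S ab f then F f else 0)"

lemma cz_upd: "M < i \<Longrightarrow> cz S ab M (f(i := y)) = cz S ab M f"
proof -
  assume i: "M < i"
  have "cons (S \<inter> {..<M}) ab (f(i := y)) \<longleftrightarrow> cons (S \<inter> {..<M}) ab f"
    unfolding cons_def using i by (intro ball_cong refl) auto
  moreover have "zzs M (f(i := y)) \<longleftrightarrow> zzs M f"
    unfolding zzs_def using i by (intro all_cong1 imp_cong refl) auto
  ultimately show ?thesis unfolding cz_def by simp
qed

lemma cz_good: "good f \<Longrightarrow> cons S ab f \<Longrightarrow> cz S ab M f = 1"
  unfolding cz_def cons_def good_def zzs_def by simp

lemma Ebet: "E * bet x y = ew x y * (E ^ (2 * l) / \<kappa>)"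
proof -
  have "E * E ^ (2 * l - 1) = E ^ (2 * l)" using l2 by (simp add: power_eq_if)
  then show ?thesis by (simp add: bet_def)
qed

definition tl_set :: "nat set \<Rightarrow> nat set" where "tl_set S = {c. c < q \<and> 2 * l - Suc c \<in> S}"

lemma tl_set_bij: "S \<subseteq> {..<2 * l} \<Longrightarrow> bij_betw (\<lambda>c. 2 * l - Suc c) (tl_set S) (S \<inter> {M..<2 * l})"
proof (rule bij_betw_byWitness[where f' = "\<lambda>i. 2 * l - Suc i"])
  assume S: "S \<subseteq> {..<2 * l}"
  have ql: "c < 2 * l" if "c < q" for c using that M_l by simp
  show "\<forall>a\<in>tl_set S. 2 * l - Suc (2 * l - Suc a) = a"
  proof
    fix a assume "a \<in> tl_set S"
    then have "a < 2 * l" using ql by (simp add: tl_set_def)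
    then show "2 * l - Suc (2 * l - Suc a) = a" by simp
  qed
  show "\<forall>a'\<in>S \<inter> {M..<2 * l}. 2 * l - Suc (2 * l - Suc a') = a'" by auto
  show "(\<lambda>c. 2 * l - Suc c) ` tl_set S \<subseteq> S \<inter> {M..<2 * l}"
    using M_l q2 by (auto simp: tl_set_def)
  show "(\<lambda>i. 2 * l - Suc i) ` (S \<inter> {M..<2 * l}) \<subseteq> tl_set S"
    using M_l by (auto simp: tl_set_def Suc_diff_Suc)
qed

lemma tl_split:
  assumes S: "S \<subseteq> {..<2 * l}"
  shows "card S = card (S \<inter> {..<M}) + card (tl_set S)"
    and "(\<Prod>i\<in>S. g i) = (\<Prod>i\<in>S \<inter> {..<M}. g i) * (\<Prod>c\<in>tl_set S. g (2 * l - Suc c) :: real)"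
proof -
  have fS: "finite S" using S finite_subset by blast
  have U: "S = (S \<inter> {..<M}) \<union> (S \<inter> {M..<2 * l})" using S by auto
  have dj: "(S \<inter> {..<M}) \<inter> (S \<inter> {M..<2 * l}) = {}" by auto
  have "card S = card (S \<inter> {..<M}) + card (S \<inter> {M..<2 * l})"
    using fS dj by (subst U, subst card_Un_disjoint) auto
  then show "card S = card (S \<inter> {..<M}) + card (tl_set S)"
    using bij_betw_same_card[OF tl_set_bij[OF S]] by simp
  have "(\<Prod>i\<in>S. g i) = (\<Prod>i\<in>S \<inter> {..<M}. g i) * (\<Prod>i\<in>S \<inter> {M..<2 * l}. g i)"
    using fS dj by (subst U, subst prod.union_disjoint) auto
  then show "(\<Prod>i\<in>S. g i) = (\<Prod>i\<in>S \<inter> {..<M}. g i) * (\<Prod>c\<in>tl_set S. g (2 * l - Suc c))"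
    by (simp add: prod.reindex_bij_betw[OF tl_set_bij[OF S], symmetric])
qed

definition tail_R :: "nat set \<Rightarrow> (nat \<Rightarrow> 'a \<times> 'a) \<Rightarrow> nat \<Rightarrow> 'a \<Rightarrow> 'a \<Rightarrow> bool" where
  "tail_R S ab = (\<lambda>c x y. c \<in> tl_set S \<longrightarrow> x = snd (ab (2 * l - Suc c)) \<and> y = fst (ab (2 * l - Suc c)))"

text \<open>\<open>\<Phi>\<close> is any consequence of goodness and of the prescribed steps that
  depends only on the two ends of the falling arm. Such a consequence is all that can still be used
  once the vertices of the arm are summed out.\<close>

lemma Ssum_le_tail:
  assumes \<Phi>: "\<And>f. f \<in> Wk (2 * l) \<Longrightarrow> good f \<Longrightarrow> cons S ab f \<Longrightarrow> \<Phi> (f 0) (f M)"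
  shows "Ssum S ab \<le> (\<Sum>f\<in>Wk M. Fp M f * (cz S ab M f * (if \<Phi> (f 0) (f M) then 1 else 0)
            * (AA (tail_R S ab) (f 0) q (f M) / pk q (f 0) (f M))))"
proof -
  define Q where "Q f = cz S ab M f * (if \<Phi> (f 0) (f M) then 1 else 0)" for f
  have "Ssum S ab \<le> (\<Sum>f\<in>Wk (2 * l). Fp (2 * l) f * (Q f * (if \<forall>c'<q. tail_R S ab c' (f (2 * l - c')) (f (2 * l - Suc c')) then 1 else 0)))"
    unfolding Ssum_def
  proof (rule sum_mono)
    fix f assume f: "f \<in> Wk (2 * l)"
    show "(if good f \<and> cons S ab f then F f else 0)
      \<le> Fp (2 * l) f * (Q f * (if \<forall>c'<q. tail_R S ab c' (f (2 * l - c')) (f (2 * l - Suc c')) then 1 else 0))"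
    proof (cases "good f \<and> cons S ab f")
      case True
      have "tail_R S ab c (f (2 * l - c)) (f (2 * l - Suc c))" if "c < q" for c
      proof -
        have "Suc (2 * l - Suc c) = 2 * l - c" using that M_l by simp
        then show ?thesis using True unfolding tail_R_def tl_set_def cons_def by force
      qed
      moreover have "Q f = 1" using True \<Phi>[OF f] cz_good by (simp add: Q_def)
      ultimately show ?thesis using True by (simp add: F_Fp)
    next
      case False
      then show ?thesis using Fp_nonneg[OF f] cz_nonneg by (auto simp: Q_def)
    qed
  qed
  also have "\<dots> \<le> (\<Sum>f\<in>Wk (2 * l - q). Fp (2 * l - q) f * (Q f * (AA (tail_R S ab) (f 0) q (f (2 * l - q)) / pk q (f 0) (f (2 * l - q)))))"
  proof (rule tail_sum)
    show "Q (f(i := y)) = Q f" if "2 * l - q < i" for f i y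
      using that M_l cz_upd[of i S ab f y] by (simp add: Q_def)
  qed (auto simp: Q_def cz_nonneg)
  finally show ?thesis using M_l by (simp add: Q_def)
qed

text \<open>A free step on the falling arm lets \<open>final_run\<close> charge every prescribed
  step of the arm \<open>E * bet\<close>, that is its edge law times
  \<open>E ^ (2 * l) / \<kappa>\<close>. The prefix contains a prescribed step, and its first one
  costs only the edge law, which explains the exponent \<open>card S - 1\<close>.\<close>

lemma spread_case1:
  assumes S: "S \<subseteq> {..<2 * l}" and abX: "\<forall>i\<in>S. fst (ab i) \<in> X \<and> snd (ab i) \<in> X"
    and gap: "M \<le> i0" "i0 < 2 * l" "i0 \<notin> S" and ne: "S \<inter> {..<M} \<noteq> {}"
  shows "Ssum S ab \<le> ((B / \<kappa>) ^ (2 * l) * (B * D)) * (\<Prod>i\<in>S. ew (fst (ab i)) (snd (ab i))) * (E ^ (2 * l)) ^ (card S - 1)"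
proof -
  define ST where "ST = tl_set S"
  define lo where "lo c = snd (ab (2 * l - Suc c))" for c
  define hi where "hi c = fst (ab (2 * l - Suc c))" for c
  define R where "R = tail_R S ab"
  have R': "R = (\<lambda>c x y. c \<in> ST \<longrightarrow> x = lo c \<and> y = hi c)"
    by (simp add: R_def tail_R_def ST_def lo_def hi_def)
  have STq: "ST \<subseteq> {..<q}" by (auto simp: ST_def tl_set_def)
  have lohi: "lo c \<in> X \<and> hi c \<in> X" if "c \<in> ST" for c
    using that abX by (auto simp: ST_def tl_set_def lo_def hi_def)
  have "2 * l - Suc i0 < q" "2 * l - Suc (2 * l - Suc i0) = i0" using gap M_l q2 by auto
  then have "2 * l - Suc i0 \<in> {..<q} - ST" using gap by (auto simp: ST_def tl_set_def)
  then have nST: "ST \<noteq> {..<q}" by auto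
  obtain a b where ab0: "a < b" "b \<le> q" "a = 0 \<or> a - 1 \<in> ST" "b < q \<longrightarrow> b \<in> ST" and
    run: "\<And>u z. u \<in> X \<Longrightarrow> z \<in> X \<Longrightarrow>
       pk (b - a) (if a = 0 then u else hi (a - 1)) (if b < q then lo b else z) \<le> B * E ^ (q - (b - a)) * pk q u z \<Longrightarrow>
       AA R u q z \<le> B * D * (\<Prod>c\<in>ST. E * bet (lo c) (hi c)) * pk q u z"
    using final_run[OF STq lohi R' nST] by blast
  \<comment> \<open>The goodness inequality for the gap. The ends of the gap are prescribed vertices
    or ends of the arm, so it is a condition on the ends of the arm alone.\<close>
  define \<Phi> where "\<Phi> u z \<longleftrightarrow> pk (b - a) (if a = 0 then u else hi (a - 1)) (if b < q then lo b else z) \<le> B * E ^ (q - (b - a)) * pk q u z" for u z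
  define Ct where "Ct = B * D * (\<Prod>c\<in>ST. E * bet (lo c) (hi c))"
  have Ct0: "Ct \<ge> 0"
    unfolding Ct_def using B1 D1 E0 lohi by (intro mult_nonneg_nonneg prod_nonneg) (auto intro: bet_nonneg)
  have "Ssum S ab \<le> (\<Sum>f\<in>Wk M. Fp M f * (cz S ab M f * (if \<Phi> (f 0) (f M) then 1 else 0)
            * (AA R (f 0) q (f M) / pk q (f 0) (f M))))"
    unfolding R_def
  proof (rule Ssum_le_tail)
    fix f assume f: "good f" "cons S ab f"
    let ?g = "\<lambda>i. f (2 * l - i)"
    have "pk (b - a) (?g a) (?g b) \<le> B * E ^ (q - (b - a)) * pk q (?g 0) (?g q)"
      using f(1) ab0(1,2) unfolding good_def gw_def by blast
    moreover have "?g a = (if a = 0 then f 0 else hi (a - 1))"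
    proof (cases "a = 0")
      case True
      then show ?thesis using f(1) by (simp add: good_def)
    next
      case False
      then have "a - 1 \<in> tl_set S" using ab0(3) by (simp add: ST_def)
      then show ?thesis using f(2) False by (auto simp: tl_set_def cons_def hi_def)
    qed
    moreover have "?g b = (if b < q then lo b else f M)"
    proof (cases "b < q")
      case True
      then have "b \<in> tl_set S" using ab0(4) by (simp add: ST_def)
      moreover have "Suc (2 * l - Suc b) = 2 * l - b" using True M_l by simp
      ultimately show ?thesis using f(2) True unfolding tl_set_def cons_def lo_def by force
    next
      case False
      then have "b = q" using ab0(2) by simp
      then show ?thesis using M_l by simp
    qed
    moreover have "?g 0 = f 0" "?g q = f M" using f(1) M_l by (simp_all add: good_def)
    ultimately show "\<Phi> (f 0) (f M)" unfolding \<Phi>_def by simp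
  qed
  also have "\<dots> \<le> (\<Sum>f\<in>Wk M. Fp M f * (cz S ab M f * Ct))"
  proof (intro sum_mono mult_left_mono Fp_nonneg)
    fix f assume f: "f \<in> Wk M"
    have X: "f 0 \<in> X" "f M \<in> X" using f by (auto intro: Wk_in)
    have "(if \<Phi> (f 0) (f M) then 1 else 0) * (AA R (f 0) q (f M) / pk q (f 0) (f M)) \<le> Ct"
    proof (cases "\<Phi> (f 0) (f M) \<and> pk q (f 0) (f M) \<noteq> 0")
      case True
      then have "pk q (f 0) (f M) > 0" using pk_nonneg[OF X, of q] by linarith
      then show ?thesis using run[OF X] True unfolding \<Phi>_def[symmetric] Ct_def by (simp add: divide_le_eq)
    next
      case False
      then show ?thesis using Ct0 by auto
    qed
    from mult_left_mono[OF this cz_nonneg[of S ab M f]]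
    show "cz S ab M f * (if \<Phi> (f 0) (f M) then 1 else 0) * (AA R (f 0) q (f M) / pk q (f 0) (f M)) \<le> cz S ab M f * Ct"
      by (simp only: mult.assoc)
  qed
  also have "\<dots> = (\<Sum>f\<in>Wk M. Fp M f * cz S ab M f) * Ct"
    by (simp only: sum_distrib_right mult.assoc)
  also have "\<dots> \<le> ((\<Prod>i\<in>S \<inter> {..<M}. ew (fst (ab i)) (snd (ab i))) * (B / \<kappa> * E ^ (2 * l)) ^ (card (S \<inter> {..<M}) - 1)) * Ct"
    by (rule mult_right_mono[OF prefix_spread[OF order_refl ne abX] Ct0])
  also have "Ct = B * D * ((\<Prod>c\<in>ST. ew (fst (ab (2 * l - Suc c))) (snd (ab (2 * l - Suc c)))) * (E ^ (2 * l) / \<kappa>) ^ card ST)"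
  proof -
    have "(\<Prod>c\<in>ST. E * bet (lo c) (hi c)) = (\<Prod>c\<in>ST. ew (fst (ab (2 * l - Suc c))) (snd (ab (2 * l - Suc c))) * (E ^ (2 * l) / \<kappa>))"
      by (intro prod.cong refl) (use lohi ew_sym in \<open>auto simp: Ebet lo_def hi_def\<close>)
    then show ?thesis unfolding Ct_def by (simp only: prod.distrib prod_constant)
  qed
  also have "((\<Prod>i\<in>S \<inter> {..<M}. ew (fst (ab i)) (snd (ab i))) * (B / \<kappa> * E ^ (2 * l)) ^ (card (S \<inter> {..<M}) - 1)) *
      (B * D * ((\<Prod>c\<in>ST. ew (fst (ab (2 * l - Suc c))) (snd (ab (2 * l - Suc c)))) * (E ^ (2 * l) / \<kappa>) ^ card ST))
     = (\<Prod>i\<in>S. ew (fst (ab i)) (snd (ab i))) * (B * D) * ((B / \<kappa> * E ^ (2 * l)) ^ (card (S \<inter> {..<M}) - 1) * (E ^ (2 * l) / \<kappa>) ^ card ST)"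
    unfolding tl_split(2)[OF S] ST_def by (simp only: mult_ac)
  also have "\<dots> \<le> (\<Prod>i\<in>S. ew (fst (ab i)) (snd (ab i))) * (B * D) * ((B / \<kappa>) ^ (2 * l) * (E ^ (2 * l)) ^ (card S - 1))"
  proof (rule mult_left_mono)
    have k: "1 / \<kappa> \<le> B / \<kappa>" "1 \<le> B / \<kappa>" using B1 \<kappa> by (auto simp: field_simps)
    have "card (S \<inter> {..<M}) > 0" using ne by (simp add: card_gt_0_iff)
    then have n: "card (S \<inter> {..<M}) - 1 + card ST = card S - 1" using tl_split(1)[OF S] by (simp add: ST_def)
    have cS: "card S \<le> 2 * l" using card_mono[OF _ S] by simp
    have "(B / \<kappa> * E ^ (2 * l)) ^ (card (S \<inter> {..<M}) - 1) * (E ^ (2 * l) / \<kappa>) ^ card ST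
       \<le> (B / \<kappa> * E ^ (2 * l)) ^ (card (S \<inter> {..<M}) - 1) * (B / \<kappa> * E ^ (2 * l)) ^ card ST"
    proof (intro mult_left_mono power_mono)
      show "E ^ (2 * l) / \<kappa> \<le> B / \<kappa> * E ^ (2 * l)"
        using mult_right_mono[OF k(1), of "E ^ (2 * l)"] E0 by simp
    qed (use E0 B1 \<kappa> in auto)
    also have "\<dots> = (B / \<kappa> * E ^ (2 * l)) ^ (card S - 1)"
      by (simp only: power_add[symmetric] n)
    also have "\<dots> = (B / \<kappa>) ^ (card S - 1) * (E ^ (2 * l)) ^ (card S - 1)"
      by (rule power_mult_distrib)
    also have "\<dots> \<le> (B / \<kappa>) ^ (2 * l) * (E ^ (2 * l)) ^ (card S - 1)"
      using k cS E0 by (intro mult_right_mono power_increasing) auto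
    finally show "(B / \<kappa> * E ^ (2 * l)) ^ (card (S \<inter> {..<M}) - 1) * (E ^ (2 * l) / \<kappa>) ^ card ST
       \<le> (B / \<kappa>) ^ (2 * l) * (E ^ (2 * l)) ^ (card S - 1)" .
    show "0 \<le> (\<Prod>i\<in>S. ew (fst (ab i)) (snd (ab i))) * (B * D)"
      using abX B1 D1 by (intro mult_nonneg_nonneg prod_nonneg) (auto intro: ew_nonneg)
  qed
  finally show ?thesis by (simp only: mult_ac)
qed

definition swap_ab :: "(nat \<Rightarrow> 'a \<times> 'a) \<Rightarrow> nat \<Rightarrow> 'a \<times> 'a" where
  "swap_ab ab i = prod.swap (ab (2 * l - Suc i))"

lemma refl_bij: "S \<subseteq> {..<2 * l} \<Longrightarrow> inj_on (\<lambda>i. 2 * l - Suc i) S"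
proof (rule inj_onI)
  fix x y assume "S \<subseteq> {..<2 * l}" "x \<in> S" "y \<in> S" and eq: "2 * l - Suc x = 2 * l - Suc y"
  then have "x < 2 * l" "y < 2 * l" by auto
  then show "x = y" using eq by simp
qed

lemma Ssum_refl:
  assumes S: "S \<subseteq> {..<2 * l}"
  shows "Ssum S ab = Ssum ((\<lambda>i. 2 * l - Suc i) ` S) (swap_ab ab)"
proof -
  have c: "cons ((\<lambda>i. 2 * l - Suc i) ` S) (swap_ab ab) (rv f) \<longleftrightarrow> cons S ab f" for f
  proof -
    have "rv f (2 * l - Suc i) = f (Suc i)" "rv f (Suc (2 * l - Suc i)) = f i" "2 * l - Suc (2 * l - Suc i) = i"
      if "i \<in> S" for i
      using that S by (auto simp: rv_def Suc_diff_Suc)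
    then show ?thesis unfolding cons_def swap_ab_def by (auto simp: rv_def)
  qed
  show ?thesis unfolding Ssum_def
  proof (rule sum.reindex_bij_witness[where i = rv and j = rv])
    fix f assume f: "f \<in> Wk (2 * l)"
    show "rv (rv f) = f" "rv (rv f) = f" using rv_rv[OF f] by auto
    show "rv f \<in> Wk (2 * l)" "rv f \<in> Wk (2 * l)" using rv_Wk[OF f] by auto
    have "good (rv f) \<longleftrightarrow> good f" using good_rv[of f] good_rv[of "rv f"] rv_rv[OF f] by auto
    then show "(if good (rv f) \<and> cons ((\<lambda>i. 2 * l - Suc i) ` S) (swap_ab ab) (rv f) then F (rv f) else 0)
       = (if good f \<and> cons S ab f then F f else 0)"
      by (simp add: c F_rv)
  qed
qed

lemma refl_data:
  assumes S: "S \<subseteq> {..<2 * l}" and abX: "\<forall>i\<in>S. fst (ab i) \<in> X \<and> snd (ab i) \<in> X"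
  defines "S' \<equiv> (\<lambda>i. 2 * l - Suc i) ` S"
  shows "S' \<subseteq> {..<2 * l}" "\<forall>i\<in>S'. fst (swap_ab ab i) \<in> X \<and> snd (swap_ab ab i) \<in> X" "card S' = card S"
    "(\<Prod>i\<in>S'. ew (fst (swap_ab ab i)) (snd (swap_ab ab i))) = (\<Prod>i\<in>S. ew (fst (ab i)) (snd (ab i)))"
proof -
  have inv: "2 * l - Suc (2 * l - Suc i) = i" if "i \<in> S" for i using that S by auto
  show "S' \<subseteq> {..<2 * l}" using l2 by (auto simp: S'_def)
  show "\<forall>i\<in>S'. fst (swap_ab ab i) \<in> X \<and> snd (swap_ab ab i) \<in> X"
    using abX inv by (auto simp: S'_def swap_ab_def)
  show "card S' = card S" unfolding S'_def by (rule card_image[OF refl_bij[OF S]])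
  have "(\<Prod>i\<in>S'. ew (fst (swap_ab ab i)) (snd (swap_ab ab i)))
      = (\<Prod>i\<in>S. ew (snd (ab i)) (fst (ab i)))"
    unfolding S'_def prod.reindex[OF refl_bij[OF S]]
    by (intro prod.cong refl) (simp add: swap_ab_def inv)
  also have "\<dots> = (\<Prod>i\<in>S. ew (fst (ab i)) (snd (ab i)))"
    by (intro prod.cong refl ew_sym) (use abX in auto)
  finally show "(\<Prod>i\<in>S'. ew (fst (swap_ab ab i)) (snd (swap_ab ab i))) = (\<Prod>i\<in>S. ew (fst (ab i)) (snd (ab i)))" .
qed


text \<open>Unlike \<open>prefix_spread\<close>, this keeps the individual costs
  \<open>mul i * bet\<close>. After a free step it also bounds the mass at each fixed current
  vertex: the free step reaches a given vertex with probability at most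
  \<open>B * D * E / E ^ l\<close>, and later steps preserve this gain.\<close>

lemma prefix_pinned:
  assumes qS: "{..<q} \<subseteq> S" and abX: "\<forall>i\<in>S. fst (ab i) \<in> X \<and> snd (ab i) \<in> X"
    and m: "1 \<le> m" "m \<le> M"
  defines "P \<equiv> \<lambda>m. ew (fst (ab 0)) (snd (ab 0)) * (\<Prod>i\<in>S \<inter> {..<m} - {0}. mul i * bet (fst (ab i)) (snd (ab i)))"
  shows "(\<Sum>f\<in>Wk m. Fp m f * cz S ab m f) \<le> P m \<and>
    ((\<exists>i<m. i \<notin> S) \<longrightarrow> (\<forall>x\<in>X. (\<Sum>f\<in>Wk m. Fp m f * (cz S ab m f * (if f m = x then 1 else 0))) \<le> P m * (B * D * E / E ^ l)))"
  using m
proof (induction m rule: dec_induct)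
  case base
  have S1: "S \<inter> {..<1} = {0}" using qS q2 by auto
  have "(\<Sum>f\<in>Wk 1. Fp 1 f * cz S ab 1 f)
    \<le> (\<Prod>i\<in>S \<inter> {..<1}. ew (fst (ab i)) (snd (ab i))) * (B / \<kappa> * E ^ (2 * l)) ^ (card (S \<inter> {..<1}) - 1)"
    by (rule prefix_spread[OF base _ abX]) (use S1 in auto)
  then have "(\<Sum>f\<in>Wk 1. Fp 1 f * cz S ab 1 f) \<le> P 1" unfolding S1 P_def by simp
  moreover have "\<not> (\<exists>i<1. i \<notin> S)" using qS q2 by auto
  ultimately show ?case by blast
next
  case (step m)
  let ?g = "B * D * E / E ^ l"
  have g0: "?g \<ge> 0" using B1 D1 E0 by simp
  have mM: "m < M" "m < 2 * l" using step M_l by auto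
  have IH: "(\<Sum>f\<in>Wk m. Fp m f * cz S ab m f) \<le> P m"
    "\<And>x. \<exists>i<m. i \<notin> S \<Longrightarrow> x \<in> X \<Longrightarrow> (\<Sum>f\<in>Wk m. Fp m f * (cz S ab m f * (if f m = x then 1 else 0))) \<le> P m * ?g"
    using step by auto
  show ?case
  proof (cases "m \<in> S")
    case True
    have abm: "fst (ab m) \<in> X" "snd (ab m) \<in> X" using abX True by auto
    let ?k = "mul m * bet (fst (ab m)) (snd (ab m))"
    have k0: "?k \<ge> 0" using mul_bounds(1)[of m] bet_nonneg[OF abm] by simp
    have "S \<inter> {..<Suc m} - {0} = insert m (S \<inter> {..<m} - {0})" using True step(1) by (auto simp: less_Suc_eq)
    then have PS: "P (Suc m) = P m * ?k" unfolding P_def by simp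
    have st: "(\<Sum>f\<in>Wk (Suc m). Fp (Suc m) f * (cz S ab (Suc m) f * \<phi> (f (Suc m))))
      \<le> (\<Sum>f\<in>Wk m. Fp m f * (cz S ab m f * (if f m = fst (ab m) then 1 else 0))) * ?k"
      if "\<And>x. 0 \<le> \<phi> x" "\<And>x. \<phi> x \<le> 1" for \<phi>
      by (rule step_pinned[where m = m and S = S and ab = ab and \<phi> = \<phi>, OF mM(1) True abm that])
    have le: "(\<Sum>f\<in>Wk m. Fp m f * (cz S ab m f * (if f m = fst (ab m) then 1 else 0))) \<le> (\<Sum>f\<in>Wk m. Fp m f * cz S ab m f)"
      using cz_nonneg by (intro sum_mono mult_left_mono Fp_nonneg) auto
    have "(\<Sum>f\<in>Wk (Suc m). Fp (Suc m) f * cz S ab (Suc m) f) \<le> P (Suc m)"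
      using st[of "\<lambda>_. 1"] mult_right_mono[OF order_trans[OF le IH(1)] k0] unfolding PS by simp
    moreover have "(\<Sum>f\<in>Wk (Suc m). Fp (Suc m) f * (cz S ab (Suc m) f * (if f (Suc m) = x then 1 else 0))) \<le> P (Suc m) * ?g"
      if ex: "\<exists>i<Suc m. i \<notin> S" for x
    proof -
      have "\<exists>i<m. i \<notin> S" using ex True less_Suc_eq by auto
      note ex' = this
      have "(\<Sum>f\<in>Wk (Suc m). Fp (Suc m) f * (cz S ab (Suc m) f * (if f (Suc m) = x then 1 else 0)))
        \<le> (\<Sum>f\<in>Wk m. Fp m f * (cz S ab m f * (if f m = fst (ab m) then 1 else 0))) * ?k"
        by (rule st) auto
      also have "\<dots> \<le> (P m * ?g) * ?k" by (rule mult_right_mono[OF IH(2)[OF ex' abm(1)] k0])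
      also have "\<dots> = P (Suc m) * ?g" unfolding PS by (simp only: mult_ac)
      finally show ?thesis .
    qed
    ultimately show ?thesis by blast
  next
    case False
    have "S \<inter> {..<Suc m} - {0} = S \<inter> {..<m} - {0}" using False by (auto simp: less_Suc_eq)
    then have PS: "P (Suc m) = P m" unfolding P_def by simp
    have mass: "(\<Sum>f\<in>Wk (Suc m). Fp (Suc m) f * cz S ab (Suc m) f) \<le> P (Suc m)"
      using step_missing[OF mM(2) False, of ab] IH(1) PS by simp
    have "(\<Sum>f\<in>Wk (Suc m). Fp (Suc m) f * (cz S ab (Suc m) f * (if f (Suc m) = x then 1 else 0))) \<le> P (Suc m) * ?g"
      if x: "x \<in> X" for x
    proof -
      have "(\<Sum>f\<in>Wk (Suc m). Fp (Suc m) f * (cz S ab (Suc m) f * (if f (Suc m) = x then 1 else 0)))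
          = (\<Sum>f\<in>Wk m. Fp m f * (\<Sum>y\<in>X. K (f 0) m (f m) y * (cz S ab (Suc m) (f(Suc m := y)) * (if y = x then 1 else 0))))"
        by (subst sum_Fp_step) simp
      also have "\<dots> \<le> (\<Sum>f\<in>Wk m. Fp m f * (cz S ab m f * ?g))"
      proof (intro sum_mono mult_left_mono Fp_nonneg)
        fix f assume f: "f \<in> Wk m"
        have fX: "f 0 \<in> X" "f m \<in> X" using f by (auto intro: Wk_in)
        have "(\<Sum>y\<in>X. K (f 0) m (f m) y * (cz S ab (Suc m) (f(Suc m := y)) * (if y = x then 1 else 0)))
            = (\<Sum>y\<in>X. if y = x then K (f 0) m (f m) x * cz S ab (Suc m) (f(Suc m := x)) else 0)"
          by (intro sum.cong refl) auto
        also have "\<dots> = K (f 0) m (f m) x * cz S ab (Suc m) (f(Suc m := x))" using finX x by simp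
        also have "\<dots> \<le> cz S ab m f * ?g"
        proof (cases "q \<le> m \<longrightarrow> zz (f 0) m (f m) x")
          case True
          have "K (f 0) m (f m) x \<le> ?g" by (rule K_small[OF mM(1) _ fX x]) (use True in blast)
          then have "K (f 0) m (f m) x * cz S ab m f \<le> ?g * cz S ab m f" using cz_nonneg by (rule mult_right_mono)
          then show ?thesis unfolding cz_Suc using True False by (simp add: mult.commute)
        next
          case nz: False
          then show ?thesis unfolding cz_Suc using mult_nonneg_nonneg[OF cz_nonneg g0, of S ab m f] by simp
        qed
        finally show "(\<Sum>y\<in>X. K (f 0) m (f m) y * (cz S ab (Suc m) (f(Suc m := y)) * (if y = x then 1 else 0))) \<le> cz S ab m f * ?g" .
      qed
      also have "\<dots> = (\<Sum>f\<in>Wk m. Fp m f * cz S ab m f) * ?g" by (simp only: sum_distrib_right mult.assoc)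
      also have "\<dots> \<le> P (Suc m) * ?g" unfolding PS by (rule mult_right_mono[OF IH(1) g0])
      finally show ?thesis .
    qed
    then show ?thesis using mass by blast
  qed
qed

lemma down_count:
  "card {i \<in> {..<M}. \<not> lam i < lam (Suc i)} \<le> h"
proof -
  have "{i \<in> {..<M}. \<not> lam i < lam (Suc i)} \<subseteq> (\<lambda>j. q + 2 * j) ` {..<h}"
  proof
    fix i assume i: "i \<in> {i \<in> {..<M}. \<not> lam i < lam (Suc i)}"
    then have qi: "q \<le> i" using first_up[of i] by (cases "i < q") simp_all
    define j where "j = i - q"
    have j: "i = q + j" "j < 2 * h" using qi i by (auto simp: j_def)
    have "even j"
    proof (rule ccontr)
      assume "odd j"
      then have "lam i = q - 1" "lam (Suc i) = q" using j lam_mid[of j] lam_mid[of "Suc j"] by simp_all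
      then show False using i q2 by simp
    qed
    then obtain t where "j = 2 * t" by (rule evenE)
    then show "i \<in> (\<lambda>j. q + 2 * j) ` {..<h}" using j by auto
  qed
  then have "card {i \<in> {..<M}. \<not> lam i < lam (Suc i)} \<le> card ((\<lambda>j. q + 2 * j) ` {..<h})"
    by (intro card_mono) auto
  also have "\<dots> \<le> h" using card_image_le[of "{..<h}" "\<lambda>j. q + 2 * j"] by simp
  finally show ?thesis .
qed

lemma prod_mul:
  assumes "finite A"
  shows "(\<Prod>i\<in>A. mul i) = (B * E) ^ card {i \<in> A. \<not> lam i < lam (Suc i)}"
proof -
  have "(\<Prod>i\<in>A. mul i) = (\<Prod>i\<in>A. if \<not> lam i < lam (Suc i) then B * E else 1)"
    by (intro prod.cong refl) (simp add: mul_def)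
  also have "\<dots> = (\<Prod>i\<in>{i \<in> A. \<not> lam i < lam (Suc i)}. B * E)"
    by (rule prod.inter_filter[OF assms, symmetric])
  finally show ?thesis by simp
qed

text \<open>With both arms prescribed no gap is available on them. The falling arm is rigid:
  \<open>AA\<close> forces \<open>f M\<close> to be one vertex, and dividing by \<open>pk q\<close>
  loses \<open>E ^ (l + q - 1)\<close> through the lower bound in \<open>gw\<close>. Every
  prescribed step after the first uses \<open>E ^ (2 * l - 1)\<close> where
  \<open>E ^ (2 * l)\<close> is allowed, and these spare factors must cover that loss as well as the
  \<open>d\<close> prescribed downward steps.\<close>

lemma spread_case2:
  assumes S: "S \<subseteq> {..<2 * l}" and abX: "\<forall>i\<in>S. fst (ab i) \<in> X \<and> snd (ab i) \<in> X"
    and qS: "{..<q} \<subseteq> S" and MS: "{M..<2 * l} \<subseteq> S"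
  shows "Ssum S ab \<le> ((B / \<kappa>) ^ (2 * l) * (2 * B * D / \<kappa>)) * (\<Prod>i\<in>S. ew (fst (ab i)) (snd (ab i))) * (E ^ (2 * l)) ^ (card S - 1)"
proof -
  define ST where "ST = tl_set S"
  define lo where "lo c = snd (ab (2 * l - Suc c))" for c
  define hi where "hi c = fst (ab (2 * l - Suc c))" for c
  define R where "R = tail_R S ab"
  have R': "R = (\<lambda>c x y. c \<in> ST \<longrightarrow> x = lo c \<and> y = hi c)"
    by (simp add: R_def tail_R_def ST_def lo_def hi_def)
  have ST: "ST = {..<q}"
    unfolding ST_def tl_set_def using MS M_l by (auto simp: subset_iff)
  have lohi: "lo c \<in> X \<and> hi c \<in> X" if "c \<in> ST" for c
    using that abX by (auto simp: ST_def tl_set_def lo_def hi_def)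
  define \<Phi> where "\<Phi> u z \<longleftrightarrow> \<kappa> / 2 \<le> pk q u z * E ^ (l + q - 1)" for u z
  let ?z = "hi (q - 1)"
  have zX: "?z \<in> X" using lohi[of "q - 1"] ST q2 by simp
  define Pt where "Pt = (\<Prod>c\<in>ST. bet (lo c) (hi c))"
  have Pt0: "Pt \<ge> 0" unfolding Pt_def using lohi by (intro prod_nonneg) (auto intro: bet_nonneg)
  let ?c = "Pt * (2 * E ^ (l + q - 1) / \<kappa>)"
  have c0: "?c \<ge> 0" using Pt0 E0 \<kappa> by simp
  let ?g = "B * D * E / E ^ l"
  have "Ssum S ab \<le> (\<Sum>f\<in>Wk M. Fp M f * (cz S ab M f * (if \<Phi> (f 0) (f M) then 1 else 0)
            * (AA R (f 0) q (f M) / pk q (f 0) (f M))))"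
    unfolding R_def
  proof (rule Ssum_le_tail)
    fix f assume f: "good f"
    then have "\<kappa> / 2 \<le> pk q (f (2 * l - 0)) (f (2 * l - q)) * E ^ (l + q - 1)"
      unfolding good_def gw_def by blast
    then show "\<Phi> (f 0) (f M)" using f M_l by (simp add: \<Phi>_def good_def)
  qed
  also have "\<dots> \<le> (\<Sum>f\<in>Wk M. Fp M f * (cz S ab M f * (if f M = ?z then 1 else 0) * ?c))"
  proof (intro sum_mono mult_left_mono Fp_nonneg)
    fix f assume f: "f \<in> Wk M"
    have X: "f 0 \<in> X" "f M \<in> X" using f by (auto intro: Wk_in)
    have "ST \<inter> {..<q} = ST" using ST by simp
    then have AAq: "AA R (f 0) q (f M) \<le> Pt * (if f M = ?z then 1 else 0)"
      using AA_initial[OF _ lohi R', of q "f 0" "f M"] ST X q2 by (simp add: Pt_def)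
    have "(if \<Phi> (f 0) (f M) then 1 else 0) * (AA R (f 0) q (f M) / pk q (f 0) (f M)) \<le> (if f M = ?z then 1 else 0) * ?c"
    proof (cases "\<Phi> (f 0) (f M)")
      case True
      then have lowr: "\<kappa> / 2 \<le> pk q (f 0) (f M) * E ^ (l + q - 1)" by (simp add: \<Phi>_def)
      then have pos: "pk q (f 0) (f M) > 0"
        using \<kappa> E0 pk_nonneg[OF X, of q] by (metis half_gt_zero less_le_trans less_le mult_zero_left)
      have "1 / pk q (f 0) (f M) \<le> 2 * E ^ (l + q - 1) / \<kappa>"
        using lowr pos \<kappa> by (simp add: field_simps)
      then have "AA R (f 0) q (f M) * (1 / pk q (f 0) (f M)) \<le> (Pt * (if f M = ?z then 1 else 0)) * (2 * E ^ (l + q - 1) / \<kappa>)"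
        using AAq pos Pt0 by (intro mult_mono) auto
      then show ?thesis using True by (simp add: mult_ac)
    next
      case False
      then show ?thesis using c0 by auto
    qed
    from mult_left_mono[OF this cz_nonneg[of S ab M f]]
    show "cz S ab M f * (if \<Phi> (f 0) (f M) then 1 else 0) * (AA R (f 0) q (f M) / pk q (f 0) (f M))
       \<le> cz S ab M f * (if f M = ?z then 1 else 0) * ?c" by (simp only: mult.assoc)
  qed
  also have "\<dots> = (\<Sum>f\<in>Wk M. Fp M f * (cz S ab M f * (if f M = ?z then 1 else 0))) * ?c"
    by (simp only: sum_distrib_right mult.assoc)
  finally have main: "Ssum S ab \<le> (\<Sum>f\<in>Wk M. Fp M f * (cz S ab M f * (if f M = ?z then 1 else 0))) * ?c" .
  define S1 where "S1 = S \<inter> {..<M} - {0}"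
  define d where "d = card {i \<in> S1. \<not> lam i < lam (Suc i)}"
  have fS: "finite S" using S finite_subset by blast
  have fS1: "finite S1" using fS by (simp add: S1_def)
  define P where "P = ew (fst (ab 0)) (snd (ab 0)) * (\<Prod>i\<in>S1. mul i * bet (fst (ab i)) (snd (ab i)))"
  have pin: "(\<Sum>f\<in>Wk M. Fp M f * cz S ab M f) \<le> P"
    "(\<exists>i<M. i \<notin> S) \<Longrightarrow> (\<Sum>f\<in>Wk M. Fp M f * (cz S ab M f * (if f M = ?z then 1 else 0))) \<le> P * ?g"
    using prefix_pinned[OF qS abX, of M] q2 zX unfolding P_def S1_def by auto
  define W where "W = (\<Prod>i\<in>S. ew (fst (ab i)) (snd (ab i)))"
  have W0: "W \<ge> 0" unfolding W_def using abX by (intro prod_nonneg) (auto intro: ew_nonneg)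
  have zS: "0 \<in> S \<inter> {..<M}" using qS q2 by auto
  have cS: "card S = Suc (card S1 + q)" "card S1 \<ge> q - 1"
  proof -
    have "card (S \<inter> {..<M}) = Suc (card S1)" unfolding S1_def using zS fS by (intro card.remove) auto
    then show "card S = Suc (card S1 + q)" using tl_split(1)[OF S] ST unfolding ST_def by simp
    have "card ({..<q} - {0}) \<le> card S1" unfolding S1_def using qS fS by (intro card_mono) auto
    then show "card S1 \<ge> q - 1" using q2 by (simp add: card_Diff_singleton)
  qed
  have PPt: "P * Pt = W * (B * E) ^ d * (E ^ (2 * l - 1) / \<kappa>) ^ (card S - 1)"
  proof -
    have "(\<Prod>i\<in>S1. mul i * bet (fst (ab i)) (snd (ab i)))
        = (B * E) ^ d * ((\<Prod>i\<in>S1. ew (fst (ab i)) (snd (ab i))) * (E ^ (2 * l - 1) / \<kappa>) ^ card S1)"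
      unfolding prod.distrib prod_mul[OF fS1] d_def bet_def times_divide_eq_right[symmetric] prod_constant ..
    moreover have "Pt = (\<Prod>c\<in>ST. ew (fst (ab (2 * l - Suc c))) (snd (ab (2 * l - Suc c)))) * (E ^ (2 * l - 1) / \<kappa>) ^ q"
    proof -
      have "Pt = (\<Prod>c\<in>ST. ew (fst (ab (2 * l - Suc c))) (snd (ab (2 * l - Suc c))) * (E ^ (2 * l - 1) / \<kappa>))"
        unfolding Pt_def by (intro prod.cong refl) (use lohi ew_sym in \<open>auto simp: bet_def lo_def hi_def\<close>)
      also have "\<dots> = (\<Prod>c\<in>ST. ew (fst (ab (2 * l - Suc c))) (snd (ab (2 * l - Suc c)))) * (E ^ (2 * l - 1) / \<kappa>) ^ card ST"
        unfolding prod.distrib prod_constant ..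
      finally show ?thesis using ST by simp
    qed
    moreover have "W = (ew (fst (ab 0)) (snd (ab 0)) * (\<Prod>i\<in>S1. ew (fst (ab i)) (snd (ab i)))) *
        (\<Prod>c\<in>ST. ew (fst (ab (2 * l - Suc c))) (snd (ab (2 * l - Suc c))))"
    proof -
      have "(\<Prod>i\<in>S \<inter> {..<M}. ew (fst (ab i)) (snd (ab i))) = ew (fst (ab 0)) (snd (ab 0)) * (\<Prod>i\<in>S1. ew (fst (ab i)) (snd (ab i)))"
        unfolding S1_def using zS fS by (intro prod.remove) auto
      then show ?thesis using tl_split(2)[OF S, of "\<lambda>i. ew (fst (ab i)) (snd (ab i))"] unfolding W_def ST_def by simp
    qed
    ultimately show ?thesis unfolding P_def cS(1) by (simp add: power_add mult_ac)
  qed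
  have d_le: "d \<le> card S1 - (q - 1)"
  proof -
    have "{i \<in> S1. \<not> lam i < lam (Suc i)} \<subseteq> S1 - ({..<q} - {0})" using first_up by auto
    then have "d \<le> card (S1 - ({..<q} - {0}))" unfolding d_def using fS1 by (intro card_mono) auto
    also have "\<dots> = card S1 - (q - 1)"
    proof -
      have "{..<q} - {0} \<subseteq> S1" unfolding S1_def using qS by auto
      then show ?thesis using q2 by (simp add: card_Diff_subset card_Diff_singleton)
    qed
    finally show ?thesis .
  qed
  have d_le_h: "d \<le> h"
  proof -
    have "d \<le> card {i \<in> {..<M}. \<not> lam i < lam (Suc i)}" unfolding d_def S1_def by (intro card_mono) auto
    then show ?thesis using down_count by linarith
  qed
  have cS2: "card S \<le> 2 * l" using card_mono[OF _ S] by simp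
  define E2 where "E2 = (2 * l - 1) * (card S - 1)"
  have "Ssum S ab \<le> W * (B * D * 2 / \<kappa>) * (B ^ d / \<kappa> ^ (card S - 1)) * E ^ (2 * l * (card S - 1))"
  proof (cases "\<exists>i<M. i \<notin> S")
    case True
    have "Ssum S ab \<le> (P * ?g) * ?c" using main mult_right_mono[OF pin(2)[OF True] c0] by linarith
    also have "\<dots> = (P * Pt) * (B * D * 2 / \<kappa>) * (E * E ^ (l + q - 1) / E ^ l)" by (simp add: mult_ac)
    also have "E * E ^ (l + q - 1) / E ^ l = E ^ q"
    proof -
      have "Suc (l + q - 1) = l + q" using q2 by simp
      then have "E * E ^ (l + q - 1) = E ^ l * E ^ q" by (metis power_Suc power_add)
      then show ?thesis using E0 by simp
    qed
    also have "(P * Pt) * (B * D * 2 / \<kappa>) * E ^ q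
        = W * (B * D * 2 / \<kappa>) * (B ^ d / \<kappa> ^ (card S - 1)) * E ^ (E2 + d + q)"
      unfolding PPt E2_def power_mult_distrib power_divide power_add power_mult by (simp add: mult_ac)
    also have "\<dots> \<le> W * (B * D * 2 / \<kappa>) * (B ^ d / \<kappa> ^ (card S - 1)) * E ^ (2 * l * (card S - 1))"
    proof (intro mult_left_mono power_increasing E1)
      \<comment> \<open>A free step makes the prescribed value of \<open>f M\<close> unlikely, which
        lowers the loss to \<open>E ^ q\<close>. No downward step lies among the first q steps, so d
        is at most \<open>card S1 - (q - 1)\<close> and enough spare factors remain.\<close>
      have "d + q \<le> card S - 1" using d_le cS q2 by linarith
      moreover have "2 * l * (card S - 1) = E2 + (card S - 1)" unfolding E2_def using l2 by (simp add: diff_mult_distrib)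
      ultimately show "E2 + d + q \<le> 2 * l * (card S - 1)" by linarith
    qed (use W0 B1 D1 \<kappa> in auto)
    finally show ?thesis .
  next
    case False
    have "{..<2 * l} \<subseteq> S"
    proof
      fix i assume "i \<in> {..<2 * l}"
      then show "i \<in> S" using False MS by (cases "i < M") auto
    qed
    then have "S = {..<2 * l}" using S by auto
    then have c2l: "card S = 2 * l" by simp
    have "(\<Sum>f\<in>Wk M. Fp M f * (cz S ab M f * (if f M = ?z then 1 else 0))) \<le> (\<Sum>f\<in>Wk M. Fp M f * cz S ab M f)"
      using cz_nonneg by (intro sum_mono mult_left_mono Fp_nonneg) auto
    then have "Ssum S ab \<le> P * ?c" using main pin(1) mult_right_mono[OF order_trans[OF _ pin(1)] c0] by (meson order_trans)
    also have "\<dots> = (P * Pt) * (1 * 2 / \<kappa>) * E ^ (l + q - 1)" by simp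
    also have "\<dots> = W * (1 * 2 / \<kappa>) * (B ^ d / \<kappa> ^ (card S - 1)) * E ^ (E2 + d + (l + q - 1))"
      unfolding PPt E2_def power_mult_distrib power_divide power_add power_mult by (simp add: mult_ac)
    also have "\<dots> \<le> W * (1 * 2 / \<kappa>) * (B ^ d / \<kappa> ^ (card S - 1)) * E ^ (2 * l * (card S - 1))"
    proof (intro mult_left_mono power_increasing E1)
      \<comment> \<open>Here every step is prescribed. There are at most h = l - q downward steps,
        so the total loss is at most \<open>E ^ (2 * l - 1)\<close>, which equals the spare factors
        of the \<open>2 * l - 1\<close> later steps: no room is left.\<close>
      have "d + (l + q - 1) \<le> card S - 1" using d_le_h lqh c2l q2 by linarith
      moreover have "2 * l * (card S - 1) = E2 + (card S - 1)" unfolding E2_def using l2 by (simp add: diff_mult_distrib)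
      ultimately show "E2 + d + (l + q - 1) \<le> 2 * l * (card S - 1)" by linarith
    qed (use W0 B1 \<kappa> in auto)
    also have "\<dots> \<le> W * (B * D * 2 / \<kappa>) * (B ^ d / \<kappa> ^ (card S - 1)) * E ^ (2 * l * (card S - 1))"
    proof (intro mult_right_mono mult_left_mono divide_right_mono)
      show "1 \<le> B * D" using mult_mono[OF B1(1) D1] B1 by simp
    qed (use W0 B1 \<kappa> E0 in auto)
    finally show ?thesis .
  qed
  also have "\<dots> \<le> W * (B * D * 2 / \<kappa>) * ((B / \<kappa>) ^ (2 * l)) * E ^ (2 * l * (card S - 1))"
  proof (intro mult_right_mono mult_left_mono)
    have "B ^ d / \<kappa> ^ (card S - 1) = B ^ d * (1 / \<kappa>) ^ (card S - 1)" by (simp add: power_divide)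
    also have "\<dots> \<le> B ^ (2 * l) * (1 / \<kappa>) ^ (2 * l)"
      using d_le_h lqh B1 \<kappa> cS2 by (intro mult_mono power_increasing) auto
    also have "\<dots> = (B / \<kappa>) ^ (2 * l)" by (simp add: power_divide)
    finally show "B ^ d / \<kappa> ^ (card S - 1) \<le> (B / \<kappa>) ^ (2 * l)" .
  qed (use W0 B1 D1 \<kappa> E0 in auto)
  finally show ?thesis unfolding W_def power_mult by (simp add: mult_ac)
qed

definition Cs :: real where "Cs = (B / \<kappa>) ^ (2 * l) * (2 * B * D / \<kappa>)"

text \<open>If some arm has a free step, reversal can be used to place such a step on the falling
  arm while a prescribed step lies before that arm. Only the case of two fully prescribed arms is
  then left over.\<close>

theorem Ssum_spread:
  assumes S: "S \<subseteq> {..<2 * l}" "S \<noteq> {}" and abX: "\<forall>i\<in>S. fst (ab i) \<in> X \<and> snd (ab i) \<in> X"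
  shows "Ssum S ab \<le> Cs * (\<Prod>i\<in>S. ew (fst (ab i)) (snd (ab i))) * (E ^ (2 * l)) ^ (card S - 1)"
proof -
  have one: "Ssum S ab \<le> Cs * (\<Prod>i\<in>S. ew (fst (ab i)) (snd (ab i))) * (E ^ (2 * l)) ^ (card S - 1)"
    if S: "S \<subseteq> {..<2 * l}" and abX: "\<forall>i\<in>S. fst (ab i) \<in> X \<and> snd (ab i) \<in> X"
      and gap: "\<exists>i. M \<le> i \<and> i < 2 * l \<and> i \<notin> S" and ne: "S \<inter> {..<M} \<noteq> {}" for S ab
  proof -
    obtain i0 where i0: "M \<le> i0" "i0 < 2 * l" "i0 \<notin> S" using gap by blast
    have "B * D \<le> 2 * B * D / \<kappa>"
    proof -
      have "B * D * \<kappa> \<le> B * D * 2" using B1 D1 \<kappa> by (intro mult_left_mono) auto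
      then show ?thesis using \<kappa> by (simp add: field_simps)
    qed
    then have "(B / \<kappa>) ^ (2 * l) * (B * D) \<le> Cs"
      unfolding Cs_def using B1 \<kappa> by (intro mult_left_mono) auto
    moreover have "0 \<le> (\<Prod>i\<in>S. ew (fst (ab i)) (snd (ab i)))"
      using abX by (intro prod_nonneg) (auto intro: ew_nonneg)
    ultimately show ?thesis
      using E0 by (intro order_trans[OF spread_case1[OF S abX i0 ne]] mult_right_mono) auto
  qed
  show ?thesis
  proof (cases "{M..<2 * l} \<subseteq> S \<and> {..<q} \<subseteq> S")
    case True
    then show ?thesis using spread_case2[OF S(1) abX] unfolding Cs_def by blast
  next
    case False
    show ?thesis
    proof (cases "(\<exists>i. M \<le> i \<and> i < 2 * l \<and> i \<notin> S) \<and> S \<inter> {..<M} \<noteq> {}")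
      case True
      then show ?thesis using one[OF S(1) abX] by blast
    next
      case F2: False
      let ?S = "(\<lambda>i. 2 * l - Suc i) ` S"
      note rd = refl_data[OF S(1) abX]
      have notF: "\<exists>i<q. i \<notin> S"
      proof (cases "S \<inter> {..<M} = {}")
        case True
        then show ?thesis using q2 by (intro exI[of _ 0]) auto
      next
        case n: False
        then have "{M..<2 * l} \<subseteq> S" using F2 by auto
        then show ?thesis using False by auto
      qed
      then obtain i where i: "i < q" "i \<notin> S" by blast
      have "2 * l - Suc i \<notin> ?S"
      proof
        assume "2 * l - Suc i \<in> ?S"
        then obtain j where "j \<in> S" "2 * l - Suc i = 2 * l - Suc j" by blast
        moreover have "j < 2 * l" "i < 2 * l" using \<open>j \<in> S\<close> S i M_l by auto
        ultimately have "i = j" by linarith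
        then show False using i \<open>j \<in> S\<close> by blast
      qed
      then have g: "\<exists>i. M \<le> i \<and> i < 2 * l \<and> i \<notin> ?S"
        using i M_l q2 by (intro exI[of _ "2 * l - Suc i"]) auto
      have "\<exists>j\<in>S. q \<le> j"
      proof (cases "S \<inter> {..<M} = {}")
        case True
        then obtain j where "j \<in> S" "M \<le> j" using S(2) by (metis IntI all_not_in_conv lessThan_iff not_less)
        then show ?thesis by (intro bexI[of _ j]) auto
      next
        case n: False
        then have "{M..<2 * l} \<subseteq> S" using F2 by auto
        then have "M \<in> S" using M_l q2 by auto
        then show ?thesis by (intro bexI[of _ M]) auto
      qed
      then obtain j where j: "j \<in> S" "q \<le> j" by blast
      then have "2 * l - Suc j \<in> ?S \<inter> {..<M}" using S(1) M_l by auto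
      then have ne: "?S \<inter> {..<M} \<noteq> {}" by blast
      show ?thesis
        using one[OF rd(1,2) g ne] unfolding rd(3,4) Ssum_refl[OF S(1), symmetric] .
    qed
  qed
qed


section \<open>Repeated vertices are rare\<close>

lemma drop_to:
  assumes "j \<le> m" "m \<le> 2 * l" "\<And>f. H f \<ge> 0" "\<And>f i y. j < i \<Longrightarrow> H (f(i := y)) = H f"
  shows "(\<Sum>f\<in>Wk m. Fp m f * H f) \<le> (\<Sum>f\<in>Wk j. Fp j f * H f)"
  using assms(1,2)
proof (induction m rule: dec_induct)
  case base
  then show ?case by simp
next
  case (step m)
  have "(\<Sum>f\<in>Wk (Suc m). Fp (Suc m) f * H f) \<le> (\<Sum>f\<in>Wk m. Fp m f * H f)"
    by (rule sum_Fp_drop) (use step assms(3,4) in auto)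
  then show ?case using step by linarith
qed

definition coll :: "nat \<Rightarrow> nat \<Rightarrow> real" where
  "coll i j = (\<Sum>f\<in>Wk (2 * l). if good f \<and> f i = f j then F f else 0)"

lemma g_bound: "B * D * E / E ^ l \<le> B * D / E"
proof -
  have "E ^ 2 \<le> E ^ l" using E1 l2 by (intro power_increasing) auto
  then have "B * D * E / E ^ l \<le> B * D * E / E ^ 2"
    using B1 D1 E0 by (intro divide_left_mono) auto
  then show ?thesis using E0 by (simp add: power2_eq_square)
qed

text \<open>Given the walk up to position j - 1, the vertex \<open>f i\<close> is one fixed target,
  which the next step meets with probability at most \<open>B * D * E / E ^ l\<close> by
  \<open>K_small\<close>.\<close>

lemma coll_prefix:
  assumes "i < j" "j \<le> M"
  shows "coll i j \<le> B * D / E"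
proof -
  obtain m where m: "j = Suc m" using assms(1) by (cases j) auto
  let ?g = "B * D * E / E ^ l"
  define H where "H f = cz {} (\<lambda>_. undefined) j f * (if f i = f j then 1 else 0)" for f
  have jl: "j \<le> 2 * l" using assms M_l by simp
  have H_upd: "H (f(k := y)) = H f" if "j < k" for f k y
  proof -
    have "zzs j (f(k := y)) \<longleftrightarrow> zzs j f"
      unfolding zzs_def using that by (intro all_cong1 imp_cong refl) auto
    moreover have "cons {} ab g" for ab g by (simp add: cons_def)
    ultimately show ?thesis using that assms(1) by (simp add: H_def cz_def)
  qed
  have "coll i j \<le> (\<Sum>f\<in>Wk (2 * l). Fp (2 * l) f * H f)"
    unfolding coll_def
  proof (rule sum_mono)
    fix f assume f: "f \<in> Wk (2 * l)"
    have "H f = 1" if "good f" "f i = f j"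
      using that assms(2) by (auto simp: H_def cz_def cons_def zzs_def good_def)
    moreover have "H f \<ge> 0" by (simp add: H_def cz_nonneg)
    ultimately show "(if good f \<and> f i = f j then F f else 0) \<le> Fp (2 * l) f * H f"
      using Fp_nonneg[OF f] by (auto simp: F_Fp)
  qed
  also have "\<dots> \<le> (\<Sum>f\<in>Wk j. Fp j f * H f)"
    by (rule drop_to[OF jl order_refl _ H_upd]) (auto simp: H_def cz_nonneg)
  also have "\<dots> = (\<Sum>f\<in>Wk m. Fp m f * (\<Sum>y\<in>X. K (f 0) m (f m) y * H (f(Suc m := y))))"
    unfolding m by (rule sum_Fp_step)
  also have "\<dots> \<le> (\<Sum>f\<in>Wk m. Fp m f * ?g)"
  proof (intro sum_mono mult_left_mono Fp_nonneg)
    fix f assume f: "f \<in> Wk m"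
    have fX: "f 0 \<in> X" "f m \<in> X" "f i \<in> X" using f assms m by (auto intro: Wk_in)
    have "(\<Sum>y\<in>X. K (f 0) m (f m) y * H (f(Suc m := y)))
       = (\<Sum>y\<in>X. if y = f i then K (f 0) m (f m) (f i) * cz {} (\<lambda>_. undefined) (Suc m) (f(Suc m := f i)) else 0)"
      using assms(1) by (intro sum.cong refl) (auto simp: H_def m)
    also have "\<dots> = K (f 0) m (f m) (f i) * cz {} (\<lambda>_. undefined) (Suc m) (f(Suc m := f i))"
      using finX fX by simp
    also have "\<dots> \<le> ?g"
    proof (cases "q \<le> m \<longrightarrow> zz (f 0) m (f m) (f i)")
      case True
      have "K (f 0) m (f m) (f i) \<le> ?g"
        by (rule K_small) (use True fX assms m in auto)
      moreover have "cz {} (\<lambda>_. undefined) (Suc m) (f(Suc m := f i)) \<le> 1" by (simp add: cz_def)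
      moreover have "0 \<le> K (f 0) m (f m) (f i)" using fX by (intro K_nonneg)
      ultimately show ?thesis by (meson mult_left_le order_trans)
    next
      case False
      then show ?thesis unfolding cz_Suc using B1 D1 E0 by simp
    qed
    finally show "(\<Sum>y\<in>X. K (f 0) m (f m) y * H (f(Suc m := y))) \<le> ?g" .
  qed
  also have "\<dots> = (\<Sum>f\<in>Wk m. Fp m f) * ?g" by (rule sum_distrib_right[symmetric])
  also have "\<dots> \<le> 1 * ?g" using Fp_total[of m] jl m B1 D1 E0 by (intro mult_right_mono) auto
  also have "\<dots> \<le> B * D / E" using g_bound by simp
  finally show ?thesis .
qed

lemma AA_le_pk: "x \<in> X \<Longrightarrow> u \<in> X \<Longrightarrow> AA R u c x \<le> pk c u x"
proof (induction c arbitrary: x)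
  case 0
  then show ?case by auto
next
  case (Suc c)
  show ?case unfolding AA.simps pk.simps
    using Suc AA_nonneg p_nonneg pk_nonneg by (intro sum_mono mult_mono) auto
qed

lemma AA_pin:
  assumes "a \<ge> 1" "u \<in> X" "v \<in> X" and R: "R = (\<lambda>c x y. Suc c = a \<longrightarrow> y = v)" and x: "x \<in> X"
  shows "AA R u (a + k) x \<le> pk a u v * pk k v x"
  using x
proof (induction k arbitrary: x)
  case 0
  obtain a' where a: "a = Suc a'" using assms(1) by (cases a) auto
  show ?case
  proof (cases "x = v")
    case True
    then show ?thesis using AA_le_pk[of x u R a] assms by simp
  next
    case False
    then have "AA R u a x = 0" unfolding a AA.simps R using a by simp
    then show ?thesis using False pk_nonneg[of u v a] assms by simp
  qed
next
  case (Suc k)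
  have "AA R u (a + Suc k) x = (\<Sum>y\<in>X. AA R u (a + k) y * p y x)"
    unfolding R by simp
  also have "\<dots> \<le> (\<Sum>y\<in>X. (pk a u v * pk k v y) * p y x)"
    using Suc p_nonneg by (intro sum_mono mult_right_mono) auto
  also have "\<dots> = pk a u v * pk (Suc k) v x" by (simp add: sum_distrib_left mult.assoc)
  finally show ?case .
qed

text \<open>A repetition between the two arms makes the falling arm pass through v =
  \<open>f i\<close> at distance a from its end. Its weight is at most the probability of going from
  the start to v in a steps and from v to \<open>f M\<close> in q - a steps. Goodness of the falling
  arm bounds the first factor by \<open>B * E ^ (q - a) * pk q\<close>, and the second is at most
  \<open>D / E ^ l\<close>.\<close>

lemma coll_tail:
  assumes i: "1 \<le> i" "i < q" and j: "M < j" "j < 2 * l"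
  shows "coll i j \<le> B * D / E"
proof -
  define a where "a = 2 * l - j"
  have a: "1 \<le> a" "a < q" "2 * l - a = j" using j M_l by (auto simp: a_def)
  define Q where "Q f = (if pk a (f 0) (f i) \<le> B * E ^ (q - a) * pk q (f 0) (f M) then 1 else 0 :: real)" for f
  define R where "R f = (\<lambda>c (x::'a) y. Suc c = a \<longrightarrow> y = f i)" for f :: "nat \<Rightarrow> 'a"
  have "coll i j \<le> (\<Sum>f\<in>Wk (2 * l). Fp (2 * l) f * (Q f * (if \<forall>c'<q. R f c' (f (2 * l - c')) (f (2 * l - Suc c')) then 1 else 0)))"
    unfolding coll_def
  proof (rule sum_mono)
    fix f assume f: "f \<in> Wk (2 * l)"
    show "(if good f \<and> f i = f j then F f else 0)
       \<le> Fp (2 * l) f * (Q f * (if \<forall>c'<q. R f c' (f (2 * l - c')) (f (2 * l - Suc c')) then 1 else 0))"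
    proof (cases "good f \<and> f i = f j")
      case True
      have gw: "gw q (\<lambda>i. f (2 * l - i))" and cl: "f (2 * l) = f 0" using True by (auto simp: good_def)
      have "pk (a - 0) (f (2 * l - 0)) (f (2 * l - a)) \<le> B * E ^ (q - (a - 0)) * pk q (f (2 * l - 0)) (f (2 * l - q))"
        by (rule conjunct1[OF gw[unfolded gw_def], rule_format]) (use a in simp)
      then have "Q f = 1" using a(3) True cl M_l by (simp add: Q_def)
      moreover have "\<forall>c'<q. R f c' (f (2 * l - c')) (f (2 * l - Suc c'))"
        using True a(3) by (auto simp: R_def)
      ultimately show ?thesis using True by (simp add: F_Fp)
    next
      case False
      then show ?thesis using Fp_nonneg[OF f] by (auto simp: Q_def)
    qed
  qed
  also have "\<dots> \<le> (\<Sum>f\<in>Wk (2 * l - q). Fp (2 * l - q) f * (Q f * (AA (R f) (f 0) q (f (2 * l - q)) / pk q (f 0) (f (2 * l - q)))))"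
  proof (rule tail_sum)
    show "Q (f(k := y)) = Q f" if "2 * l - q < k" for f k y
      using that M_l i by (simp add: Q_def)
    show "R (f(k := y)) = R f" if "M < k" for f k y
      using that i by (simp add: R_def)
  qed (auto simp: Q_def)
  also have "2 * l - q = M" using M_l by simp
  also have "(\<Sum>f\<in>Wk M. Fp M f * (Q f * (AA (R f) (f 0) q (f M) / pk q (f 0) (f M)))) \<le> (\<Sum>f\<in>Wk M. Fp M f * (B * D / E))"
  proof (intro sum_mono mult_left_mono Fp_nonneg)
    fix f assume f: "f \<in> Wk M"
    have fX: "f 0 \<in> X" "f M \<in> X" "f i \<in> X" using f i by (auto intro: Wk_in)
    have BDE: "B * D / E \<ge> 0" using B1 D1 E0 by simp
    show "Q f * (AA (R f) (f 0) q (f M) / pk q (f 0) (f M)) \<le> B * D / E"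
    proof (cases "Q f = 1 \<and> pk q (f 0) (f M) \<noteq> 0")
      case True
      then have pos: "pk q (f 0) (f M) > 0" using pk_nonneg[OF fX(1,2), of q] by linarith
      have le: "pk a (f 0) (f i) \<le> B * E ^ (q - a) * pk q (f 0) (f M)"
        using True by (simp add: Q_def split: if_splits)
      have "AA (R f) (f 0) (a + (q - a)) (f M) \<le> pk a (f 0) (f i) * pk (q - a) (f i) (f M)"
        by (rule AA_pin[OF a(1) fX(1,3) _ fX(2)]) (simp add: R_def)
      also have "\<dots> \<le> (B * E ^ (q - a) * pk q (f 0) (f M)) * (D / E ^ l)"
        using le fX a pk_le[of "f i" "f M" "q - a"] pk_nonneg B1 E0 pos
        by (intro mult_mono) auto
      finally have "AA (R f) (f 0) q (f M) / pk q (f 0) (f M) \<le> B * E ^ (q - a) * (D / E ^ l)"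
        using pos a(2) by (simp add: divide_le_eq mult_ac)
      also have "\<dots> = B * D * (E ^ (q - a) / E ^ l)" by simp
      also have "\<dots> \<le> B * D * (1 / E)"
      proof (intro mult_left_mono)
        have "E * E ^ (q - a) = E ^ (Suc (q - a))" by simp
        also have "\<dots> \<le> E ^ l" using E1 a lqh by (intro power_increasing) auto
        finally show "E ^ (q - a) / E ^ l \<le> 1 / E" using E0 by (simp add: field_simps)
      qed (use B1 D1 in auto)
      finally show ?thesis using True by simp
    next
      case False
      then show ?thesis using BDE by (auto simp: Q_def)
    qed
  qed
  also have "\<dots> = (\<Sum>f\<in>Wk M. Fp M f) * (B * D / E)" by (rule sum_distrib_right[symmetric])
  also have "\<dots> \<le> 1 * (B * D / E)" using Fp_total[of M] M_l B1 D1 E0 by (intro mult_right_mono) auto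
  finally show ?thesis by simp
qed

lemma coll_refl: assumes "i \<le> 2 * l" "j \<le> 2 * l" shows "coll i j = coll (2 * l - j) (2 * l - i)"
  unfolding coll_def
proof (rule sum.reindex_bij_witness[where i = rv and j = rv])
  fix f assume f: "f \<in> Wk (2 * l)"
  show "rv (rv f) = f" "rv (rv f) = f" using rv_rv[OF f] by auto
  show "rv f \<in> Wk (2 * l)" "rv f \<in> Wk (2 * l)" using rv_Wk[OF f] by auto
  have "good (rv f) \<longleftrightarrow> good f" using good_rv[of f] good_rv[of "rv f"] rv_rv[OF f] by auto
  moreover have "rv f (2 * l - j) = f j" "rv f (2 * l - i) = f i" using assms by (auto simp: rv_def)
  ultimately show "(if good (rv f) \<and> rv f (2 * l - j) = rv f (2 * l - i) then F (rv f) else 0)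
     = (if good f \<and> f i = f j then F f else 0)"
    by (auto simp: F_rv)
qed

lemma coll_end: "coll i 0 = coll i (2 * l)" "coll j (2 * l) = coll 0 j"
  unfolding coll_def by (intro sum.cong refl; auto simp: good_def)+

text \<open>Reversal turns pairs with \<open>q \<le> i\<close> into pairs before the falling arm.
  For i = 0 it yields the end position \<open>2 * l\<close>, which coincides with position
  0.\<close>

lemma coll_bound: assumes "i < j" "j < 2 * l" shows "coll i j \<le> B * D / E"
proof -
  consider "j \<le> M" | "M < j" "q \<le> i" | "M < j" "1 \<le> i" "i < q" | "M < j" "i = 0" by linarith
  then show ?thesis
  proof cases
    case 1
    then show ?thesis using coll_prefix assms by blast
  next
    case 2
    then have "coll (2 * l - j) (2 * l - i) \<le> B * D / E"
      using assms M_l by (intro coll_prefix) auto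
    then show ?thesis using coll_refl[of i j] assms by simp
  next
    case 3
    then show ?thesis using coll_tail assms by blast
  next
    case 4
    then have "coll i j = coll (2 * l - j) (2 * l)" using coll_refl[of i j] assms by simp
    also have "\<dots> = coll 0 (2 * l - j)" by (rule coll_end)
    also have "\<dots> \<le> B * D / E" using 4 assms M_l by (intro coll_prefix) auto
    finally show ?thesis .
  qed
qed

end

text \<open>As long as some index is hit with total weight below its threshold, remove everything
  that hits it. Afterwards this index is never hit again, so each threshold is paid at most once.
  The same cleaning is applied to edges, to pairs of vertices and to the last steps of good
  walks.\<close>

lemma cleaning_aux:
  fixes wgt :: "'e \<Rightarrow> real" and thr :: "'t \<Rightarrow> real"
  assumes "finite A" "finite I" "\<forall>t\<in>I. thr t \<ge> 0"
  shows "\<exists>A'\<subseteq>A. (\<forall>t\<in>I. (\<exists>e\<in>A'. hit e t) \<longrightarrow> thr t \<le> (\<Sum>e | e \<in> A' \<and> hit e t. wgt e)) \<and>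
    (\<Sum>e\<in>A. wgt e) - (\<Sum>t | t \<in> I \<and> (\<exists>e\<in>A. hit e t). thr t) \<le> (\<Sum>e\<in>A'. wgt e)"
  using assms(1)
proof (induction "card {t \<in> I. \<exists>e\<in>A. hit e t}" arbitrary: A rule: less_induct)
  case (less A)
  let ?T = "\<lambda>A. {t \<in> I. \<exists>e\<in>A. hit e t}"
  show ?case
  proof (cases "\<forall>t\<in>I. (\<exists>e\<in>A. hit e t) \<longrightarrow> thr t \<le> (\<Sum>e | e \<in> A \<and> hit e t. wgt e)")
    case True
    moreover have "0 \<le> (\<Sum>t\<in>?T A. thr t)" using assms(3) by (intro sum_nonneg) auto
    ultimately show ?thesis by (intro exI[of _ A]) auto
  next
    case False
    then obtain t where t: "t \<in> I" "\<exists>e\<in>A. hit e t" "(\<Sum>e | e \<in> A \<and> hit e t. wgt e) < thr t" by (auto simp: not_le)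
    define A1 where "A1 = {e \<in> A. \<not> hit e t}"
    have sub: "?T A1 \<subseteq> ?T A - {t}" unfolding A1_def by auto
    have tT: "t \<in> ?T A" using t by auto
    have fT: "finite (?T A)" using assms(2) by simp
    have "card (?T A1) \<le> card (?T A - {t})" using sub fT by (intro card_mono) auto
    also have "\<dots> < card (?T A)" using tT fT by (intro psubset_card_mono) auto
    finally have lt: "card (?T A1) < card (?T A)" .
    have "finite A1" using less.prems by (simp add: A1_def)
    from less.hyps[OF lt this] obtain A' where A': "A' \<subseteq> A1"
      "\<forall>t\<in>I. (\<exists>e\<in>A'. hit e t) \<longrightarrow> thr t \<le> (\<Sum>e | e \<in> A' \<and> hit e t. wgt e)"
      "(\<Sum>e\<in>A1. wgt e) - (\<Sum>t\<in>?T A1. thr t) \<le> (\<Sum>e\<in>A'. wgt e)" by auto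
    have "A - {e \<in> A. hit e t} = A1" by (auto simp: A1_def)
    then have "(\<Sum>e\<in>A. wgt e) = (\<Sum>e | e \<in> A \<and> hit e t. wgt e) + (\<Sum>e\<in>A1. wgt e)"
      using sum.subset_diff[of "{e \<in> A. hit e t}" A wgt] less.prems by auto
    moreover have "(\<Sum>t\<in>?T A1. thr t) + thr t \<le> (\<Sum>t\<in>?T A. thr t)"
    proof -
      have "(\<Sum>t\<in>?T A1. thr t) \<le> (\<Sum>t\<in>?T A - {t}. thr t)"
        using sub fT assms(3) by (intro sum_mono2) auto
      moreover have "(\<Sum>t\<in>?T A. thr t) = thr t + (\<Sum>t\<in>?T A - {t}. thr t)"
        using fT tT by (rule sum.remove)
      ultimately show ?thesis by simp
    qed
    ultimately have "(\<Sum>e\<in>A. wgt e) - (\<Sum>t\<in>?T A. thr t) \<le> (\<Sum>e\<in>A'. wgt e)" using A'(3) t(3) by linarith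
    then show ?thesis using A'(1,2) unfolding A1_def by (intro exI[of _ A']) auto
  qed
qed

lemma cleaning:
  fixes wgt :: "'e \<Rightarrow> real" and thr :: "'t \<Rightarrow> real"
  assumes "finite A" "finite I" "\<forall>t\<in>I. thr t \<ge> 0"
  obtains A' where "A' \<subseteq> A" "\<And>t. t \<in> I \<Longrightarrow> \<exists>e\<in>A'. hit e t \<Longrightarrow> thr t \<le> (\<Sum>e | e \<in> A' \<and> hit e t. wgt e)"
    "(\<Sum>e\<in>A. wgt e) - (\<Sum>t\<in>I. thr t) \<le> (\<Sum>e\<in>A'. wgt e)"
proof -
  have "(\<Sum>t | t \<in> I \<and> (\<exists>e\<in>A. hit e t). thr t) \<le> (\<Sum>t\<in>I. thr t)"
    using assms(2,3) by (intro sum_mono2) auto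
  moreover obtain A' where "A' \<subseteq> A" "\<forall>t\<in>I. (\<exists>e\<in>A'. hit e t) \<longrightarrow> thr t \<le> (\<Sum>e | e \<in> A' \<and> hit e t. wgt e)"
    "(\<Sum>e\<in>A. wgt e) - (\<Sum>t | t \<in> I \<and> (\<exists>e\<in>A. hit e t). thr t) \<le> (\<Sum>e\<in>A'. wgt e)"
    using cleaning_aux[where A = A and I = I and hit = hit and wgt = wgt and thr = thr, OF assms] by (elim exE conjE) (rule that)
  ultimately show ?thesis using that[of A'] by auto
qed

lemma sum_PiE_split:
  fixes G :: "(nat \<Rightarrow> 'a) \<Rightarrow> 'b::comm_monoid_add"
  shows "(\<Sum>f\<in>{..<m + c} \<rightarrow>\<^sub>E X. G f) =
    (\<Sum>g\<in>{..<m} \<rightarrow>\<^sub>E X. \<Sum>t\<in>{..<c} \<rightarrow>\<^sub>E X. G (\<lambda>i. if i < m then g i else t (i - m)))"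
proof -
  have "(\<Sum>f\<in>{..<m + c} \<rightarrow>\<^sub>E X. G f) =
    (\<Sum>(g, t)\<in>({..<m} \<rightarrow>\<^sub>E X) \<times> ({..<c} \<rightarrow>\<^sub>E X). G (\<lambda>i. if i < m then g i else t (i - m)))"
  proof (rule sum.reindex_bij_witness[where i = "\<lambda>(g, t) i. if i < m then g i else t (i - m)"
        and j = "\<lambda>f. (restrict f {..<m}, \<lambda>i. f (m + i))"])
    fix f assume f: "f \<in> {..<m + c} \<rightarrow>\<^sub>E X"
    have eq: "(\<lambda>i. if i < m then restrict f {..<m} i else f (m + (i - m))) = f"
      by (rule ext) simp
    show "(case (restrict f {..<m}, \<lambda>i. f (m + i)) of (g, t) \<Rightarrow> \<lambda>i. if i < m then g i else t (i - m)) = f"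
      using eq by simp
    show "(restrict f {..<m}, \<lambda>i. f (m + i)) \<in> ({..<m} \<rightarrow>\<^sub>E X) \<times> ({..<c} \<rightarrow>\<^sub>E X)"
      using f by (auto simp: PiE_iff extensional_def)
    show "(case (restrict f {..<m}, \<lambda>i. f (m + i)) of (g, t) \<Rightarrow> G (\<lambda>i. if i < m then g i else t (i - m))) = G f"
      using eq by simp
  next
    fix b assume "b \<in> ({..<m} \<rightarrow>\<^sub>E X) \<times> ({..<c} \<rightarrow>\<^sub>E X)"
    then obtain g t where b: "b = (g, t)" "g \<in> {..<m} \<rightarrow>\<^sub>E X" "t \<in> {..<c} \<rightarrow>\<^sub>E X" by blast
    have "restrict (\<lambda>i. if i < m then g i else t (i - m)) {..<m} = g"
      using b(2) by (intro ext) (auto simp: PiE_iff extensional_def restrict_def)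
    then show "(restrict (case b of (g, t) \<Rightarrow> \<lambda>i. if i < m then g i else t (i - m)) {..<m},
        \<lambda>i. (case b of (g, t) \<Rightarrow> \<lambda>i. if i < m then g i else t (i - m)) (m + i)) = b"
      using b(1) by simp
    show "(case b of (g, t) \<Rightarrow> \<lambda>i. if i < m then g i else t (i - m)) \<in> {..<m + c} \<rightarrow>\<^sub>E X"
      using b by (auto simp: PiE_iff extensional_def)
  qed
  then show ?thesis by (simp add: sum.cartesian_product)
qed

lemma sum_PiE_rev:
  fixes G :: "(nat \<Rightarrow> 'a) \<Rightarrow> 'b::comm_monoid_add"
  shows "(\<Sum>t\<in>{..<c} \<rightarrow>\<^sub>E X. G t) = (\<Sum>t\<in>{..<c} \<rightarrow>\<^sub>E X. G (\<lambda>i. if i < c then t (c - Suc i) else undefined))"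
  by (rule sum.reindex_bij_witness[where i = "\<lambda>t i. if i < c then t (c - Suc i) else undefined"
        and j = "\<lambda>t i. if i < c then t (c - Suc i) else undefined"])
     (auto simp: PiE_iff extensional_def fun_eq_iff Suc_diff_Suc intro!: arg_cong[of _ _ G])

section \<open>Good closed walks have constant mass\<close>

context cycle_law
begin

definition pw :: "nat \<Rightarrow> (nat \<Rightarrow> 'a) \<Rightarrow> real" where "pw m g = (\<Prod>i<m. p (g i) (g (Suc i)))"

lemma pw_nonneg: "g \<in> Wk m \<Longrightarrow> pw m g \<ge> 0"
  unfolding pw_def by (intro prod_nonneg ballI p_nonneg) (auto intro: Wk_in)

lemma pw_upd: "pw (Suc m) (g(Suc m := y)) = pw m g * p (g m) y"
proof -
  have "(\<Prod>i<m. p ((g(Suc m := y)) i) ((g(Suc m := y)) (Suc i))) = (\<Prod>i<m. p (g i) (g (Suc i)))"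
    by (intro prod.cong refl) simp
  then show ?thesis by (simp add: pw_def)
qed

lemma pw_pk:
  assumes "u \<in> X" "x \<in> X"
  shows "(\<Sum>g\<in>Wk m. pw m g * (if g 0 = u \<and> g m = x then 1 else 0)) = pk m u x"
proof -
  let ?\<phi> = "\<lambda>a b. if a = u \<and> b = x then 1 / pi u else 0"
  have "(\<Sum>g\<in>Wk m. pw m g * (if g 0 = u \<and> g m = x then 1 else 0)) = (\<Sum>g\<in>Wk m. wt m g * ?\<phi> (g 0) (g m))"
    using pi_pos[OF assms(1)] by (intro sum.cong refl) (auto simp: wt_def pw_def)
  also have "\<dots> = (\<Sum>a\<in>X. \<Sum>b\<in>X. pi a * pk m a b * ?\<phi> a b)" by (rule sum_wt_pk)
  also have "\<dots> = (\<Sum>a\<in>X. if a = u then (\<Sum>b\<in>X. if b = x then pk m u x else 0) else 0)"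
  proof (rule sum.cong[OF refl])
    fix a assume "a \<in> X"
    show "(\<Sum>b\<in>X. pi a * pk m a b * ?\<phi> a b) = (if a = u then (\<Sum>b\<in>X. if b = x then pk m u x else 0) else 0)"
    proof (cases "a = u")
      case True
      then show ?thesis using pi_pos[OF assms(1)] by (auto intro!: sum.cong)
    qed simp
  qed
  also have "\<dots> = pk m u x" using finX assms by simp
  finally show ?thesis .
qed

lemma pw_pk_last:
  assumes "u \<in> X" "y \<in> X" "z \<in> X"
  shows "(\<Sum>g\<in>Wk (Suc m). pw (Suc m) g * (if g 0 = u \<and> g m = y \<and> g (Suc m) = z then 1 else 0)) = pk m u y * p y z"
proof -
  have "(\<Sum>g\<in>Wk (Suc m). pw (Suc m) g * (if g 0 = u \<and> g m = y \<and> g (Suc m) = z then 1 else 0))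
     = (\<Sum>g\<in>Wk m. \<Sum>v\<in>X. if v = z then pw m g * (if g 0 = u \<and> g m = y then 1 else 0) * p y z else 0)"
    by (subst sum_PiE_last) (intro sum.cong refl, auto simp: pw_upd)
  also have "\<dots> = (\<Sum>g\<in>Wk m. pw m g * (if g 0 = u \<and> g m = y then 1 else 0)) * p y z"
    using finX assms(3) by (simp add: sum_distrib_right)
  finally show ?thesis using pw_pk[OF assms(1,2)] by simp
qed

lemma pk_pos:
  assumes "g \<in> Wk m" "pw m g > 0" "c \<le> m"
  shows "pk c (g 0) (g c) > 0"
  using assms(3)
proof (induction c)
  case 0
  then show ?case by simp
next
  case (Suc c)
  have X: "g 0 \<in> X" "g c \<in> X" "g (Suc c) \<in> X" using Suc assms(1) by (auto intro: Wk_in)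
  have "(\<Prod>i<m. p (g i) (g (Suc i))) \<noteq> 0" using assms(2) unfolding pw_def by linarith
  then have "\<forall>i\<in>{..<m}. p (g i) (g (Suc i)) \<noteq> 0" by (simp add: prod_zero_iff)
  then have "p (g c) (g (Suc c)) \<noteq> 0" using Suc.prems by simp
  then have "p (g c) (g (Suc c)) > 0" using p_nonneg[OF X(2,3)] by simp
  then have "0 < pk c (g 0) (g c) * p (g c) (g (Suc c))" using Suc by simp
  also have "\<dots> \<le> pk (Suc c) (g 0) (g (Suc c))"
    unfolding pk.simps using finX X
    by (intro member_le_sum[where f = "\<lambda>z. pk c (g 0) z * p z (g (Suc c))"]) (auto intro!: mult_nonneg_nonneg pk_nonneg p_nonneg)
  finally show ?case .
qed

lemma Fp_first:
  assumes "g \<in> Wk q" "pw q g > 0"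
  shows "Fp q g = pi (g 0) * pw q g"
proof -
  have "(\<Prod>i<q. K (g 0) i (g i) (g (Suc i))) = (\<Prod>i<q. p (g i) (g (Suc i)))"
  proof (intro prod.cong refl)
    fix i assume i: "i \<in> {..<q}"
    then have "pk i (g 0) (g i) > 0" using pk_pos[OF assms, of i] by simp
    then show "K (g 0) i (g i) (g (Suc i)) = p (g i) (g (Suc i))"
      using i by (simp add: K_def om_def lam_first)
  qed
  then show ?thesis by (simp add: Fp_def pw_def)
qed

text \<open>Along the falling arm the quotients of level laws telescope: read from the start vertex,
  the arm is an ordinary walk conditioned on its end.\<close>

lemma Fp_last:
  assumes y: "y \<in> Wk q" "y 0 = u" "pw q y > 0" and f: "\<And>c. c \<le> q \<Longrightarrow> f (2 * l - c) = y c" "f 0 = u"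
  shows "Fp (2 * l) f = Fp M f * (pw q y / pk q u (y q))"
proof -
  have pos: "pk c u (y c) > 0" if "c \<le> q" for c using pk_pos[OF y(1,3) that] y(2) by simp
  have "(\<Prod>i<2 * l. K u i (f i) (f (Suc i))) = (\<Prod>i<M. K u i (f i) (f (Suc i))) * (\<Prod>i=M..<2 * l. K u i (f i) (f (Suc i)))"
    using prod.atLeastLessThan_concat[of 0 M "2 * l" "\<lambda>i. K u i (f i) (f (Suc i))"] M_l by (simp add: atLeast0LessThan)
  moreover have "(\<Prod>i=M..<2 * l. K u i (f i) (f (Suc i))) = (\<Prod>c<q. K u (2 * l - Suc c) (f (2 * l - Suc c)) (f (Suc (2 * l - Suc c))))"
    by (rule prod.reindex_bij_witness[where i = "\<lambda>c. 2 * l - Suc c" and j = "\<lambda>i. 2 * l - Suc i"]) (use M_l q2 in auto)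
  moreover have "(\<Prod>c<q. K u (2 * l - Suc c) (f (2 * l - Suc c)) (f (Suc (2 * l - Suc c)))) = (\<Prod>c<q. p (y c) (y (Suc c)) * (pk c u (y c) / pk (Suc c) u (y (Suc c))))"
  proof (intro prod.cong refl)
    fix c assume "c \<in> {..<q}"
    then have c: "c < q" by simp
    have S: "Suc (2 * l - Suc c) = 2 * l - c" using c M_l by simp
    have lm: "lam (2 * l - Suc c) = Suc c" "lam (2 * l - c) = c"
      using c M_l lam_rev[of "Suc c"] lam_rev[of c] lam_first by auto
    show "K u (2 * l - Suc c) (f (2 * l - Suc c)) (f (Suc (2 * l - Suc c))) = p (y c) (y (Suc c)) * (pk c u (y c) / pk (Suc c) u (y (Suc c)))"
      unfolding S K_def om_def lm using f(1)[of c] f(1)[of "Suc c"] c by (simp del: pk.simps)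
  qed
  moreover have "(\<Prod>c<q. p (y c) (y (Suc c)) * (pk c u (y c) / pk (Suc c) u (y (Suc c)))) = pw q y * (pk 0 u (y 0) / pk q u (y q))"
  proof -
    have "(\<Prod>c<k. pk c u (y c) / pk (Suc c) u (y (Suc c))) = pk 0 u (y 0) / pk k u (y k)" if "k \<le> q" for k
      using that
    proof (induction k)
      case 0
      then show ?case using y(2) by simp
    next
      case (Suc k)
      then show ?case using pos[of k] by (simp del: pk.simps)
    qed
    then show ?thesis unfolding prod.distrib pw_def by simp
  qed
  ultimately show ?thesis using f(2) y(2) by (simp add: Fp_def)
qed


text \<open>The part of the joint law \<open>pk (q - 1) u y * p y z\<close> of the last pair that is
  contributed by good walks from \<open>u\<close>.\<close>

definition om_good :: "'a \<Rightarrow> 'a \<times> 'a \<Rightarrow> real" where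
  "om_good u e = (\<Sum>g\<in>Wk q. pw q g * (if g 0 = u \<and> gw q g \<and> (g (q - 1), g q) = e then 1 else 0))"

lemma Suc_q: "Suc (q - 1) = q" using q2 by simp

lemma om_good_le:
  assumes "u \<in> X" "y \<in> X" "z \<in> X"
  shows "om_good u (y, z) \<le> pk (q - 1) u y * p y z"
proof -
  have "om_good u (y, z) \<le> (\<Sum>g\<in>Wk (Suc (q - 1)). pw (Suc (q - 1)) g * (if g 0 = u \<and> g (q - 1) = y \<and> g (Suc (q - 1)) = z then 1 else 0))"
    unfolding om_good_def Suc_q using pw_nonneg by (intro sum_mono mult_left_mono) auto
  then show ?thesis using pw_pk_last[OF assms, of "q - 1"] by simp
qed

lemma om_good_nonneg: "om_good u e \<ge> 0"
  unfolding om_good_def using pw_nonneg by (intro sum_nonneg) auto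

lemma om_good_witness:
  assumes "om_good u (y, z) > 0"
  obtains g where "g \<in> Wk q" "pw q g > 0" "g 0 = u" "gw q g" "g (q - 1) = y" "g q = z"
proof -
  have "\<exists>g\<in>Wk q. pw q g * (if g 0 = u \<and> gw q g \<and> (g (q - 1), g q) = (y, z) then 1 else 0) \<noteq> 0"
  proof (rule ccontr)
    assume "\<not> ?thesis"
    then have "om_good u (y, z) = 0" unfolding om_good_def by (intro sum.neutral) blast
    then show False using assms by simp
  qed
  then obtain g where g: "g \<in> Wk q" "pw q g \<noteq> 0" "g 0 = u \<and> gw q g \<and> (g (q - 1), g q) = (y, z)"
    by (auto split: if_splits)
  then show ?thesis using that[of g] pw_nonneg[of g q] by auto
qed

text \<open>For a fixed start \<open>u\<close> the last edges of the good walks are cleaned so that every remaining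
  vertex keeps a fixed proportion of its weight; the zigzag may then be continued inside the
  cleaned set.\<close>

lemma mass_at:
  assumes u: "u \<in> X" and \<rho>: "0 < \<rho>" "\<rho> \<le> 1"
    and lower: "\<rho> / 2 \<le> (\<Sum>g\<in>Wk q. pw q g * (if g 0 = u \<and> gw q g then 1 else 0))"
  shows "pi u * (\<rho> / 8) ^ (2 * h + 2) \<le> (\<Sum>f\<in>Wk (2 * l). if f 0 = u \<and> good f then F f else 0)"
proof -
  \<comment> \<open>The thresholds at the two levels add up to \<open>2 * \<eta>\<close>, while the
    good walks have mass at least \<open>\<rho> / 2 = 4 * \<eta>\<close>; cleaning therefore leaves
    at least \<open>2 * \<eta>\<close>.\<close>
  define \<eta> where "\<eta> = \<rho> / 8"
  have \<eta>: "\<eta> > 0" "\<eta> \<le> 1" using \<rho> by (auto simp: \<eta>_def)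
  define A where "A = {e \<in> X \<times> X. om_good u e > 0}"
  have fA: "finite A" using finX by (simp add: A_def)
  define thr where "thr t = (case t of Inl y \<Rightarrow> \<eta> * pk (q - 1) u y | Inr z \<Rightarrow> \<eta> * pk q u z)" for t :: "'a + 'a"
  define hit where "hit e t = (case t of Inl y \<Rightarrow> fst e = y | Inr z \<Rightarrow> snd e = z)" for e :: "'a \<times> 'a" and t :: "'a + 'a"
  have finI: "finite (X <+> X)" using finX by simp
  have thr0: "\<forall>t\<in>X <+> X. thr t \<ge> 0"
    using u \<eta> pk_nonneg by (auto simp: thr_def)
  obtain A' where A': "A' \<subseteq> A"
      and keep: "\<And>t. t \<in> X <+> X \<Longrightarrow> \<exists>e\<in>A'. hit e t \<Longrightarrow> thr t \<le> (\<Sum>e | e \<in> A' \<and> hit e t. om_good u e)"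
      and tot': "(\<Sum>e\<in>A. om_good u e) - (\<Sum>t\<in>X <+> X. thr t) \<le> (\<Sum>e\<in>A'. om_good u e)"
    by (rule cleaning[where A = A and I = "X <+> X" and thr = thr and hit = hit and wgt = "om_good u", OF fA finI thr0], rule that)
  have fA': "finite A'" using A' fA finite_subset by blast
  have A'X: "fst e \<in> X" "snd e \<in> X" "om_good u e > 0" if "e \<in> A'" for e using that A' by (auto simp: A_def)
  have keepY: "\<eta> * pk (q - 1) u y \<le> (\<Sum>e | e \<in> A' \<and> fst e = y. om_good u e)" if "(y, z) \<in> A'" for y z
  proof -
    have "Inl y \<in> X <+> X" "hit (y, z) (Inl y)" using A'X[OF that] by (auto simp: hit_def)
    then have "thr (Inl y) \<le> (\<Sum>e | e \<in> A' \<and> hit e (Inl y). om_good u e)" using keep that by blast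
    then show ?thesis by (simp add: thr_def hit_def)
  qed
  have keepZ: "\<eta> * pk q u z \<le> (\<Sum>e | e \<in> A' \<and> snd e = z. om_good u e)" if "(y, z) \<in> A'" for y z
  proof -
    have "Inr z \<in> X <+> X" "hit (y, z) (Inr z)" using A'X[OF that] by (auto simp: hit_def)
    then have "thr (Inr z) \<le> (\<Sum>e | e \<in> A' \<and> hit e (Inr z). om_good u e)" using keep that by blast
    then show ?thesis by (simp add: thr_def hit_def)
  qed
  have sum_om: "(\<Sum>e\<in>T. om_good u e) = (\<Sum>g\<in>Wk q. pw q g * (if g 0 = u \<and> gw q g \<and> (g (q - 1), g q) \<in> T then 1 else 0))"
    if "finite T" for T
  proof -
    have "(\<Sum>e\<in>T. om_good u e) = (\<Sum>g\<in>Wk q. \<Sum>e\<in>T. if e = (g (q - 1), g q) then pw q g * (if g 0 = u \<and> gw q g then 1 else 0) else 0)"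
      unfolding om_good_def by (subst sum.swap) (intro sum.cong refl, auto)
    also have "\<dots> = (\<Sum>g\<in>Wk q. pw q g * (if g 0 = u \<and> gw q g \<and> (g (q - 1), g q) \<in> T then 1 else 0))"
      using that by (intro sum.cong refl) auto
    finally show ?thesis .
  qed
  have total: "(\<Sum>e\<in>A'. om_good u e) \<ge> 2 * \<eta>"
  proof -
    have "(\<Sum>t\<in>X <+> X. thr t) = (\<Sum>y\<in>X. \<eta> * pk (q - 1) u y) + (\<Sum>z\<in>X. \<eta> * pk q u z)"
      using finX by (simp add: sum.Plus thr_def)
    also have "\<dots> = 2 * \<eta>" using u by (simp add: sum_distrib_left[symmetric] pk_sum)
    finally have t2: "(\<Sum>t\<in>X <+> X. thr t) = 2 * \<eta>" .
    have "(\<Sum>e\<in>A. om_good u e) = (\<Sum>e\<in>X \<times> X. om_good u e)"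
      using finX om_good_nonneg by (intro sum.mono_neutral_left) (auto simp: A_def order_less_le)
    also have "\<dots> = (\<Sum>g\<in>Wk q. pw q g * (if g 0 = u \<and> gw q g then 1 else 0))"
      unfolding sum_om[OF finite_cartesian_product[OF finX finX]]
      by (intro sum.cong refl) (auto intro: Wk_in)
    finally show ?thesis using tot' lower t2 by (simp add: \<eta>_def)
  qed
  define ed where "ed i x y = (if lam i < lam (Suc i) then (x, y) else (y, x))" for i and x y :: 'a
  define I where "I m f \<longleftrightarrow> f 0 = u \<and> gw q f \<and> (f (q - 1), f q) \<in> A' \<and> (\<forall>i. q \<le> i \<and> i < m \<longrightarrow> ed i (f i) (f (Suc i)) \<in> A')" for m f
  define ind where "ind m f = (if I m f then 1 else 0 :: real)" for m f
  \<comment> \<open>The current vertex of the zigzag is always an end of a cleaned pair, on the side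
    that fits its level. This is what makes \<open>keepY\<close> or \<open>keepZ\<close> applicable
    to the next step.\<close>
  have side: "(\<exists>y. (y, f m) \<in> A') \<and> lam m = q \<and> (m < M \<longrightarrow> \<not> lam m < lam (Suc m)) \<or>
      (\<exists>z. (f m, z) \<in> A') \<and> lam m = q - 1 \<and> lam m < lam (Suc m)"
    if m: "q \<le> m" "m \<le> M" and If: "I m f" for m f
  proof -
    define j where "j = m - q"
    have j: "m = q + j" "j \<le> 2 * h" using m by (auto simp: j_def)
    have prev: "(\<exists>y. (y, f m) \<in> A')" if ev: "even j"
    proof (cases "j = 0")
      case True
      then show ?thesis using If j by (auto simp: I_def)
    next
      case False
      then have "lam (m - 1) = q - 1" "lam m = q" using j ev lam_mid[of "j - 1"] lam_mid[of j] by auto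
      moreover have "Suc (m - 1) = m" using m q2 by simp
      moreover have "q \<le> m - 1 \<and> m - 1 < m" using False j by auto
      ultimately have "ed (m - 1) (f (m - 1)) (f m) \<in> A'" "lam (m - 1) < lam (Suc (m - 1))" using If q2 unfolding I_def by (metis, simp)
      then show ?thesis using \<open>Suc (m - 1) = m\<close> by (auto simp: ed_def)
    qed
    have prev': "(\<exists>z. (f m, z) \<in> A')" if od: "odd j"
    proof -
      have jp: "j > 0" using od by (cases j) auto
      then have "lam (m - 1) = q" "lam m = q - 1" using j od lam_mid[of "j - 1"] lam_mid[of j] by auto
      moreover have "Suc (m - 1) = m" using m q2 by simp
      moreover have "q \<le> m - 1 \<and> m - 1 < m" using jp j by auto
      ultimately have "ed (m - 1) (f (m - 1)) (f m) \<in> A'" "\<not> lam (m - 1) < lam (Suc (m - 1))" using If unfolding I_def by (metis, simp)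
      then show ?thesis using \<open>Suc (m - 1) = m\<close> by (auto simp: ed_def)
    qed
    show ?thesis
    proof (cases "even j")
      case True
      then have "lam m = q" using lam_mid[of j] j by simp
      moreover have "\<not> lam m < lam (Suc m)" if "m < M" using lam_mid[of "Suc j"] that j True \<open>lam m = q\<close> by simp
      ultimately show ?thesis using prev[OF True] by blast
    next
      case False
      then have "j < 2 * h" using j by (metis dvd_triv_left le_neq_implies_less)
      then have "lam m = q - 1" "lam (Suc m) = q" using lam_mid[of j] lam_mid[of "Suc j"] j False by auto
      then show ?thesis using prev'[OF False] q2 by auto
    qed
  qed
  have pkpos: "pk (q - 1) u y > 0 \<and> pk q u z > 0" if yz: "(y, z) \<in> A'" for y z
  proof -
    obtain g where g: "g \<in> Wk q" "pw q g > 0" "g 0 = u" "g (q - 1) = y" "g q = z"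
      using om_good_witness[of u y z] A'X(3)[OF yz] by blast
    show ?thesis using pk_pos[OF g(1,2), of "q - 1"] pk_pos[OF g(1,2), of q] g by simp
  qed
  have om_le: "om_good u (y, z) \<le> pk (q - 1) u y * p y z" if "(y, z) \<in> A'" for y z
    using om_good_le[OF u] A'X[OF that] by simp
  \<comment> \<open>The cleaned pairs at the current vertex keep at least the share
    \<open>\<eta>\<close> of its level law, and \<open>om_good\<close> is at most the joint law of
    the step. Division by the level law shows that the step stays among the cleaned pairs with
    probability at least \<open>\<eta>\<close>.\<close>
  have row: "\<eta> \<le> (\<Sum>y\<in>X. K u m (f m) y * (if ed m (f m) y \<in> A' then 1 else 0))"
    if m: "q \<le> m" "m < M" and If: "I m f" and f: "f \<in> Wk m" for m f
  proof -
    have fm: "f m \<in> X" using f by (rule Wk_in) simp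
    from side[OF m(1) less_imp_le[OF m(2)] If] m(2)
    consider (down) y0 where "(y0, f m) \<in> A'" "lam m = q" "\<not> lam m < lam (Suc m)"
      | (up) z0 where "(f m, z0) \<in> A'" "lam m = q - 1" "lam m < lam (Suc m)" by blast
    then show ?thesis
    proof cases
      case down
      have lS: "lam (Suc m) = q - 1" using down_level[OF m down(3)] by simp
      have pos: "pk q u (f m) > 0" using pkpos[OF down(1)] by simp
      have "\<eta> * pk q u (f m) \<le> (\<Sum>e | e \<in> A' \<and> snd e = f m. om_good u e)" by (rule keepZ[OF down(1)])
      also have "\<dots> = (\<Sum>y | y \<in> X \<and> (y, f m) \<in> A'. om_good u (y, f m))"
        by (rule sum.reindex_bij_witness[where i = "\<lambda>y. (y, f m)" and j = fst]) (use A'X in auto)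
      also have "\<dots> \<le> (\<Sum>y | y \<in> X \<and> (y, f m) \<in> A'. pk (q - 1) u y * p y (f m))"
        using om_le by (intro sum_mono) auto
      also have "\<dots> = (\<Sum>y\<in>X. pk (q - 1) u y * p y (f m) * (if (y, f m) \<in> A' then 1 else 0))"
        using finX by (subst sum.inter_filter) (auto intro!: sum.cong)
      also have "\<dots> = (\<Sum>y\<in>X. K u m (f m) y * (if ed m (f m) y \<in> A' then 1 else 0)) * pk q u (f m)"
        unfolding sum_distrib_right
        using pos down lS by (intro sum.cong refl) (simp add: K_def om_def ed_def)
      finally show ?thesis using pos by simp
    next
      case up
      have pos: "pk (q - 1) u (f m) > 0" using pkpos[OF up(1)] by simp
      have "\<eta> * pk (q - 1) u (f m) \<le> (\<Sum>e | e \<in> A' \<and> fst e = f m. om_good u e)" by (rule keepY[OF up(1)])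
      also have "\<dots> = (\<Sum>z | z \<in> X \<and> (f m, z) \<in> A'. om_good u (f m, z))"
        by (rule sum.reindex_bij_witness[where i = "\<lambda>z. (f m, z)" and j = snd]) (use A'X in auto)
      also have "\<dots> \<le> (\<Sum>z | z \<in> X \<and> (f m, z) \<in> A'. pk (q - 1) u (f m) * p (f m) z)"
        using om_le by (intro sum_mono) auto
      also have "\<dots> = (\<Sum>z\<in>X. pk (q - 1) u (f m) * p (f m) z * (if (f m, z) \<in> A' then 1 else 0))"
        using finX by (subst sum.inter_filter) (auto intro!: sum.cong)
      also have "\<dots> = (\<Sum>z\<in>X. K u m (f m) z * (if ed m (f m) z \<in> A' then 1 else 0)) * pk (q - 1) u (f m)"
        unfolding sum_distrib_right
        using pos up by (intro sum.cong refl) (simp add: K_def om_def ed_def)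
      finally show ?thesis using pos by simp
    qed
  qed
  have ind_upd: "ind (Suc m) (f(Suc m := y)) = ind m f * (if ed m (f m) y \<in> A' then 1 else 0)" if "q \<le> m" for m f y
  proof -
    let ?g = "f(Suc m := y)"
    have "gw q ?g \<longleftrightarrow> gw q f" by (rule gw_cong) (use that in auto)
    moreover have "(?g (q - 1), ?g q) = (f (q - 1), f q)" using that by auto
    moreover have "(\<forall>i. q \<le> i \<and> i < m \<longrightarrow> ed i (?g i) (?g (Suc i)) \<in> A') \<longleftrightarrow> (\<forall>i. q \<le> i \<and> i < m \<longrightarrow> ed i (f i) (f (Suc i)) \<in> A')"
      by (intro all_cong1 imp_cong refl) auto
    moreover have "(\<forall>i. q \<le> i \<and> i < Suc m \<longrightarrow> ed i (?g i) (?g (Suc i)) \<in> A') \<longleftrightarrow>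
        (\<forall>i. q \<le> i \<and> i < m \<longrightarrow> ed i (?g i) (?g (Suc i)) \<in> A') \<and> ed m (?g m) (?g (Suc m)) \<in> A'"
      unfolding less_Suc_eq using that by blast
    ultimately have "I (Suc m) ?g \<longleftrightarrow> I m f \<and> ed m (f m) y \<in> A'" unfolding I_def by simp
    then show ?thesis by (simp add: ind_def)
  qed
  have zig: "pi u * (2 * \<eta>) * \<eta> ^ (m - q) \<le> (\<Sum>f\<in>Wk m. Fp m f * ind m f)" if "q \<le> m" "m \<le> M" for m
    using that
  proof (induction m rule: dec_induct)
    case base
    have "pi u * (2 * \<eta>) \<le> pi u * (\<Sum>e\<in>A'. om_good u e)"
      using total pi_pos[OF u] by (intro mult_left_mono) auto
    also have "\<dots> = (\<Sum>g\<in>Wk q. pi u * (pw q g * (if g 0 = u \<and> gw q g \<and> (g (q - 1), g q) \<in> A' then 1 else 0)))"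
      unfolding sum_om[OF fA'] by (rule sum_distrib_left)
    also have "\<dots> \<le> (\<Sum>f\<in>Wk q. Fp q f * ind q f)"
    proof (rule sum_mono)
      fix g assume g: "g \<in> Wk q"
      show "pi u * (pw q g * (if g 0 = u \<and> gw q g \<and> (g (q - 1), g q) \<in> A' then 1 else 0)) \<le> Fp q g * ind q g"
      proof (cases "pw q g > 0")
        case True
        then show ?thesis using Fp_first[OF g True] by (auto simp: ind_def I_def)
      next
        case False
        then have "pw q g = 0" using pw_nonneg[OF g] by simp
        then show ?thesis using Fp_nonneg[OF g] by (simp add: ind_def)
      qed
    qed
    finally show ?case by simp
  next
    case (step m)
    have "pi u * (2 * \<eta>) * \<eta> ^ (Suc m - q) = (pi u * (2 * \<eta>) * \<eta> ^ (m - q)) * \<eta>"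
      using step by (simp add: Suc_diff_le)
    also have "\<dots> \<le> (\<Sum>f\<in>Wk m. Fp m f * ind m f) * \<eta>" using step \<eta> by (intro mult_right_mono) auto
    also have "\<dots> = (\<Sum>f\<in>Wk m. Fp m f * (ind m f * \<eta>))" by (simp add: sum_distrib_right mult.assoc)
    also have "\<dots> \<le> (\<Sum>f\<in>Wk m. Fp m f * (\<Sum>y\<in>X. K (f 0) m (f m) y * ind (Suc m) (f(Suc m := y))))"
    proof (intro sum_mono mult_left_mono Fp_nonneg)
      fix f assume f: "f \<in> Wk m"
      show "ind m f * \<eta> \<le> (\<Sum>y\<in>X. K (f 0) m (f m) y * ind (Suc m) (f(Suc m := y)))"
      proof (cases "I m f")
        case True
        then have "f 0 = u" by (simp add: I_def)
        then show ?thesis using row[OF step(1) _ True f] step True ind_upd[of m f] by (simp add: ind_def)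
      next
        case False
        then show ?thesis using f ind_upd[of m f] step by (simp add: ind_def)
      qed
    qed
    also have "\<dots> = (\<Sum>f\<in>Wk (Suc m). Fp (Suc m) f * ind (Suc m) f)" by (rule sum_Fp_step[symmetric])
    finally show ?case .
  qed
  define glue where "glue g t = (\<lambda>i. if i < Suc M then g i else t (i - Suc M))" for g t :: "nat \<Rightarrow> 'a"
  \<comment> \<open>Every cleaned pair is the last pair of some good walk from \<open>u\<close>, and
    goodness of that walk is the inequality required by \<open>zz\<close>.\<close>
  have zzA: "zz u i x y" if "ed i x y \<in> A'" "q \<le> i" "i < M" for i x y
  proof -
    have *: "pk (q - 1) u y' \<le> B * E * pk q u z'" if yz: "(y', z') \<in> A'" for y' z'
    proof -
      obtain g where g: "g 0 = u" "gw q g" "g (q - 1) = y'" "g q = z'"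
        using om_good_witness[of u y' z'] A'X(3)[OF yz] by blast
      have "pk (q - 1 - 0) (g 0) (g (q - 1)) \<le> B * E ^ (q - (q - 1 - 0)) * pk q (g 0) (g q)"
        by (rule conjunct1[OF g(2)[unfolded gw_def], rule_format]) (use q2 in auto)
      moreover have "q - (q - 1) = 1" using q2 by simp
      ultimately show ?thesis using g by simp
    qed
    show ?thesis using that(1) * unfolding zz_def ed_def by (auto split: if_splits)
  qed
  \<comment> \<open>The falling arm is a second good walk from \<open>u\<close> to
    \<open>f M\<close>, with its last pair among the cleaned ones. By \<open>keepZ\<close> such
    walks have at least the share \<open>\<eta>\<close> of \<open>pk q u (f M)\<close>, and by
    \<open>Fp_last\<close> this share is the conditional probability of the arm.\<close>
  have "(\<Sum>f\<in>Wk M. Fp M f * (ind M f * \<eta>)) \<le> (\<Sum>f\<in>Wk M. \<Sum>t\<in>{..<q} \<rightarrow>\<^sub>E X. if glue f t 0 = u \<and> good (glue f t) then F (glue f t) else 0)"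
  proof (rule sum_mono)
    fix f assume f: "f \<in> Wk M"
    have FW: "glue f t \<in> Wk (2 * l)" if "t \<in> {..<q} \<rightarrow>\<^sub>E X" for t
    proof -
      have "Suc (2 * l) = Suc M + q" using M_l by simp
      then show ?thesis using f that by (auto simp: glue_def PiE_iff extensional_def)
    qed
    have Fnn: "F (glue f t) \<ge> 0" if "t \<in> {..<q} \<rightarrow>\<^sub>E X" for t
      using Fp_nonneg[OF FW[OF that]] by (simp add: F_Fp)
    show "Fp M f * (ind M f * \<eta>) \<le> (\<Sum>t\<in>{..<q} \<rightarrow>\<^sub>E X. if glue f t 0 = u \<and> good (glue f t) then F (glue f t) else 0)"
    proof (cases "I M f")
      case False
      then show ?thesis using Fnn by (auto simp: ind_def intro!: sum_nonneg)
    next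
      case True
      let ?z = "f M"
      have zX: "?z \<in> X" using f by (rule Wk_in) simp
      have f0: "f 0 = u" using True by (simp add: I_def)
      have lM: "lam M = q" using lam_mid[of "2 * h"] by simp
      obtain y0 where y0: "(y0, ?z) \<in> A'"
        using side[OF _ order_refl True] lM q2 by auto
      have pos: "pk q u ?z > 0" using pkpos[OF y0] by simp
      define V where "V y = pw q (y(q := ?z)) *
        (if (y(q := ?z)) 0 = u \<and> gw q (y(q := ?z)) \<and> ((y(q := ?z)) (q - 1), ?z) \<in> A' then 1 else 0)" for y
      have tailF: "Fp M f * (V y / pk q u ?z) \<le> (if glue f t 0 = u \<and> good (glue f t) then F (glue f t) else 0)"
        if y: "y \<in> {..<q} \<rightarrow>\<^sub>E X" and t: "t = (\<lambda>i. if i < q then y (q - Suc i) else undefined)" for y t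
      proof -
        define y' where "y' = y(q := ?z)"
        have yW: "y' \<in> Wk q"
          unfolding y'_def using PiE_fun_upd[of ?z "\<lambda>_. X" q y "{..<q}"] y zX by (simp add: lessThan_Suc)
        have yq: "y' q = ?z" by (simp add: y'_def)
        have tX: "t \<in> {..<q} \<rightarrow>\<^sub>E X" unfolding t using y by (auto simp: PiE_iff extensional_def)
        have Vy: "V y = pw q y' * (if y' 0 = u \<and> gw q y' \<and> (y' (q - 1), ?z) \<in> A' then 1 else 0)"
          by (simp only: V_def y'_def)
        show ?thesis
        proof (cases "y' 0 = u \<and> gw q y' \<and> (y' (q - 1), ?z) \<in> A' \<and> pw q y' > 0")
          case False
          then have "V y = 0" unfolding Vy using pw_nonneg[OF yW] by auto
          then show ?thesis using Fnn[OF tX] by simp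
        next
          case ok: True
          have gy: "glue f t (2 * l - c) = y' c" if "c \<le> q" for c
          proof (cases "c = q")
            case True
            then show ?thesis using M_l yq by (simp add: glue_def)
          next
            case False
            then have "c < q" using that by simp
            then have "\<not> 2 * l - c < Suc M" "2 * l - c - Suc M = q - Suc c" "q - Suc (q - Suc c) = c" using M_l by auto
            then show ?thesis using \<open>c < q\<close> False by (simp add: glue_def t y'_def)
          qed
          have g0: "glue f t 0 = u" using f0 by (simp add: glue_def)
          have "gw q (\<lambda>i. glue f t (2 * l - i)) \<longleftrightarrow> gw q y'" by (rule gw_cong) (use gy in auto)
          moreover have "gw q (glue f t) \<longleftrightarrow> gw q f" by (rule gw_cong) (auto simp: glue_def)
          moreover have "glue f t (2 * l) = u" using gy[of 0] ok by simp
          moreover have "zz u i (glue f t i) (glue f t (Suc i))" if "q \<le> i" "i < M" for i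
          proof -
            have "ed i (f i) (f (Suc i)) \<in> A'" using True that by (simp add: I_def)
            then show ?thesis using zzA that by (simp add: glue_def)
          qed
          ultimately have good: "good (glue f t)" using ok True g0 by (simp add: good_def I_def)
          have "F (glue f t) = Fp M (glue f t) * (pw q y' / pk q u (y' q))"
            unfolding F_Fp by (rule Fp_last[OF yW _ _ gy g0]) (use ok in auto)
          also have "Fp M (glue f t) = Fp M f" by (rule Fp_cong) (simp add: glue_def)
          finally show ?thesis using good g0 ok unfolding Vy yq by simp
        qed
      qed
      have "\<eta> * pk q u ?z \<le> (\<Sum>e | e \<in> A' \<and> snd e = ?z. om_good u e)" by (rule keepZ[OF y0])
      also have "\<dots> = (\<Sum>g\<in>Wk q. pw q g * (if g 0 = u \<and> gw q g \<and> (g (q - 1), g q) \<in> {e \<in> A'. snd e = ?z} then 1 else 0))"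
        by (rule sum_om) (use fA' in auto)
      also have "\<dots> = (\<Sum>y\<in>{..<q} \<rightarrow>\<^sub>E X. \<Sum>v\<in>X. if v = ?z then V y else 0)"
      proof -
        have mem: "(g (q - 1), g q) \<in> {e \<in> A'. snd e = ?z} \<longleftrightarrow> (g (q - 1), ?z) \<in> A' \<and> g q = ?z" for g :: "nat \<Rightarrow> 'a"
          by auto
        show ?thesis
          unfolding mem sum_PiE_last
        proof (intro sum.cong refl)
          fix y v
          show "pw q (y(q := v)) * (if (y(q := v)) 0 = u \<and> gw q (y(q := v)) \<and> ((y(q := v)) (q - 1), ?z) \<in> A' \<and> (y(q := v)) q = ?z then 1 else 0)
              = (if v = ?z then V y else 0)"
            unfolding V_def fun_upd_same by (cases "v = ?z") simp_all
        qed
      qed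
      also have "\<dots> = (\<Sum>y\<in>{..<q} \<rightarrow>\<^sub>E X. V y)"
        using finX zX by simp
      finally have "\<eta> \<le> (\<Sum>y\<in>{..<q} \<rightarrow>\<^sub>E X. V y / pk q u ?z)"
        using pos by (simp add: sum_divide_distrib[symmetric] le_divide_eq)
      then have "Fp M f * \<eta> \<le> Fp M f * (\<Sum>y\<in>{..<q} \<rightarrow>\<^sub>E X. V y / pk q u ?z)"
        using Fp_nonneg[OF f] by (rule mult_left_mono)
      also have "\<dots> = (\<Sum>y\<in>{..<q} \<rightarrow>\<^sub>E X. Fp M f * (V y / pk q u ?z))"
        by (rule sum_distrib_left)
      also have "\<dots> \<le> (\<Sum>y\<in>{..<q} \<rightarrow>\<^sub>E X. (\<lambda>t. if glue f t 0 = u \<and> good (glue f t) then F (glue f t) else 0) (\<lambda>i. if i < q then y (q - Suc i) else undefined))"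
        by (intro sum_mono) (use tailF in blast)
      also have "\<dots> = (\<Sum>t\<in>{..<q} \<rightarrow>\<^sub>E X. if glue f t 0 = u \<and> good (glue f t) then F (glue f t) else 0)"
        by (rule sum_PiE_rev[symmetric])
      finally show ?thesis using True by (simp add: ind_def)
    qed
  qed
  also have "\<dots> = (\<Sum>f\<in>{..<Suc M + q} \<rightarrow>\<^sub>E X. if f 0 = u \<and> good f then F f else 0)"
    unfolding glue_def by (rule sum_PiE_split[symmetric])
  also have "Suc M + q = Suc (2 * l)" using M_l by simp
  finally have "(\<Sum>f\<in>Wk M. Fp M f * ind M f) * \<eta> \<le> (\<Sum>f\<in>Wk (2 * l). if f 0 = u \<and> good f then F f else 0)"
    by (simp only: sum_distrib_right mult.assoc)
  moreover have "pi u * (2 * \<eta>) * \<eta> ^ (2 * h) * \<eta> \<le> (\<Sum>f\<in>Wk M. Fp M f * ind M f) * \<eta>"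
    using zig[of M] \<eta> by (intro mult_right_mono) auto
  moreover have "pi u * \<eta> ^ (2 * h + 2) \<le> pi u * (2 * \<eta>) * \<eta> ^ (2 * h) * \<eta>"
    using \<eta> pi_pos[OF u] by (simp add: power_add power2_eq_square)
  ultimately show ?thesis unfolding \<eta>_def by linarith
qed

text \<open>Averaging over the start: vertices from which a walk is good with probability at least
  \<open>\<rho> / 2\<close> have stationary mass at least \<open>\<rho> / 2\<close>, and
  \<open>mass_at\<close> applies to each. The exponents fit since \<open>q \<ge> 2\<close> gives
  \<open>2 * h + 3 \<le> 2 * l\<close>.\<close>

lemma mass:
  assumes \<rho>: "0 < \<rho>" "\<rho> \<le> 1"
    and lower: "\<rho> \<le> (\<Sum>g\<in>Wk q. wt q g * (if gw q g then 1 else 0))"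
  shows "(\<rho> / 8) ^ (2 * l) \<le> (\<Sum>f\<in>Wk (2 * l). if good f then F f else 0)"
proof -
  define r where "r u = (\<Sum>g\<in>Wk q. pw q g * (if g 0 = u \<and> gw q g then 1 else 0))" for u
  define U where "U = {u \<in> X. \<rho> / 2 \<le> r u}"
  have r_le: "r u \<le> 1" if u: "u \<in> X" for u
  proof -
    have "r u \<le> (\<Sum>g\<in>Wk q. \<Sum>x\<in>X. pw q g * (if g 0 = u \<and> g q = x then 1 else 0))"
      unfolding r_def
    proof (rule sum_mono)
      fix g assume g: "g \<in> Wk q"
      have "g q \<in> X" using g by (rule Wk_in) simp
      have "(\<Sum>x\<in>X. pw q g * (if g 0 = u \<and> g q = x then 1 else 0)) = (\<Sum>x\<in>X. if x = g q then pw q g * (if g 0 = u then 1 else 0) else 0)"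
        by (intro sum.cong refl) auto
      also have "\<dots> = pw q g * (if g 0 = u then 1 else 0)" using finX \<open>g q \<in> X\<close> by simp
      finally show "pw q g * (if g 0 = u \<and> gw q g then 1 else 0) \<le> (\<Sum>x\<in>X. pw q g * (if g 0 = u \<and> g q = x then 1 else 0))"
        using pw_nonneg[OF g] by simp
    qed
    also have "\<dots> = (\<Sum>x\<in>X. pk q u x)"
      by (subst sum.swap) (intro sum.cong refl pw_pk u)
    also have "\<dots> = 1" using u by (rule pk_sum)
    finally show ?thesis .
  qed
  have "(\<Sum>g\<in>Wk q. wt q g * (if gw q g then 1 else 0)) = (\<Sum>u\<in>X. pi u * r u)"
  proof -
    have "(\<Sum>u\<in>X. pi u * r u) = (\<Sum>u\<in>X. \<Sum>g\<in>Wk q. if u = g 0 then wt q g * (if gw q g then 1 else 0) else 0)"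
      unfolding r_def sum_distrib_left by (intro sum.cong refl) (auto simp: wt_def pw_def)
    also have "\<dots> = (\<Sum>g\<in>Wk q. \<Sum>u\<in>X. if u = g 0 then wt q g * (if gw q g then 1 else 0) else 0)" by (rule sum.swap)
    also have "\<dots> = (\<Sum>g\<in>Wk q. wt q g * (if gw q g then 1 else 0))"
      using finX by (intro sum.cong refl) (simp add: Wk_in)
    finally show ?thesis by simp
  qed
  then have "\<rho> \<le> (\<Sum>u\<in>X. pi u * r u)" using lower by simp
  also have "\<dots> \<le> (\<Sum>u\<in>X. (if u \<in> U then pi u else 0) + pi u * (\<rho> / 2))"
  proof (rule sum_mono)
    fix u assume u: "u \<in> X"
    have p0: "pi u \<ge> 0" using pi_pos[OF u] by simp
    show "pi u * r u \<le> (if u \<in> U then pi u else 0) + pi u * (\<rho> / 2)"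
    proof (cases "u \<in> U")
      case True
      have "pi u * r u \<le> pi u * 1" using r_le[OF u] p0 by (rule mult_left_mono)
      then show ?thesis using True p0 \<rho> by (simp add: add_increasing2)
    next
      case False
      then have "r u \<le> \<rho> / 2" using u by (auto simp: U_def)
      from mult_left_mono[OF this p0] show ?thesis using False by simp
    qed
  qed
  also have "\<dots> = (\<Sum>u\<in>U. pi u) + \<rho> / 2"
  proof -
    have "(\<Sum>u\<in>X. if u \<in> U then pi u else 0) = (\<Sum>u\<in>U. pi u)"
    proof -
      have "X \<inter> U = U" by (auto simp: U_def)
      then show ?thesis using sum.inter_restrict[OF finX, of pi U] by simp
    qed
    then show ?thesis by (simp add: sum.distrib sum_distrib_right[symmetric] sum_divide_distrib[symmetric] pi_sum)
  qed
  finally have U: "\<rho> / 2 \<le> (\<Sum>u\<in>U. pi u)" by simp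
  have r8: "0 \<le> \<rho> / 8" "\<rho> / 8 \<le> 1" using \<rho> by auto
  have "(\<rho> / 8) ^ (2 * l) \<le> (\<rho> / 8) ^ (Suc (2 * h + 2))"
    using r8 lqh q2 by (intro power_decreasing) auto
  also have "\<dots> \<le> (\<rho> / 2) * (\<rho> / 8) ^ (2 * h + 2)" using \<rho> by (simp add: mult_right_mono)
  also have "\<dots> \<le> (\<Sum>u\<in>U. pi u) * (\<rho> / 8) ^ (2 * h + 2)" using U r8 by (intro mult_right_mono) auto
  also have "\<dots> = (\<Sum>u\<in>U. pi u * (\<rho> / 8) ^ (2 * h + 2))" by (rule sum_distrib_right)
  also have "\<dots> \<le> (\<Sum>u\<in>U. \<Sum>f\<in>Wk (2 * l). if f 0 = u \<and> good f then F f else 0)"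
    by (intro sum_mono mass_at) (use \<rho> in \<open>auto simp: U_def r_def\<close>)
  also have "\<dots> \<le> (\<Sum>u\<in>X. \<Sum>f\<in>Wk (2 * l). if f 0 = u \<and> good f then F f else 0)"
    using finX Fp_nonneg by (intro sum_mono2) (auto simp: U_def F_Fp intro!: sum_nonneg)
  also have "\<dots> = (\<Sum>f\<in>Wk (2 * l). \<Sum>u\<in>X. if u = f 0 then (if good f then F f else 0) else 0)"
    by (subst sum.swap) (intro sum.cong refl, auto)
  also have "\<dots> = (\<Sum>f\<in>Wk (2 * l). if good f then F f else 0)"
    using finX by (intro sum.cong refl) (simp add: Wk_in)
  finally show ?thesis .
qed

end

text \<open>\<open>\<nu>\<close> is the law \<open>F\<close> restricted to good injective walks,
  which can only improve the spread bound. The at most (2l)^2 possible repetitions cost at most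
  \<open>B * D / E\<close> each, and \<open>E_big\<close> makes their sum at most half of the mass
  of good walks. \<open>\<nu>\<close> is not normalised; the lower bound on its mass replaces
  this.\<close>

theorem (in weighted_walk) spread_cycles:
  assumes E_big: "E \<ge> 2 * B * D * (2 * real l) ^ 2 * (16 * real l ^ 2) ^ (2 * l)"
  shows "\<exists>\<nu>. (\<forall>f\<in>Wk (2 * l). 0 \<le> \<nu> f \<and>
        (\<nu> f \<noteq> 0 \<longrightarrow> f (2 * l) = f 0 \<and> inj_on f {..<2 * l} \<and> (\<forall>i<2 * l. w (f i) (f (Suc i)) > 0))) \<and>
      1 / (2 * (16 * real l ^ 2) ^ (2 * l)) \<le> (\<Sum>f\<in>Wk (2 * l). \<nu> f) \<and>
      (\<forall>S\<subseteq>{..<2 * l}. S \<noteq> {} \<longrightarrow> (\<forall>ab. (\<forall>i\<in>S. fst (ab i) \<in> X \<and> snd (ab i) \<in> X) \<longrightarrow>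
        (\<Sum>f | f \<in> Wk (2 * l) \<and> (\<forall>i\<in>S. f i = fst (ab i) \<and> f (Suc i) = snd (ab i)). \<nu> f)
          \<le> (B / \<kappa>) ^ (2 * l) * (2 * B * D / \<kappa>) * (\<Prod>i\<in>S. w (fst (ab i)) (snd (ab i)) / tot) * (E ^ (2 * l)) ^ (card S - 1)))"
proof -
  obtain q where q: "2 \<le> q" "q \<le> l"
    and lower: "1 / (2 * real l ^ 2) \<le> (\<Sum>g\<in>Wk q. wt q g * (if gw q g then 1 else 0))"
    using good_length by blast
  define h where "h = l - q"
  interpret cycle_law X w E \<kappa> D l q h
    by unfold_locales (use q in \<open>auto simp: h_def\<close>)
  define \<rho> where "\<rho> = 1 / (2 * real l ^ 2)"
  have \<rho>: "0 < \<rho>" "\<rho> \<le> 1"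
  proof -
    have "real l ^ 2 \<ge> 1" using l2 by (intro one_le_power) auto
    then have "1 \<le> 2 * real l ^ 2" by linarith
    then show "0 < \<rho>" "\<rho> \<le> 1" using l2 by (simp_all add: \<rho>_def divide_le_eq)
  qed
  \<comment> \<open>\<open>good_length\<close> supplies the proportion 1/(2 l^2), and
    \<open>mass\<close> divides it by 8 and raises it to the power \<open>2 * l\<close>.\<close>
  define m0 where "m0 = 1 / (16 * real l ^ 2) ^ (2 * l)"
  have m0: "(\<rho> / 8) ^ (2 * l) = m0" by (simp add: \<rho>_def m0_def power_divide)
  have mass: "m0 \<le> (\<Sum>f\<in>Wk (2 * l). if good f then F f else 0)"
    using mass[OF \<rho>] lower m0 by (simp add: \<rho>_def)
  have nn: "F f \<ge> 0" if "f \<in> Wk (2 * l)" for f using Fp_nonneg[OF that] by (simp add: F_Fp)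
  define \<nu> where "\<nu> f = (if good f \<and> inj_on f {..<2 * l} then F f else 0)" for f
  have "(\<Sum>f\<in>Wk (2 * l). if good f then F f else 0)
     \<le> (\<Sum>f\<in>Wk (2 * l). \<nu> f + (\<Sum>(i, j)\<in>{..<2 * l} \<times> {..<2 * l}. if i < j then (if good f \<and> f i = f j then F f else 0) else 0))"
  proof (rule sum_mono)
    fix f assume f: "f \<in> Wk (2 * l)"
    let ?T = "\<lambda>(i, j). if i < j then (if good f \<and> f i = f j then F f else 0) else 0"
    have nonneg: "?T ij \<ge> 0" for ij using nn[OF f] by (cases ij) auto
    show "(if good f then F f else 0) \<le> \<nu> f + (\<Sum>ij\<in>{..<2 * l} \<times> {..<2 * l}. ?T ij)"
    proof (cases "good f \<and> \<not> inj_on f {..<2 * l}")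
      case True
      then obtain a b where ab: "a < 2 * l" "b < 2 * l" "f a = f b" "a \<noteq> b" unfolding inj_on_def by blast
      define i j where "i = min a b" and "j = max a b"
      have ij: "i < j" "j < 2 * l" "f i = f j" using ab by (auto simp: i_def j_def min_def max_def)
      have "F f = ?T (i, j)" using ij True by simp
      also have "\<dots> \<le> (\<Sum>ij\<in>{..<2 * l} \<times> {..<2 * l}. ?T ij)"
        by (rule member_le_sum) (use ij nonneg in auto)
      finally show ?thesis using True nn[OF f] by (simp add: \<nu>_def)
    next
      case False
      have "0 \<le> (\<Sum>ij\<in>{..<2 * l} \<times> {..<2 * l}. ?T ij)" using nonneg by (intro sum_nonneg)
      then show ?thesis using False by (auto simp: \<nu>_def)
    qed
  qed
  also have "\<dots> = (\<Sum>f\<in>Wk (2 * l). \<nu> f) + (\<Sum>(i, j)\<in>{..<2 * l} \<times> {..<2 * l}. if i < j then coll i j else 0)"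
  proof -
    have "(\<Sum>f\<in>Wk (2 * l). \<Sum>(i, j)\<in>{..<2 * l} \<times> {..<2 * l}. if i < j then (if good f \<and> f i = f j then F f else 0) else 0)
        = (\<Sum>(i, j)\<in>{..<2 * l} \<times> {..<2 * l}. \<Sum>f\<in>Wk (2 * l). if i < j then (if good f \<and> f i = f j then F f else 0) else 0)"
      by (subst sum.swap) (simp add: case_prod_beta)
    also have "\<dots> = (\<Sum>(i, j)\<in>{..<2 * l} \<times> {..<2 * l}. if i < j then coll i j else 0)"
      by (intro sum.cong refl) (auto simp: coll_def)
    finally show ?thesis by (simp add: sum.distrib)
  qed
  also have "(\<Sum>(i, j)\<in>{..<2 * l} \<times> {..<2 * l}. if i < j then coll i j else 0) \<le> (\<Sum>(i, j)\<in>{..<2 * l} \<times> {..<2 * l}. B * D / E)"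
    using coll_bound B1 D1 E0 by (intro sum_mono) auto
  also have "\<dots> = (2 * real l) ^ 2 * (B * D / E)" by (simp add: power2_eq_square)
  also have "\<dots> \<le> m0 / 2"
  proof -
    have "2 * ((2 * real l) ^ 2 * (B * D)) * (16 * real l ^ 2) ^ (2 * l) \<le> E" using E_big by (simp add: mult_ac)
    moreover have "(16 * real l ^ 2) ^ (2 * l) > 0" using l2 by simp
    ultimately show ?thesis using E0 by (simp add: m0_def field_simps)
  qed
  finally have "m0 / 2 \<le> (\<Sum>f\<in>Wk (2 * l). \<nu> f)" using mass by linarith
  then have "1 / (2 * (16 * real l ^ 2) ^ (2 * l)) \<le> (\<Sum>f\<in>Wk (2 * l). \<nu> f)" by (simp add: m0_def)
  moreover have "(\<Sum>f | f \<in> Wk (2 * l) \<and> (\<forall>i\<in>S. f i = fst (ab i) \<and> f (Suc i) = snd (ab i)). \<nu> f)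
          \<le> (B / \<kappa>) ^ (2 * l) * (2 * B * D / \<kappa>) * (\<Prod>i\<in>S. w (fst (ab i)) (snd (ab i)) / tot) * (E ^ (2 * l)) ^ (card S - 1)"
    if S: "S \<subseteq> {..<2 * l}" "S \<noteq> {}" and ab: "\<forall>i\<in>S. fst (ab i) \<in> X \<and> snd (ab i) \<in> X" for S ab
  proof -
    have "(\<Sum>f | f \<in> Wk (2 * l) \<and> (\<forall>i\<in>S. f i = fst (ab i) \<and> f (Suc i) = snd (ab i)). \<nu> f)
        = (\<Sum>f\<in>Wk (2 * l). if \<forall>i\<in>S. f i = fst (ab i) \<and> f (Suc i) = snd (ab i) then \<nu> f else 0)"
      by (rule sum.inter_filter[OF finWk])
    also have "\<dots> \<le> Ssum S ab"
      unfolding Ssum_def cons_def by (rule sum_mono) (use nn in \<open>auto simp: \<nu>_def\<close>)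
    also have "\<dots> \<le> Cs * (\<Prod>i\<in>S. ew (fst (ab i)) (snd (ab i))) * (E ^ (2 * l)) ^ (card S - 1)"
      by (rule Ssum_spread[OF S ab])
    finally show ?thesis by (simp add: Cs_def ew_def)
  qed
  moreover have "0 \<le> \<nu> f \<and> (\<nu> f \<noteq> 0 \<longrightarrow> f (2 * l) = f 0 \<and> inj_on f {..<2 * l} \<and> (\<forall>i<2 * l. w (f i) (f (Suc i)) > 0))"
    if f: "f \<in> Wk (2 * l)" for f
    using nn[OF f] F_closed[of f] F_edge[OF _ _ f] by (auto simp: \<nu>_def split: if_splits)
  ultimately show ?thesis by (intro exI[of _ \<nu>]) blast
qed

section \<open>Balanced supersaturation for linear cycles\<close>

definition cod :: "nat set set \<Rightarrow> nat set \<Rightarrow> real" where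
  "cod H S = real (card {e \<in> H. S \<subseteq> e})"

lemma cod_sum: "finite H \<Longrightarrow> cod H S = (\<Sum>e\<in>H. if S \<subseteq> e then 1 else 0)"
  by (simp add: cod_def sum.If_cases Int_def)

lemma cod_nonneg: "cod H S \<ge> 0" by (simp add: cod_def)

lemma finite_r_subsets: "finite (r_subsets r n)"
  unfolding r_subsets_def by (rule finite_subset[of _ "Pow {1..n}"]) auto

lemma card_subsets_le: "finite A \<Longrightarrow> real (card {S. S \<subseteq> A \<and> card S = k}) \<le> real (card A) ^ k"
proof -
  assume A: "finite A"
  have "card {S. S \<subseteq> A \<and> card S = k} = card A choose k" by (rule n_subsets[OF A])
  also have "\<dots> \<le> card A ^ k"
    by (cases "k \<le> card A") (auto intro: binomial_le_pow simp: binomial_eq_0)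
  finally show ?thesis by (metis of_nat_le_iff of_nat_power)
qed

text \<open>The thresholds on \<open>(r - 1)\<close>-sets and those on vertices each add up to at
  most a quarter of the edges. The first kind prevents a random edge through a pair from favouring
  another vertex; the second gives the minimum degree behind \<open>deg_lo\<close>.\<close>

lemma clean_hypergraph:
  assumes H: "H \<subseteq> r_subsets r n" and r: "r \<ge> 4" and n: "n \<ge> 1" and K: "K \<ge> 0"
    and big: "K * real n ^ (r - 1) \<le> real (card H)"
  obtains H1 where "H1 \<subseteq> H" "real (card H) \<le> 2 * real (card H1)"
    "\<And>e S. e \<in> H1 \<Longrightarrow> S \<subseteq> e \<Longrightarrow> card S = r - 1 \<Longrightarrow> K / 4 \<le> cod H1 S"
    "\<And>e x. e \<in> H1 \<Longrightarrow> x \<in> e \<Longrightarrow> real (card H) / (4 * real n) \<le> cod H1 {x}"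
proof -
  have fH: "finite H" using H finite_r_subsets finite_subset by blast
  define I1 where "I1 = {S. S \<subseteq> {1..n} \<and> card S = r - 1}"
  define I2 where "I2 = {S. S \<subseteq> {1..n} \<and> card S = 1}"
  define thr where "thr S = (if card S = 1 then real (card H) / (4 * real n) else K / 4)" for S :: "nat set"
  have f1: "finite I1" "finite I2" unfolding I1_def I2_def by (auto intro: finite_subset[of _ "Pow {1..n}"])
  have dj: "I1 \<inter> I2 = {}" using r by (auto simp: I1_def I2_def)
  have thr0: "\<forall>S\<in>I1 \<union> I2. thr S \<ge> 0" using K by (auto simp: thr_def)
  obtain H1 where H1: "H1 \<subseteq> H"
    and keep: "\<And>S. S \<in> I1 \<union> I2 \<Longrightarrow> \<exists>e\<in>H1. S \<subseteq> e \<Longrightarrow> thr S \<le> (\<Sum>e | e \<in> H1 \<and> S \<subseteq> e. 1 :: real)"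
    and tot: "(\<Sum>e\<in>H. 1 :: real) - (\<Sum>S\<in>I1 \<union> I2. thr S) \<le> (\<Sum>e\<in>H1. 1)"
    by (rule cleaning[where A = H and I = "I1 \<union> I2" and thr = thr and hit = "\<lambda>e S. S \<subseteq> e" and wgt = "\<lambda>_. 1 :: real", OF fH finite_UnI[OF f1] thr0], rule that)
  have cod: "(\<Sum>e | e \<in> H1 \<and> S \<subseteq> e. 1 :: real) = cod H1 S" for S by (simp add: cod_def)
  have sub: "e \<subseteq> {1..n}" if "e \<in> H1" for e using that H1 H by (auto simp: r_subsets_def)
  have "(\<Sum>S\<in>I1. thr S) = real (card I1) * (K / 4)" using r by (simp add: thr_def I1_def)
  also have "\<dots> \<le> real n ^ (r - 1) * (K / 4)"
    using card_subsets_le[of "{1..n}" "r - 1"] K by (intro mult_right_mono) (auto simp: I1_def)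
  also have "\<dots> \<le> real (card H) / 4" using big by (simp add: mult.commute)
  finally have s1: "(\<Sum>S\<in>I1. thr S) \<le> real (card H) / 4" .
  have "(\<Sum>S\<in>I2. thr S) = real (card I2) * (real (card H) / (4 * real n))" by (simp add: thr_def I2_def)
  also have "\<dots> \<le> real n * (real (card H) / (4 * real n))"
    using card_subsets_le[of "{1..n}" 1] by (intro mult_right_mono) (auto simp: I2_def)
  also have "\<dots> = real (card H) / 4" using n by simp
  finally have s2: "(\<Sum>S\<in>I2. thr S) \<le> real (card H) / 4" .
  have "(\<Sum>S\<in>I1 \<union> I2. thr S) = (\<Sum>S\<in>I1. thr S) + (\<Sum>S\<in>I2. thr S)"
    using f1 dj by (intro sum.union_disjoint)
  then have "real (card H) \<le> 2 * real (card H1)" using tot s1 s2 by simp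
  moreover have "K / 4 \<le> cod H1 S" if "e \<in> H1" "S \<subseteq> e" "card S = r - 1" for e S
  proof -
    have "S \<in> I1" using that sub[OF that(1)] by (auto simp: I1_def)
    then have "thr S \<le> cod H1 S" using keep[of S] that cod by auto
    moreover have "card S \<noteq> 1" using that(3) r by simp
    ultimately show ?thesis by (simp add: thr_def)
  qed
  moreover have "real (card H) / (4 * real n) \<le> cod H1 {x}" if "e \<in> H1" "x \<in> e" for e x
  proof -
    have "{x} \<in> I2" using that sub[OF that(1)] by (auto simp: I2_def)
    moreover have "\<exists>e\<in>H1. {x} \<subseteq> e" using that by auto
    ultimately have "thr {x} \<le> cod H1 {x}" using keep[of "{x}"] unfolding cod by blast
    then show ?thesis by (simp add: thr_def)
  qed
  ultimately show ?thesis using that H1 by blast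
qed

lemma cod_pairs:
  assumes H: "H \<subseteq> r_subsets r n" and x: "x \<in> {1..n}"
  shows "(\<Sum>y\<in>{1..n} - {x}. cod H {x, y}) = (real r - 1) * cod H {x}"
proof -
  have fH: "finite H" using H finite_r_subsets finite_subset by blast
  have "(\<Sum>y\<in>{1..n} - {x}. cod H {x, y}) = (\<Sum>e\<in>H. \<Sum>y\<in>{1..n} - {x}. if {x, y} \<subseteq> e then 1 else 0)"
    unfolding cod_sum[OF fH] by (rule sum.swap)
  also have "\<dots> = (\<Sum>e\<in>H. (real r - 1) * (if {x} \<subseteq> e then 1 else 0))"
  proof (rule sum.cong[OF refl])
    fix e assume "e \<in> H"
    then have e: "e \<subseteq> {1..n}" "card e = r" "finite e" using H by (auto simp: r_subsets_def intro: finite_subset)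
    show "(\<Sum>y\<in>{1..n} - {x}. if {x, y} \<subseteq> e then 1 else 0) = (real r - 1) * (if {x} \<subseteq> e then 1 else 0)"
    proof (cases "x \<in> e")
      case True
      have "(\<Sum>y\<in>{1..n} - {x}. if {x, y} \<subseteq> e then 1 else 0 :: real) = real (card {y \<in> {1..n} - {x}. {x, y} \<subseteq> e})"
        by (simp add: sum.If_cases Int_def)
      also have "{y \<in> {1..n} - {x}. {x, y} \<subseteq> e} = e - {x}" using e True by auto
      also have "real (card (e - {x})) = real r - 1"
        using e True by (metis card_Suc_Diff1 of_nat_Suc add_diff_cancel_left')
      finally show ?thesis using True by simp
    qed simp
  qed
  also have "\<dots> = (real r - 1) * cod H {x}" unfolding cod_sum[OF fH] by (simp only: sum_distrib_left)
  finally show ?thesis .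
qed

lemma cod_singles:
  assumes H: "H \<subseteq> r_subsets r n"
  shows "(\<Sum>x\<in>{1..n}. cod H {x}) = real r * real (card H)"
proof -
  have fH: "finite H" using H finite_r_subsets finite_subset by blast
  have "(\<Sum>x\<in>{1..n}. cod H {x}) = (\<Sum>e\<in>H. \<Sum>x\<in>{1..n}. if {x} \<subseteq> e then 1 else 0)"
    unfolding cod_sum[OF fH] by (rule sum.swap)
  also have "\<dots> = (\<Sum>e\<in>H. real r)"
  proof (rule sum.cong[OF refl])
    fix e assume "e \<in> H"
    then have e: "e \<subseteq> {1..n}" "card e = r" using H by (auto simp: r_subsets_def)
    have "(\<Sum>x\<in>{1..n}. if {x} \<subseteq> e then 1 else 0 :: real) = real (card {x \<in> {1..n}. {x} \<subseteq> e})"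
      by (simp add: sum.If_cases Int_def)
    also have "{x \<in> {1..n}. {x} \<subseteq> e} = e" using e by auto
    finally show "(\<Sum>x\<in>{1..n}. if {x} \<subseteq> e then 1 else 0) = real r" using e by simp
  qed
  finally show ?thesis by simp
qed

text \<open>An edge is bad if every pair through its vertex \<open>c\<close> of least degree is heavy. Since \<open>c\<close> has at
  most \<open>E ^ l\<close> heavy neighbours, there are at most \<open>n * E ^ (l * (r - 1)) \<le> n ^ (r - 1)\<close> bad edges; this
  is where \<open>r \<ge> 4\<close> enters.\<close>

lemma few_bad_edges:
  assumes H: "H \<subseteq> r_subsets r n" and r: "r \<ge> 4" and l: "l \<ge> 2" and E: "E \<ge> 1" "E ^ (2 * l - 1) = real n"
    and \<theta>: "\<theta> = (real r - 1) / E ^ l"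
  shows "real (card {f \<in> H. \<not> (\<exists>c b. c \<noteq> b \<and> {c, b} \<subseteq> f \<and> cod H {c, b} \<le> \<theta> * cod H {c} \<and> cod H {c, b} \<le> \<theta> * cod H {b})})
     \<le> real n ^ (r - 1)"
proof -
  have fH: "finite H" using H finite_r_subsets finite_subset by blast
  have \<theta>0: "\<theta> > 0" using \<theta> r E by simp
  define Bad where "Bad = {f \<in> H. \<not> (\<exists>c b. c \<noteq> b \<and> {c, b} \<subseteq> f \<and> cod H {c, b} \<le> \<theta> * cod H {c} \<and> cod H {c, b} \<le> \<theta> * cod H {b})}"
  define Nb where "Nb c = {b \<in> {1..n} - {c}. cod H {c, b} > \<theta> * cod H {c}}" for c
  define G where "G c = {f \<in> H. c \<in> f \<and> f - {c} \<subseteq> Nb c}" for c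
  have sub: "Bad \<subseteq> (\<Union>c\<in>{1..n}. G c)"
  proof
    fix f assume f: "f \<in> Bad"
    then have fH': "f \<in> H" by (simp add: Bad_def)
    have ff: "f \<subseteq> {1..n}" "card f = r" using fH' H by (auto simp: r_subsets_def)
    have fin: "finite f" using ff(1) finite_subset by blast
    have "f \<noteq> {}" using ff r by auto
    then have "Min ((\<lambda>c. cod H {c}) ` f) \<in> (\<lambda>c. cod H {c}) ` f" using fin by (intro Min_in) auto
    then obtain c where c: "c \<in> f" "cod H {c} = Min ((\<lambda>c. cod H {c}) ` f)" by auto
    have mn: "cod H {c} \<le> cod H {b}" if "b \<in> f" for b using c(2) fin that by simp
    have "f - {c} \<subseteq> Nb c"
    proof
      fix b assume b: "b \<in> f - {c}"
      \<comment> \<open>As \<open>c\<close> has least degree in the edge, a pair that is light at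
        \<open>c\<close> is light at \<open>b\<close> too, and the edge would not be bad.\<close>
      have "\<not> cod H {c, b} \<le> \<theta> * cod H {c}"
      proof
        assume le: "cod H {c, b} \<le> \<theta> * cod H {c}"
        also have "\<dots> \<le> \<theta> * cod H {b}" using mn b \<theta>0 by (intro mult_left_mono) auto
        finally have "cod H {c, b} \<le> \<theta> * cod H {b}" .
        then have "c \<noteq> b \<and> {c, b} \<subseteq> f \<and> cod H {c, b} \<le> \<theta> * cod H {c} \<and> cod H {c, b} \<le> \<theta> * cod H {b}"
          using le b c(1) by simp
        then have "\<exists>c b. c \<noteq> b \<and> {c, b} \<subseteq> f \<and> cod H {c, b} \<le> \<theta> * cod H {c} \<and> cod H {c, b} \<le> \<theta> * cod H {b}"
          by (intro exI)
        moreover have "\<not> (\<exists>c b. c \<noteq> b \<and> {c, b} \<subseteq> f \<and> cod H {c, b} \<le> \<theta> * cod H {c} \<and> cod H {c, b} \<le> \<theta> * cod H {b})"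
          using f unfolding Bad_def mem_Collect_eq by (rule conjunct2)
        ultimately show False by simp
      qed
      then show "b \<in> Nb c" using b ff by (auto simp: Nb_def)
    qed
    then show "f \<in> (\<Union>c\<in>{1..n}. G c)" using c(1) fH' ff by (auto simp: G_def)
  qed
  have cG: "real (card (G c)) \<le> real n ^ (r - 2)" if c: "c \<in> {1..n}" for c
  proof (cases "G c = {}")
    case True
    then show ?thesis by simp
  next
    case False
    then obtain f0 where "f0 \<in> H" "c \<in> f0" by (auto simp: G_def)
    then have "{e \<in> H. {c} \<subseteq> e} \<noteq> {}" by auto
    then have pos: "cod H {c} > 0" using fH by (auto simp: cod_def card_gt_0_iff)
    have fN: "finite (Nb c)" by (simp add: Nb_def)
    have "real (card (Nb c)) * (\<theta> * cod H {c}) = (\<Sum>b\<in>Nb c. \<theta> * cod H {c})" by simp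
    also have "\<dots> \<le> (\<Sum>b\<in>Nb c. cod H {c, b})" by (intro sum_mono) (auto simp: Nb_def)
    also have "\<dots> \<le> (\<Sum>b\<in>{1..n} - {c}. cod H {c, b})" by (intro sum_mono2) (auto simp: Nb_def cod_nonneg)
    also have "\<dots> = (real r - 1) * cod H {c}" by (rule cod_pairs[OF H c])
    finally have "real (card (Nb c)) * \<theta> \<le> real r - 1" using pos by (simp add: mult.assoc[symmetric])
    then have "real (card (Nb c)) * (real r - 1) \<le> E ^ l * (real r - 1)" using E(1) by (simp add: \<theta> field_simps)
    then have cN: "real (card (Nb c)) \<le> E ^ l" by (rule mult_right_le_imp_le) (use r in simp)
    have "card (G c) \<le> card {T. T \<subseteq> Nb c \<and> card T = r - 1}"
    proof (rule card_inj_on_le[where f = "\<lambda>f. f - {c}"])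
      show "inj_on (\<lambda>f. f - {c}) (G c)"
      proof (rule inj_onI)
        fix f g assume "f \<in> G c" "g \<in> G c" and eq: "f - {c} = g - {c}"
        then have "c \<in> f" "c \<in> g" by (auto simp: G_def)
        then show "f = g" using eq by (metis insert_Diff)
      qed
      show "(\<lambda>f. f - {c}) ` G c \<subseteq> {T. T \<subseteq> Nb c \<and> card T = r - 1}"
        using H by (auto simp: G_def r_subsets_def card_Diff_singleton)
      show "finite {T. T \<subseteq> Nb c \<and> card T = r - 1}" using fN by simp
    qed
    then have "real (card (G c)) \<le> real (card {T. T \<subseteq> Nb c \<and> card T = r - 1})" by simp
    also have "\<dots> \<le> real (card (Nb c)) ^ (r - 1)" by (rule card_subsets_le[OF fN])
    also have "\<dots> \<le> (E ^ l) ^ (r - 1)" using cN by (intro power_mono) auto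
    also have "\<dots> = E ^ (l * (r - 1))" by (simp add: power_mult)
    also have "\<dots> \<le> E ^ ((2 * l - 1) * (r - 2))"
    proof (rule power_increasing[OF _ E(1)])
      define l' where "l' = l - 2"
      define r' where "r' = r - 4"
      have l': "l = l' + 2" and r': "r = r' + 4" using l r by (simp_all add: l'_def r'_def)
      \<comment> \<open>For r = 4 this reads 3l \<le> 4l - 2, with equality at l = 2.\<close>
      show "l * (r - 1) \<le> (2 * l - 1) * (r - 2)" unfolding l' r' by (simp add: algebra_simps)
    qed
    also have "\<dots> = real n ^ (r - 2)" by (simp only: power_mult E(2))
    finally show ?thesis .
  qed
  have "card Bad \<le> card (\<Union>c\<in>{1..n}. G c)"
    using sub fH by (intro card_mono) (auto simp: G_def)
  also have "\<dots> \<le> (\<Sum>c\<in>{1..n}. card (G c))" by (rule card_UN_le) simp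
  finally have "real (card Bad) \<le> (\<Sum>c\<in>{1..n}. real (card (G c)))" by (metis of_nat_le_iff of_nat_sum)
  also have "\<dots> \<le> (\<Sum>c\<in>{1..n}. real n ^ (r - 2))" using cG by (intro sum_mono) auto
  also have "\<dots> = real n ^ Suc (r - 2)" by simp
  also have "Suc (r - 2) = r - 1" using r by simp
  finally show ?thesis unfolding Bad_def .
qed

text \<open>Half of the edges contain a pair that is light at both ends, so such pairs have total
  codegree at least half the number of edges. Cleaning them at every vertex with threshold
  \<open>cod H {x} / (4 * real r)\<close> loses at most half of that, and makes weighted degrees
  comparable with degrees in \<open>H\<close>; lightness then bounds the steps of the walk.
  \<open>N\<close> is meant for the number of edges before \<open>H\<close> was itself
  cleaned.\<close>

lemma weighted_walk_exists:
  assumes H: "H \<subseteq> r_subsets r n" and r: "r \<ge> 4" and l: "l \<ge> 2" and E: "E \<ge> 1" "E ^ (2 * l - 1) = real n"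
    and big: "2 * real n ^ (r - 1) \<le> real (card H)" and cH: "card H > 0"
    and cN: "real (card H) \<le> N" "N \<le> 2 * real (card H)"
    and dlo: "\<And>e x. e \<in> H \<Longrightarrow> x \<in> e \<Longrightarrow> N / (4 * real n) \<le> cod H {x}"
  obtains X w where "weighted_walk X w E (1 / (16 * real r ^ 3)) (4 * real r ^ 2) l" "X \<subseteq> {1..n}"
    "N / 4 \<le> (\<Sum>x\<in>X. \<Sum>y\<in>X. w x y)"
    "\<And>x y. x \<in> X \<Longrightarrow> y \<in> X \<Longrightarrow> w x y \<le> cod H {x, y}"
proof -
  have fH: "finite H" using H finite_r_subsets finite_subset by blast
  have n1: "n \<ge> 1"
    using one_le_power[OF E(1), of "2 * l - 1"] unfolding E(2) by simp
  define \<theta> where "\<theta> = (real r - 1) / E ^ l"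
  have \<theta>0: "\<theta> > 0" using r E(1) by (simp add: \<theta>_def)
  let ?good = "\<lambda>f. \<exists>c b. c \<noteq> b \<and> {c, b} \<subseteq> f \<and> cod H {c, b} \<le> \<theta> * cod H {c} \<and> cod H {c, b} \<le> \<theta> * cod H {b}"
  have bad: "real (card {f \<in> H. \<not> ?good f}) \<le> real n ^ (r - 1)"
    by (rule few_bad_edges[OF H r l E \<theta>_def])
  have "{f \<in> H. ?good f} = H - {f \<in> H. \<not> ?good f}" by blast
  then have "real (card {f \<in> H. ?good f}) = real (card H) - real (card {f \<in> H. \<not> ?good f})"
    using fH by (simp add: card_Diff_subset of_nat_diff card_mono)
  then have goods: "real (card H) / 2 \<le> real (card {f \<in> H. ?good f})" using bad big by linarith
  define G where "G = {P. P \<subseteq> {1..n} \<and> card P = 2 \<and> cod H P > 0 \<and> (\<forall>x\<in>P. cod H P \<le> \<theta> * cod H {x})}"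
  have fG: "finite G" unfolding G_def by (rule finite_subset[of _ "Pow {1..n}"]) auto
  have "card {f \<in> H. ?good f} \<le> card (\<Union>P\<in>G. {e \<in> H. P \<subseteq> e})"
  proof (rule card_mono)
    show "finite (\<Union>P\<in>G. {e \<in> H. P \<subseteq> e})" using fG fH by auto
    show "{f \<in> H. ?good f} \<subseteq> (\<Union>P\<in>G. {e \<in> H. P \<subseteq> e})"
    proof
      fix f assume "f \<in> {f \<in> H. ?good f}"
      then obtain c b where f: "f \<in> H" "c \<noteq> b" "{c, b} \<subseteq> f" "cod H {c, b} \<le> \<theta> * cod H {c}" "cod H {c, b} \<le> \<theta> * cod H {b}" by blast
      have "f \<subseteq> {1..n}" using f(1) H by (auto simp: r_subsets_def)
      moreover have "cod H {c, b} > 0" using f fH by (auto simp: cod_def card_gt_0_iff)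
      ultimately have "{c, b} \<in> G" using f by (auto simp: G_def)
      then show "f \<in> (\<Union>P\<in>G. {e \<in> H. P \<subseteq> e})" using f by blast
    qed
  qed
  also have "\<dots> \<le> (\<Sum>P\<in>G. card {e \<in> H. P \<subseteq> e})" using fG by (rule card_UN_le)
  finally have "real (card {f \<in> H. ?good f}) \<le> real (\<Sum>P\<in>G. card {e \<in> H. P \<subseteq> e})" by (rule of_nat_mono)
  also have "\<dots> = (\<Sum>P\<in>G. cod H P)" by (simp only: cod_def of_nat_sum)
  finally have sumG: "real (card H) / 2 \<le> (\<Sum>P\<in>G. cod H P)" using goods by linarith
  define thr where "thr x = cod H {x} / (4 * real r)" for x
  have thr0: "\<forall>x\<in>{1..n}. thr x \<ge> 0" using cod_nonneg by (simp add: thr_def)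
  obtain A where A: "A \<subseteq> G"
    and keep: "\<And>x. x \<in> {1..n} \<Longrightarrow> \<exists>P\<in>A. x \<in> P \<Longrightarrow> thr x \<le> (\<Sum>P | P \<in> A \<and> x \<in> P. cod H P)"
    and tot': "(\<Sum>P\<in>G. cod H P) - (\<Sum>x\<in>{1..n}. thr x) \<le> (\<Sum>P\<in>A. cod H P)"
    by (rule cleaning[where A = G and I = "{1..n}" and thr = thr and hit = "\<lambda>P x. x \<in> P" and wgt = "cod H", OF fG finite_atLeastAtMost thr0], rule that)
  have fA: "finite A" using A fG finite_subset by blast
  have "(\<Sum>x\<in>{1..n}. thr x) = real (card H) / 4"
    unfolding thr_def sum_divide_distrib[symmetric] cod_singles[OF H] using r by simp
  then have sumA: "real (card H) / 4 \<le> (\<Sum>P\<in>A. cod H P)" using tot' sumG by linarith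
  define X where "X = \<Union>A"
  define w where "w x y = (if {x, y} \<in> A \<and> x \<noteq> y then cod H {x, y} else 0)" for x y
  have XN: "X \<subseteq> {1..n}" using A by (auto simp: X_def G_def)
  have fX: "finite X" using XN finite_subset by blast
  have deg: "(\<Sum>y\<in>X. w x y) = (\<Sum>P | P \<in> A \<and> x \<in> P. cod H P)" if x: "x \<in> X" for x
  proof -
    have "(\<Sum>y\<in>X. w x y) = (\<Sum>y | y \<in> X \<and> ({x, y} \<in> A \<and> x \<noteq> y). cod H {x, y})"
      unfolding w_def using fX by (rule sum.inter_filter[symmetric])
    also have "\<dots> = (\<Sum>P | P \<in> A \<and> x \<in> P. cod H P)"
    proof (rule sum.reindex_bij_witness[where i = "\<lambda>P. THE y. P = {x, y} \<and> x \<noteq> y" and j = "\<lambda>y. {x, y}"])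
      fix y assume "y \<in> {y \<in> X. {x, y} \<in> A \<and> x \<noteq> y}"
      then show "(THE y'. {x, y} = {x, y'} \<and> x \<noteq> y') = y" "{x, y} \<in> {P \<in> A. x \<in> P}"
        by (auto intro!: the_equality simp: doubleton_eq_iff)
    next
      fix P assume P: "P \<in> {P \<in> A. x \<in> P}"
      then have "card P = 2" using A by (auto simp: G_def)
      then obtain a b where "P = {a, b}" "a \<noteq> b" by (auto simp: card_2_iff)
      then obtain y where y: "P = {x, y}" "x \<noteq> y" using P by auto
      have the: "(THE y. P = {x, y} \<and> x \<noteq> y) = y" using y by (auto intro!: the_equality simp: doubleton_eq_iff)
      show "{x, THE y. P = {x, y} \<and> x \<noteq> y} = P" using y the by simp
      show "(THE y. P = {x, y} \<and> x \<noteq> y) \<in> {y \<in> X. {x, y} \<in> A \<and> x \<noteq> y}"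
        unfolding the using P y by (auto simp: X_def)
    qed auto
    finally show ?thesis .
  qed
  have deg_lo: "cod H {x} / (4 * real r) \<le> (\<Sum>y\<in>X. w x y)" if x: "x \<in> X" for x
  proof -
    have "\<exists>P\<in>A. x \<in> P" using x by (auto simp: X_def)
    then have "thr x \<le> (\<Sum>P | P \<in> A \<and> x \<in> P. cod H P)" using keep[of x] x XN by auto
    then show ?thesis by (simp add: deg[OF x] thr_def)
  qed
  have w_le: "w x y \<le> cod H {x, y}" for x y using cod_nonneg by (simp add: w_def)
  have deg_hi: "(\<Sum>y\<in>X. w x y) \<le> (real r - 1) * cod H {x}" if x: "x \<in> X" for x
  proof -
    have "(\<Sum>y\<in>X. w x y) = (\<Sum>y\<in>X - {x}. w x y)"
      using fX by (intro sum.mono_neutral_right) (auto simp: w_def)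
    also have "\<dots> \<le> (\<Sum>y\<in>X - {x}. cod H {x, y})" by (intro sum_mono w_le)
    also have "\<dots> \<le> (\<Sum>y\<in>{1..n} - {x}. cod H {x, y})"
      using XN cod_nonneg by (intro sum_mono2) auto
    also have "\<dots> = (real r - 1) * cod H {x}" using x XN by (intro cod_pairs[OF H]) auto
    finally show ?thesis .
  qed
  define W where "W = (\<Sum>x\<in>X. \<Sum>y\<in>X. w x y)"
  have W_eq: "W = 2 * (\<Sum>P\<in>A. cod H P)"
  proof -
    have "W = (\<Sum>x\<in>X. \<Sum>P | P \<in> A \<and> x \<in> P. cod H P)" unfolding W_def by (intro sum.cong refl deg)
    also have "\<dots> = (\<Sum>x\<in>X. \<Sum>P\<in>A. if x \<in> P then cod H P else 0)"
      using fA by (intro sum.cong refl sum.inter_filter)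
    also have "\<dots> = (\<Sum>P\<in>A. \<Sum>x\<in>X. if x \<in> P then cod H P else 0)" by (rule sum.swap)
    also have "\<dots> = (\<Sum>P\<in>A. 2 * cod H P)"
    proof (rule sum.cong[OF refl])
      fix P assume P: "P \<in> A"
      have "X \<inter> P = P" using P by (auto simp: X_def)
      moreover have "card P = 2" using P A by (auto simp: G_def)
      ultimately show "(\<Sum>x\<in>X. if x \<in> P then cod H P else 0) = 2 * cod H P"
        using sum.inter_restrict[OF fX, of "\<lambda>_. cod H P" P] by simp
    qed
    finally show ?thesis by (simp only: sum_distrib_left)
  qed
  have W_lo: "N / 4 \<le> W" using sumA cN by (simp add: W_eq)
  have N0: "N > 0" using cN(1) cH by linarith
  have W_hi: "W \<le> real r ^ 2 * N"
  proof -
    have "W \<le> (\<Sum>x\<in>X. (real r - 1) * cod H {x})" unfolding W_def by (intro sum_mono deg_hi)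
    also have "\<dots> \<le> (\<Sum>x\<in>{1..n}. (real r - 1) * cod H {x})"
      using XN r cod_nonneg by (intro sum_mono2) auto
    also have "\<dots> = (real r - 1) * (real r * real (card H))"
      by (simp only: sum_distrib_left[symmetric] cod_singles[OF H])
    also have "\<dots> \<le> real r * (real r * N)" using cN(1) r by (intro mult_mono) auto
    finally show ?thesis by (simp add: power2_eq_square)
  qed
  have dlo': "N / (4 * real n) \<le> cod H {x}" if x: "x \<in> X" for x
  proof -
    obtain P where P: "P \<in> A" "x \<in> P" using x by (auto simp: X_def)
    then have "cod H P > 0" using A by (auto simp: G_def)
    then have "{e \<in> H. P \<subseteq> e} \<noteq> {}" by (auto simp: cod_def card_gt_0_iff)
    then obtain e where "e \<in> H" "P \<subseteq> e" by blast
    then show ?thesis using dlo P(2) by blast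
  qed
  \<comment> \<open>A weighted degree is at least N / (16 r n) and the total weight at most r^2 N,
    which yields 1 / (16 r^3). A pair at x has weight at most (r - 1) / E^l times a degree that is
    at most 4r times the weighted degree, which yields 4 r^2.\<close>
  have "weighted_walk X w E (1 / (16 * real r ^ 3)) (4 * real r ^ 2) l"
  proof
    show "finite X" by (rule fX)
    show "0 \<le> w x y" for x y by (simp add: w_def cod_nonneg)
    show "w x y = w y x" for x y by (simp add: w_def insert_commute)
    show "0 < (\<Sum>x\<in>X. \<Sum>y\<in>X. w x y)" using W_lo N0 by (simp add: W_def)
    show "1 / (16 * real r ^ 3) * (\<Sum>x\<in>X. \<Sum>y\<in>X. w x y) \<le> (\<Sum>y\<in>X. w x y) * E ^ (2 * l - 1)" if x: "x \<in> X" for x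
    proof -
      have "1 / (16 * real r ^ 3) * W \<le> 1 / (16 * real r ^ 3) * (real r ^ 2 * N)"
        using W_hi by (intro mult_left_mono) auto
      also have "\<dots> = N / (4 * real n) / (4 * real r) * real n"
        using r n1 by (simp add: power2_eq_square power3_eq_cube)
      also have "\<dots> \<le> cod H {x} / (4 * real r) * real n"
        using dlo'[OF x] by (intro mult_right_mono divide_right_mono) auto
      also have "\<dots> \<le> (\<Sum>y\<in>X. w x y) * real n" using deg_lo[OF x] by (intro mult_right_mono) auto
      finally show ?thesis unfolding W_def E(2) .
    qed
    show "w x y * E ^ l \<le> 4 * real r ^ 2 * (\<Sum>y\<in>X. w x y)" if xy: "x \<in> X" "y \<in> X" for x y
    proof -
      have "w x y \<le> \<theta> * cod H {x}"
      proof (cases "{x, y} \<in> A \<and> x \<noteq> y")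
        case True
        then have "{x, y} \<in> G" using A by blast
        then show ?thesis using True by (simp add: w_def G_def)
      next
        case False
        then show ?thesis using \<theta>0 cod_nonneg[of H "{x}"] by (auto simp: w_def)
      qed
      also have "\<dots> \<le> \<theta> * (4 * real r * (\<Sum>y\<in>X. w x y))"
      proof (rule mult_left_mono)
        show "cod H {x} \<le> 4 * real r * (\<Sum>y\<in>X. w x y)"
          using deg_lo[OF xy(1)] r by (simp add: pos_divide_le_eq mult.commute)
      qed (use \<theta>0 in simp)
      finally have "w x y * E ^ l \<le> \<theta> * (4 * real r * (\<Sum>y\<in>X. w x y)) * E ^ l"
        using E(1) by (intro mult_right_mono) simp_all
      also have "\<dots> = (real r - 1) * (4 * real r * (\<Sum>y\<in>X. w x y))"
      proof -
        have "\<theta> * E ^ l = real r - 1" using E(1) by (simp add: \<theta>_def)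
        then show ?thesis by (metis mult.commute mult.left_commute)
      qed
      also have "\<dots> \<le> real r * (4 * real r * (\<Sum>y\<in>X. w x y))"
      proof (rule mult_right_mono)
        have "0 \<le> (\<Sum>y\<in>X. w x y)" by (rule sum_nonneg) (simp add: w_def cod_nonneg)
        then show "0 \<le> 4 * real r * (\<Sum>y\<in>X. w x y)" by simp
      qed simp
      finally show ?thesis by (simp add: power2_eq_square)
    qed
    show "1 \<le> E" by (rule E)
    show "0 < 1 / (16 * real r ^ 3)" "1 / (16 * real r ^ 3) \<le> 1" "1 \<le> 4 * real r ^ 2"
    proof -
      have "1 \<le> real r" using r by simp
      from one_le_power[OF this, of 3] one_le_power[OF this, of 2]
      have *: "1 \<le> 16 * real r ^ 3" "1 \<le> 4 * real r ^ 2" by linarith+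
      then show "1 \<le> 4 * real r ^ 2" by blast
      show "0 < 1 / (16 * real r ^ 3)" using r by simp
      show "1 / (16 * real r ^ 3) \<le> 1" using *(1) r by (simp add: divide_le_eq_1)
    qed
    show "2 \<le> l" by (rule l)
  qed
  then show ?thesis
  proof (rule that)
    show "X \<subseteq> {1..n}" by (rule XN)
    show "N / 4 \<le> (\<Sum>x\<in>X. \<Sum>y\<in>X. w x y)" using W_lo by (simp add: W_def)
    show "w x y \<le> cod H {x, y}" for x y by (rule w_le)
  qed
qed

section \<open>Expanding pairs to random edges\<close>

lemma prod_marginal_le:
  fixes a :: "nat \<Rightarrow> 'a \<Rightarrow> real"
  assumes V: "finite V" and a0: "\<And>i v. a i v \<ge> 0" and a1: "\<And>i. i < k \<Longrightarrow> (\<Sum>v\<in>V. a i v) \<le> 1"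
    and S: "S \<subseteq> {..<k}"
  shows "(\<Sum>e | e \<in> {..<k} \<rightarrow>\<^sub>E V \<and> (\<forall>i\<in>S. e i = g i). \<Prod>i<k. a i (e i)) \<le> (\<Prod>i\<in>S. a i (g i))"
proof -
  let ?V = "\<lambda>i. if i \<in> S then {g i} else V"
  have "(\<Sum>e | e \<in> {..<k} \<rightarrow>\<^sub>E V \<and> (\<forall>i\<in>S. e i = g i). \<Prod>i<k. a i (e i)) \<le> (\<Sum>e\<in>PiE {..<k} ?V. \<Prod>i<k. a i (e i))"
  proof (rule sum_mono2)
    show "finite (PiE {..<k} ?V)" using V by (intro finite_PiE) auto
    show "{e. e \<in> {..<k} \<rightarrow>\<^sub>E V \<and> (\<forall>i\<in>S. e i = g i)} \<subseteq> PiE {..<k} ?V"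
      by (auto simp: PiE_iff extensional_def)
  qed (auto intro: prod_nonneg a0)
  also have "\<dots> = (\<Prod>i<k. \<Sum>v\<in>?V i. a i v)" using V by (intro prod_sum_PiE[symmetric]) auto
  also have "\<dots> \<le> (\<Prod>i<k. if i \<in> S then a i (g i) else 1)"
    using a0 a1 by (intro prod_mono) (auto intro: sum_nonneg)
  also have "\<dots> = (\<Prod>i\<in>S. a i (g i))"
    using S by (simp add: prod.If_cases inf.absorb2)
  finally show ?thesis .
qed

text \<open>For the pairs along an injective closed walk of length at least three,
  \<open>P i \<inter> P j\<close> is the common vertex of neighbouring pairs and empty for all
  others, so this expresses that the edges form a linear cycle.\<close>

definition nondegenerate :: "nat \<Rightarrow> (nat \<Rightarrow> 'a set) \<Rightarrow> (nat \<Rightarrow> 'a set) \<Rightarrow> bool" where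
  "nondegenerate k P e \<longleftrightarrow> (\<forall>i<k. \<forall>j<k. i \<noteq> j \<longrightarrow> e i \<inter> e j \<subseteq> P i \<inter> P j)"

text \<open>A forbidden common vertex of two edges lies outside one of the two pairs, say outside
  \<open>P j\<close>. With all other edges fixed, the edge at j contains a given such vertex with
  probability at most \<open>\<delta>\<close>, and the edge at i offers at most r candidates. The
  union bound over ordered positions is \<open>small\<close>.\<close>

lemma nondegenerate_mass:
  fixes a :: "nat \<Rightarrow> 'a set \<Rightarrow> real"
  assumes V: "finite V" and a0: "\<And>i v. a i v \<ge> 0" and a1: "\<And>i. i < k \<Longrightarrow> (\<Sum>v\<in>V. a i v) = 1"
    and card: "\<And>v. v \<in> V \<Longrightarrow> finite v \<and> card v = r" and \<delta>0: "\<delta> \<ge> 0"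
    and \<delta>: "\<And>j z. j < k \<Longrightarrow> z \<notin> P j \<Longrightarrow> (\<Sum>v\<in>V. if z \<in> v then a j v else 0) \<le> \<delta>"
    and small: "real k ^ 2 * (real r * \<delta>) \<le> 1 / 2"
  shows "1 / 2 \<le> (\<Sum>e\<in>{..<k} \<rightarrow>\<^sub>E V. if nondegenerate k P e then \<Prod>i<k. a i (e i) else 0)"
proof -
  let ?hit = "\<lambda>i j e. \<exists>z\<in>e i \<inter> e j. z \<notin> P j"
  let ?J = "{(i, j). i < k \<and> j < k \<and> i \<noteq> j}"
  have fJ: "finite ?J" by (rule finite_subset[of _ "{..<k} \<times> {..<k}"]) auto
  have pr0: "(\<Prod>i\<in>A. a i (e i)) \<ge> 0" for A e using a0 by (intro prod_nonneg) auto
  have fP: "finite ({..<k} \<rightarrow>\<^sub>E V)" using V by (intro finite_PiE) auto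
  have one: "(\<Sum>e\<in>A \<rightarrow>\<^sub>E V. \<Prod>i\<in>A. a i (e i)) = 1" if "A \<subseteq> {..<k}" for A
  proof -
    have fA: "finite A" using that finite_subset by blast
    have "(\<Sum>e\<in>A \<rightarrow>\<^sub>E V. \<Prod>i\<in>A. a i (e i)) = (\<Prod>i\<in>A. \<Sum>v\<in>V. a i v)"
      using V fA by (intro prod_sum_PiE[symmetric]) auto
    also have "\<dots> = (\<Prod>i\<in>A. 1)" using that a1 by (intro prod.cong) auto
    finally show ?thesis by simp
  qed
  have pair: "(\<Sum>e\<in>{..<k} \<rightarrow>\<^sub>E V. if ?hit i j e then \<Prod>m<k. a m (e m) else 0) \<le> real r * \<delta>" if ij: "i < k" "j < k" "i \<noteq> j" for i j
  proof -
    define A where "A = {..<k} - {j}"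
    have ins: "{..<k} = insert j A" and jA: "j \<notin> A" and iA: "i \<in> A" and fA: "finite A" using ij by (auto simp: A_def)
    have "(\<Sum>e\<in>{..<k} \<rightarrow>\<^sub>E V. if ?hit i j e then \<Prod>m<k. a m (e m) else 0)
       = (\<Sum>e\<in>A \<rightarrow>\<^sub>E V. \<Sum>v\<in>V. if \<exists>z\<in>e i \<inter> v. z \<notin> P j then a j v * (\<Prod>m\<in>A. a m (e m)) else 0)"
      unfolding ins sum_PiE_insert[OF jA]
    proof (intro sum.cong refl)
      fix e v
      have "(\<Prod>m\<in>A. a m ((e(j := v)) m)) = (\<Prod>m\<in>A. a m (e m))" using jA by (intro prod.cong) auto
      then have "(\<Prod>m\<in>insert j A. a m ((e(j := v)) m)) = a j v * (\<Prod>m\<in>A. a m (e m))"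
        using jA fA by simp
      then show "(if ?hit i j (e(j := v)) then \<Prod>m\<in>insert j A. a m ((e(j := v)) m) else 0)
        = (if \<exists>z\<in>e i \<inter> v. z \<notin> P j then a j v * (\<Prod>m\<in>A. a m (e m)) else 0)" using ij(3) by simp
    qed
    also have "\<dots> \<le> (\<Sum>e\<in>A \<rightarrow>\<^sub>E V. (real r * \<delta>) * (\<Prod>m\<in>A. a m (e m)))"
    proof (rule sum_mono)
      fix e assume e: "e \<in> A \<rightarrow>\<^sub>E V"
      then have ei: "finite (e i)" "card (e i) = r" using card[of "e i"] iA by (auto simp: PiE_iff)
      have "(\<Sum>v\<in>V. if \<exists>z\<in>e i \<inter> v. z \<notin> P j then a j v * (\<Prod>m\<in>A. a m (e m)) else 0)
        = (\<Sum>v\<in>V. if \<exists>z\<in>e i \<inter> v. z \<notin> P j then a j v else 0) * (\<Prod>m\<in>A. a m (e m))"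
        unfolding sum_distrib_right by (intro sum.cong) auto
      also have "\<dots> \<le> (\<Sum>v\<in>V. \<Sum>z\<in>e i - P j. if z \<in> v then a j v else 0) * (\<Prod>m\<in>A. a m (e m))"
      proof (intro mult_right_mono sum_mono pr0)
        fix v
        show "(if \<exists>z\<in>e i \<inter> v. z \<notin> P j then a j v else 0) \<le> (\<Sum>z\<in>e i - P j. if z \<in> v then a j v else 0)"
        proof (cases "\<exists>z\<in>e i \<inter> v. z \<notin> P j")
          case True
          then obtain z where z: "z \<in> e i - P j" "z \<in> v" by blast
          have "(if z \<in> v then a j v else 0) \<le> (\<Sum>z\<in>e i - P j. if z \<in> v then a j v else 0)"
            by (rule member_le_sum[OF z(1)]) (use ei a0 in auto)
          then show ?thesis using True z(2) by simp
        next
          case False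
          then show ?thesis using a0 by (simp add: sum_nonneg)
        qed
      qed
      also have "(\<Sum>v\<in>V. \<Sum>z\<in>e i - P j. if z \<in> v then a j v else 0) = (\<Sum>z\<in>e i - P j. \<Sum>v\<in>V. if z \<in> v then a j v else 0)"
        by (rule sum.swap)
      also have "\<dots> * (\<Prod>m\<in>A. a m (e m)) \<le> (real r * \<delta>) * (\<Prod>m\<in>A. a m (e m))"
      proof (intro mult_right_mono pr0)
        have "(\<Sum>z\<in>e i - P j. \<Sum>v\<in>V. if z \<in> v then a j v else 0) \<le> (\<Sum>z\<in>e i - P j. \<delta>)"
          using \<delta>[OF ij(2)] by (intro sum_mono) auto
        also have "\<dots> = real (card (e i - P j)) * \<delta>" by simp
        also have "\<dots> \<le> real r * \<delta>" using ei \<delta>0 card_mono[of "e i" "e i - P j"] by (intro mult_right_mono) auto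
        finally show "(\<Sum>z\<in>e i - P j. \<Sum>v\<in>V. if z \<in> v then a j v else 0) \<le> real r * \<delta>" .
      qed
      finally show "(\<Sum>v\<in>V. if \<exists>z\<in>e i \<inter> v. z \<notin> P j then a j v * (\<Prod>m\<in>A. a m (e m)) else 0)
        \<le> (real r * \<delta>) * (\<Prod>m\<in>A. a m (e m))" .
    qed
    also have "\<dots> = real r * \<delta>"
    proof -
      have "A \<subseteq> {..<k}" by (auto simp: A_def)
      from one[OF this] show ?thesis by (simp only: sum_distrib_left[symmetric] mult_1_right)
    qed
    finally show ?thesis .
  qed
  have "1 = (\<Sum>e\<in>{..<k} \<rightarrow>\<^sub>E V. \<Prod>i<k. a i (e i))" using one[of "{..<k}"] by simp
  also have "\<dots> \<le> (\<Sum>e\<in>{..<k} \<rightarrow>\<^sub>E V. (if nondegenerate k P e then \<Prod>i<k. a i (e i) else 0)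
      + (\<Sum>(i, j)\<in>?J. if ?hit i j e then \<Prod>m<k. a m (e m) else 0))"
  proof (rule sum_mono)
    fix e
    let ?T = "\<lambda>(i, j). if ?hit i j e then \<Prod>m<k. a m (e m) else 0"
    have T0: "?T ij \<ge> 0" for ij using pr0 by (cases ij) auto
    show "(\<Prod>i<k. a i (e i)) \<le> (if nondegenerate k P e then \<Prod>i<k. a i (e i) else 0) + sum ?T ?J"
    proof (cases "nondegenerate k P e")
      case True
      then show ?thesis using sum_nonneg[of ?J ?T] T0 by simp
    next
      case False
      then obtain i j z where 1: "i < k" "j < k" "i \<noteq> j" "z \<in> e i \<inter> e j" "z \<notin> P i \<inter> P j"
        unfolding nondegenerate_def by blast
      have "\<exists>ij\<in>?J. ?T ij = (\<Prod>m<k. a m (e m))"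
      proof (cases "z \<in> P j")
        case True
        then have "?hit j i e" using 1 by blast
        then show ?thesis using 1 by (intro bexI[of _ "(j, i)"]) auto
      next
        case False
        then have "?hit i j e" using 1 by blast
        then show ?thesis using 1 by (intro bexI[of _ "(i, j)"]) auto
      qed
      then obtain ij where ij: "ij \<in> ?J" "?T ij = (\<Prod>m<k. a m (e m))" by blast
      have "?T ij \<le> sum ?T ?J" by (rule member_le_sum[OF ij(1)]) (use T0 fJ in auto)
      then show ?thesis using ij(2) False by simp
    qed
  qed
  also have "\<dots> = (\<Sum>e\<in>{..<k} \<rightarrow>\<^sub>E V. if nondegenerate k P e then \<Prod>i<k. a i (e i) else 0)
      + (\<Sum>(i, j)\<in>?J. \<Sum>e\<in>{..<k} \<rightarrow>\<^sub>E V. if ?hit i j e then \<Prod>m<k. a m (e m) else 0)"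
    unfolding sum.distrib by (subst sum.swap) (simp only: case_prod_unfold)
  also have "(\<Sum>(i, j)\<in>?J. \<Sum>e\<in>{..<k} \<rightarrow>\<^sub>E V. if ?hit i j e then \<Prod>m<k. a m (e m) else 0) \<le> (\<Sum>ij\<in>?J. real r * \<delta>)"
  proof (rule sum_mono)
    fix ij assume "ij \<in> ?J"
    then obtain i j where ij: "ij = (i, j)" "i < k" "j < k" "i \<noteq> j" by auto
    show "(case ij of (i, j) \<Rightarrow> \<Sum>e\<in>{..<k} \<rightarrow>\<^sub>E V. if ?hit i j e then \<Prod>m<k. a m (e m) else 0) \<le> real r * \<delta>"
      unfolding ij(1) prod.case by (rule pair[OF ij(2-4)])
  qed
  also have "\<dots> = real (card ?J) * (real r * \<delta>)" by simp
  also have "\<dots> \<le> real k ^ 2 * (real r * \<delta>)"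
  proof (rule mult_right_mono)
    have "card ?J \<le> card ({..<k} \<times> {..<k})" by (rule card_mono) auto
    then have "card ?J \<le> k ^ 2" by (simp add: power2_eq_square card_cartesian_product)
    then have "real (card ?J) \<le> real (k ^ 2)" by (rule of_nat_mono)
    then show "real (card ?J) \<le> real k ^ 2" by simp
  qed (use \<delta>0 in simp)
  finally show ?thesis using small by linarith
qed

text \<open>Exchanging \<open>z\<close> for another vertex in an edge through \<open>P \<union> {z}\<close> gives at least \<open>K\<close> edges
  through \<open>P\<close>, and every edge arises from at most \<open>r\<close> others.\<close>

lemma cod_insert_le:
  assumes H: "H \<subseteq> r_subsets r n" and r: "r \<ge> 1" and z: "z \<notin> P"
    and K: "\<And>e S. e \<in> H \<Longrightarrow> S \<subseteq> e \<Longrightarrow> card S = r - 1 \<Longrightarrow> K \<le> cod H S"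
  shows "K * cod H (insert z P) \<le> real r * cod H P"
proof -
  have fH: "finite H" using H finite_r_subsets finite_subset by blast
  have er: "finite e" "card e = r" if "e \<in> H" for e
    using that H finite_subset[of e "{1..n}"] by (auto simp: r_subsets_def)
  let ?A = "{e \<in> H. insert z P \<subseteq> e}" and ?B = "{e \<in> H. P \<subseteq> e}"
  have "K * cod H (insert z P) = (\<Sum>e\<in>?A. K)" by (simp add: cod_def)
  also have "\<dots> \<le> (\<Sum>e\<in>?A. \<Sum>e'\<in>?B. if e - {z} \<subseteq> e' then 1 else 0)"
  proof (rule sum_mono)
    fix e assume e: "e \<in> ?A"
    have "K \<le> cod H (e - {z})" using e er[of e] by (intro K[of e]) (auto simp: card_Diff_singleton)
    also have "\<dots> = (\<Sum>e'\<in>{e' \<in> ?B. e - {z} \<subseteq> e'}. 1)"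
    proof -
      have "{e' \<in> H. e - {z} \<subseteq> e'} = {e' \<in> ?B. e - {z} \<subseteq> e'}" using e z by blast
      then show ?thesis by (simp add: cod_def)
    qed
    also have "\<dots> = (\<Sum>e'\<in>?B. if e - {z} \<subseteq> e' then 1 else 0)"
      using fH by (intro sum.inter_filter) auto
    finally show "K \<le> (\<Sum>e'\<in>?B. if e - {z} \<subseteq> e' then 1 else 0)" .
  qed
  also have "\<dots> = (\<Sum>e'\<in>?B. \<Sum>e\<in>?A. if e - {z} \<subseteq> e' then 1 else 0)" by (rule sum.swap)
  also have "\<dots> \<le> (\<Sum>e'\<in>?B. real r)"
  proof (rule sum_mono)
    fix e' assume e': "e' \<in> ?B"
    have sub: "{e \<in> ?A. e - {z} \<subseteq> e'} \<subseteq> (\<lambda>v. insert z (e' - {v})) ` e'"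
    proof
      fix e assume e: "e \<in> {e \<in> ?A. e - {z} \<subseteq> e'}"
      then have eH: "e \<in> H" "z \<in> e" "e - {z} \<subseteq> e'" by auto
      have "card (e - {z}) = r - 1" using er[OF eH(1)] eH(2) by simp
      then have "card (e' - (e - {z})) = 1"
        using er[of e'] e' eH(3) r er(1)[OF eH(1)] by (simp add: card_Diff_subset)
      then obtain v where v: "e' - (e - {z}) = {v}" by (auto simp: card_1_singleton_iff)
      then have "v \<in> e'" "e' - {v} = e - {z}" using eH(3) by blast+
      then have "e = insert z (e' - {v})" using eH(2) by auto
      then show "e \<in> (\<lambda>v. insert z (e' - {v})) ` e'" using \<open>v \<in> e'\<close> by blast
    qed
    have "(\<Sum>e\<in>?A. if e - {z} \<subseteq> e' then 1 else 0) = (\<Sum>e\<in>{e \<in> ?A. e - {z} \<subseteq> e'}. 1 :: real)"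
      using fH by (intro sum.inter_filter[symmetric]) auto
    also have "\<dots> = real (card {e \<in> ?A. e - {z} \<subseteq> e'})" by simp
    also have "\<dots> \<le> real r"
      using surj_card_le[OF _ sub] er[of e'] e' by simp
    finally show "(\<Sum>e\<in>?A. if e - {z} \<subseteq> e' then 1 else 0) \<le> real r" .
  qed
  also have "\<dots> = real r * cod H P" by (simp add: cod_def)
  finally show ?thesis .
qed

text \<open>\<open>\<mu>\<close> draws a closed walk by \<open>\<nu>\<close>, then for each of its
  pairs an independent uniform edge of \<open>H1\<close> containing it, and keeps the nondegenerate
  outcomes. For each walk these have probability at least one half, so only half of the mass is
  lost.\<close>

lemma expand_cycles:
  fixes H H1 :: "nat set set" and X :: "nat set" and w :: "nat \<Rightarrow> nat \<Rightarrow> real"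
  assumes H: "H \<subseteq> r_subsets r n" and H1: "H1 \<subseteq> H" and r: "r \<ge> 1" and X: "finite X"
    and \<nu>0: "\<And>f. f \<in> {..<Suc k} \<rightarrow>\<^sub>E X \<Longrightarrow> 0 \<le> \<nu> f"
    and \<nu>w: "\<And>f i. f \<in> {..<Suc k} \<rightarrow>\<^sub>E X \<Longrightarrow> \<nu> f \<noteq> 0 \<Longrightarrow> i < k \<Longrightarrow> w (f i) (f (Suc i)) > 0"
    and w0: "\<And>x y. x \<in> X \<Longrightarrow> y \<in> X \<Longrightarrow> 0 \<le> w x y"
    and w_le: "\<And>x y. x \<in> X \<Longrightarrow> y \<in> X \<Longrightarrow> w x y \<le> cod H1 {x, y}"
    and mass: "m \<le> (\<Sum>f\<in>{..<Suc k} \<rightarrow>\<^sub>E X. \<nu> f)"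
    and pos: "tot > 0" "Cs \<ge> 0" "T \<ge> 0" "K > 0"
    and cyc: "\<And>S ab. S \<subseteq> {..<k} \<Longrightarrow> S \<noteq> {} \<Longrightarrow> \<forall>i\<in>S. fst (ab i) \<in> X \<and> snd (ab i) \<in> X \<Longrightarrow>
        (\<Sum>f | f \<in> {..<Suc k} \<rightarrow>\<^sub>E X \<and> (\<forall>i\<in>S. f i = fst (ab i) \<and> f (Suc i) = snd (ab i)). \<nu> f)
          \<le> Cs * (\<Prod>i\<in>S. w (fst (ab i)) (snd (ab i)) / tot) * T ^ (card S - 1)"
    and K: "\<And>e S. e \<in> H1 \<Longrightarrow> S \<subseteq> e \<Longrightarrow> card S = r - 1 \<Longrightarrow> K \<le> cod H1 S"
    and small: "real k ^ 2 * (real r * (real r / K)) \<le> 1 / 2"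
  shows "\<exists>\<mu>. (\<forall>e. 0 \<le> \<mu> e) \<and> m / 2 \<le> (\<Sum>e\<in>{..<k} \<rightarrow>\<^sub>E H. \<mu> e) \<and>
     (\<forall>S\<subseteq>{..<k}. S \<noteq> {} \<longrightarrow> (\<forall>g. marg k H \<mu> S g \<le> (real r ^ 2) ^ card S * (Cs * (1 / tot) ^ card S * T ^ (card S - 1)))) \<and>
     (\<forall>e. \<mu> e \<noteq> 0 \<longrightarrow> (\<exists>f\<in>{..<Suc k} \<rightarrow>\<^sub>E X. \<nu> f \<noteq> 0 \<and> (\<forall>i<k. {f i, f (Suc i)} \<subseteq> e i) \<and>
        nondegenerate k (\<lambda>i. {f i, f (Suc i)}) e))"
proof -
  let ?F = "{..<Suc k} \<rightarrow>\<^sub>E X"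
  have fF: "finite ?F" using X by (intro finite_PiE) auto
  have fH: "finite H" using H finite_r_subsets finite_subset by blast
  have er: "finite e \<and> card e = r" if "e \<in> H" for e
    using that H finite_subset[of e "{1..n}"] by (auto simp: r_subsets_def)
  define P where "P f i = {f i, f (Suc i)}" for f :: "nat \<Rightarrow> nat" and i
  define a where "a f i v = (if v \<in> H1 \<and> P f i \<subseteq> v then 1 / cod H1 (P f i) else 0)" for f i v
  have a0: "a f i v \<ge> 0" for f i v by (simp add: a_def cod_nonneg)
  have FX: "f i \<in> X" if "f \<in> ?F" "i \<le> k" for f i
    using PiE_mem[OF that(1), of i] that(2) by simp
  have codpos: "cod H1 (P f i) > 0" if "f \<in> ?F" "\<nu> f \<noteq> 0" "i < k" for f i
    using \<nu>w[OF that] w_le[OF FX[OF that(1), of i] FX[OF that(1), of "Suc i"]] that(3) by (simp add: P_def)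
  have sumH: "(\<Sum>v\<in>H. if v \<in> H1 \<and> Q \<subseteq> v then c else 0) = cod H1 Q * c" for Q and c :: real
  proof -
    have "(\<Sum>v\<in>H. if v \<in> H1 \<and> Q \<subseteq> v then c else 0) = (\<Sum>v\<in>{v \<in> H. v \<in> H1 \<and> Q \<subseteq> v}. c)"
      using fH by (rule sum.inter_filter[symmetric])
    also have "{v \<in> H. v \<in> H1 \<and> Q \<subseteq> v} = {v \<in> H1. Q \<subseteq> v}" using H1 by blast
    finally show ?thesis by (simp add: cod_def)
  qed
  have a1: "(\<Sum>v\<in>H. a f i v) = 1" if "f \<in> ?F" "\<nu> f \<noteq> 0" "i < k" for f i
    unfolding a_def sumH using codpos[OF that] by simp
  have a\<delta>: "(\<Sum>v\<in>H. if z \<in> v then a f i v else 0) \<le> real r / K" if f: "f \<in> ?F" "\<nu> f \<noteq> 0" "i < k" and z: "z \<notin> P f i" for f i z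
  proof -
    have "(\<Sum>v\<in>H. if z \<in> v then a f i v else 0) = (\<Sum>v\<in>H. if v \<in> H1 \<and> insert z (P f i) \<subseteq> v then 1 / cod H1 (P f i) else 0)"
      by (intro sum.cong) (auto simp: a_def)
    also have "\<dots> = cod H1 (insert z (P f i)) / cod H1 (P f i)" unfolding sumH by simp
    also have "\<dots> \<le> real r / K"
      using cod_insert_le[of H1 r n z "P f i" K] H H1 r z K codpos[OF f] pos(4)
      by (simp add: field_simps)
    finally show ?thesis .
  qed
  define I where "I f e = (if nondegenerate k (P f) e then \<Prod>i<k. a f i (e i) else 0)" for f e
  have I0: "I f e \<ge> 0" for f e unfolding I_def using a0 by (auto intro: prod_nonneg)
  define \<mu> where "\<mu> e = (\<Sum>f\<in>?F. \<nu> f * I f e)" for e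
  have \<mu>0: "\<mu> e \<ge> 0" for e unfolding \<mu>_def using \<nu>0 I0 by (intro sum_nonneg) auto
  have "m / 2 \<le> (\<Sum>f\<in>?F. \<nu> f * (1 / 2))" using mass by (simp add: sum_divide_distrib[symmetric])
  also have "\<dots> \<le> (\<Sum>f\<in>?F. \<nu> f * (\<Sum>e\<in>{..<k} \<rightarrow>\<^sub>E H. I f e))"
  proof (rule sum_mono)
    fix f assume f: "f \<in> ?F"
    show "\<nu> f * (1 / 2) \<le> \<nu> f * (\<Sum>e\<in>{..<k} \<rightarrow>\<^sub>E H. I f e)"
    proof (cases "\<nu> f = 0")
      case False
      have "1 / 2 \<le> (\<Sum>e\<in>{..<k} \<rightarrow>\<^sub>E H. I f e)" unfolding I_def
        by (rule nondegenerate_mass[where \<delta> = "real r / K" and r = r])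
          (use fH a0 a1[OF f False] er pos(4) a\<delta>[OF f False] small in auto)
      then show ?thesis using \<nu>0[OF f] by (rule mult_left_mono)
    qed simp
  qed
  also have "\<dots> = (\<Sum>e\<in>{..<k} \<rightarrow>\<^sub>E H. \<mu> e)"
    unfolding \<mu>_def sum_distrib_left by (rule sum.swap)
  finally have tm: "m / 2 \<le> (\<Sum>e\<in>{..<k} \<rightarrow>\<^sub>E H. \<mu> e)" .
  have mg: "marg k H \<mu> S g \<le> (real r ^ 2) ^ card S * (Cs * (1 / tot) ^ card S * T ^ (card S - 1))"
    if S: "S \<subseteq> {..<k}" "S \<noteq> {}" for S g
  proof -
    have fS: "finite S" using S(1) finite_subset by blast
    \<comment> \<open>A prescribed edge leaves open which ordered pair of its vertices the walk
      used; there are at most r^2 possibilities, whence the factor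
      \<open>(real r ^ 2) ^ card S\<close>.\<close>
    define AB where "AB i = (if g i \<in> H1 then (g i \<inter> X) \<times> (g i \<inter> X) else {})" for i
    have fAB: "finite (AB i)" for i using X by (simp add: AB_def)
    have cAB: "card (AB i) \<le> r ^ 2" for i
    proof (cases "g i \<in> H1")
      case True
      then have "card (g i \<inter> X) \<le> r" using er[of "g i"] H1 card_mono[of "g i" "g i \<inter> X"] by auto
      then show ?thesis using True by (simp add: AB_def card_cartesian_product power2_eq_square mult_le_mono)
    qed (simp add: AB_def)
    let ?c = "\<lambda>ab. \<Prod>i\<in>S. 1 / cod H1 {fst (ab i), snd (ab i)}"
    let ?ag = "\<lambda>f ab. \<forall>i\<in>S. f i = fst (ab i) \<and> f (Suc i) = snd (ab i)"
    have c0: "?c ab \<ge> 0" for ab by (intro prod_nonneg) (simp add: cod_nonneg)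
    have fPi: "finite (PiE S AB)" using fS fAB by (intro finite_PiE) auto
    have aS: "(\<Prod>i\<in>S. a f i (g i)) \<le> (\<Sum>ab\<in>PiE S AB. if ?ag f ab then ?c ab else 0)" if f: "f \<in> ?F" for f
    proof (cases "\<forall>i\<in>S. g i \<in> H1 \<and> P f i \<subseteq> g i")
      case True
      define ab where "ab = restrict (\<lambda>i. (f i, f (Suc i))) S"
      have abP: "ab \<in> PiE S AB"
      proof (rule PiE_I)
        fix i assume i: "i \<in> S"
        then have "f i \<in> X" "f (Suc i) \<in> X" using S(1) by (auto intro!: FX[OF f])
        then show "ab i \<in> AB i" using True i by (auto simp: ab_def AB_def P_def)
      qed (simp add: ab_def)
      have "(\<Prod>i\<in>S. a f i (g i)) = (if ?ag f ab then ?c ab else 0)"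
        using True by (simp add: ab_def a_def P_def)
      also have "\<dots> \<le> (\<Sum>ab\<in>PiE S AB. if ?ag f ab then ?c ab else 0)"
        by (rule member_le_sum[OF abP]) (use c0 fPi in auto)
      finally show ?thesis .
    next
      case False
      then obtain i where i: "i \<in> S" "\<not> (g i \<in> H1 \<and> P f i \<subseteq> g i)" by blast
      then have "a f i (g i) = 0" unfolding a_def by (simp only: if_False)
      with i(1) have "(\<Prod>i\<in>S. a f i (g i)) = 0" using fS by auto
      then show ?thesis using c0 by (simp add: sum_nonneg)
    qed
    have "marg k H \<mu> S g = (\<Sum>f\<in>?F. \<Sum>e | e \<in> {..<k} \<rightarrow>\<^sub>E H \<and> (\<forall>i\<in>S. e i = g i). \<nu> f * I f e)"
      unfolding marg_def \<mu>_def by (rule sum.swap)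
    also have "\<dots> \<le> (\<Sum>f\<in>?F. \<nu> f * (\<Sum>ab\<in>PiE S AB. if ?ag f ab then ?c ab else 0))"
    proof (rule sum_mono)
      fix f assume f: "f \<in> ?F"
      show "(\<Sum>e | e \<in> {..<k} \<rightarrow>\<^sub>E H \<and> (\<forall>i\<in>S. e i = g i). \<nu> f * I f e) \<le> \<nu> f * (\<Sum>ab\<in>PiE S AB. if ?ag f ab then ?c ab else 0)"
      proof (cases "\<nu> f = 0")
        case False
        have "(\<Sum>e | e \<in> {..<k} \<rightarrow>\<^sub>E H \<and> (\<forall>i\<in>S. e i = g i). I f e)
          \<le> (\<Sum>e | e \<in> {..<k} \<rightarrow>\<^sub>E H \<and> (\<forall>i\<in>S. e i = g i). \<Prod>i<k. a f i (e i))"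
          unfolding I_def using a0 by (intro sum_mono) (auto intro: prod_nonneg)
        also have "\<dots> \<le> (\<Prod>i\<in>S. a f i (g i))"
          by (rule prod_marginal_le[OF fH a0 _ S(1)]) (use a1[OF f False] in simp)
        also have "\<dots> \<le> (\<Sum>ab\<in>PiE S AB. if ?ag f ab then ?c ab else 0)" by (rule aS[OF f])
        finally show ?thesis unfolding sum_distrib_left[symmetric] by (rule mult_left_mono) (rule \<nu>0[OF f])
      qed simp
    qed
    also have "\<dots> = (\<Sum>ab\<in>PiE S AB. \<Sum>f\<in>?F. \<nu> f * (if ?ag f ab then ?c ab else 0))"
      unfolding sum_distrib_left by (rule sum.swap)
    also have "\<dots> \<le> (\<Sum>ab\<in>PiE S AB. Cs * (1 / tot) ^ card S * T ^ (card S - 1))"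
    proof (rule sum_mono)
      fix ab assume ab: "ab \<in> PiE S AB"
      have abX: "\<forall>i\<in>S. fst (ab i) \<in> X \<and> snd (ab i) \<in> X"
      proof
        fix i assume "i \<in> S"
        then have "ab i \<in> AB i" by (rule PiE_mem[OF ab])
        then show "fst (ab i) \<in> X \<and> snd (ab i) \<in> X" by (auto simp: AB_def split: if_splits)
      qed
      have "(\<Sum>f\<in>?F. \<nu> f * (if ?ag f ab then ?c ab else 0)) = (\<Sum>f\<in>?F. if ?ag f ab then \<nu> f * ?c ab else 0)"
        by (intro sum.cong) auto
      also have "\<dots> = (\<Sum>f\<in>{f \<in> ?F. ?ag f ab}. \<nu> f * ?c ab)" using fF by (rule sum.inter_filter[symmetric])
      also have "\<dots> = (\<Sum>f | f \<in> ?F \<and> ?ag f ab. \<nu> f) * ?c ab" by (rule sum_distrib_right[symmetric])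
      also have "\<dots> \<le> (Cs * (\<Prod>i\<in>S. w (fst (ab i)) (snd (ab i)) / tot) * T ^ (card S - 1)) * ?c ab"
        using cyc[OF S abX] c0 by (rule mult_right_mono)
      also have "\<dots> = Cs * (\<Prod>i\<in>S. w (fst (ab i)) (snd (ab i)) / tot * (1 / cod H1 {fst (ab i), snd (ab i)})) * T ^ (card S - 1)"
        by (simp only: prod.distrib mult.assoc mult.commute mult.left_commute)
      \<comment> \<open>The probability \<open>1 / cod\<close> of choosing the prescribed edge
        cancels the weight of its pair, which is at most the codegree. This is why pairs are
        weighted by codegree: every edge is left with the same cost \<open>1 / tot\<close>.\<close>
      also have "\<dots> \<le> Cs * (\<Prod>i\<in>S. 1 / tot) * T ^ (card S - 1)"
      proof (intro mult_right_mono mult_left_mono prod_mono conjI)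
        fix i assume "i \<in> S"
        then have xy: "fst (ab i) \<in> X" "snd (ab i) \<in> X" using abX by auto
        show "0 \<le> w (fst (ab i)) (snd (ab i)) / tot * (1 / cod H1 {fst (ab i), snd (ab i)})"
          using w0[OF xy] pos(1) cod_nonneg by simp
        have "w (fst (ab i)) (snd (ab i)) * (1 / cod H1 {fst (ab i), snd (ab i)}) \<le> 1"
          using w_le[OF xy] w0[OF xy] by (auto simp: divide_le_eq_1)
        from divide_right_mono[OF this, of tot]
        show "w (fst (ab i)) (snd (ab i)) / tot * (1 / cod H1 {fst (ab i), snd (ab i)}) \<le> 1 / tot"
          using pos(1) by (simp add: mult.commute)
      qed (use pos in auto)
      finally show "(\<Sum>f\<in>?F. \<nu> f * (if ?ag f ab then ?c ab else 0)) \<le> Cs * (1 / tot) ^ card S * T ^ (card S - 1)" by simp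
    qed
    also have "\<dots> = real (card (PiE S AB)) * (Cs * (1 / tot) ^ card S * T ^ (card S - 1))" by simp
    also have "\<dots> \<le> (real r ^ 2) ^ card S * (Cs * (1 / tot) ^ card S * T ^ (card S - 1))"
    proof (rule mult_right_mono)
      have "card (PiE S AB) = (\<Prod>i\<in>S. card (AB i))" using fS by (rule card_PiE)
      also have "\<dots> \<le> (\<Prod>i\<in>S. r ^ 2)" using cAB by (intro prod_mono) auto
      also have "\<dots> = (r ^ 2) ^ card S" by simp
      finally have "real (card (PiE S AB)) \<le> real ((r ^ 2) ^ card S)" by (rule of_nat_mono)
      then show "real (card (PiE S AB)) \<le> (real r ^ 2) ^ card S" by simp
    qed (use pos in simp)
    finally show ?thesis .
  qed
  have ex: "\<exists>f\<in>?F. \<nu> f \<noteq> 0 \<and> (\<forall>i<k. {f i, f (Suc i)} \<subseteq> e i) \<and> nondegenerate k (\<lambda>i. {f i, f (Suc i)}) e"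
    if "\<mu> e \<noteq> 0" for e
  proof -
    obtain f where f: "f \<in> ?F" "\<nu> f * I f e \<noteq> 0" using sum.not_neutral_contains_not_neutral[OF \<open>\<mu> e \<noteq> 0\<close>[unfolded \<mu>_def]] by blast
    then have nz: "\<nu> f \<noteq> 0" "I f e \<noteq> 0" by auto
    then have nd: "nondegenerate k (P f) e" "(\<Prod>i<k. a f i (e i)) \<noteq> 0" by (auto simp: I_def split: if_splits)
    have "P f i \<subseteq> e i" if "i < k" for i
    proof -
      have "a f i (e i) \<noteq> 0" using nd(2) that by (simp add: prod_zero_iff)
      then show ?thesis by (simp add: a_def split: if_splits)
    qed
    then show ?thesis using f(1) nz nd(1) unfolding P_def by blast
  qed
  show ?thesis
  proof (intro exI[of _ \<mu>] conjI allI impI)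
    show "\<mu> e \<ge> 0" for e by (rule \<mu>0)
  qed (use tm mg ex in auto)
qed

text \<open>In terms of E = n^(1/(2l-1)) the spread parameter is
  \<open>E ^ (2 * l) / card H\<close>. The total weight of the pair graph is at least a quarter of
  \<open>card H\<close>, so each factor \<open>1 / tot\<close> becomes at most
  \<open>4 / card H\<close>; normalising the measure costs a further constant
  \<open>2 / m\<close>.\<close>

lemma supersaturation:
  assumes r: "r \<ge> 4" and l: "l \<ge> 2"
  shows "\<exists>(K::real) (C::real) (n0::nat). K \<ge> 1 \<and> C \<ge> 1 \<and> n0 \<ge> 1 \<and>
    (\<forall>n\<ge>n0. \<forall>H\<subseteq>r_subsets r n. K * real n ^ (r - 1) \<le> real (card H) \<longrightarrow>
      (\<exists>\<mu>. spread (2 * l) H \<mu> C (real n powr (1 + 1 / (2 * real l - 1)) / real (card H)) \<and>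
        (\<forall>e\<in>{..<2 * l} \<rightarrow>\<^sub>E H. \<mu> e \<noteq> 0 \<longrightarrow> (\<exists>f. f (2 * l) = f 0 \<and> inj_on f {..<2 * l} \<and>
           (\<forall>i<2 * l. {f i, f (Suc i)} \<subseteq> e i) \<and> nondegenerate (2 * l) (\<lambda>i. {f i, f (Suc i)}) e))))"
proof -
  define \<kappa> D B \<Theta> where "\<kappa> = 1 / (16 * real r ^ 3)" and "D = 4 * real r ^ 2" and "B = 2 * D / \<kappa>"
    and "\<Theta> = 2 * B * D * (2 * real l) ^ 2 * (16 * real l ^ 2) ^ (2 * l)"
  define m Cs where "m = 1 / (2 * (16 * real l ^ 2) ^ (2 * l))" and "Cs = (B / \<kappa>) ^ (2 * l) * (2 * B * D / \<kappa>)"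
  \<comment> \<open>Edges through an \<open>(r - 1)\<close>-set number at least
    \<open>K / 4\<close>, so the union bound for nondegeneracy is (2l)^2 * r * (4r / K), which is
    exactly 1/2.\<close>
  define K where "K = 32 * real l ^ 2 * real r ^ 2"
  define C where "C = max 1 ((4 * real r ^ 2) ^ (2 * l) * Cs * (2 / m))"
  \<comment> \<open>Ensures \<open>\<Theta> \<le> E\<close>, the size demanded by the collision
    estimate in \<open>spread_cycles\<close>.\<close>
  define n0 where "n0 = nat \<lceil>\<Theta> ^ (2 * l - 1)\<rceil> + 1"
  have pos: "\<kappa> > 0" "D > 0" "B > 0" "\<Theta> > 0" "m > 0" "Cs > 0"
    using r l by (auto simp: \<kappa>_def D_def B_def \<Theta>_def m_def Cs_def)
  have l1: "1 \<le> real l ^ 2" and r1: "1 \<le> real r ^ 2" using r l by (auto intro: one_le_power)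
  have K4: "K \<ge> 4"
  proof -
    have "4 \<le> 32 * real l ^ 2" using l1 by linarith
    also have "\<dots> * 1 \<le> 32 * real l ^ 2 * real r ^ 2" using r1 l1 by (intro mult_left_mono) auto
    finally show ?thesis by (simp add: K_def)
  qed
  have main: "\<exists>\<mu>. spread (2 * l) H \<mu> C (real n powr (1 + 1 / (2 * real l - 1)) / real (card H)) \<and>
        (\<forall>e\<in>{..<2 * l} \<rightarrow>\<^sub>E H. \<mu> e \<noteq> 0 \<longrightarrow> (\<exists>f. f (2 * l) = f 0 \<and> inj_on f {..<2 * l} \<and>
           (\<forall>i<2 * l. {f i, f (Suc i)} \<subseteq> e i) \<and> nondegenerate (2 * l) (\<lambda>i. {f i, f (Suc i)}) e))"
    if n: "n \<ge> n0" and H: "H \<subseteq> r_subsets r n" and big: "K * real n ^ (r - 1) \<le> real (card H)" for n H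
  proof -
    have n1: "n \<ge> 1" using n by (simp add: n0_def)
    define E where "E = real n powr (1 / (2 * real l - 1))"
    have rl: "real (2 * l - 1) = 2 * real l - 1" using l by (simp add: of_nat_diff)
    have E1: "E \<ge> 1" unfolding E_def using n1 l by (intro ge_one_powr_ge_zero) auto
    have Ep: "E ^ j = real n powr (real j / (2 * real l - 1))" for j
      unfolding E_def using n1 by (simp add: powr_power)
    have En: "E ^ (2 * l - 1) = real n"
      unfolding Ep rl using l n1 by simp
    have ET: "E ^ (2 * l) = real n powr (1 + 1 / (2 * real l - 1))"
    proof -
      have "real (2 * l) / (2 * real l - 1) = 1 + 1 / (2 * real l - 1)" using l by (simp add: field_simps)
      then show ?thesis unfolding Ep by (simp only:)
    qed
    have E\<Theta>: "\<Theta> \<le> E"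
    proof -
      have "\<Theta> ^ (2 * l - 1) \<le> real n" using n unfolding n0_def by linarith
      then have "\<Theta> ^ (2 * l - 1) \<le> E ^ (2 * l - 1)" using En by simp
      then show ?thesis using E1 l by (subst (asm) power_mono_iff) (use pos in auto)
    qed
    obtain H1 where H1: "H1 \<subseteq> H" "real (card H) \<le> 2 * real (card H1)"
      and d1: "\<And>e S. e \<in> H1 \<Longrightarrow> S \<subseteq> e \<Longrightarrow> card S = r - 1 \<Longrightarrow> K / 4 \<le> cod H1 S"
      and d2: "\<And>e x. e \<in> H1 \<Longrightarrow> x \<in> e \<Longrightarrow> real (card H) / (4 * real n) \<le> cod H1 {x}"
      by (rule clean_hypergraph[OF H r n1 _ big], use K4 in linarith, rule that)
    have fH: "finite H" using H finite_r_subsets finite_subset by blast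
    have np: "real n ^ (r - 1) \<ge> 1" using n1 by (intro one_le_power) auto
    have "4 * real n ^ (r - 1) \<le> K * real n ^ (r - 1)" using K4 np by (intro mult_right_mono) auto
    then have bigH: "4 * real n ^ (r - 1) \<le> real (card H)" using big by linarith
    then have big1: "2 * real n ^ (r - 1) \<le> real (card H1)" using H1(2) by linarith
    have c1: "card H1 > 0" using big1 np by linarith
    have c2: "real (card H) > 0" using bigH np by linarith
    have H1r: "H1 \<subseteq> r_subsets r n" using H1(1) H by blast
    have le1: "real (card H1) \<le> real (card H)" using card_mono[OF fH H1(1)] by simp
    obtain X w where ww: "weighted_walk X w E (1 / (16 * real r ^ 3)) (4 * real r ^ 2) l" and X: "X \<subseteq> {1..n}"
      and tot: "real (card H) / 4 \<le> (\<Sum>x\<in>X. \<Sum>y\<in>X. w x y)"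
      and wle: "\<And>x y. x \<in> X \<Longrightarrow> y \<in> X \<Longrightarrow> w x y \<le> cod H1 {x, y}"
      by (rule weighted_walk_exists[OF H1r r l E1 En big1 c1 le1 H1(2) d2], assumption, assumption, rule that)
    interpret W: weighted_walk X w E \<kappa> D l using ww by (simp add: \<kappa>_def D_def)
    have WB: "W.B = B" by (simp add: W.B_def B_def)
    have Wt: "real (card H) / 4 \<le> W.tot" using tot by (simp add: W.tot_def W.deg_def)
    have "E \<ge> 2 * W.B * D * (2 * real l) ^ 2 * (16 * real l ^ 2) ^ (2 * l)" using E\<Theta> by (simp add: WB \<Theta>_def)
    from W.spread_cycles[OF this] obtain \<nu> where
      \<nu>1: "\<forall>f\<in>W.Wk (2 * l). 0 \<le> \<nu> f \<and>
        (\<nu> f \<noteq> 0 \<longrightarrow> f (2 * l) = f 0 \<and> inj_on f {..<2 * l} \<and> (\<forall>i<2 * l. w (f i) (f (Suc i)) > 0))"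
      and \<nu>2: "m \<le> (\<Sum>f\<in>W.Wk (2 * l). \<nu> f)"
      and \<nu>3: "\<forall>S\<subseteq>{..<2 * l}. S \<noteq> {} \<longrightarrow> (\<forall>ab. (\<forall>i\<in>S. fst (ab i) \<in> X \<and> snd (ab i) \<in> X) \<longrightarrow>
        (\<Sum>f | f \<in> W.Wk (2 * l) \<and> (\<forall>i\<in>S. f i = fst (ab i) \<and> f (Suc i) = snd (ab i)). \<nu> f)
          \<le> Cs * (\<Prod>i\<in>S. w (fst (ab i)) (snd (ab i)) / W.tot) * (E ^ (2 * l)) ^ (card S - 1))"
      unfolding WB m_def[symmetric] Cs_def[symmetric] by (elim exE conjE) (rule that)
    have small: "real (2 * l) ^ 2 * (real r * (real r / (K / 4))) \<le> 1 / 2"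
      using r l by (simp add: K_def power2_eq_square)
    have "\<exists>\<mu>. (\<forall>e. 0 \<le> \<mu> e) \<and> m / 2 \<le> (\<Sum>e\<in>{..<2 * l} \<rightarrow>\<^sub>E H. \<mu> e) \<and>
     (\<forall>S\<subseteq>{..<2 * l}. S \<noteq> {} \<longrightarrow> (\<forall>g. marg (2 * l) H \<mu> S g
        \<le> (real r ^ 2) ^ card S * (Cs * (1 / W.tot) ^ card S * (E ^ (2 * l)) ^ (card S - 1)))) \<and>
     (\<forall>e. \<mu> e \<noteq> 0 \<longrightarrow> (\<exists>f\<in>{..<Suc (2 * l)} \<rightarrow>\<^sub>E X. \<nu> f \<noteq> 0 \<and> (\<forall>i<2 * l. {f i, f (Suc i)} \<subseteq> e i) \<and>
        nondegenerate (2 * l) (\<lambda>i. {f i, f (Suc i)}) e))"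
    proof (rule expand_cycles[OF H H1(1) _ W.finX, where w = w and K = "K / 4"])
      show "w (f i) (f (Suc i)) > 0" if "f \<in> W.Wk (2 * l)" "\<nu> f \<noteq> 0" "i < 2 * l" for f i
        using \<nu>1 that by blast
      show "(\<Sum>f | f \<in> W.Wk (2 * l) \<and> (\<forall>i\<in>S. f i = fst (ab i) \<and> f (Suc i) = snd (ab i)). \<nu> f)
          \<le> Cs * (\<Prod>i\<in>S. w (fst (ab i)) (snd (ab i)) / W.tot) * (E ^ (2 * l)) ^ (card S - 1)"
        if "S \<subseteq> {..<2 * l}" "S \<noteq> {}" "\<forall>i\<in>S. fst (ab i) \<in> X \<and> snd (ab i) \<in> X" for S ab
        using \<nu>3[rule_format, OF that(1,2)] that(3) by simp
      show "1 \<le> r" "0 < K / 4" "0 \<le> Cs" "0 < W.tot" "0 \<le> E ^ (2 * l)"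
        using r K4 pos W.tot0 E1 by auto
      show "m \<le> (\<Sum>f\<in>W.Wk (2 * l). \<nu> f)" by (rule \<nu>2)
      show "\<nu> f \<ge> 0" if "f \<in> W.Wk (2 * l)" for f using \<nu>1 that by blast
      show "K / 4 \<le> cod H1 S" if "e \<in> H1" "S \<subseteq> e" "card S = r - 1" for e S by (rule d1[OF that])
      show "w x y \<le> cod H1 {x, y}" if "x \<in> X" "y \<in> X" for x y by (rule wle[OF that])
      show "w x y \<ge> 0" if "x \<in> X" "y \<in> X" for x y by (rule W.w_nonneg[OF that])
    qed (rule small)
    then obtain \<mu> where \<mu>0: "\<forall>e. 0 \<le> \<mu> e" and mm: "m / 2 \<le> (\<Sum>e\<in>{..<2 * l} \<rightarrow>\<^sub>E H. \<mu> e)"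
      and mg: "\<forall>S\<subseteq>{..<2 * l}. S \<noteq> {} \<longrightarrow> (\<forall>g. marg (2 * l) H \<mu> S g
        \<le> (real r ^ 2) ^ card S * (Cs * (1 / W.tot) ^ card S * (E ^ (2 * l)) ^ (card S - 1)))"
      and ex: "\<forall>e. \<mu> e \<noteq> 0 \<longrightarrow> (\<exists>f\<in>{..<Suc (2 * l)} \<rightarrow>\<^sub>E X. \<nu> f \<noteq> 0 \<and> (\<forall>i<2 * l. {f i, f (Suc i)} \<subseteq> e i) \<and>
        nondegenerate (2 * l) (\<lambda>i. {f i, f (Suc i)}) e)"
      by (elim exE conjE) (rule that)
    define Z where "Z = (\<Sum>e\<in>{..<2 * l} \<rightarrow>\<^sub>E H. \<mu> e)"
    have Z: "Z > 0" "m / 2 \<le> Z" using mm pos by (auto simp: Z_def)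
    define T where "T = E ^ (2 * l)"
    have T0: "T \<ge> 0" using E1 by (simp add: T_def)
    let ?\<mu> = "\<lambda>e. \<mu> e / Z"
    have "marg (2 * l) H ?\<mu> S g \<le> C / real (card H) * (T / real (card H)) ^ (card S - 1)"
      if S: "S \<subseteq> {..<2 * l}" "S \<noteq> {}" for S g
    proof -
      define s where "s = card S"
      have s: "1 \<le> s" "s \<le> 2 * l"
        using S card_mono[OF _ S(1)] finite_subset[OF S(1)] by (auto simp: s_def Suc_le_eq card_gt_0_iff)
      have "marg (2 * l) H ?\<mu> S g = marg (2 * l) H \<mu> S g / Z" unfolding marg_def by (rule sum_divide_distrib[symmetric])
      also have "\<dots> \<le> ((real r ^ 2) ^ s * (Cs * (1 / W.tot) ^ s * T ^ (s - 1))) / Z"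
        using mg S Z(1) unfolding s_def T_def by (intro divide_right_mono) auto
      also have "\<dots> \<le> ((real r ^ 2) ^ s * (Cs * (4 / real (card H)) ^ s * T ^ (s - 1))) / (m / 2)"
      proof (rule frac_le)
        have "1 / W.tot \<le> 4 / real (card H)" using Wt c2 W.tot0 by (simp add: field_simps)
        then have "(1 / W.tot) ^ s \<le> (4 / real (card H)) ^ s" using W.tot0 by (intro power_mono) auto
        then show "(real r ^ 2) ^ s * (Cs * (1 / W.tot) ^ s * T ^ (s - 1)) \<le> (real r ^ 2) ^ s * (Cs * (4 / real (card H)) ^ s * T ^ (s - 1))"
          using pos(6) T0 by (intro mult_left_mono mult_right_mono) auto
      qed (use Z pos T0 in auto)
      also have "\<dots> = (4 * real r ^ 2) ^ s * Cs * (2 / m) * (1 / real (card H)) ^ s * T ^ (s - 1)"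
        by (simp add: power_mult_distrib power_divide mult_ac)
      also have "\<dots> \<le> C * (1 / real (card H)) ^ s * T ^ (s - 1)"
      proof (intro mult_right_mono)
        have "(4 * real r ^ 2) ^ s * Cs * (2 / m) \<le> (4 * real r ^ 2) ^ (2 * l) * Cs * (2 / m)"
          using pos r1 s by (intro mult_right_mono power_increasing) auto
        then show "(4 * real r ^ 2) ^ s * Cs * (2 / m) \<le> C" by (simp add: C_def)
      qed (use T0 in auto)
      also have "(1 / real (card H)) ^ s = 1 / real (card H) * (1 / real (card H)) ^ (s - 1)"
        using s(1) by (metis power_eq_if not_one_le_zero)
      also have "C * (1 / real (card H) * (1 / real (card H)) ^ (s - 1)) * T ^ (s - 1)
         = C / real (card H) * (T / real (card H)) ^ (s - 1)" by (simp add: power_divide)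
      finally show ?thesis by (simp only: s_def)
    qed
    moreover have "(\<Sum>e\<in>{..<2 * l} \<rightarrow>\<^sub>E H. ?\<mu> e) = 1"
      unfolding sum_divide_distrib[symmetric] Z_def[symmetric] using Z(1) by simp
    ultimately have "spread (2 * l) H ?\<mu> C (T / real (card H))"
      unfolding spread_def using \<mu>0 Z(1) by simp
    moreover have "\<exists>f. f (2 * l) = f 0 \<and> inj_on f {..<2 * l} \<and>
           (\<forall>i<2 * l. {f i, f (Suc i)} \<subseteq> e i) \<and> nondegenerate (2 * l) (\<lambda>i. {f i, f (Suc i)}) e" if "?\<mu> e \<noteq> 0" for e
    proof -
      have "\<mu> e \<noteq> 0" using that by auto
      then obtain f where "f \<in> W.Wk (2 * l)" "\<nu> f \<noteq> 0" "\<forall>i<2 * l. {f i, f (Suc i)} \<subseteq> e i"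
        "nondegenerate (2 * l) (\<lambda>i. {f i, f (Suc i)}) e" using ex by blast
      then show ?thesis using \<nu>1 by blast
    qed
    ultimately show ?thesis unfolding T_def ET by blast
  qed
  show ?thesis
  proof (rule exI[of _ K], rule exI[of _ C], rule exI[of _ n0], intro conjI allI impI)
    show "1 \<le> K" "1 \<le> C" "1 \<le> n0" using K4 by (auto simp: C_def n0_def)
  qed (rule main)
qed

section \<open>Nondegenerate expansions are linear cycles\<close>

definition cycle_free :: "nat \<Rightarrow> 'a set set \<Rightarrow> bool" where
  "cycle_free k I \<longleftrightarrow> \<not> (\<exists>e f. (\<forall>i<k. e i \<in> I) \<and> f k = f 0 \<and> inj_on f {..<k} \<and>
     (\<forall>i<k. {f i, f (Suc i)} \<subseteq> e i) \<and> nondegenerate k (\<lambda>i. {f i, f (Suc i)}) e)"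

text \<open>Each edge consists of the two walk vertices \<open>f i\<close>, \<open>f (Suc i)\<close>
  and \<open>r - 2\<close> private vertices, which by nondegeneracy lie in no other edge. Listing,
  edge by edge, the private vertices and then \<open>f (Suc i)\<close> gives the labels of the
  linear cycle.\<close>

lemma contains_linear_cycle:
  fixes G :: "'a hypergraph"
  assumes r: "r \<ge> 3" and k: "k \<ge> 2"
    and G: "\<And>A. A \<in> edges G \<Longrightarrow> finite A \<and> card A = r \<and> A \<subseteq> verts G"
    and nc: "\<not> cycle_free k (edges G)"
  shows "contains_copy G (linear_cycle r k)"
proof -
  from nc obtain e f where e: "\<forall>i<k. e i \<in> edges G" and fk: "f k = f 0" and inj: "inj_on f {..<k}"
    and fe: "\<forall>i<k. {f i, f (Suc i)} \<subseteq> e i" and nd: "nondegenerate k (\<lambda>i. {f i, f (Suc i)}) e"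
    unfolding cycle_free_def not_not by (elim exE conjE) (rule that)
  have inj': "i = j" if "f (Suc i) = f (Suc j)" "i < k" "j < k" for i j
  proof -
    have *: "f (Suc m) = f (if Suc m = k then 0 else Suc m)" if "m < k" for m using fk by simp
    have "(if Suc i = k then 0 else Suc i) = (if Suc j = k then 0 else Suc j)"
      by (rule inj_onD[OF inj]) (use that *[of i] *[of j] k in auto)
    then show ?thesis using k by (auto split: if_splits)
  qed
  have ne: "f i \<noteq> f (Suc i)" if "i < k" for i
  proof (cases "Suc i = k")
    case True
    then show ?thesis using inj_onD[OF inj, of i 0] fk k by auto
  next
    case False
    then show ?thesis using inj_onD[OF inj, of i "Suc i"] that by auto
  qed
  define M where "M i = e i - {f i, f (Suc i)}" for i
  have Mc: "finite (M i) \<and> card (M i) = r - 2" if i: "i < k" for i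
  proof -
    have "finite (e i)" "card (e i) = r" using G[of "e i"] e i by auto
    then show ?thesis using fe i ne[OF i] by (simp add: M_def card_Diff_subset)
  qed
  have "\<exists>b. \<forall>i<k. bij_betw (b i) {0..<r - 2} (M i)"
  proof -
    have "\<forall>i. \<exists>b. i < k \<longrightarrow> bij_betw b {0..<r - 2} (M i)"
      using Mc ex_bij_betw_nat_finite by metis
    then show ?thesis by metis
  qed
  then obtain b where b: "\<And>i. i < k \<Longrightarrow> bij_betw (b i) {0..<r - 2} (M i)" by blast
  define q where "q = r - 1"
  have q: "q \<ge> 2" "r - 2 = q - 1" using r by (auto simp: q_def)
  \<comment> \<open>Block i has length \<open>q = r - 1\<close> and ends with the vertex shared with
    the next edge. Labels start at 1, so \<open>\<psi> i s\<close> receives the label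
    \<open>i * q + s + 1\<close>.\<close>
  define \<psi> where "\<psi> i s = (if s = q - 1 then f (Suc i) else b i s)" for i s
  define \<phi> where "\<phi> j = \<psi> ((j - 1) div q) ((j - 1) mod q)" for j
  have \<phi>: "\<phi> (i * q + s + 1) = \<psi> i s" if "s < q" for i s
    using that by (simp add: \<phi>_def)
  have \<psi>b: "\<psi> i s \<in> M i" if "i < k" "s < q" "s \<noteq> q - 1" for i s
    using bij_betwE[OF b[OF that(1)], rule_format, of s] that q by (simp add: \<psi>_def)
  have sep: "x \<notin> e j" if "x \<in> M i" "i \<noteq> j" "i < k" "j < k" for x i j
    using that nd unfolding nondegenerate_def M_def by blast
  have \<psi>i: "i = i' \<and> s = s'" if eq: "\<psi> i s = \<psi> i' s'" and i: "i < k" "i' < k" and s: "s < q" "s' < q" for i i' s s'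
  proof (cases "s = q - 1")
    case s1: True
    show ?thesis
    proof (cases "s' = q - 1")
      case True
      then show ?thesis using eq s1 inj'[OF _ i] by (simp add: \<psi>_def)
    next
      case False
      have "f (Suc i) \<in> M i'" using \<psi>b[OF i(2) s(2) False] eq s1 by (simp add: \<psi>_def)
      moreover have "f (Suc i) \<in> e i" using fe i by blast
      ultimately have "i' = i" using sep[of "f (Suc i)" i' i] i by blast
      then show ?thesis using \<open>f (Suc i) \<in> M i'\<close> by (simp add: M_def)
    qed
  next
    case s1: False
    have m: "\<psi> i s \<in> M i" by (rule \<psi>b[OF i(1) s(1) s1])
    show ?thesis
    proof (cases "s' = q - 1")
      case True
      have "f (Suc i') \<in> M i" using m eq True by (simp add: \<psi>_def)
      moreover have "f (Suc i') \<in> e i'" using fe i by blast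
      ultimately have "i' = i" using sep[of "f (Suc i')" i i'] i by blast
      then show ?thesis using \<open>f (Suc i') \<in> M i\<close> by (simp add: M_def)
    next
      case False
      have m': "\<psi> i s \<in> M i'" using \<psi>b[OF i(2) s(2) False] eq by simp
      then have "\<psi> i s \<in> e i'" by (simp add: M_def)
      then have ii: "i = i'" using sep[OF m] i by blast
      then have "b i s = b i s'" using eq s1 False by (simp add: \<psi>_def)
      then have "s = s'" using inj_onD[OF bij_betw_imp_inj_on[OF b[OF i(1)]]] s s1 False q by auto
      then show ?thesis using ii by simp
    qed
  qed
  have dec: "\<exists>i s. j = i * q + s + 1 \<and> i < k \<and> s < q" if "j \<in> {1..k * q}" for j
  proof (rule exI[of _ "(j - 1) div q"], rule exI[of _ "(j - 1) mod q"], intro conjI)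
    show "j = (j - 1) div q * q + (j - 1) mod q + 1" using that by simp
    show "(j - 1) div q < k" using that q by (intro less_mult_imp_div_less) auto
    show "(j - 1) mod q < q" using q by simp
  qed
  have edge: "\<phi> ` (\<lambda>j. if j = 0 then k * q else j) ` {(i - 1) * q..i * q} = e (i - 1)" if i: "i \<in> {1..k}" for i
  proof -
    define i' where "i' = i - 1"
    have i': "i = Suc i'" "i' < k" using i by (auto simp: i'_def)
    have "{i' * q..i * q} = insert (i' * q) ((\<lambda>s. i' * q + s + 1) ` {..<q})"
    proof -
      have "{i' * q..i * q} = insert (i' * q) {i' * q + 1..<i' * q + 1 + q}" using i'(1) by auto
      also have "{i' * q + 1..<i' * q + 1 + q} = (\<lambda>s. i' * q + s + 1) ` {..<q}"
      proof (intro subset_antisym subsetI)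
        fix j assume "j \<in> {i' * q + 1..<i' * q + 1 + q}"
        then have "j = i' * q + (j - i' * q - 1) + 1" "j - i' * q - 1 \<in> {..<q}" by auto
        then show "j \<in> (\<lambda>s. i' * q + s + 1) ` {..<q}" by (rule image_eqI)
      qed auto
      finally show ?thesis .
    qed
    then have "\<phi> ` (\<lambda>j. if j = 0 then k * q else j) ` {i' * q..i * q}
      = insert (\<phi> (if i' * q = 0 then k * q else i' * q)) ((\<lambda>s. \<phi> (if i' * q + s + 1 = 0 then k * q else i' * q + s + 1)) ` {..<q})"
      by (simp only: image_insert image_image)
    also have "(\<lambda>s. \<phi> (if i' * q + s + 1 = 0 then k * q else i' * q + s + 1)) = (\<lambda>s. \<phi> (i' * q + s + 1))" by simp
    also have "\<phi> (if i' * q = 0 then k * q else i' * q) = f i'"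
    \<comment> \<open>The first vertex of an edge is the last label of the preceding block. For the
      first edge this is label 0, replaced by \<open>k * q\<close>, the last label of the last
      block; the two agree because \<open>f k = f 0\<close>.\<close>
    proof (cases i')
      case 0
      have "k * q = (k - 1) * q + (q - 1) + 1" using q k by (cases k) auto
      then show ?thesis using \<phi>[of "q - 1" "k - 1"] q k 0 fk by (simp add: \<psi>_def)
    next
      case (Suc m)
      have "i' * q = m * q + (q - 1) + 1" using q Suc by auto
      moreover have "\<phi> (m * q + (q - 1) + 1) = f (Suc m)"
        using \<phi>[of "q - 1" m] q by (simp add: \<psi>_def)
      ultimately have "\<phi> (i' * q) = f i'" using Suc by (simp only:)
      then show ?thesis using q Suc by simp
    qed
    also have "(\<lambda>s. \<phi> (i' * q + s + 1)) ` {..<q} = \<psi> i' ` {..<q}" by (rule image_cong[OF refl \<phi>]) simp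
    also have "{..<q} = insert (q - 1) {0..<r - 2}" using q by auto
    also have "\<psi> i' ` insert (q - 1) {0..<r - 2} = insert (f (Suc i')) (b i' ` {0..<r - 2})"
      using q by (auto simp: \<psi>_def)
    also have "b i' ` {0..<r - 2} = M i'" using b[OF i'(2)] by (simp add: bij_betw_def)
    also have "insert (f i') (insert (f (Suc i')) (M i')) = e i'" using fe i'(2) by (auto simp: M_def)
    finally show ?thesis by (simp only: i'_def)
  qed
  show ?thesis unfolding contains_copy_def
  proof (intro exI[of _ \<phi>] conjI)
    show "inj_on \<phi> (verts (linear_cycle r k))"
    proof (rule inj_onI)
      fix x y assume "x \<in> verts (linear_cycle r k)" "y \<in> verts (linear_cycle r k)" and eq: "\<phi> x = \<phi> y"
      then have "x \<in> {1..k * q}" "y \<in> {1..k * q}" by (auto simp: linear_cycle_def q_def)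
      with dec obtain i s i' s' where x: "x = i * q + s + 1" "i < k" "s < q" and y: "y = i' * q + s' + 1" "i' < k" "s' < q"
        by meson
      have "\<psi> i s = \<psi> i' s'" using eq unfolding x(1) y(1) \<phi>[OF x(3)] \<phi>[OF y(3)] .
      then have "i = i' \<and> s = s'" by (rule \<psi>i) (use x y in auto)
      then show "x = y" using x y by simp
    qed
    have ed: "(\<lambda>A. \<phi> ` A) ` edges (linear_cycle r k) = (\<lambda>i. e (i - 1)) ` {1..k}"
      unfolding linear_cycle_def hypergraph.simps image_image[of "\<lambda>A. \<phi> ` A"] q_def[symmetric]
      by (rule image_cong[OF refl edge])
    have vs: "\<phi> ` {1..k * q} \<subseteq> \<Union> (e ` {..<k})"
    proof (rule image_subsetI)
      fix j assume "j \<in> {1..k * q}"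
      with dec obtain i s where x: "j = i * q + s + 1" "i < k" "s < q" by meson
      have "\<psi> i s \<in> e i"
      proof (cases "s = q - 1")
        case True
        then show ?thesis using fe x(2) by (simp add: \<psi>_def)
      next
        case False
        then show ?thesis using \<psi>b[OF x(2,3)] by (simp add: M_def)
      qed
      then show "\<phi> j \<in> \<Union> (e ` {..<k})" unfolding x(1) \<phi>[OF x(3)] using x(2) by blast
    qed
    have lv: "verts (linear_cycle r k) = {1..k * q}" by (simp add: linear_cycle_def q_def)
    show "subhypergraph (map_hypergraph \<phi> (linear_cycle r k)) G"
      unfolding subhypergraph_def map_hypergraph_def hypergraph.simps ed lv
    proof (intro conjI ballI)
      show "\<phi> ` {1..k * q} \<subseteq> verts G" using vs e G by blast
      show "(\<lambda>i. e (i - 1)) ` {1..k} \<subseteq> edges G" using e by auto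
      fix A assume "A \<in> (\<lambda>i. e (i - 1)) ` {1..k}"
      then obtain i where i: "i \<in> {1..k}" "A = e (i - 1)" by blast
      have "(\<lambda>j. if j = 0 then k * q else j) ` {(i - 1) * q..i * q} \<subseteq> {1..k * q}"
      proof (rule image_subsetI)
        fix j assume j: "j \<in> {(i - 1) * q..i * q}"
        have "j \<le> i * q" using j by simp
        also have "i * q \<le> k * q" using i by (intro mult_le_mono1) auto
        finally have "j \<le> k * q" .
        moreover have "1 \<le> k * q" using q k by (simp add: Suc_le_eq)
        ultimately show "(if j = 0 then k * q else j) \<in> {1..k * q}" using j by auto
      qed
      then show "A \<subseteq> \<phi> ` {1..k * q}" unfolding i(2) edge[OF i(1), symmetric] by (rule image_mono)
    qed
  qed
qed

section \<open>Containers for cycle-free hypergraphs and the random hypergraph\<close>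

lemma coverable_self: "real (card V) \<le> s \<Longrightarrow> M \<ge> 1 \<Longrightarrow> coverable V Q s M"
  unfolding coverable_def by (intro exI[of _ "{V}"]) auto

lemma coverable_refine:
  assumes cov: "coverable V Q t M1" and fV: "finite V"
    and sub: "\<And>W. W \<subseteq> V \<Longrightarrow> real (card W) \<le> t \<Longrightarrow> coverable W Q s M2"
  shows "coverable V Q s (M1 * M2)"
proof -
  obtain \<C> where C: "finite \<C>" "card \<C> \<le> M1" "\<forall>C\<in>\<C>. C \<subseteq> V \<and> real (card C) \<le> t"
      "\<forall>I. I \<subseteq> V \<longrightarrow> Q I \<longrightarrow> (\<exists>C\<in>\<C>. I \<subseteq> C)"
    using cov unfolding coverable_def by (elim exE conjE) (rule that)
  have "\<forall>C\<in>\<C>. \<exists>\<D>. finite \<D> \<and> card \<D> \<le> M2 \<and> (\<forall>D\<in>\<D>. D \<subseteq> C \<and> real (card D) \<le> s) \<and>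
      (\<forall>I. I \<subseteq> C \<longrightarrow> Q I \<longrightarrow> (\<exists>D\<in>\<D>. I \<subseteq> D))"
    using sub C(3) unfolding coverable_def by simp
  then obtain \<D> where D: "\<forall>C\<in>\<C>. finite (\<D> C) \<and> card (\<D> C) \<le> M2 \<and> (\<forall>D\<in>\<D> C. D \<subseteq> C \<and> real (card D) \<le> s) \<and>
      (\<forall>I. I \<subseteq> C \<longrightarrow> Q I \<longrightarrow> (\<exists>D\<in>\<D> C. I \<subseteq> D))"
    by (rule bchoice[THEN exE])
  have "card (\<Union>C\<in>\<C>. \<D> C) \<le> (\<Sum>C\<in>\<C>. card (\<D> C))" using C(1) by (rule card_UN_le)
  also have "\<dots> \<le> (\<Sum>C\<in>\<C>. M2)" using D by (intro sum_mono) auto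
  also have "\<dots> \<le> M1 * M2" using C(2) by simp
  finally have le: "card (\<Union>C\<in>\<C>. \<D> C) \<le> M1 * M2" .
  show ?thesis unfolding coverable_def
  proof (intro exI[of _ "\<Union>C\<in>\<C>. \<D> C"] conjI allI impI ballI)
    show "finite (\<Union>C\<in>\<C>. \<D> C)" using C(1) D by blast
    show "card (\<Union>C\<in>\<C>. \<D> C) \<le> M1 * M2" by (rule le)
    show "W \<subseteq> V" "real (card W) \<le> s" if "W \<in> (\<Union>C\<in>\<C>. \<D> C)" for W using that C(3) D by blast+
    show "\<exists>W\<in>\<Union>C\<in>\<C>. \<D> C. I \<subseteq> W" if I: "I \<subseteq> V" "Q I" for I
    proof -
      obtain C' where C': "C' \<in> \<C>" "I \<subseteq> C'" using C(4) I by blast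
      then obtain D' where "D' \<in> \<D> C'" "I \<subseteq> D'" using D I(2) by blast
      then show ?thesis using C'(1) by blast
    qed
  qed
qed

text \<open>With T = n^(1+1/(2l-1)), the spread parameter of every container H is T /
  \<open>card H\<close>, so the number of edges accepted in a round does not depend on the size of
  H. Each round shrinks containers by the factor \<open>1 - c\<close> until supersaturation stops
  applying. One logarithm in the bound counts rounds, the other comes from choosing accepted edges
  among at most n^r.\<close>

lemma cycle_free_containers:
  assumes r: "r \<ge> 4" and l: "l \<ge> 2"
  shows "\<exists>(K::real) (A::real). K \<ge> 1 \<and> A \<ge> 0 \<and> (\<forall>\<^sub>F n in sequentially. \<exists>M\<ge>1.
     ln (real M) \<le> A * real n powr (1 + 1 / (2 * real l - 1)) * ln (real n) ^ 2 \<and>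
     coverable (r_subsets r n) (cycle_free (2 * l)) (K * real n ^ (r - 1)) M)"
proof -
  from supersaturation[OF r l] obtain K C :: real and n0 :: nat where KC: "K \<ge> 1" "C \<ge> 1" "n0 \<ge> 1"
    and ss: "\<forall>n\<ge>n0. \<forall>H\<subseteq>r_subsets r n. K * real n ^ (r - 1) \<le> real (card H) \<longrightarrow>
      (\<exists>\<mu>. spread (2 * l) H \<mu> C (real n powr (1 + 1 / (2 * real l - 1)) / real (card H)) \<and>
        (\<forall>e\<in>{..<2 * l} \<rightarrow>\<^sub>E H. \<mu> e \<noteq> 0 \<longrightarrow> (\<exists>f. f (2 * l) = f 0 \<and> inj_on f {..<2 * l} \<and>
           (\<forall>i<2 * l. {f i, f (Suc i)} \<subseteq> e i) \<and> nondegenerate (2 * l) (\<lambda>i. {f i, f (Suc i)}) e)))"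
    by (elim exE conjE) (rule that)
  from container_lemma[OF KC(2), where k = "2 * l" and 'a = "nat set"] obtain c \<tau>0 :: real where c: "c > 0" "c < 1" "\<tau>0 > 0"
    and cl: "\<forall>(V::nat set set) \<mu> (\<tau>::real). finite V \<longrightarrow> V \<noteq> {} \<longrightarrow> spread (2 * l) V \<mu> C \<tau> \<longrightarrow>
    0 < \<tau> \<longrightarrow> \<tau> \<le> \<tau>0 \<longrightarrow> \<tau> * card V \<ge> 1 \<longrightarrow>
    coverable V (independent (2 * l) \<mu>) ((1 - c) * card V) ((card V + 1) ^ (2 * l * nat \<lceil>\<tau> * card V\<rceil>))"
    by (elim exE conjE) (rule that)
  define \<epsilon> where "\<epsilon> = 1 / (2 * real l - 1)"
  have \<epsilon>: "0 < \<epsilon>" "\<epsilon> < 1" using l by (auto simp: \<epsilon>_def)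
  \<comment> \<open>The factors come from the number of rounds, the \<open>2 * l\<close>
    coordinates, the rounding of T and \<open>ln (n ^ r + 1) \<le> (r + 1) * ln n\<close>.\<close>
  define A where "A = (1 / c + 1) * (2 * real l) * 2 * (real r + 1)"
  have A0: "A \<ge> 0" using c by (simp add: A_def)
  have main: "\<exists>M\<ge>1. ln (real M) \<le> A * real n powr (1 + \<epsilon>) * ln (real n) ^ 2 \<and>
     coverable (r_subsets r n) (cycle_free (2 * l)) (K * real n ^ (r - 1)) M"
    if n: "n \<ge> n0" "n \<ge> 3" and small: "real n powr (1 + \<epsilon>) \<le> \<tau>0 * real n ^ (r - 1)" for n
  proof -
    define T where "T = real n powr (1 + \<epsilon>)"
    have T1: "T \<ge> 1" unfolding T_def using n \<epsilon> by (intro ge_one_powr_ge_zero) auto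
    define t where "t = nat \<lceil>T\<rceil>"
    define M1 where "M1 = (n ^ r + 1) ^ (2 * l * t)"
    have M11: "M1 \<ge> 1" by (simp add: M1_def)
    let ?s = "K * real n ^ (r - 1)"
    have s0: "?s > 0" using KC(1) n(2) by simp
    have iter: "coverable H (cycle_free (2 * l)) ?s (M1 ^ i)"
      if "H \<subseteq> r_subsets r n" "(1 - c) ^ i * real (card H) \<le> ?s" for i H
      using that
    proof (induction i arbitrary: H)
      case 0
      then show ?case by (intro coverable_self) auto
    next
      case (Suc i)
      show ?case
      proof (cases "real (card H) \<le> ?s")
        case True
        then show ?thesis using M11 by (intro coverable_self) auto
      next
        case False
        then have big: "?s \<le> real (card H)" by simp
        have H0: "real (card H) > 0" using big s0 by linarith
        have Hne: "H \<noteq> {}" using H0 by auto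
        have fH: "finite H" using Suc.prems(1) finite_r_subsets finite_subset by blast
        from ss[rule_format, OF n(1) Suc.prems(1) big] obtain \<mu> where
          sp: "spread (2 * l) H \<mu> C (T / real (card H))"
          and ex: "\<forall>e\<in>{..<2 * l} \<rightarrow>\<^sub>E H. \<mu> e \<noteq> 0 \<longrightarrow> (\<exists>f. f (2 * l) = f 0 \<and> inj_on f {..<2 * l} \<and>
           (\<forall>i<2 * l. {f i, f (Suc i)} \<subseteq> e i) \<and> nondegenerate (2 * l) (\<lambda>i. {f i, f (Suc i)}) e)"
          unfolding \<epsilon>_def[symmetric] T_def[symmetric] by (elim exE conjE) (rule that)
        have \<tau>: "0 < T / real (card H)" "T / real (card H) * real (card H) = T" using T1 H0 by auto
        have \<tau>le: "T / real (card H) \<le> \<tau>0"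
        proof -
          have "T \<le> \<tau>0 * real n ^ (r - 1)" using small by (simp add: T_def)
          also have "\<dots> \<le> \<tau>0 * real (card H)"
          proof (rule mult_left_mono)
            have "1 * real n ^ (r - 1) \<le> ?s" using KC(1) by (intro mult_right_mono) auto
            then show "real n ^ (r - 1) \<le> real (card H)" using big by linarith
          qed (use c in simp)
          finally show ?thesis using H0 by (simp add: divide_le_eq)
        qed
        have "coverable H (independent (2 * l) \<mu>) ((1 - c) * card H) ((card H + 1) ^ (2 * l * nat \<lceil>T / real (card H) * card H\<rceil>))"
          by (rule cl[rule_format, OF fH Hne sp \<tau>(1) \<tau>le]) (use \<tau>(2) T1 in simp)
        then have cov: "coverable H (independent (2 * l) \<mu>) ((1 - c) * card H) ((card H + 1) ^ (2 * l * t))"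
          unfolding \<tau>(2) t_def .
        have "coverable H (cycle_free (2 * l)) ((1 - c) * card H) M1"
        proof (rule coverable_mono[OF cov])
          show "independent (2 * l) \<mu> I" if I: "I \<subseteq> H" "cycle_free (2 * l) I" for I
            unfolding independent_def
          proof (rule ballI, rule ccontr)
            fix e assume e: "e \<in> {..<2 * l} \<rightarrow>\<^sub>E I" and ne: "\<mu> e \<noteq> 0"
            have "e \<in> {..<2 * l} \<rightarrow>\<^sub>E H" using e I(1) by (meson PiE_mono subsetD)
            with ex ne obtain f where f: "f (2 * l) = f 0 \<and> inj_on f {..<2 * l} \<and>
              (\<forall>i<2 * l. {f i, f (Suc i)} \<subseteq> e i) \<and> nondegenerate (2 * l) (\<lambda>i. {f i, f (Suc i)}) e" by meson
            have "\<forall>i<2 * l. e i \<in> I" using PiE_mem[OF e] by simp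
            with f have "\<not> cycle_free (2 * l) I"
              unfolding cycle_free_def not_not by (intro exI[of _ e] exI[of _ f] conjI) (elim conjE, assumption)+
            with I(2) show False by simp
          qed
          have "card H \<le> card (r_subsets r n)" by (rule card_mono[OF finite_r_subsets Suc.prems(1)])
          also have "\<dots> \<le> n ^ r"
          proof -
            have "real (card (r_subsets r n)) \<le> real n ^ r"
              using card_subsets_le[of "{1..n}" r] by (simp add: r_subsets_def)
            then have "real (card (r_subsets r n)) \<le> real (n ^ r)" by simp
            then show ?thesis by (simp only: of_nat_le_iff)
          qed
          finally show "(card H + 1) ^ (2 * l * t) \<le> M1" unfolding M1_def by (intro power_mono) auto
        qed simp
        then have "coverable H (cycle_free (2 * l)) ?s (M1 * M1 ^ i)"
        proof (rule coverable_refine[OF _ fH])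
          fix W assume W: "W \<subseteq> H" "real (card W) \<le> (1 - c) * card H"
          have "(1 - c) ^ i * real (card W) \<le> (1 - c) ^ i * ((1 - c) * card H)"
            using W(2) c by (intro mult_left_mono) auto
          also have "\<dots> \<le> ?s" using Suc.prems(2) by (simp add: mult_ac)
          finally show "coverable W (cycle_free (2 * l)) ?s (M1 ^ i)"
            by (rule Suc.IH[rotated]) (use W(1) Suc.prems(1) in blast)
        qed
        then show ?thesis by simp
      qed
    qed
    have L1: "ln (real n) \<ge> 1"
    proof -
      have "exp 1 \<le> (3 :: real)" by (rule exp_le)
      then have "exp 1 \<le> real n" using n(2) by linarith
      then show ?thesis using n(2) by (subst ln_ge_iff) auto
    qed
    \<comment> \<open>After so many rounds \<open>(1 - c) ^ i\<close> is at most 1/n, enough to pass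
      from n^r edges to n^(r-1).\<close>
    define i where "i = nat \<lceil>ln (real n) / c\<rceil>"
    have i_lo: "ln (real n) \<le> c * real i"
    proof -
      have "ln (real n) / c \<le> real i" unfolding i_def by linarith
      then show ?thesis using c by (simp add: divide_le_eq mult.commute)
    qed
    have i_hi: "real i \<le> (1 / c + 1) * ln (real n)"
    proof -
      have "ln (real n) / c \<ge> 0" using L1 c by simp
      then have "real i \<le> ln (real n) / c + 1" unfolding i_def by linarith
      also have "\<dots> \<le> ln (real n) / c + ln (real n)" using L1 by simp
      finally show ?thesis by (simp add: distrib_right)
    qed
    have "coverable (r_subsets r n) (cycle_free (2 * l)) ?s (M1 ^ i)"
    proof (rule iter[OF subset_refl])
      have "(1 - c) ^ i \<le> exp (- c) ^ i" using c exp_ge_add_one_self[of "- c"] by (intro power_mono) auto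
      also have "\<dots> = exp (- (c * real i))" by (simp add: exp_of_nat_mult[symmetric] mult.commute)
      also have "\<dots> \<le> exp (- ln (real n))" using i_lo by simp
      also have "\<dots> = 1 / real n" using n(2) by (simp add: exp_minus inverse_eq_divide)
      finally have "(1 - c) ^ i * real (card (r_subsets r n)) \<le> 1 / real n * real n ^ r"
        using card_subsets_le[of "{1..n}" r] c by (intro mult_mono) (auto simp: r_subsets_def)
      also have "\<dots> = real n ^ (r - 1)" using n(2) r by (cases r) auto
      also have "\<dots> \<le> ?s" using mult_right_mono[OF KC(1), of "real n ^ (r - 1)"] by simp
      finally show "(1 - c) ^ i * real (card (r_subsets r n)) \<le> ?s" .
    qed
    moreover have "ln (real (M1 ^ i)) \<le> A * real n powr (1 + \<epsilon>) * ln (real n) ^ 2"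
    proof -
      have lnn: "ln (real (n ^ r + 1)) \<le> (real r + 1) * ln (real n)"
      proof -
        have "1 \<le> n ^ r" using n(2) by simp
        then have "n ^ r + 1 \<le> 2 * n ^ r" by linarith
        also have "\<dots> \<le> n * n ^ r" using n(2) by (intro mult_right_mono) auto
        finally have "n ^ r + 1 \<le> n ^ (r + 1)" by simp
        then have "real (n ^ r + 1) \<le> real (n ^ (r + 1))" by (rule of_nat_mono)
        then have "ln (real (n ^ r + 1)) \<le> ln (real (n ^ (r + 1)))"
          by (subst ln_le_cancel_iff) (use n(2) in \<open>auto simp: add_pos_nonneg\<close>)
        also have "\<dots> = real (r + 1) * ln (real n)" unfolding of_nat_power by (rule ln_realpow)
        finally show ?thesis by (simp add: add.commute)
      qed
      have t2: "real t \<le> 2 * T" unfolding t_def using T1 by linarith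
      have "ln (real (M1 ^ i)) = real i * (2 * real l * real t * ln (real (n ^ r + 1)))"
        unfolding M1_def of_nat_power[of _ "_ * _"] of_nat_power[of _ i] by (simp add: ln_realpow)
      also have "\<dots> \<le> ((1 / c + 1) * ln (real n)) * (2 * real l * (2 * T) * ((real r + 1) * ln (real n)))"
        using i_hi t2 lnn T1 L1 c by (intro mult_mono) auto
      also have "\<dots> = A * T * ln (real n) ^ 2" by (simp add: A_def power2_eq_square)
      finally show ?thesis by (simp add: T_def)
    qed
    ultimately show ?thesis using M11 by (intro exI[of _ "M1 ^ i"]) auto
  qed
  have "\<forall>\<^sub>F n in sequentially. real n powr (1 + \<epsilon>) \<le> \<tau>0 * real n ^ (r - 1)"
  proof -
    define n2 where "n2 = nat \<lceil>1 / \<tau>0\<rceil> + 1"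
    show ?thesis unfolding eventually_sequentially
    proof (intro exI[of _ n2] allI impI)
      fix n assume n: "n \<ge> n2"
      then have n1: "real n \<ge> 1" "1 / \<tau>0 \<le> real n" unfolding n2_def by linarith+
      have "real n powr (1 + \<epsilon>) \<le> real n powr 2" using \<epsilon> n1 by (intro powr_mono) auto
      also have "\<dots> = 1 * real n ^ 2" using n1 by (simp add: powr_numeral)
      also have "\<dots> \<le> (\<tau>0 * real n) * real n ^ 2"
        using n1 c by (intro mult_right_mono) (auto simp: field_simps)
      also have "\<dots> = \<tau>0 * real n ^ 3" by (simp add: power2_eq_square power3_eq_cube)
      also have "\<dots> \<le> \<tau>0 * real n ^ (r - 1)" using n1 c r by (intro mult_left_mono power_increasing) auto
      finally show "real n powr (1 + \<epsilon>) \<le> \<tau>0 * real n ^ (r - 1)" .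
    qed
  qed
  then have "\<forall>\<^sub>F n in sequentially. \<exists>M\<ge>1. ln (real M) \<le> A * real n powr (1 + \<epsilon>) * ln (real n) ^ 2 \<and>
     coverable (r_subsets r n) (cycle_free (2 * l)) (K * real n ^ (r - 1)) M"
    using eventually_ge_at_top[of "max n0 3"]
  proof eventually_elim
    case (elim n)
    then show ?case by (intro main) auto
  qed
  then show ?thesis using KC(1) A0 unfolding \<epsilon>_def by (intro exI[of _ K] exI[of _ A]) auto
qed

text \<open>Markov's inequality for 2 to the power of the number of chosen elements, whose
  expectation is \<open>(1 + p) ^ card C\<close> and thus at most
  \<open>exp (p * card C)\<close>.\<close>

lemma bernoulli_sum_tail:
  assumes R: "finite R" and C: "C \<subseteq> R" and p: "0 \<le> p" "p \<le> 1"
  shows "measure_pmf.prob (Pi_pmf R False (\<lambda>_. bernoulli_pmf p)) {f. real (card {e \<in> C. f e}) > m}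
     \<le> exp (p * real (card C) - m * ln 2)"
proof -
  let ?P = "Pi_pmf R False (\<lambda>_. bernoulli_pmf p)"
  define X :: "('a \<Rightarrow> bool) \<Rightarrow> real" where "X f = (\<Prod>e\<in>R. if e \<in> C \<and> f e then 2 else 1)" for f
  have fC: "finite C" using C R finite_subset by blast
  have X_eq: "X f = 2 powr real (card {e \<in> C. f e})" for f
  proof -
    have "{e \<in> R. e \<in> C \<and> f e} = {e \<in> C. f e}" using C by blast
    then show ?thesis unfolding X_def using R
      by (simp add: prod.If_cases Int_def powr_realpow)
  qed
  have "measure_pmf.expectation ?P X = (\<Prod>e\<in>R. measure_pmf.expectation (bernoulli_pmf p) (\<lambda>b. if e \<in> C \<and> b then 2 else 1))"
    unfolding X_def by (rule expectation_prod_Pi_pmf[OF R]) (auto intro: integrable_measure_pmf_finite)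
  also have "\<dots> = (\<Prod>e\<in>R. if e \<in> C then 1 + p else 1)"
    using p by (intro prod.cong) auto
  also have "\<dots> = (1 + p) ^ card C" using R C by (simp add: prod.If_cases inf.absorb2)
  also have "\<dots> \<le> exp p ^ card C" using p by (intro power_mono exp_ge_add_one_self) auto
  also have "\<dots> = exp (p * real (card C))" by (simp add: exp_of_nat_mult[symmetric] mult.commute)
  finally have ex: "measure_pmf.expectation ?P X \<le> exp (p * real (card C))" .
  have fin: "finite (set_pmf ?P)"
    unfolding set_Pi_pmf[OF R] using R by (intro finite_PiE_dflt) auto
  have X0: "X f \<ge> 0" for f by (simp add: X_eq)
  have "measure_pmf.prob ?P {f. real (card {e \<in> C. f e}) > m} \<le> measure_pmf.prob ?P {f \<in> space ?P. 2 powr m \<le> X f}"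
    by (rule measure_pmf.finite_measure_mono) (auto simp: X_eq)
  also have "\<dots> \<le> measure_pmf.expectation ?P X / 2 powr m"
    by (rule integral_Markov_inequality_measure[where A = "{}"])
      (use fin X0 in \<open>auto intro: integrable_measure_pmf_finite\<close>)
  also have "\<dots> \<le> exp (p * real (card C)) / 2 powr m" using ex by (intro divide_right_mono) auto
  also have "\<dots> = exp (p * real (card C) - m * ln 2)" by (simp add: exp_diff powr_def)
  finally show ?thesis .
qed

lemma ex_number_witness:
  assumes "finite (edges G)" and F: "edges F \<noteq> {}" and big: "real (ex_number G F) > m"
  obtains H where "subhypergraph H G" "\<not> contains_copy H F" "real (card (edges H)) > m"
proof -
  let ?S = "{card (edges H) | H. subhypergraph H G \<and> \<not> contains_copy H F}"
  have "?S \<subseteq> {..card (edges G)}"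
    using assms(1) by (auto simp: subhypergraph_def intro: card_mono)
  then have fin: "finite ?S" using finite_subset by blast
  \<comment> \<open>Since \<open>F\<close> has an edge, the empty hypergraph contains no copy of it;
    the maximum is therefore over a nonempty set and is attained.\<close>
  let ?H0 = "\<lparr>verts = {}, edges = {}\<rparr> :: 'a hypergraph"
  have "subhypergraph ?H0 G" "\<not> contains_copy ?H0 F"
    using F by (auto simp: contains_copy_def subhypergraph_def map_hypergraph_def)
  then have "card (edges ?H0) \<in> ?S" by blast
  then have "?S \<noteq> {}" by blast
  with fin have "ex_number G F \<in> ?S" unfolding ex_number_def by (rule Max_in)
  then obtain H where "ex_number G F = card (edges H)" "subhypergraph H G" "\<not> contains_copy H F" by blast
  then show thesis using big by (intro that[of H]) auto
qed

text \<open>A subgraph without the linear cycle is cycle-free, so its edges are random edges inside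
  one container. It therefore suffices to bound, for every container, the number of its edges that
  appear.\<close>

lemma ex_number_tail:
  assumes r: "r \<ge> 3" and k: "k \<ge> 2" and p: "0 \<le> p" "p \<le> 1"
    and cov: "coverable (r_subsets r n) (cycle_free k) s M"
  shows "measure_pmf.prob (random_r_graph r n p) {G. real (ex_number G (linear_cycle r k)) > m}
     \<le> real M * exp (p * s - m * ln 2)"
proof -
  let ?R = "r_subsets r n"
  let ?P = "Pi_pmf ?R False (\<lambda>_. bernoulli_pmf p)"
  let ?G = "\<lambda>f. \<lparr>verts = {1..n}, edges = {e \<in> ?R. f e}\<rparr> :: nat hypergraph"
  obtain \<C> where C: "finite \<C>" "card \<C> \<le> M" "\<forall>C\<in>\<C>. C \<subseteq> ?R \<and> real (card C) \<le> s"
      "\<forall>I. I \<subseteq> ?R \<longrightarrow> cycle_free k I \<longrightarrow> (\<exists>C\<in>\<C>. I \<subseteq> C)"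
    using cov unfolding coverable_def by (elim exE conjE) (rule that)
  have sub: "{f. real (ex_number (?G f) (linear_cycle r k)) > m} \<subseteq> (\<Union>C\<in>\<C>. {f. real (card {e \<in> C. f e}) > m})"
  proof
    fix f assume "f \<in> {f. real (ex_number (?G f) (linear_cycle r k)) > m}"
    then have big: "real (ex_number (?G f) (linear_cycle r k)) > m" by simp
    obtain H where H: "subhypergraph H (?G f)" "\<not> contains_copy H (linear_cycle r k)" "real (card (edges H)) > m"
    proof (rule ex_number_witness[OF _ _ big])
      show "finite (edges (?G f))" using finite_r_subsets by simp
      show "edges (linear_cycle r k) \<noteq> {}" using k by (simp add: linear_cycle_def)
    qed
    have eR: "edges H \<subseteq> ?R" "\<And>e. e \<in> edges H \<Longrightarrow> f e" "\<And>e. e \<in> edges H \<Longrightarrow> e \<subseteq> verts H"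
      using H(1) by (auto simp: subhypergraph_def)
    have "cycle_free k (edges H)"
    proof (rule ccontr)
      assume nc: "\<not> cycle_free k (edges H)"
      have "contains_copy H (linear_cycle r k)"
      proof (rule contains_linear_cycle[OF r k _ nc])
        fix A assume A: "A \<in> edges H"
        then have "A \<subseteq> {1..n}" "card A = r" using eR(1) by (auto simp: r_subsets_def)
        then show "finite A \<and> card A = r \<and> A \<subseteq> verts H" using eR(3)[OF A] finite_subset by blast
      qed
      then show False using H(2) by simp
    qed
    then obtain C' where C': "C' \<in> \<C>" "edges H \<subseteq> C'" using C(4) eR(1) by blast
    have "card (edges H) \<le> card {e \<in> C'. f e}"
    proof (rule card_mono)
      have "finite C'" using C(3) C'(1) finite_r_subsets finite_subset by blast
      then show "finite {e \<in> C'. f e}" by simp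
      show "edges H \<subseteq> {e \<in> C'. f e}" using C'(2) eR(2) by blast
    qed
    then have "real (card {e \<in> C'. f e}) > m" using H(3) by linarith
    then show "f \<in> (\<Union>C\<in>\<C>. {f. real (card {e \<in> C. f e}) > m})" using C'(1) by blast
  qed
  have "measure_pmf.prob (random_r_graph r n p) {G. real (ex_number G (linear_cycle r k)) > m}
     = measure_pmf.prob ?P {f. real (ex_number (?G f) (linear_cycle r k)) > m}"
    by (simp add: random_r_graph_def vimage_def)
  also have "\<dots> \<le> measure_pmf.prob ?P (\<Union>C\<in>\<C>. {f. real (card {e \<in> C. f e}) > m})"
    using sub by (rule measure_pmf.finite_measure_mono) simp
  also have "\<dots> \<le> (\<Sum>C\<in>\<C>. measure_pmf.prob ?P {f. real (card {e \<in> C. f e}) > m})"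
    using C(1) by (intro measure_pmf.finite_measure_subadditive_finite) auto
  also have "\<dots> \<le> (\<Sum>C\<in>\<C>. exp (p * s - m * ln 2))"
  proof (rule sum_mono)
    fix C' assume C': "C' \<in> \<C>"
    have "measure_pmf.prob ?P {f. real (card {e \<in> C'. f e}) > m} \<le> exp (p * real (card C') - m * ln 2)"
      using C(3) C' by (intro bernoulli_sum_tail[OF finite_r_subsets _ p]) blast
    also have "\<dots> \<le> exp (p * s - m * ln 2)" using C(3) C' p(1) by (simp add: mult_left_mono)
    finally show "measure_pmf.prob ?P {f. real (card {e \<in> C'. f e}) > m} \<le> exp (p * s - m * ln 2)" .
  qed
  also have "\<dots> = real (card \<C>) * exp (p * s - m * ln 2)" by simp
  also have "\<dots> \<le> real M * exp (p * s - m * ln 2)" using C(2) by (intro mult_right_mono) auto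
  finally show ?thesis .
qed

theorem theorem1p6:
  fixes r l :: nat
  assumes "r \<ge> 4" and "l \<ge> 2"
  shows "\<exists>c::real. c > 0 \<and>
    (\<forall>p :: nat \<Rightarrow> real.
       (\<forall>n. 0 \<le> p n \<and> p n \<le> 1) \<longrightarrow>
       (\<forall>\<^sub>F n in sequentially.
          p n \<ge> ln (real n) ^ (2 * r - 2)
                 * real n powr (- real r + 2 + 1 / (2 * real l - 1))) \<longrightarrow>
       (\<lambda>n. measure_pmf.prob (random_r_graph r n (p n))
              {G. real (ex_number G (linear_cycle r (2 * l))) \<le> c * p n * real n ^ (r - 1)})
         \<longlonglongrightarrow> 1)"
proof -
  from cycle_free_containers[OF assms] obtain K A :: real where K: "K \<ge> 1" and A: "A \<ge> 0"
    and ev: "\<forall>\<^sub>F n in sequentially. \<exists>M\<ge>1.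
     ln (real M) \<le> A * real n powr (1 + 1 / (2 * real l - 1)) * ln (real n) ^ 2 \<and>
     coverable (r_subsets r n) (cycle_free (2 * l)) (K * real n ^ (r - 1)) M"
    by (elim exE conjE) (rule that)
  \<comment> \<open>Makes the exponent in \<open>ex_number_tail\<close> equal to
    \<open>K * P - (K + 1) * P = - P\<close> with \<open>P = p n * real n ^ (r - 1)\<close>, leaving
    one full P against the logarithm of the number of containers.\<close>
  define c where "c = (K + 1) / ln 2"
  have c0: "c > 0" using K by (simp add: c_def)
  have c2: "c * ln 2 = K + 1" by (simp add: c_def)
  show ?thesis
  proof (intro exI[of _ c] conjI allI impI c0)
    fix p :: "nat \<Rightarrow> real"
    assume p: "\<forall>n. 0 \<le> p n \<and> p n \<le> 1"
      and pl: "\<forall>\<^sub>F n in sequentially. p n \<ge> ln (real n) ^ (2 * r - 2) * real n powr (- real r + 2 + 1 / (2 * real l - 1))"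
    let ?pr = "\<lambda>n. measure_pmf.prob (random_r_graph r n (p n)) {G. real (ex_number G (linear_cycle r (2 * l))) \<le> c * p n * real n ^ (r - 1)}"
    have "\<forall>\<^sub>F n in sequentially. ln (real n) \<ge> A + 1"
      by (intro filterlim_at_top[THEN iffD1, rule_format] filterlim_compose[OF ln_at_top] filterlim_real_sequentially)
    then have lower: "\<forall>\<^sub>F n in sequentially. 1 - 1 / real n \<le> ?pr n"
      using ev pl eventually_ge_at_top[of 1]
    proof eventually_elim
      case (elim n)
      define T where "T = real n powr (1 + 1 / (2 * real l - 1))"
      define L where "L = ln (real n)"
      define P where "P = p n * real n ^ (r - 1)"
      from elim(2) obtain M where M: "M \<ge> 1" "ln (real M) \<le> A * T * L ^ 2"
        and cov: "coverable (r_subsets r n) (cycle_free (2 * l)) (K * real n ^ (r - 1)) M"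
        unfolding T_def[symmetric] L_def[symmetric] by (elim exE conjE) (rule that)
      have L: "L \<ge> A + 1" "L \<ge> 1" using elim(1) A by (auto simp: L_def)
      have T1: "T \<ge> 1" unfolding T_def using elim(4) assms by (intro ge_one_powr_ge_zero) auto
      \<comment> \<open>One logarithm more than in the container count absorbs both the constant
        \<open>A\<close> and the extra term L, because \<open>L \<ge> A + 1\<close>; three powers of
        L are available since \<open>2 * r - 2 \<ge> 3\<close>. The extra L is what yields the
        failure probability 1/n.\<close>
      have "L ^ 3 * T \<le> L ^ (2 * r - 2) * T"
        using L(2) T1 assms(1) by (intro mult_right_mono power_increasing) auto
      also have "\<dots> \<le> P"
      proof -
        have "T = real n powr (- real r + 2 + 1 / (2 * real l - 1)) * real n powr real (r - 1)"
          unfolding T_def powr_add[symmetric] using assms(1) by (simp add: of_nat_diff)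
        also have "real n powr real (r - 1) = real n ^ (r - 1)" using elim(4) by (simp add: powr_realpow)
        finally have "L ^ (2 * r - 2) * T = L ^ (2 * r - 2) * real n powr (- real r + 2 + 1 / (2 * real l - 1)) * real n ^ (r - 1)"
          by (simp only: mult.assoc)
        also have "\<dots> \<le> P" unfolding P_def L_def using elim(3) by (intro mult_right_mono) auto
        finally show ?thesis .
      qed
      finally have P: "L ^ 3 * T \<le> P" .
      have TL: "1 \<le> T * L" using mult_mono[OF T1 L(2)] T1 by simp
      have "A * T * L ^ 2 + L \<le> A * T * L ^ 2 + T * L * L"
        using mult_right_mono[OF TL, of L] L(2) by simp
      also have "\<dots> = (A + 1) * (T * L ^ 2)" by (simp add: algebra_simps power2_eq_square)
      also have "\<dots> \<le> L * (T * L ^ 2)" using L T1 by (intro mult_right_mono) auto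
      also have "\<dots> = L ^ 3 * T" by (simp add: power2_eq_square power3_eq_cube)
      finally have key: "A * T * L ^ 2 + L \<le> P" using P by linarith
      let ?m = "c * p n * real n ^ (r - 1)"
      have mP: "?m * ln 2 = (K + 1) * P" unfolding P_def c2[symmetric] by (simp add: mult_ac)
      have "measure_pmf.prob (random_r_graph r n (p n)) {G. real (ex_number G (linear_cycle r (2 * l))) > ?m}
        \<le> real M * exp (p n * (K * real n ^ (r - 1)) - ?m * ln 2)"
        by (rule ex_number_tail[OF _ _ _ _ cov]) (use assms p in auto)
      also have "\<dots> = exp (ln (real M)) * exp (- P)"
        unfolding mP using M(1) by (simp add: P_def algebra_simps)
      also have "\<dots> = exp (ln (real M) - P)" by (simp add: exp_diff exp_minus divide_inverse)
      also have "\<dots> \<le> exp (- L)" using M(2) key by simp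
      also have "\<dots> = 1 / real n" using elim(4) by (simp add: L_def exp_minus inverse_eq_divide)
      finally have "measure_pmf.prob (random_r_graph r n (p n)) {G. real (ex_number G (linear_cycle r (2 * l))) > ?m} \<le> 1 / real n" .
      moreover have "?pr n = 1 - measure_pmf.prob (random_r_graph r n (p n)) {G. real (ex_number G (linear_cycle r (2 * l))) > ?m}"
      proof -
        have eq: "{G. real (ex_number G (linear_cycle r (2 * l))) \<le> ?m} = UNIV - {G. real (ex_number G (linear_cycle r (2 * l))) > ?m}" by auto
        show ?thesis unfolding eq
          using measure_pmf.prob_compl[of "{G. real (ex_number G (linear_cycle r (2 * l))) > ?m}" "random_r_graph r n (p n)"] by simp
      qed
      ultimately show ?case by simp
    qed
    show "?pr \<longlonglongrightarrow> 1"
    proof (rule tendsto_sandwich[OF lower])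
      show "\<forall>\<^sub>F n in sequentially. ?pr n \<le> 1" by simp
      have "(\<lambda>n. 1 - 1 / real n) \<longlonglongrightarrow> 1 - 0" by (intro tendsto_intros lim_1_over_n)
      then show "(\<lambda>n. 1 - 1 / real n) \<longlonglongrightarrow> 1" by simp
    qed simp
  qed
qed

end
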